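(* Let $d,n,m$ be integers with $d\ge n>m>0$ and set $c=\gcd(n,m)$. Let $L\subset\mathbb{P}^2$ be a line and $q\in L$ a point. Then $$\operatorname{codim} U^{(m,n)}_d(L;q)\ \ge\ \frac{nm+m+n+c-2}{2},$$ with equality when $c=1$.
   Context: Work over $\mathbb{C}$. A point of an integral curve is unibranch if it has exactly one preimage in the normalization. Plane curves of degree $d$ are parametrized by $\mathbb{P}^{d(d+3)/2}$. $U^{(m,n)}_d(L;q)\subset\mathbb{P}^{d(d+3)/2}$ denotes the space of integral plane curves $C$ of degree $d\geq 2$ that have at $q$ a unibranch $(m,n)$-point with tangent line equal to $L$; that is, $q\in C$ is unibranch, $\operatorname{mult}_q(C)=m$, $L$ is the tangent line to $C$ at $q$, and $(C\cdot L)_q=n$. $\operatorname{codim}U^{(m,n)}_d(L;q)$ denotes the codimension in $\mathbb{P}^{d(d+3)/2}$ of the closure of $U^{(m,n)}_d(L;q)$. *)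

theory Defs
  imports
    "HOL-Analysis.Analysis"
    "HOL-Library.Poly_Mapping"
    "HOL-Library.Extended_Real"
    "HOL-Computational_Algebra.Fraction_Field"
    "HOL-Computational_Algebra.Factorial_Ring"
    "HOL-Algebra.Algebraic_Closure_Type"
    "HOL-Algebra.Embedded_Algebras"
begin

hide_const (open) Divisibility.irreducible Polynomials.degree Polynomials.lead_coeff


section \<open>Complex polynomials in several variables\<close>

type_synonym 'v mpoly = "('v \<Rightarrow>\<^sub>0 nat) \<Rightarrow>\<^sub>0 complex"

definition Const :: "complex \<Rightarrow> 'v mpoly"
  where "Const c = Poly_Mapping.single 0 c"

definition Var :: "'v \<Rightarrow> 'v mpoly"
  where "Var i = Poly_Mapping.single (Poly_Mapping.single i 1) 1"

definition mdeg :: "('v \<Rightarrow>\<^sub>0 nat) \<Rightarrow> nat"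
  where "mdeg e = (\<Sum>i\<in>Poly_Mapping.keys e. Poly_Mapping.lookup e i)"

definition homogeneous :: "nat \<Rightarrow> 'v mpoly \<Rightarrow> bool"
  where "homogeneous k p \<longleftrightarrow> (\<forall>e\<in>Poly_Mapping.keys p. mdeg e = k)"

definition hom_part :: "nat \<Rightarrow> 'v mpoly \<Rightarrow> 'v mpoly"
  where "hom_part k p =
    (\<Sum>e\<in>{e \<in> Poly_Mapping.keys p. mdeg e = k}. Poly_Mapping.single e (Poly_Mapping.lookup p e))"

text \<open>Substitution of the \<open>x i\<close> for the variables, with \<open>h\<close> applied to the coefficients.\<close>

definition psubst :: "(complex \<Rightarrow> 'b) \<Rightarrow> ('v \<Rightarrow> 'b) \<Rightarrow> 'v mpoly \<Rightarrow> 'b::comm_ring_1"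
  where "psubst h x p = (\<Sum>e\<in>Poly_Mapping.keys p. h (Poly_Mapping.lookup p e) *
    (\<Prod>i\<in>Poly_Mapping.keys e. x i ^ Poly_Mapping.lookup e i))"

definition peval :: "('v \<Rightarrow> complex) \<Rightarrow> 'v mpoly \<Rightarrow> complex"
  where "peval = psubst (\<lambda>c. c)"

definition translate :: "('v \<Rightarrow> complex) \<Rightarrow> 'v mpoly \<Rightarrow> 'v mpoly"
  where "translate v = psubst Const (\<lambda>i. Var i + Const (v i))"

lemma mdeg_superset:
  assumes "finite A" "Poly_Mapping.keys e \<subseteq> A"
  shows "mdeg e = (\<Sum>i\<in>A. Poly_Mapping.lookup e i)"
  unfolding mdeg_def using assms by (intro sum.mono_neutral_left) (auto simp: in_keys_iff)

lemma mdeg_add: "mdeg (e + f) = mdeg e + mdeg f"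
proof -
  let ?A = "Poly_Mapping.keys e \<union> Poly_Mapping.keys f"
  have "mdeg (e + f) = (\<Sum>i\<in>?A. Poly_Mapping.lookup (e + f) i)"
    by (rule mdeg_superset) (auto dest: subsetD[OF keys_add])
  also have "\<dots> = (\<Sum>i\<in>?A. Poly_Mapping.lookup e i) + (\<Sum>i\<in>?A. Poly_Mapping.lookup f i)"
    by (simp add: lookup_add sum.distrib)
  also have "\<dots> = mdeg e + mdeg f"
    by (simp add: mdeg_superset[of ?A])
  finally show ?thesis .
qed

lemma homogeneous_mult:
  assumes "homogeneous k p" "homogeneous l q"
  shows "homogeneous (k + l) (p * q)"
  unfolding homogeneous_def
proof
  fix e assume "e \<in> Poly_Mapping.keys (p * q)"
  then obtain a b where "e = a + b" "a \<in> Poly_Mapping.keys p" "b \<in> Poly_Mapping.keys q"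
    using keys_mult[of p q] by blast
  then show "mdeg e = k + l"
    using assms by (simp add: homogeneous_def mdeg_add)
qed

lemma monom_superset:
  fixes x :: "'v \<Rightarrow> 'b::comm_ring_1"
  assumes "finite A" "Poly_Mapping.keys e \<subseteq> A"
  shows "(\<Prod>i\<in>Poly_Mapping.keys e. x i ^ Poly_Mapping.lookup e i) =
    (\<Prod>i\<in>A. x i ^ Poly_Mapping.lookup e i)"
  using assms by (intro prod.mono_neutral_left) (auto simp: in_keys_iff)

lemma monom_add:
  fixes x :: "'v \<Rightarrow> 'b::comm_ring_1"
  shows "(\<Prod>i\<in>Poly_Mapping.keys (e + f). x i ^ Poly_Mapping.lookup (e + f) i) =
    (\<Prod>i\<in>Poly_Mapping.keys e. x i ^ Poly_Mapping.lookup e i) *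
    (\<Prod>i\<in>Poly_Mapping.keys f. x i ^ Poly_Mapping.lookup f i)"
proof -
  let ?A = "Poly_Mapping.keys e \<union> Poly_Mapping.keys f"
  have "(\<Prod>i\<in>Poly_Mapping.keys (e + f). x i ^ Poly_Mapping.lookup (e + f) i) =
      (\<Prod>i\<in>?A. x i ^ Poly_Mapping.lookup (e + f) i)"
    by (rule monom_superset) (auto dest: subsetD[OF keys_add])
  also have "\<dots> = (\<Prod>i\<in>?A. x i ^ Poly_Mapping.lookup e i) * (\<Prod>i\<in>?A. x i ^ Poly_Mapping.lookup f i)"
    by (simp add: lookup_add power_add prod.distrib)
  finally show ?thesis
    by (simp add: monom_superset[of ?A e] monom_superset[of ?A f])
qed

lemma psubst_superset:
  assumes "h 0 = 0" "finite A" "Poly_Mapping.keys p \<subseteq> A"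
  shows "psubst h x p = (\<Sum>e\<in>A. h (Poly_Mapping.lookup p e) *
    (\<Prod>i\<in>Poly_Mapping.keys e. x i ^ Poly_Mapping.lookup e i))"
  unfolding psubst_def
proof (rule sum.mono_neutral_left[OF assms(2,3)], rule ballI)
  fix e assume "e \<in> A - Poly_Mapping.keys p"
  then have "Poly_Mapping.lookup p e = 0"
    by (simp add: in_keys_iff)
  then show "h (Poly_Mapping.lookup p e) *
      (\<Prod>i\<in>Poly_Mapping.keys e. x i ^ Poly_Mapping.lookup e i) = 0"
    by (simp add: assms(1))
qed

lemma psubst_add:
  assumes "h 0 = 0" "\<And>a b. h (a + b) = h a + h b"
  shows "psubst h x (p + q) = psubst h x p + psubst h x q"
proof -
  let ?A = "Poly_Mapping.keys p \<union> Poly_Mapping.keys q"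
  have "psubst h x (p + q) = (\<Sum>e\<in>?A. h (Poly_Mapping.lookup (p + q) e) *
      (\<Prod>i\<in>Poly_Mapping.keys e. x i ^ Poly_Mapping.lookup e i))"
    by (rule psubst_superset) (auto simp: assms dest: subsetD[OF keys_add])
  then show ?thesis
    by (simp add: psubst_superset[of h ?A] assms lookup_add sum.distrib algebra_simps)
qed

lemma psubst_single:
  assumes "h 0 = 0"
  shows "psubst h x (Poly_Mapping.single e c) =
    h c * (\<Prod>i\<in>Poly_Mapping.keys e. x i ^ Poly_Mapping.lookup e i)"
  by (subst psubst_superset[of h "{e}"]) (auto simp: assms)

lemma psubst_sum:
  assumes "h 0 = 0" "\<And>a b. h (a + b) = h a + h b"
  shows "psubst h x (\<Sum>i\<in>A. f i) = (\<Sum>i\<in>A. psubst h x (f i))"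
proof -
  have "psubst h x 0 = 0"
    by (simp add: psubst_def)
  then show ?thesis
    by (induction A rule: infinite_finite_induct) (simp_all add: psubst_add[of h] assms)
qed

lemma mpoly_sum_single:
  "p = (\<Sum>e\<in>Poly_Mapping.keys p. Poly_Mapping.single e (Poly_Mapping.lookup p e))"
proof (rule poly_mapping_eqI)
  fix k
  show "Poly_Mapping.lookup p k = Poly_Mapping.lookup
      (\<Sum>e\<in>Poly_Mapping.keys p. Poly_Mapping.single e (Poly_Mapping.lookup p e)) k"
    by (simp add: lookup_sum lookup_single when_def in_keys_iff)
qed

lemma psubst_mult:
  assumes h: "h 0 = 0" "\<And>a b. h (a + b) = h a + h b" "\<And>a b. h (a * b) = h a * h b"
  shows "psubst h x (p * q) = psubst h x p * psubst h x q"
proof -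
  let ?s = "\<lambda>p e. Poly_Mapping.single e (Poly_Mapping.lookup p e)"
  have "p * q = (\<Sum>e\<in>Poly_Mapping.keys p. \<Sum>f\<in>Poly_Mapping.keys q. ?s p e * ?s q f)"
    by (subst mpoly_sum_single[of p], subst mpoly_sum_single[of q]) (rule sum_product)
  then have "psubst h x (p * q) =
      (\<Sum>e\<in>Poly_Mapping.keys p. \<Sum>f\<in>Poly_Mapping.keys q. psubst h x (?s p e * ?s q f))"
    by (simp add: psubst_sum[of h] h)
  also have "\<dots> = (\<Sum>e\<in>Poly_Mapping.keys p. \<Sum>f\<in>Poly_Mapping.keys q.
      psubst h x (?s p e) * psubst h x (?s q f))"
    by (simp add: mult_single psubst_single[of h] h monom_add algebra_simps)
  also have "\<dots> = psubst h x p * psubst h x q"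
    unfolding sum_product[symmetric] by (simp add: psubst_single[of h] h) (simp add: psubst_def)
  finally show ?thesis .
qed

lemma peval_mult: "peval x (p * q) = peval x p * peval x q"
  unfolding peval_def by (rule psubst_mult) auto

lemma peval_scale:
  assumes "homogeneous k p"
  shows "peval (\<lambda>i. c * v i) p = c ^ k * peval v p"
proof -
  have "(\<Prod>i\<in>Poly_Mapping.keys e. (c * v i) ^ Poly_Mapping.lookup e i) =
      c ^ k * (\<Prod>i\<in>Poly_Mapping.keys e. v i ^ Poly_Mapping.lookup e i)"
    if "e \<in> Poly_Mapping.keys p" for e
    using assms that
    by (auto simp: homogeneous_def mdeg_def power_mult_distrib prod.distrib power_sum)
  then show ?thesis
    by (simp add: peval_def psubst_def sum_distrib_left algebra_simps cong: sum.cong)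
qed


section \<open>Projective spaces, Zariski topology and codimension\<close>

text \<open>
  The projective space of dimension \<open>card I - 1\<close> whose homogeneous coordinates are indexed by a
  finite nonempty set \<open>I\<close>. A point is the set of all its coordinate vectors.
\<close>

definition proj_space :: "'i set \<Rightarrow> ('i \<Rightarrow> complex) set set"
  where "proj_space I =
    {{\<lambda>i. c * v i | c. c \<noteq> 0} | v. (\<exists>i. v i \<noteq> 0) \<and> (\<forall>i. i \<notin> I \<longrightarrow> v i = 0)}"

definition proj_zeros :: "'i set \<Rightarrow> 'i mpoly set \<Rightarrow> ('i \<Rightarrow> complex) set set"
  where "proj_zeros I S = {x \<in> proj_space I. \<forall>p\<in>S. \<forall>v\<in>x. peval v p = 0}"

definition zariski :: "'i set \<Rightarrow> ('i \<Rightarrow> complex) set topology"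
  where "zariski I = topology (\<lambda>U. \<exists>S. (\<forall>p\<in>S. \<exists>k. homogeneous k p) \<and>
    U = proj_space I - proj_zeros I S)"

lemma peval_proj_nonzero:
  assumes "x \<in> proj_space I" "v \<in> x" "w \<in> x" "homogeneous k p" "peval v p \<noteq> 0"
  shows "peval w p \<noteq> 0"
proof -
  obtain u a b where "v = (\<lambda>i. a * u i)" "w = (\<lambda>i. b * u i)" "b \<noteq> 0"
    using assms(1-3) by (auto simp: proj_space_def)
  then show ?thesis
    using assms(5) by (auto simp: peval_scale[OF assms(4)])
qed

lemma proj_zeros_Un:
  assumes "\<forall>p\<in>S. \<exists>k. homogeneous k p" "\<forall>p\<in>T. \<exists>k. homogeneous k p"
  shows "proj_zeros I S \<union> proj_zeros I T = proj_zeros I {p * q | p q. p \<in> S \<and> q \<in> T}"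
proof (intro equalityI subsetI)
  fix x assume "x \<in> proj_zeros I S \<union> proj_zeros I T"
  then show "x \<in> proj_zeros I {p * q | p q. p \<in> S \<and> q \<in> T}"
    by (auto simp: proj_zeros_def peval_mult)
next
  fix x assume x: "x \<in> proj_zeros I {p * q | p q. p \<in> S \<and> q \<in> T}"
  show "x \<in> proj_zeros I S \<union> proj_zeros I T"
  proof (rule ccontr)
    assume "x \<notin> proj_zeros I S \<union> proj_zeros I T"
    then obtain p q v w where
      pq: "p \<in> S" "v \<in> x" "peval v p \<noteq> 0" "q \<in> T" "w \<in> x" "peval w q \<noteq> 0"
      using x by (auto simp: proj_zeros_def)
    moreover obtain k where "homogeneous k q"
      using assms(2) \<open>q \<in> T\<close> by blast
    moreover have "x \<in> proj_space I"
      using x by (simp add: proj_zeros_def)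
    ultimately have "peval v q \<noteq> 0"
      using peval_proj_nonzero by blast
    then have "peval v (p * q) \<noteq> 0"
      using pq by (simp add: peval_mult)
    then show False
      using x pq by (auto simp: proj_zeros_def)
  qed
qed

lemma istopology_zariski:
  "istopology (\<lambda>U. \<exists>S. (\<forall>p\<in>S. \<exists>k. homogeneous k p) \<and> U = proj_space I - proj_zeros I S)"
  (is "istopology ?P")
  unfolding istopology_def
proof (intro conjI allI impI)
  fix U V assume "?P U" "?P V"
  then obtain S T where ST: "\<forall>p\<in>S. \<exists>k. homogeneous k p" "\<forall>p\<in>T. \<exists>k. homogeneous k p"
    "U = proj_space I - proj_zeros I S" "V = proj_space I - proj_zeros I T"
    by blast
  then have "U \<inter> V = proj_space I - proj_zeros I {p * q | p q. p \<in> S \<and> q \<in> T}"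
    using proj_zeros_Un[of S T I] by blast
  moreover have "\<forall>r\<in>{p * q | p q. p \<in> S \<and> q \<in> T}. \<exists>k. homogeneous k r"
    using ST homogeneous_mult by blast
  ultimately show "?P (U \<inter> V)"
    by blast
next
  fix \<U> assume "\<forall>U\<in>\<U>. ?P U"
  then obtain S where S: "\<And>U. U \<in> \<U> \<Longrightarrow> (\<forall>p\<in>S U. \<exists>k. homogeneous k p) \<and>
      U = proj_space I - proj_zeros I (S U)"
    by metis
  then have "\<Union>\<U> = proj_space I - proj_zeros I (\<Union>U\<in>\<U>. S U)"
  proof (intro equalityI subsetI)
    fix x assume "x \<in> \<Union>\<U>"
    then obtain U where "U \<in> \<U>" "x \<in> U"
      by blast
    with S[of U] have "x \<in> proj_space I - proj_zeros I (S U)"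
      by blast
    with \<open>U \<in> \<U>\<close> show "x \<in> proj_space I - proj_zeros I (\<Union>U\<in>\<U>. S U)"
      by (auto simp: proj_zeros_def)
  next
    fix x assume "x \<in> proj_space I - proj_zeros I (\<Union>U\<in>\<U>. S U)"
    then obtain U where "U \<in> \<U>" "x \<in> proj_space I - proj_zeros I (S U)"
      by (auto simp: proj_zeros_def)
    with S[of U] show "x \<in> \<Union>\<U>"
      by blast
  qed
  moreover have "\<forall>p\<in>(\<Union>U\<in>\<U>. S U). \<exists>k. homogeneous k p"
    using S by blast
  ultimately show "?P (\<Union>\<U>)"
    by blast
qed

lemma openin_zariski:
  "openin (zariski I) U \<longleftrightarrow>
    (\<exists>S. (\<forall>p\<in>S. \<exists>k. homogeneous k p) \<and> U = proj_space I - proj_zeros I S)"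
  unfolding zariski_def by (simp add: topology_inverse'[OF istopology_zariski])

lemma topspace_zariski: "topspace (zariski I) = proj_space I"
proof
  show "topspace (zariski I) \<subseteq> proj_space I"
    using openin_topspace[of "zariski I"] unfolding openin_zariski by blast
  have "homogeneous 0 (1 :: 'a mpoly)"
    by (simp add: homogeneous_def mdeg_def)
  moreover have "peval v 1 = 1" for v :: "'a \<Rightarrow> complex"
    by (simp add: peval_def psubst_def)
  moreover have "x \<noteq> {}" if "x \<in> proj_space I" for x
    using that by (auto simp: proj_space_def intro: exI[of _ 1])
  ultimately have "openin (zariski I) (proj_space I)"
    unfolding openin_zariski by (intro exI[of _ "{1}"]) (auto simp: proj_zeros_def)
  then show "proj_space I \<subseteq> topspace (zariski I)"
    by (rule openin_subset)
qed

lemma closedin_zariski: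
  "closedin (zariski I) Z \<longleftrightarrow> (\<exists>S. (\<forall>p\<in>S. \<exists>k. homogeneous k p) \<and> Z = proj_zeros I S)"
proof -
  have "proj_zeros I S \<subseteq> proj_space I" for S
    by (auto simp: proj_zeros_def)
  then show ?thesis
    unfolding closedin_def topspace_zariski openin_zariski by (metis Diff_Diff_Int inf.absorb2)
qed

definition irreducible_closed :: "'a topology \<Rightarrow> 'a set \<Rightarrow> bool"
  where "irreducible_closed T Y \<longleftrightarrow> closedin T Y \<and> Y \<noteq> {} \<and>
    (\<forall>A B. closedin T A \<and> closedin T B \<and> Y = A \<union> B \<longrightarrow> Y = A \<or> Y = B)"

definition codim_irreducible :: "'a topology \<Rightarrow> 'a set \<Rightarrow> enat"
  where "codim_irreducible T Y = Sup {enat k | k. \<exists>Z. Z 0 = Y \<and>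
    (\<forall>i\<le>k. irreducible_closed T (Z i)) \<and> (\<forall>i<k. Z i \<subset> Z (Suc i))}"

text \<open>As usual, the empty set has codimension \<open>\<infinity>\<close>.\<close>

definition codim :: "'a topology \<Rightarrow> 'a set \<Rightarrow> enat"
  where "codim T Z = (INF Y \<in> {Y. irreducible_closed T Y \<and> Y \<subseteq> Z}. codim_irreducible T Y)"


section \<open>Plane curves\<close>

type_synonym form = "3 mpoly"
type_synonym point = "(3 \<Rightarrow> complex) set"
type_synonym curve = "((3 \<Rightarrow>\<^sub>0 nat) \<Rightarrow> complex) set"

abbreviation plane :: "point set"
  where "plane \<equiv> proj_space UNIV"

text \<open>
  The homogeneous coordinates of a plane curve of degree \<open>d\<close> are the coefficients of its equation,
  indexed by the \<open>(d + 1) * (d + 2) div 2\<close> monomials of degree \<open>d\<close>.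
\<close>

abbreviation monomials :: "nat \<Rightarrow> (3 \<Rightarrow>\<^sub>0 nat) set"
  where "monomials d \<equiv> {e. mdeg e = d}"

definition plane_curves :: "nat \<Rightarrow> curve set"
  where "plane_curves d = proj_space (monomials d)"

definition equations :: "curve \<Rightarrow> form set"
  where "equations C = {F. Poly_Mapping.lookup F \<in> C}"

definition curve_points :: "curve \<Rightarrow> point set"
  where "curve_points C = proj_zeros UNIV (equations C)"

text \<open>
  For a multiplicative set \<open>D\<close>, \<open>hloc D\<close> is the degree zero part of the localization of the ring
  of ternary polynomials at the homogeneous elements of \<open>D\<close>, and \<open>hloc_ideal D F\<close> is the ideal
  generated in it by \<open>F\<close>.
\<close>

definition hloc :: "form set \<Rightarrow> form fract ring"
  where "hloc D = ring_of_type_algebra \<lparr>carrier :=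
    {Fraction_Field.Fract a b | a b k. homogeneous k a \<and> homogeneous k b \<and> b \<in> D}\<rparr>"

definition hloc_ideal :: "form set \<Rightarrow> form \<Rightarrow> form fract set"
  where "hloc_ideal D F =
    {Fraction_Field.Fract a b | a b k. homogeneous k a \<and> homogeneous k b \<and> b \<in> D \<and> F dvd a}"

text \<open>
  \<open>hloc (dens_at v)\<close> is the local ring of the plane at the point with coordinates \<open>v\<close>, and
  \<open>hloc (dens_gen F)\<close> is its local ring at the generic point of the curve \<open>F = 0\<close>, for
  irreducible \<open>F\<close>. The residue field of the latter is the function field of the curve; the image
  of \<open>hloc (dens_at v)\<close> in it is the local ring of the curve at \<open>v\<close>.
\<close>

definition dens_at :: "(3 \<Rightarrow> complex) \<Rightarrow> form set"
  where "dens_at v = {b. peval v b \<noteq> 0}"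

definition dens_gen :: "form \<Rightarrow> form set"
  where "dens_gen F = {b. \<not> F dvd b}"

definition function_field :: "form \<Rightarrow> form fract set ring"
  where "function_field F = hloc (dens_gen F) Quot hloc_ideal (dens_gen F) F"

definition curve_local_ring :: "form \<Rightarrow> (3 \<Rightarrow> complex) \<Rightarrow> form fract set set"
  where "curve_local_ring F v =
    (\<lambda>x. hloc_ideal (dens_gen F) F +>\<^bsub>hloc (dens_gen F)\<^esub> x) ` carrier (hloc (dens_at v))"

definition integral_closure :: "('a, 'm) ring_scheme \<Rightarrow> 'a set \<Rightarrow> 'a set"
  where "integral_closure K A = {x \<in> carrier K. \<exists>p. polynomial\<^bsub>K\<^esub> A p \<and> p \<noteq> [] \<and>
    hd p = \<one>\<^bsub>K\<^esub> \<and> ring.eval K p x = \<zero>\<^bsub>K\<^esub>}"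

text \<open>
  The fibre of the normalization over a point is the set of maximal ideals of the integral closure
  of the local ring in the function field: the normalization is the spectrum of the integral closure
  over affine opens, and integral closure commutes with localization.
\<close>

definition normalization_fibre :: "form \<Rightarrow> (3 \<Rightarrow> complex) \<Rightarrow> form fract set set set"
  where "normalization_fibre F v = {M. maximalideal M (function_field F
    \<lparr>carrier := integral_closure (function_field F) (curve_local_ring F v)\<rparr>)}"

definition unibranch :: "form \<Rightarrow> (3 \<Rightarrow> complex) \<Rightarrow> bool"
  where "unibranch F v \<longleftrightarrow> (\<exists>!M. M \<in> normalization_fibre F v)"

text \<open>
  Taylor expansion of \<open>F\<close> at a coordinate vector \<open>v\<close> of the point. For homogeneous \<open>F\<close> the lowest
  nonzero part of \<open>F(v + w)\<close> is invariant under \<open>w \<mapsto> w + s v\<close>, and it restricts to the lowest part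
  of the Taylor expansion at the point in any affine chart. So it cuts out the (projective) tangent
  cone, which is a union of lines through the point.
\<close>

definition multiplicity_at :: "form \<Rightarrow> (3 \<Rightarrow> complex) \<Rightarrow> nat"
  where "multiplicity_at F v = (LEAST k. hom_part k (translate v F) \<noteq> 0)"

definition tangent_cone :: "form \<Rightarrow> (3 \<Rightarrow> complex) \<Rightarrow> point set"
  where "tangent_cone F v = proj_zeros UNIV {hom_part (multiplicity_at F v) (translate v F)}"

text \<open>
  The intersection number of the curves \<open>F = 0\<close> and \<open>G = 0\<close> at a point is the dimension over
  \<open>\<complex>\<close> of the local ring of the plane modulo the ideal generated by their equations. As a relation,
  it does not hold for any \<open>n\<close> if this dimension is infinite.
\<close>

definition has_intersection_number :: "form \<Rightarrow> form \<Rightarrow> (3 \<Rightarrow> complex) \<Rightarrow> nat \<Rightarrow> bool"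
  where "has_intersection_number F G v n \<longleftrightarrow>
    (let R = hloc (dens_at v);
         J = hloc_ideal (dens_at v) F <+>\<^bsub>R\<^esub> hloc_ideal (dens_at v) G;
         k = (\<lambda>c. J +>\<^bsub>R\<^esub> Fraction_Field.Fract (Const c) 1) ` UNIV
     in ring.dimension (R Quot J) n k (carrier (R Quot J)))"

text \<open>
  A plane curve is integral iff its equation is irreducible. The conditions do not depend on the
  equations and the coordinate vector chosen.
\<close>

definition unibranch_locus :: "nat \<Rightarrow> nat \<Rightarrow> nat \<Rightarrow> curve \<Rightarrow> point \<Rightarrow> curve set"
  where "unibranch_locus d m n L q = {C \<in> plane_curves d.
    \<exists>F\<in>equations C. \<exists>l\<in>equations L. \<exists>v\<in>q.
      irreducible F \<and> q \<in> curve_points C \<and> unibranch F v \<and> multiplicity_at F v = m \<and>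
      tangent_cone F v = curve_points L \<and> has_intersection_number F l v n}"

end

theory Submission
  imports Defs "Jordan_Normal_Form.Char_Poly"
begin

text \<open>
  Choose coordinates \<open>x\<close>, \<open>y\<close> at the point with \<open>y = 0\<close> on the line. If the point is unibranch, the
  integral closure \<open>S\<close> of the local ring of the curve is local, and so the Newton polygon is the single
  edge from \<open>x\<^sup>n\<close> to \<open>y\<^sup>m\<close> and the form on this edge is a constant times the \<open>c\<close>-th power of a binomial.
  The vanishing of the coefficients below the edge and the \<open>c - 1\<close> equations on the edge can be dropped
  one by one, which gives a chain of irreducible closed sets above the locus; lattice points are counted
  with the point reflection of the rectangle. For \<open>c = 1\<close>, conversely, \<open>S\<close> contains a Laurent monomial
  \<open>t\<close> of weight 1, and every element of \<open>S\<close> is a constant modulo \<open>t S\<close>. So almost every equation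
  whose Newton polygon is this edge belongs to the locus, if it is irreducible; this holds for infinitely many
  members of the pencil through an irreducible curve, by compactness. A Hilbert function estimate bounds the
  length of chains in projective space from above.
\<close>

hide_const (open) up_ring.coeff up_ring.monom Coset.order Divisibility.irreducible

Polynomials.degree Polynomials.lead_coeff

section \<open>Integral elements of a field over a subring\<close>

text \<open>The function field is a residue field, so its elements are cosets. The argument is
  carried out upstairs, in the fraction field of ternary polynomials: each ring is replaced by its
  preimage in the local ring \<open>Og\<close> of the plane at the generic point of the curve, with
  maximal ideal \<open>I\<close>. Units do not notice the change, as \<open>1 + I\<close> consists
  of units. Neither valuations nor Puiseux series occur. An edge of weights \<alpha>, \<beta> is
  tested by the one fraction \<open>y ^ \<alpha> / x ^ \<beta>\<close>; to get an equation for it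
  without adjoining roots, the equation of the curve is replaced by its norm, which only involves
  powers of \<open>y ^ \<alpha>\<close>. Nonzero roots of the edge form give residues of this
  fraction, and two different residues, or one together with the value 0 or infinity, contradict
  locality. In the converse the hard point is that an element of \<open>S\<close> has a residue at
  all: it must have finite order in \<open>t\<close>, and eliminating \<open>y\<close> bounds this
  order. Codimension is defined by lengths of chains, so the lower bound needs explicit families and
  the upper bound needs the dimension of projective space.\<close>

definition ring_closed :: "'a::ring_1 set \<Rightarrow> bool"
  where "ring_closed B \<longleftrightarrow> 1 \<in> B \<and> (\<forall>x\<in>B. \<forall>y\<in>B. x - y \<in> B \<and> x * y \<in> B)"

lemma ring_closedI:
  assumes "1 \<in> B" "\<And>x y. x \<in> B \<Longrightarrow> y \<in> B \<Longrightarrow> x - y \<in> B" "\<And>x y. x \<in> B \<Longrightarrow> y \<in> B \<Longrightarrow> x * y \<in> B"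
  shows "ring_closed B"
  using assms by (auto simp: ring_closed_def)

context
  fixes B :: "'a::ring_1 set"
  assumes B: "ring_closed B"
begin

lemma rc_1: "1 \<in> B" and rc_diff: "x \<in> B \<Longrightarrow> y \<in> B \<Longrightarrow> x - y \<in> B"
  and rc_mult: "x \<in> B \<Longrightarrow> y \<in> B \<Longrightarrow> x * y \<in> B"
  using B by (auto simp: ring_closed_def)

lemma rc_0: "0 \<in> B"
  using rc_diff[OF rc_1 rc_1] by simp

lemma rc_uminus: "x \<in> B \<Longrightarrow> - x \<in> B"
  using rc_diff[OF rc_0, of x] by simp

lemma rc_add: "x \<in> B \<Longrightarrow> y \<in> B \<Longrightarrow> x + y \<in> B"
  using rc_diff[of x "- y"] rc_uminus by simp

lemma rc_power: "x \<in> B \<Longrightarrow> x ^ n \<in> B"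
  by (induction n) (auto intro: rc_1 rc_mult)

lemma rc_sum: "(\<And>i. i \<in> A \<Longrightarrow> f i \<in> B) \<Longrightarrow> sum f A \<in> B"
  by (induction A rule: infinite_finite_induct) (auto intro: rc_0 rc_add)

lemma rc_of_nat: "of_nat n \<in> B"
  by (induction n) (auto intro: rc_0 rc_add rc_1)

end

lemma rc_prod:
  fixes B :: "'a::comm_ring_1 set"
  assumes "ring_closed B" "\<And>i. i \<in> A \<Longrightarrow> f i \<in> B"
  shows "prod f A \<in> B"
  using assms(2) by (induction A rule: infinite_finite_induct) (auto intro: rc_1 rc_mult assms(1))

lemma ring_closed_poly:
  assumes "ring_closed (B :: 'a::comm_ring_1 set)"
  shows "ring_closed {p. \<forall>i. coeff p i \<in> B}"
  using assms
  by (intro ring_closedI) (auto simp: coeff_mult coeff_1 intro: rc_0 rc_1 rc_diff rc_sum rc_mult)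

definition integral_over :: "'a::field set \<Rightarrow> 'a \<Rightarrow> bool"
  where "integral_over B g \<longleftrightarrow> (\<exists>p. lead_coeff p = 1 \<and> (\<forall>i. coeff p i \<in> B) \<and> poly p g = 0)"

lemma integral_overI_sum:
  assumes "ring_closed B" "\<And>i. i < n \<Longrightarrow> a i \<in> B" "g ^ n + (\<Sum>i<n. a i * g ^ i) = 0"
  shows "integral_over B g"
proof -
  define p where "p = monom 1 n + (\<Sum>i<n. monom (a i) i)"
  have c: "coeff p k = (if k = n then 1 else if k < n then a k else 0)" for k
    by (auto simp: p_def coeff_sum)
  then have "degree p = n"
    by (intro antisym degree_le le_degree) auto
  moreover have "poly p g = 0"
    using assms(3) by (simp add: p_def poly_monom poly_sum)
  ultimately show ?thesis
    using assms(1,2) unfolding integral_over_def by (intro exI[of _ p]) (auto simp: c rc_0 rc_1)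
qed

lemma integral_overE_sum:
  assumes "integral_over B g"
  obtains n a where "\<And>i. a i \<in> B" "g ^ n + (\<Sum>i<n. a i * g ^ i) = 0"
proof -
  obtain p where p: "lead_coeff p = 1" "\<forall>i. coeff p i \<in> B" "poly p g = 0"
    using assms by (auto simp: integral_over_def)
  have "poly p g = (\<Sum>i<Suc (degree p). coeff p i * g ^ i)"
    by (simp add: poly_altdef lessThan_Suc_atMost)
  then have "g ^ degree p + (\<Sum>i<degree p. coeff p i * g ^ i) = 0"
    using p by (simp add: add.commute)
  then show ?thesis
    using that p(2) by blast
qed

lemma integral_over_mono:
  assumes "B \<subseteq> C" "integral_over B g"
  shows "integral_over C g"
  using assms unfolding integral_over_def by blast

lemma integral_over_mem:
  assumes "ring_closed B" "g \<in> B"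
  shows "integral_over B g"
  by (rule integral_overI_sum[of B 1 "\<lambda>_. - g"]) (use assms in \<open>auto intro: rc_uminus\<close>)

section \<open>Finitely generated modules and closure properties of integrality\<close>

inductive_set mspan :: "'a::comm_ring_1 set \<Rightarrow> 'a set \<Rightarrow> 'a set" for B T where
  zero: "0 \<in> mspan B T"
| step: "b \<in> B \<Longrightarrow> t \<in> T \<Longrightarrow> x \<in> mspan B T \<Longrightarrow> b * t + x \<in> mspan B T"

lemma mspan_add: "x \<in> mspan B T \<Longrightarrow> y \<in> mspan B T \<Longrightarrow> x + y \<in> mspan B T"
  by (induction rule: mspan.induct) (auto simp: add.assoc intro: mspan.step)

lemma mspan_scale:
  assumes "ring_closed B" "b \<in> B" "x \<in> mspan B T"
  shows "b * x \<in> mspan B T"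
  using assms(3)
proof (induction rule: mspan.induct)
  case (step c t x)
  then have "(b * c) * t + b * x \<in> mspan B T"
    using assms(1,2) by (intro mspan.step) (auto intro: rc_mult)
  then show ?case
    by (simp add: algebra_simps)
qed (auto intro: mspan.zero)

lemma mspan_base: "ring_closed B \<Longrightarrow> t \<in> T \<Longrightarrow> t \<in> mspan B T"
  using mspan.step[of 1 B t T 0] by (auto intro: rc_1 mspan.zero)

lemma mspan_smult: "ring_closed B \<Longrightarrow> b \<in> B \<Longrightarrow> t \<in> T \<Longrightarrow> b * t \<in> mspan B T"
  by (intro mspan_scale mspan_base)

lemma mspan_sum: "(\<And>i. i \<in> A \<Longrightarrow> f i \<in> mspan B T) \<Longrightarrow> sum f A \<in> mspan B T"
  by (induction A rule: infinite_finite_induct) (auto intro: mspan.zero mspan_add)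

lemma mspan_uminus: "ring_closed B \<Longrightarrow> x \<in> mspan B T \<Longrightarrow> - x \<in> mspan B T"
  using mspan_scale[of B "- 1" x T] by (auto intro: rc_1 rc_uminus)

lemma mspan_times:
  assumes "x \<in> mspan B T" "\<And>t. t \<in> T \<Longrightarrow> y * t \<in> mspan B U" "ring_closed B"
  shows "y * x \<in> mspan B U"
  using assms(1)
proof (induction rule: mspan.induct)
  case (step b t x)
  have "b * (y * t) + y * x \<in> mspan B U"
    using step assms by (intro mspan_add mspan_scale[OF assms(3), of b "y * t"]) auto
  then show ?case
    by (simp add: algebra_simps)
qed (auto intro: mspan.zero)

lemma mspan_coeffs:
  assumes "finite T" "ring_closed B" "x \<in> mspan B T"
  shows "\<exists>c. (\<forall>t\<in>T. c t \<in> B) \<and> x = (\<Sum>t\<in>T. c t * t)"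
  using assms(3)
proof (induction rule: mspan.induct)
  case zero
  then show ?case
    using assms(2) by (intro exI[of _ "\<lambda>_. 0"]) (auto intro: rc_0)
next
  case (step b t x)
  then obtain c where c: "\<forall>t\<in>T. c t \<in> B" "x = (\<Sum>t\<in>T. c t * t)"
    by blast
  let ?c = "\<lambda>s. (if s = t then b else 0) + c s"
  have "(\<Sum>s\<in>T. ?c s * s) = (\<Sum>s\<in>T. if s = t then b * s else 0) + x"
    unfolding c(2) sum.distrib[symmetric] by (intro sum.cong) (auto simp: algebra_simps)
  also have "(\<Sum>s\<in>T. if s = t then b * s else 0) = b * t"
    using assms(1) step by (simp add: sum.delta)
  finally show ?case
    using c step assms(2) by (intro exI[of _ ?c]) (auto intro: rc_add)
qed

text \<open>Determinant trick: multiplication by \<open>g\<close> on the generators is given by a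
  matrix over \<open>B\<close> with eigenvalue \<open>g\<close>, so its characteristic polynomial is
  a monic equation for \<open>g\<close>. The generator 1 makes the eigenvector nonzero.\<close>

lemma integral_over_module:
  assumes B: "ring_closed B" and T: "finite T" "1 \<in> T" "\<And>t. t \<in> T \<Longrightarrow> g * t \<in> mspan B T"
  shows "integral_over B g"
proof -
  obtain c where c: "\<And>t s. t \<in> T \<Longrightarrow> s \<in> T \<Longrightarrow> c t s \<in> B" "\<And>t. t \<in> T \<Longrightarrow> g * t = (\<Sum>s\<in>T. c t s * s)"
    using mspan_coeffs[OF T(1) B T(3)] by metis
  obtain n :: nat and h where h: "bij_betw h {0..<n} T"
    using ex_bij_betw_nat_finite[OF T(1)] by blast
  have hT: "i < n \<Longrightarrow> h i \<in> T" for i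
    using h by (auto simp: bij_betw_def)
  obtain k where k: "k < n" "h k = 1"
    using h T(2) by (metis atLeastLessThan_iff bij_betwE bij_betw_def imageE)
  define A where "A = mat n n (\<lambda>(i, j). c (h i) (h j))"
  have A: "A \<in> carrier_mat n n"
    by (simp add: A_def)
  have "A *\<^sub>v vec n h = g \<cdot>\<^sub>v vec n h"
  proof (rule eq_vecI)
    fix i assume i: "i < dim_vec (g \<cdot>\<^sub>v vec n h)"
    then have "(A *\<^sub>v vec n h) $ i = (\<Sum>j\<in>{0..<n}. c (h i) (h j) * h j)"
      by (simp add: A_def scalar_prod_def)
    also have "\<dots> = (\<Sum>s\<in>T. c (h i) s * s)"
      by (rule sum.reindex_bij_betw[OF h])
    finally show "(A *\<^sub>v vec n h) $ i = (g \<cdot>\<^sub>v vec n h) $ i"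
      using i c(2)[of "h i"] hT by simp
  qed (simp add: A_def)
  moreover have "vec n h \<noteq> 0\<^sub>v n"
    using k by (metis index_vec index_zero_vec(1) zero_neq_one)
  ultimately have "eigenvalue A g"
    unfolding eigenvalue_def eigenvector_def using A by (intro exI[of _ "vec n h"]) auto
  then have root: "poly (char_poly A) g = 0"
    using eigenvalue_root_char_poly[OF A] by blast
  \<comment> \<open>This ring contains the entries of the characteristic matrix, hence also its
    determinant.\<close>
  let ?P = "{p. \<forall>i. coeff p i \<in> B}"
  have P: "ring_closed ?P"
    by (rule ring_closed_poly[OF B])
  have "char_poly_matrix A $$ (i, j) \<in> ?P" if "i < n" "j < n" for i j
    using that B by (auto simp: char_poly_matrix_def A_def coeff_pCons hT c split: nat.split
        intro!: rc_0 rc_1 rc_uminus rc_diff c(1))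
  moreover have "of_int (sign p) \<in> ?P" for p :: "nat \<Rightarrow> nat"
    using rc_1[OF P] rc_uminus[OF P rc_1[OF P]] by (cases "evenperm p") (simp_all add: sign_def)
  ultimately have "char_poly A \<in> ?P"
    unfolding char_poly_def det_def'[OF char_poly_matrix_closed[OF A]]
    by (intro rc_sum[OF P] rc_mult[OF P] rc_prod[OF P]) (auto dest: permutes_in_image)
  then show ?thesis
    unfolding integral_over_def using root degree_monic_char_poly[OF A] by auto
qed

text \<open>Stability under \<open>C\<close> passes to sums and products of its elements, and the
  generator 1 makes every stabilizing element integral by the determinant trick.\<close>

definition module_of :: "'a::field set \<Rightarrow> 'a set \<Rightarrow> 'a set \<Rightarrow> bool"
  where "module_of B C T \<longleftrightarrow> finite T \<and> 1 \<in> T \<and> (\<forall>c\<in>C. \<forall>t\<in>T. c * t \<in> mspan B T)"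

lemma module_of_closure:
  assumes "ring_closed B" "module_of B C T"
  shows "ring_closed {x. \<forall>t\<in>T. x * t \<in> mspan B T}" (is "ring_closed ?R")
proof (rule ring_closedI)
  show "1 \<in> ?R"
    using assms by (auto intro: mspan_base)
next
  fix x y assume xy: "x \<in> ?R" "y \<in> ?R"
  then show "x - y \<in> ?R"
    using assms mspan_add[OF _ mspan_uminus] by (fastforce simp: left_diff_distrib)
  show "x * y \<in> ?R"
    using xy mspan_times[of _ B T x T] assms(1) by (auto simp: mult.assoc)
qed

lemma module_of_single:
  assumes "ring_closed B" "integral_over B g"
  shows "\<exists>T. module_of B {g} T"
proof -
  obtain n a where a: "\<And>i. a i \<in> B" "g ^ n + (\<Sum>i<n. a i * g ^ i) = 0"
    using integral_overE_sum[OF assms(2)] by blast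
  have n: "n > 0"
    using a(2) by (cases n) auto
  let ?T = "(\<lambda>i. g ^ i) ` {..<n}"
  have "g * g ^ i \<in> mspan B ?T" if "i < n" for i
  proof (cases "Suc i < n")
    case True
    then have "g ^ Suc i \<in> ?T"
      by blast
    then show ?thesis
      using mspan_base[OF assms(1)] by fastforce
  next
    case False
    then have "g * g ^ i = g ^ n"
      using that by (metis Suc_lessI power_Suc)
    also have "\<dots> = - (\<Sum>i<n. a i * g ^ i)"
      using a(2) by (simp add: eq_neg_iff_add_eq_0)
    also have "\<dots> \<in> mspan B ?T"
      using a(1) assms(1) by (intro mspan_uminus mspan_sum mspan_smult) auto
    finally show ?thesis .
  qed
  then have "module_of B {g} ?T"
    using n by (auto simp: module_of_def intro: image_eqI[of _ _ 0])
  then show ?thesis ..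
qed

text \<open>The products of the two generating sets generate a module that is stable under both
  families.\<close>

lemma module_of_Un:
  assumes "ring_closed B" "module_of B C T" "module_of B D U"
  shows "\<exists>V. module_of B (C \<union> D) V"
proof -
  let ?V = "(\<lambda>(t, u). t * u) ` (T \<times> U)"
  have l: "x * u \<in> mspan B ?V" if "x \<in> mspan B T" "u \<in> U" for x u
    using mspan_times[OF that(1), of u ?V] assms(1) that(2)
    by (metis (no_types, lifting) SigmaI case_prod_conv image_eqI mspan_base mult.commute)
  have r: "x * t \<in> mspan B ?V" if "x \<in> mspan B U" "t \<in> T" for x t
    using mspan_times[OF that(1), of t ?V] assms(1) that(2)
    by (metis (no_types, lifting) SigmaI case_prod_conv image_eqI mspan_base mult.commute)
  have "c * v \<in> mspan B ?V" if "c \<in> C \<union> D" "v \<in> ?V" for c v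
  proof -
    obtain t u where tu: "t \<in> T" "u \<in> U" "v = t * u"
      using \<open>v \<in> ?V\<close> by auto
    show ?thesis
      using \<open>c \<in> C \<union> D\<close>
    proof
      assume "c \<in> C"
      then have "(c * t) * u \<in> mspan B ?V"
        using assms(2) tu by (intro l) (auto simp: module_of_def)
      then show ?thesis
        by (simp add: tu mult.assoc)
    next
      assume "c \<in> D"
      then have "(c * u) * t \<in> mspan B ?V"
        using assms(3) tu by (intro r) (auto simp: module_of_def)
      then show ?thesis
        by (simp add: tu mult_ac)
    qed
  qed
  moreover have "1 \<in> ?V" "finite ?V"
    using assms by (auto simp: module_of_def intro: image_eqI[of _ _ "(1, 1)"])
  ultimately show ?thesis
    unfolding module_of_def by blast
qed

lemma module_of_finite:
  assumes "ring_closed B" "finite C" "\<And>c. c \<in> C \<Longrightarrow> integral_over B c"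
  shows "\<exists>T. module_of B C T"
  using assms(2,3)
proof (induction C rule: finite_induct)
  case empty
  show ?case
    by (rule exI[of _ "{1}"]) (simp add: module_of_def)
next
  case (insert c C)
  then show ?case
    using module_of_single[OF assms(1), of c] module_of_Un[OF assms(1), of "{c}" _ C]
    by (metis insertCI insert_is_Un)
qed

lemma integral_over_ring:
  assumes "ring_closed B"
  shows "ring_closed {g. integral_over B g}"
proof (rule ring_closedI)
  show "1 \<in> {g. integral_over B g}"
    using integral_over_mem[OF assms rc_1[OF assms]] by simp
next
  fix g h assume "g \<in> {g. integral_over B g}" "h \<in> {g. integral_over B g}"
  then obtain T where T: "module_of B {g, h} T"
    using module_of_finite[OF assms, of "{g, h}"] by auto
  let ?R = "{x. \<forall>t\<in>T. x * t \<in> mspan B T}"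
  have R: "ring_closed ?R"
    by (rule module_of_closure[OF assms T])
  have gh: "g \<in> ?R" "h \<in> ?R"
    using T by (auto simp: module_of_def)
  have "x \<in> ?R \<Longrightarrow> integral_over B x" for x
    using integral_over_module[OF assms, of T x] T by (auto simp: module_of_def)
  then show "g - h \<in> {g. integral_over B g}" "g * h \<in> {g. integral_over B g}"
    using rc_diff[OF R gh] rc_mult[OF R gh] by blast+
qed

text \<open>The coefficients of the equation for \<open>g\<close> act on one finitely generated
  \<open>B\<close>-module. Its products with the powers of \<open>g\<close> below the degree
  generate a module that is stable under \<open>g\<close>.\<close>

lemma integral_over_trans:
  assumes B: "ring_closed B" and S: "\<And>s. s \<in> S \<Longrightarrow> integral_over B s" and g: "integral_over S g"
  shows "integral_over B g"
proof -
  obtain n a where a: "\<And>i. a i \<in> S" "g ^ n + (\<Sum>i<n. a i * g ^ i) = 0"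
    using integral_overE_sum[OF g] by blast
  obtain T where T: "module_of B (a ` {..<n}) T"
    using module_of_finite[OF B, of "a ` {..<n}"] a(1) S by auto
  let ?U = "(\<lambda>(t, i). t * g ^ i) ` (T \<times> {..<n})"
  have n: "n > 0"
    using a(2) by (cases n) auto
  have low: "x * g ^ i \<in> mspan B ?U" if "x \<in> mspan B T" "i < n" for x i
    using mspan_times[OF that(1), of "g ^ i" ?U] B that(2)
    by (metis (no_types, lifting) SigmaI case_prod_conv image_eqI lessThan_iff mspan_base mult.commute)
  have "g * u \<in> mspan B ?U" if u: "u \<in> ?U" for u
  proof -
    obtain t i where ti: "t \<in> T" "i < n" "u = t * g ^ i"
      using u by auto
    show ?thesis
    proof (cases "Suc i < n")
      case True
      then have "t * g ^ Suc i \<in> mspan B ?U"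
        using ti B by (intro low mspan_base) auto
      then show ?thesis
        by (simp add: ti mult_ac)
    next
      case False
      then have "g * u = t * g ^ n"
        using ti by (metis Suc_lessI mult.left_commute power_Suc)
      also have "g ^ n = - (\<Sum>i<n. a i * g ^ i)"
        using a(2) by (simp add: eq_neg_iff_add_eq_0)
      also have "t * \<dots> = - (\<Sum>i<n. (a i * t) * g ^ i)"
        by (simp add: sum_distrib_left mult_ac)
      also have "\<dots> \<in> mspan B ?U"
        using B T ti by (intro mspan_uminus mspan_sum low) (auto simp: module_of_def)
      finally show ?thesis .
    qed
  qed
  moreover have "1 \<in> ?U" "finite ?U"
    using T n by (auto simp: module_of_def intro: image_eqI[of _ _ "(1, 0)"])
  ultimately show ?thesis
    by (intro integral_over_module[OF B, of ?U]) auto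
qed

section \<open>Local rings in a field\<close>

definition unit_in :: "'a::field set \<Rightarrow> 'a \<Rightarrow> bool"
  where "unit_in S x \<longleftrightarrow> x \<in> S \<and> x \<noteq> 0 \<and> inverse x \<in> S"

text \<open>Contrapositive form of the criterion that the nonunits of a local ring are closed under
  addition. It avoids ideals and so transfers easily along the quotient by \<open>I\<close>.\<close>

definition local_in :: "'a::field set \<Rightarrow> bool"
  where "local_in S \<longleftrightarrow> (\<forall>x\<in>S. \<forall>y\<in>S. unit_in S (x + y) \<longrightarrow> unit_in S x \<or> unit_in S y)"

lemma unit_in_mult: "ring_closed S \<Longrightarrow> unit_in S x \<Longrightarrow> unit_in S y \<Longrightarrow> unit_in S (x * y)"
  by (auto simp: unit_in_def intro: rc_mult)

lemma unit_in_inverse: "unit_in S x \<Longrightarrow> unit_in S (inverse x)"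
  by (auto simp: unit_in_def)

lemma unit_in_factor:
  assumes "ring_closed S" "x \<in> S" "y \<in> S" "unit_in S (x * y)"
  shows "unit_in S x"
proof -
  have "y * inverse (x * y) \<in> S"
    using assms by (intro rc_mult) (auto simp: unit_in_def)
  then show ?thesis
    using assms by (auto simp: unit_in_def field_simps)
qed

lemma unit_in_uminus: "ring_closed S \<Longrightarrow> unit_in S (- x) \<longleftrightarrow> unit_in S x"
  by (auto simp: unit_in_def dest: rc_uminus)

lemma unit_in_power: "ring_closed S \<Longrightarrow> unit_in S x \<Longrightarrow> unit_in S (x ^ n)"
  by (auto simp: unit_in_def power_inverse[symmetric] intro: rc_power)

text \<open>Seidenberg's lemma: the top coefficient is absorbed into the next one, as \<open>a\<^sub>N * z\<close> is integral.\<close>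

lemma local_unit_coefficient:
  assumes S: "ring_closed S" "local_in S" and SO: "S \<subseteq> R" "ring_closed R"
    and int: "\<And>g. g \<in> R \<Longrightarrow> integral_over S g \<Longrightarrow> g \<in> S" and z: "z \<in> R"
    and "\<And>i. i \<le> N \<Longrightarrow> a i \<in> S" "(\<Sum>i\<le>N. a i * z ^ i) = 0" "\<exists>i\<le>N. unit_in S (a i)"
  shows "z \<in> S \<or> z \<noteq> 0 \<and> inverse z \<in> S"
  using assms(7-9)
proof (induction N arbitrary: a)
  case 0
  then show ?case
    by (simp add: unit_in_def)
next
  case (Suc N)
  let ?c = "a (Suc N)"
  let ?w = "?c * z"
  have eq: "?c * z ^ Suc N + (\<Sum>i\<le>N. a i * z ^ i) = 0"
    using Suc.prems(2) by (simp add: add.commute)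
  \<comment> \<open>Multiplication by \<open>?c ^ N\<close> turns the relation for \<open>z\<close>
    into a monic one for \<open>?w\<close>.\<close>
  have "?w ^ Suc N + (\<Sum>i<Suc N. (a i * ?c ^ (N - i)) * ?w ^ i) =
      ?c ^ N * (?c * z ^ Suc N + (\<Sum>i\<le>N. a i * z ^ i))"
  proof -
    have "(a i * ?c ^ (N - i)) * ?w ^ i = ?c ^ N * (a i * z ^ i)" if "i \<le> N" for i
    proof -
      have "?c ^ (N - i) * ?c ^ i = ?c ^ N"
        using that by (simp add: power_add[symmetric])
      then show ?thesis
        by (simp add: power_mult_distrib mult_ac)
    qed
    then have "(\<Sum>i\<le>N. (a i * ?c ^ (N - i)) * ?w ^ i) = (\<Sum>i\<le>N. ?c ^ N * (a i * z ^ i))"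
      by (intro sum.cong) auto
    moreover have "?w ^ Suc N = ?c ^ N * (?c * z ^ Suc N)"
      by (simp add: power_mult_distrib mult_ac)
    ultimately show ?thesis
      by (simp only: lessThan_Suc_atMost distrib_left sum_distrib_left)
  qed
  then have "integral_over S ?w"
    using eq Suc.prems(1) S(1)
    by (intro integral_overI_sum[of S "Suc N" "\<lambda>i. a i * ?c ^ (N - i)"] rc_mult[OF S(1)]
        rc_power[OF S(1)]) auto
  moreover have "?w \<in> R"
    using Suc.prems(1) SO z by (auto intro: rc_mult)
  ultimately have w: "?w \<in> S"
    using int by blast
  \<comment> \<open>If the top coefficient or \<open>?w\<close> is a unit, then \<open>z\<close> or
    its inverse is visibly in \<open>S\<close>. Otherwise locality keeps a unit among the shortened
    list of coefficients.\<close>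
  consider "unit_in S ?c" | "unit_in S ?w" | "\<not> unit_in S ?c" "\<not> unit_in S ?w"
    by blast
  then show ?case
  proof cases
    case 1
    then have "inverse ?c * ?w \<in> S"
      using rc_mult[OF S(1) _ w] 1 by (simp only: unit_in_def)
    moreover have "inverse ?c * ?w = z"
      using 1 by (simp add: unit_in_def)
    ultimately show ?thesis
      by simp
  next
    case 2
    then have "?c * inverse ?w \<in> S"
      using rc_mult[OF S(1) Suc.prems(1)[OF order_refl], of "inverse ?w"] 2
      by (simp only: unit_in_def)
    moreover have "?c * inverse ?w = inverse z"
      using 2 by (auto simp: unit_in_def)
    ultimately show ?thesis
      using 2 by (metis mult_zero_right unit_in_def)
  next
    case 3
    let ?a = "\<lambda>i. if i = N then a N + ?w else a i"
    have aS: "?a i \<in> S" if "i \<le> N" for i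
      using that Suc.prems(1) w S(1) by (auto intro: rc_add)
    have "(\<Sum>i\<le>N. ?a i * z ^ i) = (\<Sum>i\<in>{..<N}. a i * z ^ i) + (a N + ?w) * z ^ N"
      by (simp flip: lessThan_Suc_atMost)
    also have "\<dots> = ?c * z ^ Suc N + (\<Sum>i\<le>N. a i * z ^ i)"
      by (simp add: algebra_simps flip: lessThan_Suc_atMost)
    finally have sum: "(\<Sum>i\<le>N. ?a i * z ^ i) = 0"
      using eq by simp
    obtain i where i: "i \<le> Suc N" "unit_in S (a i)"
      using Suc.prems(3) by blast
    have "unit_in S (?a i)"
    proof (cases "i = N")
      case True
      then have "unit_in S ((a N + ?w) + (- ?w))"
        using i by simp
      moreover have "- ?w \<in> S" "a N + ?w \<in> S"
        using rc_uminus[OF S(1) w] aS[of N] by auto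
      ultimately have "unit_in S (a N + ?w) \<or> unit_in S (- ?w)"
        using S(2) unfolding local_in_def by blast
      then show ?thesis
        using 3 True by (simp add: unit_in_uminus[OF S(1)])
    qed (use i in auto)
    moreover have "i \<le> N"
      using i 3 by (metis le_SucE)
    ultimately show ?thesis
      using Suc.IH[of ?a] aS sum by blast
  qed
qed

section \<open>Ring homomorphisms and substitutions\<close>

definition is_hom :: "('a::comm_ring_1 \<Rightarrow> 'b::comm_ring_1) \<Rightarrow> bool"
  where "is_hom g \<longleftrightarrow> g 1 = 1 \<and> (\<forall>x y. g (x + y) = g x + g y \<and> g (x * y) = g x * g y)"

context
  fixes g :: "'a::comm_ring_1 \<Rightarrow> 'b::comm_ring_1"
  assumes g: "is_hom g"
begin

lemma hom_1: "g 1 = 1" and hom_add: "g (x + y) = g x + g y" and hom_mult: "g (x * y) = g x * g y"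
  using g by (auto simp: is_hom_def)

lemma hom_0: "g 0 = 0"
  using hom_add[of 0 0] by simp

lemma hom_uminus: "g (- x) = - g x"
  using hom_add[of x "- x"] by (simp add: hom_0 eq_neg_iff_add_eq_0 add.commute)

lemma hom_diff: "g (x - y) = g x - g y"
  using hom_add[of x "- y"] by (simp add: hom_uminus)

lemma hom_power: "g (x ^ n) = g x ^ n"
  by (induction n) (auto simp: hom_1 hom_mult)

lemma hom_sum: "g (sum f A) = (\<Sum>i\<in>A. g (f i))"
  by (induction A rule: infinite_finite_induct) (auto simp: hom_0 hom_add)

lemma hom_prod: "g (prod f A) = (\<Prod>i\<in>A. g (f i))"
  by (induction A rule: infinite_finite_induct) (auto simp: hom_1 hom_mult)

lemmas hom_simps = hom_0 hom_1 hom_add hom_mult hom_uminus hom_diff hom_power hom_sum hom_prod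

end

lemma is_homI:
  assumes "g 1 = 1" "\<And>x y. g (x + y) = g x + g y" "\<And>x y. g (x * y) = g x * g y"
  shows "is_hom g"
  using assms by (simp add: is_hom_def)

lemma is_hom_comp: "is_hom f \<Longrightarrow> is_hom g \<Longrightarrow> is_hom (\<lambda>x. f (g x))"
  by (simp add: is_hom_def)

lemma is_hom_Const: "is_hom (Const :: complex \<Rightarrow> 'v mpoly)"
  by (intro is_homI) (auto simp: Const_def single_add mult_single simp flip: single_one)

lemma is_hom_pCons: "is_hom (\<lambda>c. [:c:])"
  by (intro is_homI) (auto simp: one_pCons)

lemma is_hom_poly: "is_hom (\<lambda>p. poly p x)"
  by (intro is_homI) auto

lemma is_hom_psubst:
  assumes "is_hom h"
  shows "is_hom (psubst h x)"
proof (rule is_homI)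
  show "psubst h x 1 = 1"
    using psubst_single[of h x 0 1] by (simp add: hom_simps[OF assms])
qed (intro psubst_add psubst_mult; simp add: hom_simps[OF assms])+

lemma psubst_Const: "is_hom h \<Longrightarrow> psubst h x (Const c) = h c"
  by (simp add: Const_def psubst_single hom_0)

lemma psubst_Var: "is_hom h \<Longrightarrow> psubst h x (Var i) = x i"
  by (simp add: Var_def psubst_single hom_simps)

lemma hom_psubst:
  assumes "is_hom g"
  shows "g (psubst h x p) = psubst (\<lambda>c. g (h c)) (\<lambda>i. g (x i)) p"
  by (simp add: psubst_def hom_simps[OF assms])

lemma Var_power: "Var i ^ k = Poly_Mapping.single (Poly_Mapping.single i k) 1"
  by (induction k) (auto simp: Var_def mult_single single_add[symmetric])

lemma monom_Var:
  "(\<Prod>i\<in>Poly_Mapping.keys e. Var i ^ Poly_Mapping.lookup e i) = Poly_Mapping.single e 1"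
proof -
  have "(\<Prod>i\<in>A. Var i ^ Poly_Mapping.lookup e i) =
      Poly_Mapping.single (\<Sum>i\<in>A. Poly_Mapping.single i (Poly_Mapping.lookup e i)) 1" if "finite A" for A
    using that by (induction A) (auto simp: Var_power mult_single)
  moreover have "(\<Sum>i\<in>Poly_Mapping.keys e. Poly_Mapping.single i (Poly_Mapping.lookup e i)) = e"
    by (intro poly_mapping_eqI) (auto simp: lookup_sum lookup_single when_def in_keys_iff)
  ultimately show ?thesis
    by simp
qed

lemma psubst_id: "psubst Const Var p = p"
  by (subst (2) mpoly_sum_single) (simp add: psubst_def monom_Var Const_def mult_single)

lemma hom_eq_psubst: "is_hom g \<Longrightarrow> g p = psubst (\<lambda>c. g (Const c)) (\<lambda>i. g (Var i)) p"
  using hom_psubst[of g Const Var p] by (simp add: psubst_id)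

definition pev :: "('a::comm_ring_1 \<Rightarrow> 'b::comm_ring_1) \<Rightarrow> 'b \<Rightarrow> 'a poly \<Rightarrow> 'b"
  where "pev h x p = poly (map_poly h p) x"

lemma is_hom_pev:
  assumes "is_hom h"
  shows "is_hom (pev h x)"
proof (rule is_homI)
  fix p q
  have "map_poly h (p + q) = map_poly h p + map_poly h q"
    by (intro poly_eqI) (simp add: coeff_map_poly hom_simps[OF assms])
  then show "pev h x (p + q) = pev h x p + pev h x q"
    by (simp add: pev_def)
  have "map_poly h (p * q) = map_poly h p * map_poly h q"
    by (intro poly_eqI) (simp add: coeff_map_poly coeff_mult hom_simps[OF assms])
  then show "pev h x (p * q) = pev h x p * pev h x q"
    by (simp add: pev_def)
qed (simp add: pev_def hom_simps[OF assms])

lemma pev_pCons: "is_hom h \<Longrightarrow> pev h x (pCons c p) = h c + x * pev h x p"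
  by (cases "c = 0 \<and> p = 0") (auto simp: pev_def map_poly_pCons hom_0)

lemma pev_0: "is_hom h \<Longrightarrow> pev h x 0 = 0"
  by (simp add: pev_def)

section \<open>Homogeneous polynomials\<close>

lemma homogeneous_0 [simp]: "homogeneous k 0"
  by (simp add: homogeneous_def)

lemma homogeneous_Const [simp]: "homogeneous 0 (Const c)"
  by (auto simp: homogeneous_def Const_def mdeg_def split: if_splits)

lemma homogeneous_1 [simp]: "homogeneous 0 1"
  using homogeneous_Const[of 1] by (simp add: hom_1[OF is_hom_Const])

lemma homogeneous_Var [simp]: "homogeneous 1 (Var i)"
  by (auto simp: homogeneous_def Var_def mdeg_def)

lemma homogeneous_add: "homogeneous k p \<Longrightarrow> homogeneous k q \<Longrightarrow> homogeneous k (p + q)"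
  using keys_add[of p q] by (auto simp: homogeneous_def)

lemma homogeneous_uminus: "homogeneous k p \<Longrightarrow> homogeneous k (- p)"
  by (simp add: homogeneous_def)

lemma homogeneous_diff: "homogeneous k p \<Longrightarrow> homogeneous k q \<Longrightarrow> homogeneous k (p - q)"
  using homogeneous_add[of k p "- q"] homogeneous_uminus[of k q] by simp

lemma homogeneous_sum: "(\<And>i. i \<in> A \<Longrightarrow> homogeneous k (f i)) \<Longrightarrow> homogeneous k (sum f A)"
  by (induction A rule: infinite_finite_induct) (auto intro: homogeneous_add)

lemma homogeneous_power: "homogeneous k p \<Longrightarrow> homogeneous (k * n) (p ^ n)"
proof (induction n)
  case (Suc n)
  then show ?case
    using homogeneous_mult[of k p "k * n" "p ^ n"] by simp
qed simp

lemma homogeneous_Const_mult: "homogeneous k p \<Longrightarrow> homogeneous k (Const c * p)"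
  using homogeneous_mult[of 0 "Const c" k p] by simp

lemma homogeneous_prod:
  "(\<And>i. i \<in> A \<Longrightarrow> homogeneous (k i) (f i)) \<Longrightarrow> homogeneous (\<Sum>i\<in>A. k i) (prod f A)"
  by (induction A rule: infinite_finite_induct) (auto intro: homogeneous_mult)

lemma homogeneous_unique:
  assumes "homogeneous j p" "homogeneous k p" "p \<noteq> 0"
  shows "j = k"
proof -
  obtain e where "e \<in> Poly_Mapping.keys p"
    using assms(3) by (metis equals0I keys_eq_empty)
  then show ?thesis
    using assms(1,2) by (auto simp: homogeneous_def)
qed

lemma lookup_hom_part:
  "Poly_Mapping.lookup (hom_part k p) e = (if mdeg e = k then Poly_Mapping.lookup p e else 0)"
  by (auto simp: hom_part_def lookup_sum lookup_single when_def in_keys_iff)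

lemma homogeneous_hom_part [simp]: "homogeneous k (hom_part k p)"
  by (auto simp: homogeneous_def in_keys_iff lookup_hom_part split: if_splits)

lemma hom_part_add: "hom_part k (p + q) = hom_part k p + hom_part k q"
  by (intro poly_mapping_eqI) (simp add: lookup_hom_part lookup_add)

lemma hom_part_0 [simp]: "hom_part k 0 = 0"
  by (intro poly_mapping_eqI) (simp add: lookup_hom_part)

lemma hom_part_sum: "hom_part k (sum f A) = (\<Sum>i\<in>A. hom_part k (f i))"
  by (induction A rule: infinite_finite_induct) (auto simp: hom_part_add)

lemma hom_part_homogeneous:
  assumes "homogeneous j p"
  shows "hom_part k p = (if j = k then p else 0)"
  using assms by (intro poly_mapping_eqI) (auto simp: lookup_hom_part homogeneous_def in_keys_iff)

lemma sum_hom_part: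
  obtains N where "\<And>M. M \<ge> N \<Longrightarrow> p = (\<Sum>k\<le>M. hom_part k p)"
proof -
  have "p = (\<Sum>k\<le>M. hom_part k p)" if "M \<ge> Max (mdeg ` Poly_Mapping.keys p)" for M
  proof (intro poly_mapping_eqI)
    fix e
    have "mdeg e \<le> M" if "e \<in> Poly_Mapping.keys p"
      using that \<open>M \<ge> Max _\<close> by (meson Max_ge finite_imageI finite_keys imageI order_trans)
    then show "Poly_Mapping.lookup p e = Poly_Mapping.lookup (\<Sum>k\<le>M. hom_part k p) e"
      by (auto simp: lookup_sum lookup_hom_part in_keys_iff)
  qed
  then show thesis
    using that by blast
qed

lemma hom_part_mult_homogeneous:
  assumes "homogeneous d F"
  shows "hom_part (d + k) (F * p) = F * hom_part k p"
proof -
  obtain N where N: "\<And>M. M \<ge> N \<Longrightarrow> p = (\<Sum>k\<le>M. hom_part k p)"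
    using sum_hom_part[of p] by blast
  have "F * p = (\<Sum>j\<le>max N k. F * hom_part j p)"
    using N[of "max N k"] by (simp flip: sum_distrib_left)
  then have "hom_part (d + k) (F * p) = (\<Sum>j\<le>max N k. hom_part (d + k) (F * hom_part j p))"
    by (simp add: hom_part_sum)
  also have "\<dots> = (\<Sum>j\<le>max N k. if j = k then F * hom_part j p else 0)"
    using hom_part_homogeneous[OF homogeneous_mult[OF assms homogeneous_hom_part]]
    by (intro sum.cong) auto
  finally show ?thesis
    by simp
qed

lemma homogeneous_psubst:
  assumes "homogeneous k p" "\<And>i. homogeneous 1 (x i)"
  shows "homogeneous k (psubst Const x p)"
  unfolding psubst_def
proof (intro homogeneous_sum homogeneous_Const_mult)
  fix e assume "e \<in> Poly_Mapping.keys p"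
  then have "k = (\<Sum>i\<in>Poly_Mapping.keys e. Poly_Mapping.lookup e i)"
    using assms(1) by (auto simp: homogeneous_def mdeg_def)
  then show "homogeneous k (\<Prod>i\<in>Poly_Mapping.keys e. x i ^ Poly_Mapping.lookup e i)"
    using homogeneous_power[OF assms(2)] by (auto intro: homogeneous_prod)
qed

lemma homogeneous_degree_0:
  assumes "homogeneous 0 p"
  obtains c where "p = Const c"
proof -
  have "e = 0" if "e \<in> Poly_Mapping.keys p" for e
  proof -
    have "mdeg e = 0"
      using assms that by (simp add: homogeneous_def)
    then show ?thesis
      by (intro poly_mapping_eqI) (auto simp: mdeg_def in_keys_iff)
  qed
  then have "p = Const (Poly_Mapping.lookup p 0)"
    unfolding Const_def by (intro poly_mapping_eqI) (auto simp: lookup_single when_def in_keys_iff)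
  then show thesis
    using that by blast
qed

text \<open>Multiply every variable by a new variable X and sort by powers of X. The product becomes
  a monomial in X, so in each factor the order at 0 equals the degree: only one homogeneous part
  survives.\<close>

lemma homogeneous_factor:
  fixes p q :: form
  assumes "homogeneous k (p * q)" "p \<noteq> 0" "q \<noteq> 0"
  obtains i j where "homogeneous i p" "homogeneous j q" "i + j = k"
proof -
  define T :: "form \<Rightarrow> form poly" where
    "T = psubst (\<lambda>c. [:Const c:]) (\<lambda>i. [:0, Var i:])"
  have h: "is_hom (\<lambda>c. [:Const c:] :: form poly)"
    by (rule is_hom_comp[OF is_hom_pCons is_hom_Const])
  have T: "is_hom T"
    unfolding T_def by (rule is_hom_psubst[OF h])
  have xe: "(\<Prod>i\<in>Poly_Mapping.keys e. [:0, Var i:] ^ Poly_Mapping.lookup e i) =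
      monom (Poly_Mapping.single e 1) (mdeg e)" for e :: "3 \<Rightarrow>\<^sub>0 nat"
  proof -
    have "[:0, Var i:] = monom (Var i) 1" for i :: 3
      by (simp add: monom_altdef)
    moreover have "(\<Prod>i\<in>A. monom (f i) (n i)) = monom (prod f A) (sum n A)" if "finite A"
      for A and f :: "3 \<Rightarrow> form" and n
      using that by (induction A) (auto simp: mult_monom)
    ultimately show ?thesis
      by (simp add: monom_power mdeg_def monom_Var)
  qed
  have co: "coeff (T r) n = hom_part n r" for r n
  proof -
    have "coeff (T r) n = (\<Sum>e\<in>Poly_Mapping.keys r.
        if mdeg e = n then Poly_Mapping.single e (Poly_Mapping.lookup r e) else 0)"
      unfolding T_def psubst_def xe coeff_sum
      by (intro sum.cong refl) (simp add: Const_def mult_single smult_monom)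
    also have "\<dots> = hom_part n r"
      by (simp add: hom_part_def sum.inter_filter)
    finally show ?thesis .
  qed
  have T0: "T r = 0 \<longleftrightarrow> r = 0" for r
  proof
    assume "T r = 0"
    then have "hom_part n r = 0" for n
      using co[of r n] by simp
    moreover obtain N where "r = (\<Sum>k\<le>N. hom_part k r)"
      using sum_hom_part[of r] by blast
    ultimately show "r = 0"
      by simp
  qed (simp add: hom_0[OF T])
  have ord: "order 0 (T r) = n \<Longrightarrow> degree (T r) = n \<Longrightarrow> homogeneous n r" if "r \<noteq> 0" for r n
  proof -
    assume *: "order 0 (T r) = n" "degree (T r) = n"
    have z: "hom_part j r = 0" if "j \<noteq> n" for j
    proof (cases "j < n")
      case True
      have "monom 1 n dvd T r"
        using *(1) \<open>r \<noteq> 0\<close> T0 monom_1_dvd_iff[of "T r" n] by auto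
      then show ?thesis
        using True co[of r j] by (auto simp: monom_1_dvd_iff')
    next
      case False
      then show ?thesis
        using that *(2) co[of r j] by (metis coeff_eq_0 linorder_neqE_nat)
    qed
    obtain N where "\<And>M. M \<ge> N \<Longrightarrow> r = (\<Sum>k\<le>M. hom_part k r)"
      using sum_hom_part[of r] by blast
    then have "r = (\<Sum>k\<le>max N n. hom_part k r)"
      by simp
    also have "\<dots> = (\<Sum>k\<le>max N n. if k = n then hom_part n r else 0)"
      using z by (intro sum.cong) auto
    finally have "r = hom_part n r"
      by simp
    then show "homogeneous n r"
      by (metis homogeneous_hom_part)
  qed
  have "T p * T q = T (p * q)"
    by (simp add: hom_mult[OF T])
  also have "\<dots> = monom (p * q) k"
    by (intro poly_eqI) (simp add: co hom_part_homogeneous[OF assms(1)])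
  finally have TT: "T p * T q = monom (p * q) k" .
  have nz: "p * q \<noteq> 0" "T p \<noteq> 0" "T q \<noteq> 0"
    using assms T0 by auto
  have deg: "degree (T p) + degree (T q) = k"
    using nz by (simp flip: degree_mult_eq add: TT degree_monom_eq)
  have "order 0 (monom (p * q) k) = k"
    using nz by (simp add: order_0_monom)
  then have "order 0 (T p) + order 0 (T q) = k"
    using nz TT by (metis order_mult no_zero_divisors)
  moreover have "order 0 (T p) \<le> degree (T p)" "order 0 (T q) \<le> degree (T q)"
    using nz by (auto intro: order_degree)
  ultimately have "order 0 (T p) = degree (T p)" "order 0 (T q) = degree (T q)"
    using deg by linarith+
  then show thesis
    using that[OF ord ord deg] assms(2,3) by blast
qed

section \<open>Coordinates adapted to a point and a line\<close>

definition pairing :: "(3 \<Rightarrow> complex) \<Rightarrow> (3 \<Rightarrow> complex) \<Rightarrow> complex"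
  where "pairing c w = (\<Sum>i\<in>UNIV. c i * w i)"

definition lin :: "(3 \<Rightarrow> complex) \<Rightarrow> form"
  where "lin c = (\<Sum>i\<in>UNIV. Const (c i) * Var i)"

lemma homogeneous_lin: "homogeneous 1 (lin c)"
  unfolding lin_def by (intro homogeneous_sum homogeneous_Const_mult homogeneous_Var)

lemma peval_lin: "peval w (lin c) = pairing c w"
proof -
  have "is_hom (\<lambda>c :: complex. c)"
    by (simp add: is_hom_def)
  note h = this
  show ?thesis
    unfolding peval_def lin_def pairing_def hom_sum[OF is_hom_psubst[OF h]]
      hom_mult[OF is_hom_psubst[OF h]] psubst_Const[OF h] psubst_Var[OF h] ..
qed

definition triangle :: "nat \<Rightarrow> (nat \<times> nat) set"
  where "triangle d = {(i, j). i + j \<le> d}"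

lemma finite_triangle [simp]: "finite (triangle d)"
  by (rule finite_subset[of _ "{..d} \<times> {..d}"]) (auto simp: triangle_def)

lemma mem_triangle [simp]: "(i, j) \<in> triangle d \<longleftrightarrow> i + j \<le> d"
  by (simp add: triangle_def)

lemma triangle_delta:
  "(\<Sum>p\<in>triangle d. if p = (i, j) then c else 0) = (if i + j \<le> d then c else 0)"
  by (simp only: sum.delta[OF finite_triangle] mem_triangle)

text \<open>\<open>v\<close> is the point, \<open>v\<close> and \<open>a\<close> span the line
  \<open>L2 = 0\<close>, and \<open>b\<close> is off it; the primed vectors are the dual basis.
  \<open>complete\<close> states the other half of the inverse matrix relation, so that
  substitutions can be undone at once.\<close>

locale plane_basis =
  fixes v a b v' a' b' :: "3 \<Rightarrow> complex"
  assumes dual: "pairing v' v = 1" "pairing v' a = 0" "pairing v' b = 0"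
    "pairing a' v = 0" "pairing a' a = 1" "pairing a' b = 0"
    "pairing b' v = 0" "pairing b' a = 0" "pairing b' b = 1"
    and complete: "v i * v' j + a i * a' j + b i * b' j = (if i = j then 1 else 0)"
begin

abbreviation "L0 \<equiv> lin v'"
abbreviation "L1 \<equiv> lin a'"
abbreviation "L2 \<equiv> lin b'"

definition mon :: "nat \<Rightarrow> nat \<Rightarrow> nat \<Rightarrow> form"
  where "mon d i j = L1 ^ i * L2 ^ j * L0 ^ (d - i - j)"

definition lsubst :: "(complex \<Rightarrow> 'b) \<Rightarrow> 'b \<Rightarrow> 'b \<Rightarrow> 'b \<Rightarrow> form \<Rightarrow> 'b::comm_ring_1"
  where "lsubst h x0 x1 x2 = psubst h (\<lambda>i. h (v i) * x0 + h (a i) * x1 + h (b i) * x2)"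

lemma is_hom_lsubst: "is_hom h \<Longrightarrow> is_hom (lsubst h x0 x1 x2)"
  unfolding lsubst_def by (rule is_hom_psubst)

lemma lsubst_lin:
  assumes h: "is_hom h"
  shows "lsubst h x0 x1 x2 (lin c) = h (pairing c v) * x0 + h (pairing c a) * x1 + h (pairing c b) * x2"
  by (simp add: lin_def pairing_def lsubst_def hom_simps[OF is_hom_psubst[OF h]] psubst_Const[OF h]
      psubst_Var[OF h] hom_simps[OF h] sum_distrib_left sum.distrib algebra_simps)

lemma lsubst_L:
  assumes "is_hom h"
  shows "lsubst h x0 x1 x2 L0 = x0" "lsubst h x0 x1 x2 L1 = x1" "lsubst h x0 x1 x2 L2 = x2"
  by (simp_all add: lsubst_lin[OF assms] dual hom_simps[OF assms])

lemma lsubst_Const: "is_hom h \<Longrightarrow> lsubst h x0 x1 x2 (Const c) = h c"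
  by (simp add: lsubst_def psubst_Const)

lemma lsubst_mon:
  assumes "is_hom h"
  shows "lsubst h x0 x1 x2 (mon d i j) = x1 ^ i * x2 ^ j * x0 ^ (d - i - j)"
  by (simp add: mon_def hom_simps[OF is_hom_lsubst[OF assms]] lsubst_L[OF assms])

lemma Var_eq: "Var i = Const (v i) * L0 + Const (a i) * L1 + Const (b i) * L2"
proof -
  have "Const (v i) * L0 + Const (a i) * L1 + Const (b i) * L2 =
      (\<Sum>j\<in>UNIV. Const (v i * v' j + a i * a' j + b i * b' j) * Var j)"
    by (simp add: lin_def sum_distrib_left sum.distrib[symmetric] hom_simps[OF is_hom_Const] algebra_simps)
  also have "\<dots> = (\<Sum>j\<in>UNIV. if i = j then Var j else 0)"
    by (intro sum.cong) (simp_all add: complete hom_simps[OF is_hom_Const])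
  finally show ?thesis
    by simp
qed

lemma lsubst_id: "lsubst Const L0 L1 L2 F = F"
  by (simp add: lsubst_def Var_eq[symmetric] psubst_id)

lemma hom_lsubst:
  assumes "is_hom g"
  shows "g (lsubst h x0 x1 x2 F) = lsubst (\<lambda>c. g (h c)) (g x0) (g x1) (g x2) F"
  by (simp add: lsubst_def hom_psubst[OF assms] hom_simps[OF assms])

lemma hom_eq_lsubst:
  assumes "is_hom g"
  shows "g F = lsubst (\<lambda>c. g (Const c)) (g L0) (g L1) (g L2) F"
  using hom_lsubst[OF assms, of Const L0 L1 L2 F] by (simp add: lsubst_id)

lemma homogeneous_mon: "i + j \<le> d \<Longrightarrow> homogeneous d (mon d i j)"
proof -
  assume "i + j \<le> d"
  then have "(1 * i + 1 * j) + 1 * (d - i - j) = d"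
    by simp
  moreover have "homogeneous ((1 * i + 1 * j) + 1 * (d - i - j)) (mon d i j)"
    unfolding mon_def by (intro homogeneous_mult homogeneous_power homogeneous_lin)
  ultimately show ?thesis
    by simp
qed

abbreviation "emb \<equiv> \<lambda>c :: complex. [:[:c:]:]"

lemma is_hom_emb: "is_hom emb"
  by (rule is_hom_comp[OF is_hom_pCons is_hom_pCons])

text \<open>Dehomogenization at \<open>L0 = 1\<close>. The inner variable is \<open>x\<close>, the
  outer one \<open>y\<close>, so \<open>cf F i j\<close> is the coefficient of
  \<open>x ^ i * y ^ j\<close>.\<close>

definition aff :: "form \<Rightarrow> complex poly poly"
  where "aff = lsubst emb 1 [:[:0, 1:]:] [:0, 1:]"

definition cf :: "form \<Rightarrow> nat \<Rightarrow> nat \<Rightarrow> complex"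
  where "cf F i j = coeff (coeff (aff F) j) i"

lemma is_hom_aff: "is_hom aff"
  unfolding aff_def by (rule is_hom_lsubst[OF is_hom_emb])

lemma aff_mon: "aff (mon d i j) = monom (monom 1 i) j"
proof -
  have "[:[:0, 1 :: complex:]:] ^ i = [:monom 1 i:]"
    by (simp add: monom_altdef hom_power[OF is_hom_pCons, symmetric])
  then show ?thesis
    unfolding aff_def lsubst_mon[OF is_hom_emb] by (simp add: monom_altdef[of "monom 1 i"])
qed

lemma aff_Const: "aff (Const c) = [:[:c:]:]"
  unfolding aff_def by (rule lsubst_Const[OF is_hom_emb])

lemma cf_add: "cf (F + G) i j = cf F i j + cf G i j"
  by (simp add: cf_def hom_add[OF is_hom_aff])

lemma cf_Const_mult: "cf (Const c * F) i j = c * cf F i j"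
  by (simp add: cf_def hom_mult[OF is_hom_aff] aff_Const)

lemma cf_sum: "cf (sum f A) i j = (\<Sum>k\<in>A. cf (f k) i j)"
  by (simp add: cf_def hom_sum[OF is_hom_aff] coeff_sum)

lemma cf_mon: "cf (mon d i j) k l = (if i = k \<and> j = l then 1 else 0)"
  by (simp add: cf_def aff_mon)

definition of_cf :: "nat \<Rightarrow> (nat \<Rightarrow> nat \<Rightarrow> complex) \<Rightarrow> form"
  where "of_cf d c = (\<Sum>(i, j)\<in>triangle d. Const (c i j) * mon d i j)"

lemma homogeneous_of_cf: "homogeneous d (of_cf d c)"
  unfolding of_cf_def
  by (intro homogeneous_sum) (auto simp: triangle_def intro!: homogeneous_Const_mult homogeneous_mon)

lemma cf_of_cf: "cf (of_cf d c) i j = (if i + j \<le> d then c i j else 0)"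
proof -
  have "cf (of_cf d c) i j = (\<Sum>x\<in>triangle d. if x = (i, j) then c i j else 0)"
    unfolding of_cf_def cf_sum
    by (intro sum.cong) (auto simp: cf_Const_mult cf_mon split: if_splits)
  then show ?thesis
    by (simp add: triangle_delta)
qed

text \<open>Multiplication by each of the three linear forms, hence by each variable, maps the span
  of the \<open>mon k i j\<close> into the span for \<open>Suc k\<close>. So these spans contain all
  monomials in the original variables.\<close>

lemma of_cf_cf:
  assumes "homogeneous d F"
  shows "of_cf d (cf F) = F"
proof -
  define P where "P = (\<lambda>d. mspan (range Const) ((\<lambda>(i, j). mon d i j) ` triangle d))"
  have C: "ring_closed (range (Const :: complex \<Rightarrow> form))"
    by (intro ring_closedI)
      (auto simp: image_iff hom_simps[OF is_hom_Const, symmetric])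
  have L: "l * F \<in> P (Suc k)" if "F \<in> P k" "l \<in> {L0, L1, L2}" for l F k
    unfolding P_def
  proof (rule mspan_times[OF that(1)[unfolded P_def] _ C])
    fix t assume "t \<in> (\<lambda>(i, j). mon k i j) ` triangle k"
    then obtain i j where t: "t = mon k i j" "i + j \<le> k"
      by (auto simp: triangle_def)
    then have "L0 * t = mon (Suc k) i j" "L1 * t = mon (Suc k) (Suc i) j" "L2 * t = mon (Suc k) i (Suc j)"
      by (auto simp: mon_def Suc_diff_le algebra_simps simp flip: power_Suc)
    moreover have "(i, j) \<in> triangle (Suc k)" "(Suc i, j) \<in> triangle (Suc k)" "(i, Suc j) \<in> triangle (Suc k)"
      using t by (auto simp: triangle_def)
    ultimately have "l * t \<in> (\<lambda>(i, j). mon (Suc k) i j) ` triangle (Suc k)"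
      using that(2) by (metis (no_types, lifting) case_prod_conv image_eqI insertE singletonD)
    then show "l * t \<in> mspan (range Const) ((\<lambda>(i, j). mon (Suc k) i j) ` triangle (Suc k))"
      by (rule mspan_base[OF C])
  qed
  have V: "Var i * F \<in> P (Suc k)" if "F \<in> P k" for i k F
  proof -
    have "Var i * F = Const (v i) * (L0 * F) + Const (a i) * (L1 * F) + Const (b i) * (L2 * F)"
      by (subst Var_eq) (simp add: algebra_simps)
    also have "\<dots> \<in> P (Suc k)"
      using L[OF that] unfolding P_def
      by (intro mspan_add; intro mspan_scale[OF C rangeI]) auto
    finally show ?thesis .
  qed
  have Vp: "Var i ^ n * F \<in> P (k + n)" if "F \<in> P k" for i k n F
    by (induction n) (use that V in \<open>auto simp: mult.assoc\<close>)
  have m: "(\<Prod>i\<in>A. Var i ^ e i) \<in> P (\<Sum>i\<in>A. e i)" if "finite A" for A e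
    using that
  proof (induction A)
    case empty
    have "1 = mon 0 0 0"
      by (simp add: mon_def)
    then show ?case
      unfolding P_def by (auto simp: triangle_def intro!: mspan_base[OF C] image_eqI[of _ _ "(0,0)"])
  next
    case (insert x A)
    then show ?case
      using Vp[OF insert.IH, of x "e x"] by (simp add: add.commute)
  qed
  have "F = psubst Const Var F"
    by (simp add: psubst_id)
  also have "\<dots> \<in> P d"
    unfolding psubst_def
  proof (subst P_def, intro mspan_sum mspan_scale[OF C])
    fix e assume "e \<in> Poly_Mapping.keys F"
    then have "d = (\<Sum>i\<in>Poly_Mapping.keys e. Poly_Mapping.lookup e i)"
      using assms by (auto simp: homogeneous_def mdeg_def)
    with m[of "Poly_Mapping.keys e" "Poly_Mapping.lookup e"]
    show "(\<Prod>i\<in>Poly_Mapping.keys e. Var i ^ Poly_Mapping.lookup e i)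
        \<in> mspan (range Const) ((\<lambda>(i, j). mon d i j) ` triangle d)"
      by (simp add: P_def)
  qed auto
  finally have "F \<in> mspan (range Const) ((\<lambda>(i, j). mon d i j) ` triangle d)"
    by (simp add: P_def)
  then show ?thesis
  proof (induction rule: mspan.induct)
    case zero
    show ?case
      by (simp add: of_cf_def cf_def hom_simps[OF is_hom_aff] hom_simps[OF is_hom_Const] split_beta)
  next
    case (step c t x)
    then obtain z i j where z: "c = Const z" "t = mon d i j" "(i, j) \<in> triangle d"
      by auto
    have "of_cf d (cf (c * t + x)) =
        (\<Sum>p\<in>triangle d. if p = (i, j) then Const z * mon d i j else 0) + of_cf d (cf x)"
      unfolding of_cf_def z cf_add cf_Const_mult cf_mon sum.distrib[symmetric]
      by (intro sum.cong) (auto simp: hom_simps[OF is_hom_Const] algebra_simps split: if_splits)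
    also have "\<dots> = c * t + x"
      using z step by (simp only: triangle_delta) simp
    finally show ?case .
  qed
qed

lemma cf_eq_0: "homogeneous d F \<Longrightarrow> i + j > d \<Longrightarrow> cf F i j = 0"
  using cf_of_cf[of d "cf F" i j] of_cf_cf[of d F] by simp

lemma homogeneous_eqI:
  assumes "homogeneous d F" "homogeneous d G" "\<And>i j. i + j \<le> d \<Longrightarrow> cf F i j = cf G i j"
  shows "F = G"
proof -
  have "of_cf d (cf F) = of_cf d (cf G)"
    unfolding of_cf_def by (intro sum.cong) (auto simp: triangle_def assms(3))
  then show ?thesis
    using assms of_cf_cf by metis
qed

lemma lsubst_homogeneous:
  assumes "is_hom h" "homogeneous d F"
  shows "lsubst h x0 x1 x2 F = (\<Sum>(i, j)\<in>triangle d. h (cf F i j) * (x1 ^ i * x2 ^ j * x0 ^ (d - i - j)))"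
proof -
  have "lsubst h x0 x1 x2 F = lsubst h x0 x1 x2 (of_cf d (cf F))"
    by (simp add: of_cf_cf[OF assms(2)])
  also have "\<dots> = (\<Sum>(i, j)\<in>triangle d. h (cf F i j) * (x1 ^ i * x2 ^ j * x0 ^ (d - i - j)))"
    by (simp add: of_cf_def split_beta hom_simps[OF is_hom_lsubst[OF assms(1)]]
        lsubst_mon[OF assms(1)] lsubst_Const[OF assms(1)])
  finally show ?thesis .
qed

lemma is_hom_id: "is_hom (\<lambda>c :: complex. c)"
  by (simp add: is_hom_def)

lemma peval_lsubst: "peval (\<lambda>i. x0 * v i + x1 * a i + x2 * b i) F = lsubst (\<lambda>c. c) x0 x1 x2 F"
  by (simp add: peval_def lsubst_def mult.commute)

lemma peval_v: "homogeneous d F \<Longrightarrow> peval v F = cf F 0 0"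
proof -
  assume F: "homogeneous d F"
  have "peval v F = lsubst (\<lambda>c. c) 1 0 0 F"
    using peval_lsubst[of 1 0 0 F] by simp
  also have "\<dots> = (\<Sum>p\<in>triangle d. if p = (0, 0) then cf F 0 0 else 0)"
    unfolding lsubst_homogeneous[OF is_hom_id F] by (intro sum.cong) (auto simp: power_0_left split: if_splits)
  finally have "peval v F = (\<Sum>p\<in>triangle d. if p = (0, 0) then cf F 0 0 else 0)" .
  then show ?thesis
    by (simp add: triangle_delta)
qed

lemma peval_b:
  assumes F: "homogeneous d F"
  shows "peval b F = cf F 0 d"
proof -
  have "peval b F = lsubst (\<lambda>c. c) 0 0 1 F"
    using peval_lsubst[of 0 0 1 F] by simp
  also have "\<dots> = (\<Sum>p\<in>triangle d. if p = (0, d) then cf F 0 d else 0)"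
    unfolding lsubst_homogeneous[OF is_hom_id F] by (intro sum.cong) (auto simp: power_0_left split: if_splits)
  finally have "peval b F = (\<Sum>p\<in>triangle d. if p = (0, d) then cf F 0 d else 0)" .
  then show ?thesis
    by (simp add: triangle_delta)
qed

lemma mult_L0_cf: "cf (L0 * F) i j = cf F i j"
  unfolding cf_def hom_mult[OF is_hom_aff] by (simp add: aff_def lsubst_L(1)[OF is_hom_emb])

subsection \<open>Irreducible forms are prime\<close>

text \<open>Isomorphism with a threefold univariate polynomial ring, where irreducible elements are
  known to be prime.\<close>

definition iter :: "form \<Rightarrow> complex poly poly poly"
  where "iter = lsubst (\<lambda>c. [:[:[:c:]:]:]) [:[:[:0, 1:]:]:] [:[:0, 1:]:] [:0, 1:]"

definition uniter :: "complex poly poly poly \<Rightarrow> form"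
  where "uniter = pev (pev (pev Const L0) L1) L2"

lemma is_hom_iter: "is_hom iter"
  unfolding iter_def by (intro is_hom_lsubst is_hom_comp[OF is_hom_pCons is_hom_emb])

lemmas is_hom_pevs = is_hom_pev[OF is_hom_Const] is_hom_pev[OF is_hom_pev[OF is_hom_Const]]
  is_hom_pev[OF is_hom_pev[OF is_hom_pev[OF is_hom_Const]]]

lemma is_hom_uniter: "is_hom uniter"
  unfolding uniter_def by (rule is_hom_pevs)

lemma uniter_iter: "uniter (iter F) = F"
proof -
  have "uniter (iter F) = lsubst (\<lambda>c. Const c) L0 L1 L2 F"
    unfolding iter_def hom_lsubst[OF is_hom_uniter]
    by (simp add: uniter_def pev_pCons[OF is_hom_Const] pev_0[OF is_hom_Const]
        pev_pCons[OF is_hom_pevs(1)] pev_0[OF is_hom_pevs(1)]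
        pev_pCons[OF is_hom_pevs(2)] pev_0[OF is_hom_pevs(2)] hom_simps[OF is_hom_Const]
        hom_1[OF is_hom_pevs(1)] hom_1[OF is_hom_pevs(2)])
  then show ?thesis
    by (simp add: lsubst_id)
qed

lemma iter_uniter: "iter (uniter p) = p"
proof -
  have h: "is_hom (\<lambda>c :: complex. [:[:[:c:]:]:])"
    by (rule is_hom_comp[OF is_hom_pCons is_hom_emb])
  have i: "iter (Const c) = [:[:[:c:]:]:]" "iter L0 = [:[:[:0, 1:]:]:]" "iter L1 = [:[:0, 1:]:]"
    "iter L2 = [:0, 1:]" for c
    by (simp_all add: iter_def lsubst_Const[OF h] lsubst_L[OF h])
  note H = hom_0[OF is_hom_iter] hom_add[OF is_hom_iter] hom_mult[OF is_hom_iter] i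
  have 1: "iter (pev Const L0 r) = [:[:r:]:]" for r
    by (induction r) (simp_all add: pev_0[OF is_hom_Const] pev_pCons[OF is_hom_Const] H)
  have 2: "iter (pev (pev Const L0) L1 r) = [:r:]" for r
    by (induction r) (simp_all add: pev_0[OF is_hom_pevs(1)] pev_pCons[OF is_hom_pevs(1)] H 1)
  have 3: "iter (pev (pev (pev Const L0) L1) L2 r) = r" for r
    by (induction r) (simp_all add: pev_0[OF is_hom_pevs(2)] pev_pCons[OF is_hom_pevs(2)] H 2)
  show ?thesis
    unfolding uniter_def by (rule 3)
qed

lemma iter_dvd_iff: "iter F dvd iter G \<longleftrightarrow> F dvd G"
proof
  assume "iter F dvd iter G"
  then obtain p where "iter G = iter F * p"
    by (elim dvdE)
  then have "G = F * uniter p"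
    by (metis hom_mult[OF is_hom_uniter] uniter_iter)
  then show "F dvd G"
    by simp
qed (auto simp: dvd_def hom_mult[OF is_hom_iter])

lemma irreducible_iter:
  assumes "irreducible F"
  shows "irreducible (iter F)"
proof (rule Factorial_Ring.irreducibleI)
  show "iter F \<noteq> 0"
    using assms uniter_iter[of F] hom_0[OF is_hom_uniter] by (auto simp: Factorial_Ring.irreducible_def)
  show "\<not> iter F dvd 1"
    using assms iter_dvd_iff[of F 1] by (simp add: hom_1[OF is_hom_iter] Factorial_Ring.irreducible_def)
next
  fix p q assume "iter F = p * q"
  then have "F = uniter p * uniter q"
    by (metis hom_mult[OF is_hom_uniter] uniter_iter)
  then have "uniter p dvd 1 \<or> uniter q dvd 1"
    using assms by (simp add: Factorial_Ring.irreducible_def)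
  then show "p dvd 1 \<or> q dvd 1"
    using iter_dvd_iff[of _ 1] by (metis hom_1[OF is_hom_iter] iter_uniter)
qed

lemma prime_elem_iter: "irreducible F \<Longrightarrow> prime_elem (iter F)"
  using irreducible_iter Factorial_Ring.irreducible_imp_prime_elem by blast

lemma irreducible_dvd_mult:
  fixes F :: form
  assumes "irreducible F" "F dvd G * H"
  shows "F dvd G \<or> F dvd H"
  using prime_elem_dvd_multD[OF prime_elem_iter[OF assms(1)], of "iter G" "iter H"] assms(2)
  by (simp flip: hom_mult[OF is_hom_iter] add: iter_dvd_iff)

end

section \<open>Degree zero fractions\<close>

abbreviation fr :: "form \<Rightarrow> form fract"
  where "fr p \<equiv> Fraction_Field.Fract p 1"

declare add_fract [simp del] diff_fract [simp del] minus_fract [simp del] mult_fract [simp del]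
  inverse_fract [simp del] divide_fract [simp del]

lemma is_hom_fr: "is_hom fr"
  by (intro is_homI) (auto simp: One_fract_def add_fract mult_fract)

lemma fr_eq_iff [simp]: "fr p = fr q \<longleftrightarrow> p = q"
  by (simp add: eq_fract)

lemma fr_eq_0 [simp]: "fr p = 0 \<longleftrightarrow> p = 0"
  by (simp add: Zero_fract_def eq_fract)

lemma Fract_fr: "q \<noteq> 0 \<Longrightarrow> Fraction_Field.Fract p q = fr p / fr q"
  by (simp add: divide_fract)

lemma frac_add: "q \<noteq> 0 \<Longrightarrow> q' \<noteq> 0 \<Longrightarrow> fr p / fr q + fr p' / fr q' = fr (p * q' + p' * q) / fr (q * q')"
  by (simp add: add_frac_eq hom_simps[OF is_hom_fr])

lemma frac_diff: "q \<noteq> 0 \<Longrightarrow> q' \<noteq> 0 \<Longrightarrow> fr p / fr q - fr p' / fr q' = fr (p * q' - p' * q) / fr (q * q')"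
  by (simp add: diff_frac_eq hom_simps[OF is_hom_fr])

lemma frac_mult: "(fr p / fr q) * (fr p' / fr q') = fr (p * p') / fr (q * q')"
  by (simp add: hom_simps[OF is_hom_fr])

definition mult_set :: "form set \<Rightarrow> bool"
  where "mult_set D \<longleftrightarrow> 1 \<in> D \<and> 0 \<notin> D \<and> (\<forall>x\<in>D. \<forall>y\<in>D. x * y \<in> D)"

text \<open>The carrier of \<open>hloc D\<close> as a bare set, so that computations take place in
  the field type \<open>form fract\<close>.\<close>

definition hfrac :: "form set \<Rightarrow> form fract set"
  where "hfrac D = {Fraction_Field.Fract p q | p q k. homogeneous k p \<and> homogeneous k q \<and> q \<in> D}"

lemma hfracI: "homogeneous k p \<Longrightarrow> homogeneous k q \<Longrightarrow> q \<in> D \<Longrightarrow> 0 \<notin> D \<Longrightarrow> fr p / fr q \<in> hfrac D"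
  unfolding hfrac_def mem_Collect_eq
  by (rule exI[of _ p], rule exI[of _ q], rule exI[of _ k], simp, metis Fract_fr)

lemma hfracE:
  assumes "x \<in> hfrac D" "0 \<notin> D"
  obtains p q k where "homogeneous k p" "homogeneous k q" "q \<in> D" "q \<noteq> 0" "x = fr p / fr q"
proof -
  obtain p q k where *: "x = Fraction_Field.Fract p q" "homogeneous k p" "homogeneous k q" "q \<in> D"
    using assms(1) unfolding hfrac_def by blast
  moreover have "q \<noteq> 0"
    using assms(2) * by blast
  ultimately show thesis
    using that[of k p q] Fract_fr[of q p] by metis
qed

lemma hloc_idealI:
  "homogeneous k p \<Longrightarrow> homogeneous k q \<Longrightarrow> q \<in> D \<Longrightarrow> 0 \<notin> D \<Longrightarrow> F dvd p \<Longrightarrow> fr p / fr q \<in> hloc_ideal D F"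
  unfolding hloc_ideal_def mem_Collect_eq
  by (rule exI[of _ p], rule exI[of _ q], rule exI[of _ k], simp, metis Fract_fr)

lemma hloc_idealE:
  assumes "x \<in> hloc_ideal D F" "0 \<notin> D"
  obtains p q k where "homogeneous k p" "homogeneous k q" "q \<in> D" "q \<noteq> 0" "F dvd p" "x = fr p / fr q"
proof -
  obtain p q k where *: "x = Fraction_Field.Fract p q" "homogeneous k p" "homogeneous k q" "q \<in> D" "F dvd p"
    using assms(1) unfolding hloc_ideal_def by blast
  moreover have "q \<noteq> 0"
    using assms(2) * by blast
  ultimately show thesis
    using that[of k p q] Fract_fr[of q p] by metis
qed

context
  fixes D :: "form set"
  assumes D: "mult_set D"
begin

lemma mult_set_0: "0 \<notin> D" and mult_set_1: "1 \<in> D" and mult_set_mult: "x \<in> D \<Longrightarrow> y \<in> D \<Longrightarrow> x * y \<in> D"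
  using D by (auto simp: mult_set_def)

lemma ring_closed_hfrac: "ring_closed (hfrac D)"
proof (rule ring_closedI)
  show "1 \<in> hfrac D"
    using hfracI[OF homogeneous_1 homogeneous_1 mult_set_1 mult_set_0] by (simp add: hom_1[OF is_hom_fr])
next
  fix x y assume "x \<in> hfrac D" "y \<in> hfrac D"
  then obtain p q k p' q' k' where *: "homogeneous k p" "homogeneous k q" "q \<in> D" "q \<noteq> 0" "x = fr p / fr q"
      "homogeneous k' p'" "homogeneous k' q'" "q' \<in> D" "q' \<noteq> 0" "y = fr p' / fr q'"
    by (elim hfracE[OF _ mult_set_0]) blast
  have "x - y = fr (p * q' - p' * q) / fr (q * q')"
    using * by (simp add: frac_diff)
  moreover have "x * y = fr (p * p') / fr (q * q')"
    using * by (simp only: frac_mult)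
  moreover have "homogeneous (k + k') (p * q' - p' * q)"
    using homogeneous_mult[of k p k' q'] homogeneous_mult[of k' p' k q] *
    by (intro homogeneous_diff) (auto simp: add.commute)
  ultimately show "x - y \<in> hfrac D" "x * y \<in> hfrac D"
    using * homogeneous_mult[of k q k' q'] homogeneous_mult[of k p k' p']
    by (auto intro!: hfracI[OF _ _ _ mult_set_0] mult_set_mult)
qed

lemma hloc_ideal_subset: "hloc_ideal D F \<subseteq> hfrac D"
  unfolding hloc_ideal_def hfrac_def by blast

lemma hloc_ideal_zero: "0 \<in> hloc_ideal D F"
  using hloc_idealI[OF homogeneous_0 homogeneous_1 mult_set_1 mult_set_0, of F]
  by (simp add: hom_0[OF is_hom_fr])

lemma hloc_ideal_add:
  assumes "x \<in> hloc_ideal D F" "y \<in> hloc_ideal D F"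
  shows "x + y \<in> hloc_ideal D F"
proof -
  obtain p q k p' q' k' where *: "homogeneous k p" "homogeneous k q" "q \<in> D" "q \<noteq> 0" "x = fr p / fr q"
      "homogeneous k' p'" "homogeneous k' q'" "q' \<in> D" "q' \<noteq> 0" "y = fr p' / fr q'" "F dvd p" "F dvd p'"
    using assms by (elim hloc_idealE[OF _ mult_set_0]) blast
  have "x + y = fr (p * q' + p' * q) / fr (q * q')"
    using * by (simp add: frac_add)
  moreover have "homogeneous (k + k') (p * q' + p' * q)"
    using homogeneous_mult[of k p k' q'] homogeneous_mult[of k' p' k q] *
    by (intro homogeneous_add) (auto simp: add.commute)
  ultimately show ?thesis
    using * homogeneous_mult[of k q k' q']
    by (auto intro!: hloc_idealI[OF _ _ _ mult_set_0] mult_set_mult)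
qed

lemma hloc_ideal_mult:
  assumes "x \<in> hloc_ideal D F" "y \<in> hfrac D"
  shows "x * y \<in> hloc_ideal D F"
proof -
  obtain p q k where *: "homogeneous k p" "homogeneous k q" "q \<in> D" "q \<noteq> 0" "x = fr p / fr q" "F dvd p"
    using assms by (elim hloc_idealE[OF _ mult_set_0]) blast
  obtain p' q' k' where **: "homogeneous k' p'" "homogeneous k' q'" "q' \<in> D" "q' \<noteq> 0" "y = fr p' / fr q'"
    using assms by (elim hfracE[OF _ mult_set_0]) blast
  have "x * y = fr (p * p') / fr (q * q')"
    using * ** by (simp only: frac_mult)
  then show ?thesis
    using * ** homogeneous_mult[of k q k' q'] homogeneous_mult[of k p k' p']
    by (auto intro!: hloc_idealI[OF _ _ _ mult_set_0] mult_set_mult)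
qed

end

lemma carrier_hloc: "carrier (hloc D) = hfrac D"
  by (simp add: hloc_def hfrac_def)

lemma peval_1 [simp]: "peval v 1 = 1"
  by (simp add: peval_def psubst_def)

lemma is_hom_peval: "is_hom (peval v)"
  unfolding peval_def by (rule is_hom_psubst) (simp add: is_hom_def)

lemma peval_Const [simp]: "peval v (Const c) = c"
  unfolding peval_def by (rule psubst_Const) (simp add: is_hom_def)

lemma mult_set_at: "mult_set (dens_at v)"
  by (auto simp: mult_set_def dens_at_def hom_simps[OF is_hom_peval])

section \<open>The integral closure of the local ring of a curve at a point\<close>

locale curve_at =
  fixes F :: form and d :: nat and v :: "3 \<Rightarrow> complex"
  assumes hom_F: "homogeneous d F" and F_prime: "F dvd p * q \<Longrightarrow> F dvd p \<or> F dvd q"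
    and F_nonunit: "\<not> F dvd 1" and F_v: "peval v F = 0"
begin

lemma mult_set_gen: "mult_set (dens_gen F)"
  unfolding mult_set_def dens_gen_def using F_prime F_nonunit by fastforce

text \<open>\<open>Og\<close> modulo its maximal ideal \<open>I\<close> is the function field.
  \<open>B\<close> is the local ring of the plane at the point; \<open>B'\<close> and
  \<open>S\<close> are the preimages in \<open>Og\<close> of the local ring of the curve and of its
  integral closure.\<close>

definition Og where "Og = hfrac (dens_gen F)"
definition I where "I = hloc_ideal (dens_gen F) F"
definition B where "B = hfrac (dens_at v)"
definition B' where "B' = {x + y | x y. x \<in> B \<and> y \<in> I}"
definition S where "S = {x \<in> Og. integral_over B' x}"

lemma ring_O: "ring_closed Og"
  unfolding Og_def by (rule ring_closed_hfrac[OF mult_set_gen])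

lemma ring_B: "ring_closed B"
  unfolding B_def by (rule ring_closed_hfrac[OF mult_set_at])

lemma at_subset_gen: "dens_at v \<subseteq> dens_gen F"
  by (auto simp: dens_at_def dens_gen_def F_v hom_mult[OF is_hom_peval] elim!: dvdE)

lemma B_subset_O: "B \<subseteq> Og"
  using at_subset_gen by (auto simp: B_def Og_def hfrac_def)

lemma I_subset_O: "I \<subseteq> Og"
  unfolding I_def Og_def by (rule hloc_ideal_subset[OF mult_set_gen])

lemma I_0: "0 \<in> I" and I_add: "x \<in> I \<Longrightarrow> y \<in> I \<Longrightarrow> x + y \<in> I"
  and I_mult: "x \<in> I \<Longrightarrow> y \<in> Og \<Longrightarrow> x * y \<in> I"
  unfolding I_def Og_def
  using hloc_ideal_zero[OF mult_set_gen] hloc_ideal_add[OF mult_set_gen] hloc_ideal_mult[OF mult_set_gen]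
  by blast+

lemma I_uminus: "x \<in> I \<Longrightarrow> - x \<in> I"
  using I_mult[of x "- 1"] rc_uminus[OF ring_O rc_1[OF ring_O]] by simp

lemma I_diff: "x \<in> I \<Longrightarrow> y \<in> I \<Longrightarrow> x - y \<in> I"
  using I_add[of x "- y"] I_uminus by simp

text \<open>Primality of \<open>F\<close> makes membership in \<open>I\<close> independent of the
  representing fraction.\<close>

lemma I_frac:
  assumes "p \<in> dens_gen F" "fr q / fr p \<in> I"
  shows "F dvd q"
proof -
  obtain r s where rs: "s \<in> dens_gen F" "s \<noteq> 0" "F dvd r" "fr q / fr p = fr r / fr s"
    using assms(2) unfolding I_def by (elim hloc_idealE[OF _ mult_set_0[OF mult_set_gen]])
  have "p \<noteq> 0"
    using assms(1) by (auto simp: dens_gen_def)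
  then have "fr (q * s) = fr (r * p)"
    using rs by (simp add: frac_eq_eq hom_mult[OF is_hom_fr])
  then have "q * s = r * p"
    by simp
  then have "F dvd q * s"
    using rs(3) by simp
  then show ?thesis
    using F_prime rs(1) by (auto simp: dens_gen_def)
qed

lemma I_1: "1 \<notin> I"
  using I_frac[of 1 1] F_nonunit mult_set_1[OF mult_set_gen] by (auto simp: hom_1[OF is_hom_fr])

text \<open>Outside \<open>I\<close> the numerator is itself an admissible denominator.\<close>

lemma O_inverse:
  assumes "x \<in> Og" "x \<notin> I"
  shows "inverse x \<in> Og" "x \<noteq> 0"
proof -
  obtain p q k where *: "homogeneous k p" "homogeneous k q" "q \<in> dens_gen F" "q \<noteq> 0" "x = fr p / fr q"
    using assms(1) unfolding Og_def by (elim hfracE[OF _ mult_set_0[OF mult_set_gen]]) blast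
  then have "p \<in> dens_gen F"
    using assms(2) hloc_idealI[of k p q "dens_gen F" F] mult_set_0[OF mult_set_gen]
    by (auto simp: dens_gen_def I_def)
  then show "inverse x \<in> Og"
    using * hfracI[of k q p "dens_gen F"] mult_set_0[OF mult_set_gen] by (simp add: Og_def)
  show "x \<noteq> 0"
    using assms(2) I_0 by auto
qed

lemma I_prime: "x \<in> Og \<Longrightarrow> y \<in> Og \<Longrightarrow> x * y \<in> I \<Longrightarrow> x \<in> I \<or> y \<in> I"
proof -
  assume *: "x \<in> Og" "y \<in> Og" "x * y \<in> I"
  have "y \<in> I" if "x \<notin> I"
  proof -
    have "(x * y) * inverse x \<in> I"
      by (rule I_mult[OF *(3) O_inverse(1)[OF *(1) that]])
    then show ?thesis
      using O_inverse(2)[OF *(1) that] by (simp add: field_simps)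
  qed
  then show ?thesis
    by blast
qed

lemma ring_B': "ring_closed B'"
proof (rule ring_closedI)
  show "1 \<in> B'"
    unfolding B'_def using rc_1[OF ring_B] I_0 by force
next
  fix x y assume "x \<in> B'" "y \<in> B'"
  then obtain a i c j where *: "x = a + i" "y = c + j" "a \<in> B" "c \<in> B" "i \<in> I" "j \<in> I"
    by (auto simp: B'_def)
  have "x - y = (a - c) + (i - j)" "x * y = a * c + (j * a + i * c + i * j)"
    by (auto simp: * algebra_simps)
  moreover have "i - j \<in> I" "j * a + i * c + i * j \<in> I"
    using * B_subset_O I_subset_O by (auto intro!: I_add I_diff I_mult)
  ultimately show "x - y \<in> B'" "x * y \<in> B'"
    unfolding B'_def using * rc_diff[OF ring_B] rc_mult[OF ring_B] by blast+
qed

lemma B_subset_B': "B \<subseteq> B'"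
  unfolding B'_def using I_0 by force

lemma I_subset_B': "I \<subseteq> B'"
  unfolding B'_def using rc_0[OF ring_B] by force

lemma B'_subset_O: "B' \<subseteq> Og"
  unfolding B'_def using B_subset_O I_subset_O rc_add[OF ring_O] by blast

lemma B'_subset_S: "B' \<subseteq> S"
  unfolding S_def using B'_subset_O integral_over_mem[OF ring_B'] by blast

lemma S_subset_O: "S \<subseteq> Og"
  by (auto simp: S_def)

lemma ring_S: "ring_closed S"
  using ring_O integral_over_ring[OF ring_B'] by (auto simp: S_def ring_closed_def)

lemma S_closed: "x \<in> Og \<Longrightarrow> integral_over S x \<Longrightarrow> x \<in> S"
  using integral_over_trans[OF ring_B', of S] by (auto simp: S_def)

text \<open>The maximal ideal of \<open>B\<close>.\<close>

definition mB where "mB = {fr p / fr q | p q k. homogeneous k p \<and> homogeneous k q \<and> q \<in> dens_at v \<and> peval v p = 0}"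

lemma mB_subset: "mB \<subseteq> B"
  unfolding mB_def B_def using mult_set_0[OF mult_set_at[of v]] by (auto intro: hfracI)

lemma B_unit:
  assumes "homogeneous k p" "homogeneous k q" "q \<in> dens_at v" "p \<in> dens_at v"
  shows "unit_in B (fr p / fr q)"
proof -
  have "p \<noteq> 0" "q \<noteq> 0"
    using assms mult_set_0[OF mult_set_at[of v]] by auto
  then show ?thesis
    using assms mult_set_0[OF mult_set_at[of v]]
    by (auto simp: unit_in_def B_def intro: hfracI)
qed

definition const :: "complex \<Rightarrow> form fract"
  where "const c = fr (Const c)"

lemma is_hom_const: "is_hom const"
  unfolding const_def by (rule is_hom_comp[OF is_hom_fr is_hom_Const])

lemma const_B: "const c \<in> B"
  using hfracI[OF homogeneous_Const homogeneous_1, of "dens_at v" c] mult_set_at[of v]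
  by (simp add: B_def const_def mult_set_def hom_1[OF is_hom_fr])

lemma const_inverse: "c \<noteq> 0 \<Longrightarrow> const c \<noteq> 0 \<and> inverse (const c) = const (inverse c)"
proof -
  assume "c \<noteq> 0"
  then have "const c * const (inverse c) = 1"
    by (simp add: hom_1[OF is_hom_const] flip: hom_mult[OF is_hom_const])
  then show ?thesis
    using inverse_unique[of "const c" "const (inverse c)"] by auto
qed

lemma mB_mult: "x \<in> mB \<Longrightarrow> y \<in> B \<Longrightarrow> x * y \<in> mB"
proof -
  assume "x \<in> mB" "y \<in> B"
  then obtain p q k p' q' k' where *: "homogeneous k p" "homogeneous k q" "q \<in> dens_at v" "x = fr p / fr q"
      "peval v p = 0" "homogeneous k' p'" "homogeneous k' q'" "q' \<in> dens_at v" "q' \<noteq> 0" "y = fr p' / fr q'"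
    unfolding mB_def B_def by (auto elim: hfracE[OF _ mult_set_0[OF mult_set_at]])
  then have "x * y = fr (p * p') / fr (q * q')"
    by (simp only: frac_mult)
  then show ?thesis
    unfolding mB_def mem_Collect_eq using * homogeneous_mult[of k q k' q'] homogeneous_mult[of k p k' p']
      mult_set_mult[OF mult_set_at, of q v q']
    by (intro exI[of _ "p * p'"] exI[of _ "q * q'"] exI[of _ "k + k'"]) (simp add: hom_mult[OF is_hom_peval])
qed

lemma mB_add: "x \<in> mB \<Longrightarrow> y \<in> mB \<Longrightarrow> x + y \<in> mB"
proof -
  assume "x \<in> mB" "y \<in> mB"
  then obtain p q k p' q' k' where *: "homogeneous k p" "homogeneous k q" "q \<in> dens_at v" "x = fr p / fr q"
      "peval v p = 0" "homogeneous k' p'" "homogeneous k' q'" "q' \<in> dens_at v" "y = fr p' / fr q'" "peval v p' = 0"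
    unfolding mB_def by blast
  then have "q \<noteq> 0" "q' \<noteq> 0"
    using mult_set_0[OF mult_set_at[of v]] by auto
  then have "x + y = fr (p * q' + p' * q) / fr (q * q')"
    using * by (simp add: frac_add)
  moreover have "homogeneous (k + k') (p * q' + p' * q)"
    using homogeneous_mult[of k p k' q'] homogeneous_mult[of k' p' k q] *
    by (intro homogeneous_add) (auto simp: add.commute)
  ultimately show ?thesis
    unfolding mB_def mem_Collect_eq using * homogeneous_mult[of k q k' q']
      mult_set_mult[OF mult_set_at, of q v q']
    by (intro exI[of _ "p * q' + p' * q"] exI[of _ "q * q'"] exI[of _ "k + k'"])
      (simp add: hom_mult[OF is_hom_peval] hom_add[OF is_hom_peval])
qed

lemma B_decomp:
  assumes "x \<in> B"
  obtains c y where "y \<in> mB" "x = const c + y"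
proof -
  obtain p q k where *: "homogeneous k p" "homogeneous k q" "q \<in> dens_at v" "q \<noteq> 0" "x = fr p / fr q"
    using assms unfolding B_def by (elim hfracE[OF _ mult_set_0[OF mult_set_at]]) blast
  define c where "c = peval v p / peval v q"
  have "peval v (p - Const c * q) = 0"
    using * by (simp add: hom_diff[OF is_hom_peval] hom_mult[OF is_hom_peval] c_def dens_at_def)
  then have "fr (p - Const c * q) / fr q \<in> mB"
    unfolding mB_def using * homogeneous_diff[OF _ homogeneous_Const_mult] by blast
  moreover have "x = const c + fr (p - Const c * q) / fr q"
    using * by (simp add: const_def field_simps hom_simps[OF is_hom_fr])
  ultimately show thesis
    using that by blast
qed

text \<open>The inverse is \<open>1 - x * inverse (1 + x)\<close>, again in \<open>1 + I\<close>.
  This is why units can be tested before or after passing to the quotient by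
  \<open>I\<close>.\<close>

lemma unit_1_plus_I: "x \<in> I \<Longrightarrow> unit_in B' (1 + x)"
proof -
  assume x: "x \<in> I"
  then have "1 + x \<in> Og" "1 + x \<notin> I"
    using I_subset_O rc_add[OF ring_O rc_1[OF ring_O]] I_diff[of "1 + x" x] I_1 by auto
  then have "inverse (1 + x) \<in> Og" "1 + x \<noteq> 0"
    by (auto dest: O_inverse)
  moreover from this have "inverse (1 + x) = 1 - x * inverse (1 + x)"
    by (simp add: field_simps)
  ultimately show ?thesis
    unfolding unit_in_def using x I_subset_B' rc_add[OF ring_B' rc_1[OF ring_B']]
      rc_diff[OF ring_B' rc_1[OF ring_B']] I_mult by (metis subsetD)
qed

text \<open>The part in \<open>B\<close> is a unit because its numerator does not vanish at the
  point; dividing by it leaves an element of \<open>1 + I\<close>.\<close>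

lemma unit_B':
  assumes "c \<noteq> 0" "x \<in> mB" "y \<in> I"
  shows "unit_in B' (const c + x + y)"
proof -
  obtain p q k where *: "homogeneous k p" "homogeneous k q" "q \<in> dens_at v" "x = fr p / fr q" "peval v p = 0"
    using assms(2) unfolding mB_def by blast
  then have "q \<noteq> 0"
    using mult_set_0[OF mult_set_at[of v]] by auto
  then have "const c + x = fr (Const c * q + p) / fr q"
    using * by (simp add: const_def field_simps hom_simps[OF is_hom_fr])
  moreover have "peval v (Const c * q + p) \<noteq> 0"
    using * assms(1) by (simp add: hom_simps[OF is_hom_peval] dens_at_def)
  ultimately have u: "unit_in B (const c + x)"
    using * by (auto intro!: B_unit homogeneous_add homogeneous_Const_mult simp: dens_at_def)
  then have "unit_in B' (const c + x)"
    using B_subset_B' by (auto simp: unit_in_def)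
  moreover have "unit_in B' (1 + y * inverse (const c + x))"
    using u B_subset_O assms(3) by (intro unit_1_plus_I I_mult) (auto simp: unit_in_def)
  moreover have "const c + x + y = (const c + x) * (1 + y * inverse (const c + x))"
    using u by (simp add: unit_in_def field_simps)
  ultimately show ?thesis
    using unit_in_mult[OF ring_B'] by metis
qed

lemma unit_B'_imp_S: "unit_in B' x \<Longrightarrow> unit_in S x"
  using B'_subset_S by (auto simp: unit_in_def)

lemma unit_const: "c \<noteq> 0 \<Longrightarrow> unit_in S (const c)"
  using const_B B_subset_B' B'_subset_S const_inverse by (auto simp: unit_in_def)

text \<open>Elements of \<open>mB\<close> lie in the Jacobson radical of \<open>S\<close>: if \<open>s\<close> is integral, so is \<open>u = 1 + x s\<close>, with a
  polynomial whose constant term is a unit.\<close>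

lemma unit_1_plus:
  assumes x: "x \<in> mB" and s: "s \<in> S"
  shows "unit_in S (1 + x * s)"
proof -
  have "integral_over B' s"
    using s by (simp add: S_def)
  then obtain n c where c: "\<And>i. c i \<in> B'" "s ^ n + (\<Sum>i<n. c i * s ^ i) = 0"
    using integral_overE_sum[of B' s] by blast
  define u where "u = 1 + x * s"
  have xB: "x \<in> B"
    using x mB_subset by blast
  then have "x \<in> S"
    using B_subset_B' B'_subset_S by blast
  then have xS: "x \<in> S" "u \<in> S" "- 1 \<in> S" "c i \<in> S" for i
    using s c B'_subset_S rc_add[OF ring_S rc_1[OF ring_S]] rc_mult[OF ring_S, of x s]
      rc_uminus[OF ring_S rc_1[OF ring_S]] by (auto simp: u_def)
  \<comment> \<open>The equation of \<open>s\<close>, rescaled to a monic equation of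
    \<open>x * s\<close>, that is of \<open>u - 1\<close>. All lower coefficients carry a power of
    \<open>x\<close>.\<close>
  define Q where "Q = (\<lambda>y. y ^ n + (\<Sum>i<n. c i * x ^ (n - i) * y ^ i))"
  have "Q (u - 1) = x ^ n * (s ^ n + (\<Sum>i<n. c i * s ^ i))"
  proof -
    have "c i * x ^ (n - i) * (x * s) ^ i = x ^ n * (c i * s ^ i)" if "i < n" for i
    proof -
      have "x ^ (n - i) * x ^ i = x ^ n"
        using that by (simp flip: power_add)
      then show ?thesis
        by (simp add: power_mult_distrib mult_ac)
    qed
    then have "(\<Sum>i<n. c i * x ^ (n - i) * (x * s) ^ i) = x ^ n * (\<Sum>i<n. c i * s ^ i)"
      unfolding sum_distrib_left by (intro sum.cong) auto
    then show ?thesis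
      by (simp add: Q_def u_def power_mult_distrib distrib_left)
  qed
  then have Q1: "Q (u - 1) = 0"
    by (simp add: c)
  have diff: "\<exists>r\<in>S. (u - 1) ^ i = (- 1) ^ i + u * r" for i
  proof (induction i)
    case 0
    show ?case
      using rc_0[OF ring_S] by (intro bexI[of _ 0]) auto
  next
    case (Suc i)
    then obtain r where r: "r \<in> S" "(u - 1) ^ i = (- 1) ^ i + u * r"
      by blast
    then have "(u - 1) ^ Suc i = (- 1) ^ Suc i + u * ((- 1) ^ i + (u - 1) * r)"
      by (simp add: algebra_simps)
    moreover have "(- 1) ^ i + (u - 1) * r \<in> S"
      using r xS rc_1[OF ring_S] by (intro rc_add[OF ring_S] rc_mult[OF ring_S] rc_power[OF ring_S] rc_diff[OF ring_S])
    ultimately show ?case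
      by blast
  qed
  then obtain r where r: "\<And>i. r i \<in> S" "\<And>i. (u - 1) ^ i = (- 1) ^ i + u * r i"
    by metis
  define R where "R = r n + (\<Sum>i<n. c i * x ^ (n - i) * r i)"
  \<comment> \<open>Reduction of \<open>Q\<close> modulo \<open>u\<close>. Hence \<open>u\<close>
    divides \<open>Q (- 1)\<close>, which is plus or minus 1 up to elements of \<open>mB\<close> and
    \<open>I\<close>.\<close>
  have "Q (u - 1) = Q (- 1) + u * R"
    by (simp add: Q_def r R_def algebra_simps sum.distrib sum_distrib_left)
  then have "Q (- 1) = u * (- R)"
    using Q1 by (simp add: eq_neg_iff_add_eq_0)
  moreover have "unit_in S (Q (- 1))"
  proof -
    have t1: "c i * x ^ (n - i) * (- 1) ^ i \<in> {y + z | y z. y \<in> mB \<and> z \<in> I}" if "i < n" for i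
    proof -
      obtain y z where yz: "c i = y + z" "y \<in> B" "z \<in> I"
        using c(1)[of i] by (auto simp: B'_def)
      have xi: "x ^ (n - i - 1) * (- 1) ^ i \<in> B"
        using xB rc_uminus[OF ring_B rc_1[OF ring_B]]
        by (intro rc_mult[OF ring_B] rc_power[OF ring_B]) auto
      have "x ^ (n - i) = x * x ^ (n - i - 1)"
        using that by (subst power_eq_if) simp
      then have "c i * x ^ (n - i) * (- 1) ^ i =
          x * (y * (x ^ (n - i - 1) * (- 1) ^ i)) + z * (x * (x ^ (n - i - 1) * (- 1) ^ i))"
        by (simp add: yz algebra_simps)
      moreover have "x * (y * (x ^ (n - i - 1) * (- 1) ^ i)) \<in> mB"
        by (rule mB_mult[OF x rc_mult[OF ring_B yz(2) xi]])
      moreover have "z * (x * (x ^ (n - i - 1) * (- 1) ^ i)) \<in> I"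
        using rc_mult[OF ring_B xB xi] B_subset_O by (intro I_mult[OF yz(3)]) auto
      ultimately show ?thesis
        by blast
    qed
    have t2: "(\<Sum>i\<in>A. f i) \<in> {y + z | y z. y \<in> mB \<and> z \<in> I}"
      if "\<And>i. i \<in> A \<Longrightarrow> f i \<in> {y + z | y z. y \<in> mB \<and> z \<in> I}" for f and A :: "nat set"
      using that
    proof (induction A rule: infinite_finite_induct)
      case (insert i A)
      then obtain y z y' z' where "y \<in> mB" "z \<in> I" "y' \<in> mB" "z' \<in> I" "f i = y + z" "sum f A = y' + z'"
        by blast
      then have "sum f (insert i A) = (y + y') + (z + z')" "y + y' \<in> mB" "z + z' \<in> I"
        using insert by (auto intro: mB_add I_add)
      then show ?case
        by blast
    qed (use mB_mult[OF x rc_0[OF ring_B]] I_0 in force)+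
    have "(\<Sum>i<n. c i * x ^ (n - i) * (- 1) ^ i) \<in> {y + z | y z. y \<in> mB \<and> z \<in> I}"
      by (rule t2) (use t1 in blast)
    then obtain y z where yz: "y \<in> mB" "z \<in> I" "(\<Sum>i<n. c i * x ^ (n - i) * (- 1) ^ i) = y + z"
      by blast
    then have "Q (- 1) = const ((- 1) ^ n) + y + z"
      by (simp add: Q_def hom_simps[OF is_hom_const])
    then show ?thesis
      using unit_B'[OF _ yz(1,2), of "(- 1) ^ n"] unit_B'_imp_S by simp
  qed
  moreover have "- R \<in> S"
    unfolding R_def using r xS
    by (intro rc_uminus[OF ring_S] rc_add[OF ring_S] rc_sum[OF ring_S] rc_mult[OF ring_S] rc_power[OF ring_S])
  ultimately show ?thesis
    using unit_in_factor[OF ring_S xS(2)] by (simp add: u_def)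
qed

end

section \<open>The fibre of the normalization\<close>

text \<open>Zorn's lemma for the ideals that contain \<open>x\<close> but not 1; the principal ideal
  of \<open>x\<close> is one of them.\<close>

lemma (in cring) nonunit_in_maximalideal:
  assumes x: "x \<in> carrier R" "x \<notin> Units R"
  shows "\<exists>M. maximalideal M R \<and> x \<in> M"
proof -
  let ?A = "{J. ideal J R \<and> x \<in> J \<and> \<one> \<notin> J}"
  have "\<one> \<notin> PIdl x"
  proof
    assume "\<one> \<in> PIdl x"
    then obtain y where "y \<in> carrier R" "y \<otimes> x = \<one>"
      unfolding cgenideal_def by auto
    then have "x \<in> Units R"
      using x(1) m_comm[of x y] unfolding Units_def by auto
    then show False
      using x(2) by blast
  qed
  then have "PIdl x \<in> ?A"
    using cgenideal_ideal[OF x(1)] cgenideal_self[OF x(1)] by simp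
  then have ne: "?A \<noteq> {}"
    by blast
  have "\<exists>M\<in>?A. \<forall>J\<in>?A. M \<subseteq> J \<longrightarrow> J = M"
  proof (rule subset_Zorn_nonempty[OF ne])
    fix C assume C: "C \<noteq> {}" "subset.chain ?A C"
    then have "subset.chain {J. ideal J R} C"
      by (auto simp: pred_on.chain_def)
    then have "ideal (\<Union>C) R"
      using chain_Union_is_ideal[of C] C(1) by simp
    then show "\<Union>C \<in> ?A"
      using C by (auto simp: pred_on.chain_def)
  qed
  then obtain M where M: "ideal M R" "x \<in> M" "\<one> \<notin> M" "\<And>J. J \<in> ?A \<Longrightarrow> M \<subseteq> J \<Longrightarrow> J = M"
    by blast
  have "maximalideal M R"
  proof (rule maximalidealI[OF M(1)])
    show "carrier R \<noteq> M"
      using M(3) by blast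
  next
    fix J assume J: "ideal J R" "M \<subseteq> J" "J \<subseteq> carrier R"
    show "J = M \<or> J = carrier R"
      using M(2) M(4)[of J] J ideal.one_imp_carrier[OF J(1)] by blast
  qed
  then show ?thesis
    using M(2) by blast
qed

text \<open>A unique maximal ideal contains all nonunits. Conversely, closure under addition makes
  the nonunits an ideal, and this ideal contains every proper ideal.\<close>

lemma (in cring) ex1_maximalideal_iff:
  assumes "\<one> \<noteq> \<zero>"
  shows "(\<exists>!M. maximalideal M R) \<longleftrightarrow>
    (\<forall>x\<in>carrier R. \<forall>y\<in>carrier R. x \<oplus> y \<in> Units R \<longrightarrow> x \<in> Units R \<or> y \<in> Units R)"
proof -
  have unit_carrier: "J = carrier R" if "ideal J R" "u \<in> J" "u \<in> Units R" for J u
  proof -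
    have "inv u \<otimes> u \<in> J"
      using that by (intro ideal.I_l_closed) auto
    then show ?thesis
      using that ideal.one_imp_carrier[OF that(1)] by simp
  qed
  show ?thesis
  proof
    assume *: "\<exists>!M. maximalideal M R"
    show "\<forall>x\<in>carrier R. \<forall>y\<in>carrier R. x \<oplus> y \<in> Units R \<longrightarrow> x \<in> Units R \<or> y \<in> Units R"
    proof (intro ballI impI, rule ccontr)
      fix x y assume xy: "x \<in> carrier R" "y \<in> carrier R" "x \<oplus> y \<in> Units R" "\<not> (x \<in> Units R \<or> y \<in> Units R)"
      then obtain M where M: "maximalideal M R" "x \<in> M" "y \<in> M"
        using nonunit_in_maximalideal[of x] nonunit_in_maximalideal[of y] * by blast
      interpret maximalideal M R
        by (rule M(1))
      have "M = carrier R"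
        using unit_carrier[OF is_ideal _ xy(3)] M a_closed by blast
      then show False
        using I_notcarr by blast
    qed
  next
    assume *: "\<forall>x\<in>carrier R. \<forall>y\<in>carrier R. x \<oplus> y \<in> Units R \<longrightarrow> x \<in> Units R \<or> y \<in> Units R"
    let ?M = "carrier R - Units R"
    have mult: "a \<in> Units R" if "a \<otimes> x \<in> Units R" "a \<in> carrier R" "x \<in> carrier R" for a x
    proof -
      obtain e where "e = x \<otimes> inv (a \<otimes> x)"
        by blast
      then have "a \<otimes> e = \<one>" "e \<in> carrier R"
        using that by (simp_all add: m_assoc[symmetric])
      then show ?thesis
        using that(2) m_comm[of a e] by (auto simp: Units_def)
    qed
    have M: "ideal ?M R"
    proof (rule idealI[OF ring_axioms])
      show "subgroup ?M (add_monoid R)"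
      proof (rule subgroup.intro)
        show "x \<otimes>\<^bsub>add_monoid R\<^esub> y \<in> ?M" if "x \<in> ?M" "y \<in> ?M" for x y
          using * that by auto
        have "\<zero> \<notin> Units R"
          using assms Units_r_inv[of \<zero>] l_null[OF Units_inv_closed, of \<zero>] by auto
        then show "\<one>\<^bsub>add_monoid R\<^esub> \<in> ?M"
          by simp
        show "inv\<^bsub>add_monoid R\<^esub> x \<in> ?M" if "x \<in> ?M" for x
        proof -
          have "\<ominus> x \<notin> Units R"
            using mult[of x "\<ominus> \<one>"] that by (auto simp: r_minus)
          then show ?thesis
            using that by (simp add: a_inv_def[symmetric])
        qed
      qed auto
    next
      fix a x assume "a \<in> ?M" "x \<in> carrier R"
      then show "x \<otimes> a \<in> ?M" "a \<otimes> x \<in> ?M"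
        using mult[of a x] m_comm[of x a] by auto
    qed
    have max: "maximalideal ?M R"
    proof (rule maximalidealI[OF M])
      show "carrier R \<noteq> ?M"
        using Units_one_closed by blast
    next
      fix J assume "ideal J R" "?M \<subseteq> J" "J \<subseteq> carrier R"
      then show "J = ?M \<or> J = carrier R"
        using unit_carrier[of J] by blast
    qed
    moreover have "N = ?M" if "maximalideal N R" for N
    proof -
      interpret N: maximalideal N R
        by (rule that)
      have "N \<subseteq> ?M"
        using unit_carrier[OF N.is_ideal] N.I_notcarr N.Icarr by blast
      then show ?thesis
        using N.I_maximal[OF M] maximalideal.I_notcarr[OF max] by blast
    qed
    ultimately show "\<exists>!M. maximalideal M R"
      by blast
  qed
qed

section \<open>Subrings of a type as rings with carrier\<close>

abbreviation type_subring :: "'a::comm_ring_1 set \<Rightarrow> 'a ring"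
  where "type_subring A \<equiv> ring_of_type_algebra\<lparr>carrier := A\<rparr>"

lemma type_subring_simps [simp]:
  "mult (type_subring A) = (*)" "add (type_subring A) = (+)"
  "one (type_subring A) = 1" "zero (type_subring A) = 0"
  by (simp_all add: ring_of_type_algebra_def)

lemma cring_type_subring:
  assumes "ring_closed A"
  shows "cring (type_subring A)"
proof (rule cringI)
  show "abelian_group (type_subring A)"
  proof (rule abelian_groupI)
    fix x assume "x \<in> carrier (type_subring A)"
    then show "\<exists>y\<in>carrier (type_subring A). y \<oplus>\<^bsub>type_subring A\<^esub> x = \<zero>\<^bsub>type_subring A\<^esub>"
      using rc_uminus[OF assms] by (intro bexI[of _ "- x"]) auto
  qed (use rc_add[OF assms] rc_0[OF assms] in auto)
  show "comm_monoid (type_subring A)"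
    by (rule comm_monoidI) (use rc_mult[OF assms] rc_1[OF assms] in auto)
qed (auto simp: algebra_simps)

lemma a_inv_type_subring:
  assumes "ring_closed A" "x \<in> A"
  shows "\<ominus>\<^bsub>type_subring A\<^esub> x = - x"
proof -
  interpret cring "type_subring A"
    by (rule cring_type_subring[OF assms(1)])
  show ?thesis
    using assms rc_uminus[OF assms] by (intro minus_equality) auto
qed

lemma a_minus_type_subring:
  "ring_closed A \<Longrightarrow> x \<in> A \<Longrightarrow> y \<in> A \<Longrightarrow> x \<ominus>\<^bsub>type_subring A\<^esub> y = x - y"
  by (simp add: a_minus_def a_inv_type_subring)

lemma ideal_type_subring:
  assumes A: "ring_closed A" and J: "J \<subseteq> A" "0 \<in> J" "\<And>x y. x \<in> J \<Longrightarrow> y \<in> J \<Longrightarrow> x + y \<in> J"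
    "\<And>x y. x \<in> J \<Longrightarrow> y \<in> A \<Longrightarrow> x * y \<in> J"
  shows "ideal J (type_subring A)"
proof -
  interpret cring "type_subring A"
    by (rule cring_type_subring[OF A])
  show ?thesis
  proof (rule idealI[OF ring_axioms])
    show "subgroup J (add_monoid (type_subring A))"
    proof (rule subgroup.intro)
      show "inv\<^bsub>add_monoid (type_subring A)\<^esub> x \<in> J" if "x \<in> J" for x
      proof -
        have "x * (- 1) \<in> J"
          using that J rc_uminus[OF A rc_1[OF A]] by blast
        then have "\<ominus>\<^bsub>type_subring A\<^esub> x \<in> J"
          using that J A by (subst a_inv_type_subring) auto
        then show ?thesis
          by (simp add: a_inv_def)
      qed
    qed (use J in auto)
  qed (use J in \<open>auto simp: mult.commute\<close>)
qed

lemma (in ring) eval_rev: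
  assumes "\<And>i. i < n \<Longrightarrow> f i \<in> carrier R" "x \<in> carrier R"
  shows "eval (map f (rev [0..<Suc n])) x = f n \<otimes> x [^] n \<oplus> eval (map f (rev [0..<n])) x"
  by simp

lemma hloc_eq: "hloc D = type_subring (hfrac D)"
  by (simp add: hloc_def hfrac_def)

context curve_at
begin

abbreviation "R \<equiv> type_subring Og"
definition cs where "cs x = I +>\<^bsub>R\<^esub> x"

lemma ideal_I: "ideal I R"
  by (intro ideal_type_subring ring_O I_subset_O I_0 I_add I_mult)

lemma function_field_eq: "function_field F = R Quot I"
  by (simp add: function_field_def hloc_eq Og_def I_def)

lemma cring_K: "cring (R Quot I)"
  by (rule ideal.quotient_is_cring[OF ideal_I cring_type_subring[OF ring_O]])

lemma cs_hom: "cs \<in> Ring.ring_hom R (R Quot I)"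
  using ideal.rcos_ring_hom[OF ideal_I] by (simp add: cs_def[abs_def])

lemma cs_add: "x \<in> Og \<Longrightarrow> y \<in> Og \<Longrightarrow> cs (x + y) = cs x \<oplus>\<^bsub>R Quot I\<^esub> cs y"
  and cs_mult: "x \<in> Og \<Longrightarrow> y \<in> Og \<Longrightarrow> cs (x * y) = cs x \<otimes>\<^bsub>R Quot I\<^esub> cs y"
  and cs_1: "cs 1 = \<one>\<^bsub>R Quot I\<^esub>"
  using ring_hom_memE[OF cs_hom] by auto

lemma cs_eq_iff: "x \<in> Og \<Longrightarrow> y \<in> Og \<Longrightarrow> cs x = cs y \<longleftrightarrow> x - y \<in> I"
  using ring.quotient_eq_iff_same_a_r_cos[OF cring.axioms(1)[OF cring_type_subring[OF ring_O]] ideal_I, of x y]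
  by (simp add: cs_def a_minus_type_subring[OF ring_O])

lemma cs_0: "cs 0 = \<zero>\<^bsub>R Quot I\<^esub>"
proof -
  interpret K: cring "R Quot I"
    by (rule cring_K)
  have "cs 0 \<in> carrier (R Quot I)"
    using ring_hom_memE(1)[OF cs_hom] rc_0[OF ring_O] by simp
  then show ?thesis
    using cs_add[OF rc_0[OF ring_O] rc_0[OF ring_O]] by (simp add: K.add.l_cancel_one')
qed

lemma cs_power: "x \<in> Og \<Longrightarrow> cs (x ^ n) = cs x [^]\<^bsub>R Quot I\<^esub> n"
proof (induction n)
  case (Suc n)
  then show ?case
    using cs_mult[OF rc_power[OF ring_O] Suc.prems] by (simp add: mult.commute)
qed (simp add: cs_1)

lemma carrier_K: "carrier (R Quot I) = cs ` Og"
  by (auto simp: FactRing_def A_RCOSETS_def' cs_def)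

lemma curve_local_ring_eq: "curve_local_ring F v = cs ` B"
  by (simp add: curve_local_ring_def carrier_hloc B_def cs_def[abs_def] I_def Og_def hloc_eq)

lemma eval_cs:
  assumes "x \<in> Og" "\<And>i. i < n \<Longrightarrow> c i \<in> Og"
  shows "ring.eval (R Quot I) (map (\<lambda>i. cs (c i)) (rev [0..<n])) (cs x) = cs (\<Sum>i<n. c i * x ^ i)"
  using assms(2)
proof (induction n)
  case 0
  interpret K: cring "R Quot I"
    by (rule cring_K)
  show ?case
    by (simp add: cs_0)
next
  case (Suc n)
  interpret K: cring "R Quot I"
    by (rule cring_K)
  have "(\<Sum>i<n. c i * x ^ i) \<in> Og" "c n * x ^ n \<in> Og" "x ^ n \<in> Og"
    using Suc.prems assms(1) by (auto intro!: rc_sum[OF ring_O] rc_mult[OF ring_O] rc_power[OF ring_O])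
  then have "cs (\<Sum>i<Suc n. c i * x ^ i) =
      cs (c n) \<otimes>\<^bsub>R Quot I\<^esub> cs x [^]\<^bsub>R Quot I\<^esub> n \<oplus>\<^bsub>R Quot I\<^esub> cs (\<Sum>i<n. c i * x ^ i)"
    using Suc.prems assms(1) by (simp add: cs_add cs_mult cs_power add.commute[of _ "c n * x ^ n"])
  then show ?case
    using Suc by simp
qed

text \<open>An equation for a coset lifts to one that holds up to an element of \<open>I\<close>,
  and the constant coefficient absorbs this error because \<open>B'\<close> contains
  \<open>I\<close>.\<close>

lemma integral_closure_eq: "integral_closure (R Quot I) (cs ` B) = cs ` S"
proof (intro equalityI subsetI)
  fix z assume "z \<in> integral_closure (R Quot I) (cs ` B)"
  then obtain p where p: "z \<in> carrier (R Quot I)" "Polynomials.polynomial (R Quot I) (cs ` B) p" "p \<noteq> []"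
      "hd p = \<one>\<^bsub>R Quot I\<^esub>" "ring.eval (R Quot I) p z = \<zero>\<^bsub>R Quot I\<^esub>"
    by (auto simp: integral_closure_def)
  obtain x where x: "x \<in> Og" "z = cs x"
    using p(1) carrier_K by auto
  obtain q where q: "p = \<one>\<^bsub>R Quot I\<^esub> # q"
    using p(3,4) by (cases p) auto
  have "set q \<subseteq> cs ` B"
    using p(2) q by (auto simp: polynomial_def)
  then have "\<exists>b\<in>B. rev q ! i = cs b" if "i < length q" for i
    using nth_mem[of i "rev q"] that by auto
  then obtain c where c: "\<And>i. i < length q \<Longrightarrow> c i \<in> B" "\<And>i. i < length q \<Longrightarrow> rev q ! i = cs (c i)"
    by metis
  let ?n = "length q"
  let ?c = "\<lambda>i. if i = ?n then 1 else c i"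
  have rv: "rev q = map (\<lambda>i. cs (c i)) [0..<?n]"
    using c(2) by (intro nth_equalityI) auto
  have "q = map (\<lambda>i. cs (c i)) (rev [0..<?n])"
    by (simp add: rv[symmetric] rev_map[symmetric])
  also have "\<dots> = map (\<lambda>i. cs (?c i)) (rev [0..<?n])"
    by (intro map_cong) auto
  finally have "p = map (\<lambda>i. cs (?c i)) (rev [0..<Suc ?n])"
    unfolding q by (simp add: cs_1)
  moreover have "?c i \<in> Og" if "i < Suc ?n" for i
    using that c(1)[of i] B_subset_O rc_1[OF ring_O] by (auto simp: less_Suc_eq)
  ultimately have "cs (\<Sum>i<Suc ?n. ?c i * x ^ i) = cs 0"
    using p(5) eval_cs[OF x(1), of "Suc ?n" ?c] by (simp only: x(2) cs_0)
  moreover have "(\<Sum>i<Suc ?n. ?c i * x ^ i) \<in> Og"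
    using \<open>\<And>i. i < Suc ?n \<Longrightarrow> ?c i \<in> Og\<close> x(1)
    by (intro rc_sum[OF ring_O] rc_mult[OF ring_O] rc_power[OF ring_O]) auto
  ultimately have mem: "x ^ ?n + (\<Sum>i<?n. c i * x ^ i) \<in> I" (is "?e \<in> I")
    using cs_eq_iff[OF _ rc_0[OF ring_O]] by (simp add: add.commute)
  \<comment> \<open>Degree 0 would put 1 into \<open>I\<close>. So there is a constant coefficient
    to absorb the error.\<close>
  have n: "?n > 0"
    using mem I_1 by (cases ?n) auto
  let ?b = "\<lambda>i. if i = 0 then c 0 - ?e else c i"
  have "(\<Sum>i<?n. ?b i * x ^ i) = (\<Sum>i<?n. c i * x ^ i) - ?e"
    using n by (subst (1 3) sum.remove[of _ 0]) auto
  then have "x ^ ?n + (\<Sum>i<?n. ?b i * x ^ i) = 0"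
    by simp
  moreover have "?b i \<in> B'" if "i < ?n" for i
    using that c(1) mem B_subset_B' I_subset_B' n by (auto intro!: rc_diff[OF ring_B'])
  ultimately have "integral_over B' x"
    by (intro integral_overI_sum[OF ring_B', of ?n ?b])
  then show "z \<in> cs ` S"
    using x by (auto simp: S_def)
next
  fix z assume "z \<in> cs ` S"
  then obtain x where x: "x \<in> Og" "integral_over B' x" "z = cs x"
    by (auto simp: S_def)
  obtain n c where c: "\<And>i. c i \<in> B'" "x ^ n + (\<Sum>i<n. c i * x ^ i) = 0"
    using integral_overE_sum[OF x(2)] by metis
  \<comment> \<open>For the other inclusion each coefficient in \<open>B'\<close> is replaced by its
    part in \<open>B\<close>, which changes the value only by an element of
    \<open>I\<close>.\<close>
  have "\<exists>b\<in>B. c i - b \<in> I" for i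
  proof -
    obtain b y where "c i = b + y" "b \<in> B" "y \<in> I"
      using c(1)[of i] by (auto simp: B'_def)
    then show ?thesis
      by (intro bexI[of _ b]) auto
  qed
  then obtain b where b: "\<And>i. b i \<in> B" "\<And>i. c i - b i \<in> I"
    by metis
  let ?b = "\<lambda>i. if i = n then 1 else b i"
  let ?p = "map (\<lambda>i. cs (?b i)) (rev [0..<Suc n])"
  have bO: "?b i \<in> Og" for i
    using b B_subset_O rc_1[OF ring_O] by auto
  have "(\<Sum>i<Suc n. ?b i * x ^ i) = (\<Sum>i<n. b i * x ^ i) + x ^ n"
    by simp
  also have "\<dots> = (\<Sum>i<n. b i * x ^ i) - (\<Sum>i<n. c i * x ^ i)"
    using c(2) by (simp add: add_eq_0_iff)
  also have "\<dots> = - (\<Sum>i<n. (c i - b i) * x ^ i)"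
    by (simp add: left_diff_distrib sum_subtractf)
  finally have eq: "(\<Sum>i<Suc n. ?b i * x ^ i) = - (\<Sum>i<n. (c i - b i) * x ^ i)" .
  have "(\<Sum>i\<in>A. (c i - b i) * x ^ i) \<in> I" for A
    using b x(1) by (induction A rule: infinite_finite_induct)
      (auto intro!: I_0 I_add I_mult rc_power[OF ring_O])
  then have "(\<Sum>i<Suc n. ?b i * x ^ i) \<in> I"
    unfolding eq by (intro I_uminus) auto
  then have "cs (\<Sum>i<Suc n. ?b i * x ^ i) = cs 0"
    using cs_eq_iff[OF _ rc_0[OF ring_O]] I_subset_O by auto
  then have ev: "ring.eval (R Quot I) ?p (cs x) = \<zero>\<^bsub>R Quot I\<^esub>"
    using eval_cs[OF x(1), of "Suc n" ?b] bO by (simp only: cs_0)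
  have ne: "\<one>\<^bsub>R Quot I\<^esub> \<noteq> \<zero>\<^bsub>R Quot I\<^esub>"
    using I_1 cs_eq_iff[OF rc_1[OF ring_O] rc_0[OF ring_O]] by (simp add: cs_1 cs_0)
  have hd: "?p \<noteq> []" "hd ?p = \<one>\<^bsub>R Quot I\<^esub>"
    by (simp_all add: cs_1)
  have "?b i \<in> B" for i
    using b(1) rc_1[OF ring_B] by simp
  then have "set ?p \<subseteq> cs ` B"
    by (simp only: set_map) blast
  moreover have "Polynomials.polynomial (R Quot I) A p" if "set p \<subseteq> A" "hd p = \<one>\<^bsub>R Quot I\<^esub>" for A p
    using that ne by (simp add: polynomial_def)
  ultimately have "Polynomials.polynomial (R Quot I) (cs ` B) ?p"
    using hd by blast
  moreover have "cs x \<in> carrier (R Quot I)"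
    using x carrier_K by blast
  ultimately show "z \<in> integral_closure (R Quot I) (cs ` B)"
    unfolding integral_closure_def mem_Collect_eq x(3) using ev hd by (intro conjI exI[of _ ?p])
qed

text \<open>The quotient by \<open>I\<close> neither creates nor loses units of \<open>S\<close>, so
  the criterion for a unique maximal ideal can be read off in \<open>S\<close>.\<close>

lemma unibranch_iff_local: "unibranch F v \<longleftrightarrow> local_in S"
proof -
  interpret K: cring "R Quot I"
    by (rule cring_K)
  interpret h: ring_hom_ring R "R Quot I" cs
    using ideal.rcos_ring_hom_ring[OF ideal_I] by (simp add: cs_def[abs_def])
  have "subring S R"
  proof (rule h.R.subringI)
    show "\<ominus>\<^bsub>R\<^esub> x \<in> S" if "x \<in> S" for x
      using that S_subset_O rc_uminus[OF ring_S] by (subst a_inv_type_subring[OF ring_O]) auto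
  qed (use S_subset_O rc_1[OF ring_S] rc_mult[OF ring_S] rc_add[OF ring_S] in auto)
  then have sub: "subring (cs ` S) (R Quot I)"
    by (rule h.img_is_subring)
  define N where "N = (R Quot I)\<lparr>carrier := cs ` S\<rparr>"
  have "cring N"
    unfolding N_def using K.subcring_iff[OF subringE(1)[OF sub]] K.subcringI'[OF sub] by (rule iffD1)
  then interpret N: cring N .
  have N1: "\<one>\<^bsub>N\<^esub> \<noteq> \<zero>\<^bsub>N\<^esub>"
    using I_1 cs_eq_iff[OF rc_1[OF ring_O] rc_0[OF ring_O]] by (simp add: N_def cs_1 cs_0)
  have un: "cs x \<in> Units N \<longleftrightarrow> unit_in S x" if "x \<in> S" for x
  proof
    assume "cs x \<in> Units N"
    then obtain y where y: "y \<in> S" "cs x \<otimes>\<^bsub>R Quot I\<^esub> cs y = \<one>\<^bsub>R Quot I\<^esub>"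
      by (auto simp: Units_def N_def)
    have xy: "x * y \<in> S"
      using that y ring_S by (intro rc_mult)
    have "cs (x * y) = cs 1"
      using that y S_subset_O by (subst cs_mult) (auto simp: cs_1)
    then have "x * y - 1 \<in> I"
      using xy S_subset_O rc_1[OF ring_O] cs_eq_iff by blast
    then have "unit_in S (1 + (x * y - 1))"
      using unit_1_plus_I unit_B'_imp_S by blast
    then show "unit_in S x"
      using unit_in_factor[OF ring_S that y(1)] by simp
  next
    assume u: "unit_in S x"
    then have "cs x \<otimes>\<^bsub>R Quot I\<^esub> cs (inverse x) = \<one>\<^bsub>R Quot I\<^esub>"
      using S_subset_O by (subst cs_mult[symmetric]) (auto simp: unit_in_def cs_1)
    moreover from this have "cs (inverse x) \<otimes>\<^bsub>R Quot I\<^esub> cs x = \<one>\<^bsub>R Quot I\<^esub>"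
      using u S_subset_O cs_mult[of x "inverse x"] cs_mult[of "inverse x" x]
      by (auto simp: unit_in_def mult.commute)
    ultimately show "cs x \<in> Units N"
      using u by (auto simp: Units_def N_def unit_in_def)
  qed
  have "unibranch F v \<longleftrightarrow> (\<exists>!M. maximalideal M N)"
    by (simp add: unibranch_def normalization_fibre_def function_field_eq curve_local_ring_eq
        integral_closure_eq N_def)
  also have "\<dots> \<longleftrightarrow> (\<forall>x\<in>S. \<forall>y\<in>S. cs (x + y) \<in> Units N \<longrightarrow> cs x \<in> Units N \<or> cs y \<in> Units N)"
  proof -
    have "cs (x + y) = cs x \<oplus>\<^bsub>N\<^esub> cs y" if "x \<in> S" "y \<in> S" for x y
      using that S_subset_O cs_add by (auto simp: N_def)
    then show ?thesis
      unfolding N.ex1_maximalideal_iff[OF N1] by (auto simp: N_def)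
  qed
  also have "\<dots> \<longleftrightarrow> local_in S"
    unfolding local_in_def using un rc_add[OF ring_S] by blast
  finally show ?thesis .
qed

end

section \<open>Newton polygons and the local ring\<close>

lemma plane_basis_swap:
  assumes "plane_basis v a b v' a' b'"
  shows "plane_basis v b a v' b' a'"
proof -
  interpret plane_basis v a b v' a' b'
    by (rule assms)
  show ?thesis
  proof
    fix i j
    show "v i * v' j + b i * b' j + a i * a' j = (if i = j then 1 else 0)"
      using complete[of i j] by (simp add: algebra_simps)
  qed (rule dual)+
qed

section \<open>Weighted substitutions, initial forms and norms\<close>

lemma biv_induct [case_names add monom]:
  assumes "\<And>p q. P p \<Longrightarrow> P q \<Longrightarrow> P (p + q)" "\<And>c i j. P (monom (monom c i) j)"
  shows "P (p :: 'a::comm_monoid_add poly poly)"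
proof -
  have s: "P (sum f A)" if "finite A" "\<And>i. i \<in> A \<Longrightarrow> P (f i)" for A :: "nat set" and f
    using that(1,2)
  proof (induction A)
    case empty
    show ?case
      using assms(2)[of 0 0 0] by simp
  qed (simp add: assms(1))
  have m: "P (monom q j)" for q j
  proof -
    have "P (monom (\<Sum>i\<in>A. monom (c i) (i :: nat)) j)" if "finite A" for A c
      using that
    proof (induction A)
      case empty
      show ?case
        using assms(2)[of 0 0 0] by simp
    next
      case (insert k A)
      then show ?case
        using assms(1)[OF assms(2)[of "c k" k j] insert.IH] by (simp add: add_monom)
    qed
    from this[of "{..degree q}" "coeff q"] show ?thesis
      by (simp add: poly_as_sum_of_monoms)
  qed
  have "P (\<Sum>j\<le>degree p. monom (coeff p j) j)"
    by (rule s) (auto intro: m)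
  then show ?thesis
    by (simp add: poly_as_sum_of_monoms)
qed

text \<open>Substitution of \<open>\<tau>^\<alpha>\<close> for \<open>x\<close> and
  \<open>s \<tau>^\<beta>\<close> for \<open>y\<close>, with \<tau> the outer and \<open>s\<close>
  the inner variable. The coefficient of \<open>\<tau>^W\<close> is the part of weight
  \<open>W\<close>, restricted to \<open>x = 1\<close>.\<close>

definition wsubst :: "nat \<Rightarrow> nat \<Rightarrow> complex poly poly \<Rightarrow> complex poly poly"
  where "wsubst \<alpha> \<beta> = pev (pev (\<lambda>c. [:[:c:]:]) (monom 1 \<alpha>)) (monom [:0, 1:] \<beta>)"

lemma is_hom_emb2: "is_hom (\<lambda>c :: complex. [:[:c:]:])"
  by (rule is_hom_comp[OF is_hom_pCons is_hom_pCons])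

lemma is_hom_wsubst: "is_hom (wsubst \<alpha> \<beta>)"
  unfolding wsubst_def by (intro is_hom_pev is_hom_emb2)

lemma pev_monom: "is_hom h \<Longrightarrow> pev h x (monom c n) = h c * x ^ n"
  by (simp add: pev_def map_poly_monom hom_0 poly_monom)

lemma X_power: "[:0, 1 :: complex:] ^ n = monom 1 n"
  by (simp add: monom_altdef)

lemma wsubst_monom: "wsubst \<alpha> \<beta> (monom (monom c i) j) = monom (monom c j) (\<alpha> * i + \<beta> * j)"
proof -
  have "[:[:c:]:] = monom [:c:] 0"
    by (simp add: monom_0)
  moreover have "[:c:] * monom 1 j = monom c j"
    by (simp add: smult_monom)
  ultimately show ?thesis
    by (simp add: wsubst_def pev_monom is_hom_pev is_hom_emb2 monom_power X_power mult_monom mult.commute add.commute)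
qed

lemma coeff_wsubst:
  assumes "\<alpha> > 0"
  shows "coeff (coeff (wsubst \<alpha> \<beta> p) (\<alpha> * i + \<beta> * j)) j = coeff (coeff p j) i"
  by (induction p rule: biv_induct) (use assms in \<open>auto simp: hom_add[OF is_hom_wsubst] wsubst_monom\<close>)

lemma coeff_wsubst_nonzero:
  assumes "\<alpha> > 0" "coeff (coeff (wsubst \<alpha> \<beta> p) w) j \<noteq> 0"
  obtains i where "w = \<alpha> * i + \<beta> * j" "coeff (coeff p j) i \<noteq> 0"
proof -
  have "(\<nexists>i. w = \<alpha> * i + \<beta> * j) \<Longrightarrow> coeff (coeff (wsubst \<alpha> \<beta> p) w) j = 0"
    by (induction p rule: biv_induct) (auto simp: hom_add[OF is_hom_wsubst] wsubst_monom)
  then obtain i where "w = \<alpha> * i + \<beta> * j"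
    using assms(2) by blast
  then show thesis
    using that assms coeff_wsubst[OF assms(1), of \<beta> p i j] by simp
qed

definition scale_y :: "complex \<Rightarrow> complex poly poly \<Rightarrow> complex poly poly"
  where "scale_y c p = pcompose p [:0, [:c:]:]"

lemma is_hom_scale_y: "is_hom (scale_y c)"
  by (intro is_homI) (auto simp: scale_y_def pcompose_add pcompose_mult pcompose_1)

lemma coeff_scale_y: "coeff (coeff (scale_y c p) j) i = c ^ j * coeff (coeff p j) i"
proof (induction p rule: biv_induct)
  case (monom z k l)
  have "scale_y c (monom (monom z k) l) = monom (monom z k * [:c ^ l:]) l"
  proof -
    have "[:0, [:c:]:] = monom [:c:] 1"
      by (simp add: monom_altdef)
    then show ?thesis
      by (simp add: scale_y_def pcompose_altdef map_poly_monom poly_monom monom_power smult_monom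
          hom_power[OF is_hom_pCons, symmetric] mult.commute)
  qed
  then show ?case
    by auto
qed (simp add: hom_add[OF is_hom_scale_y] algebra_simps)

text \<open>The norm of \<open>f(x, y)\<close> from \<open>\<complex>(x)[y]\<close> to \<open>\<complex>(x)[y\<^sup>\<alpha>]\<close>.\<close>

definition y_norm :: "nat \<Rightarrow> complex poly poly \<Rightarrow> complex poly poly"
  where "y_norm \<alpha> p = (\<Prod>k<\<alpha>. scale_y (exp (2 * of_real pi * \<i> * (of_nat k / of_nat \<alpha>))) p)"

text \<open>Scaling \<open>y\<close> by a primitive root of unity of order \<alpha> permutes the
  factors cyclically, so the norm is invariant. The coefficient of \<open>y ^ j\<close> is thereby
  multiplied by \<open>w j\<close>, which is not 1 unless \<alpha> divides \<open>j\<close>.\<close>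

lemma coeff_y_norm:
  assumes "\<alpha> > 0" "\<not> \<alpha> dvd j"
  shows "coeff (y_norm \<alpha> p) j = 0"
proof -
  define w where "w k = exp (2 * of_real pi * \<i> * (of_nat k / of_nat \<alpha>))" for k
  have w_Suc: "w k * w 1 = w (Suc k)" for k
    by (simp add: w_def exp_add[symmetric] add_divide_distrib algebra_simps)
  have w_\<alpha>: "w \<alpha> = w 0"
    using assms(1) by (simp add: w_def)
  have sc: "scale_y c (scale_y c' p) = scale_y (c * c') p" for c c'
    by (intro poly_eqI) (simp add: coeff_scale_y power_mult_distrib)
  have yn: "y_norm \<alpha> p = (\<Prod>k<\<alpha>. scale_y (w k) p)"
    by (simp only: y_norm_def w_def)
  have "scale_y (w 1) (y_norm \<alpha> p) = (\<Prod>k<\<alpha>. scale_y (w (Suc k)) p)"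
    by (simp only: yn hom_prod[OF is_hom_scale_y] sc mult.commute[of "w 1"] w_Suc)
  also have "\<dots> = y_norm \<alpha> p"
  proof -
    \<comment> \<open>The cyclic shift is proved by adding the overlapping factor to both products
      and cancelling it, which is possible unless \<open>p = 0\<close>.\<close>
    have "scale_y (w 0) p * (\<Prod>k<\<alpha>. scale_y (w (Suc k)) p) = (\<Prod>k<Suc \<alpha>. scale_y (w k) p)"
      by (simp only: prod.lessThan_Suc_shift o_def)
    also have "\<dots> = scale_y (w 0) p * (\<Prod>k<\<alpha>. scale_y (w k) p)"
      by (simp add: w_\<alpha> mult.commute)
    finally have "scale_y (w 0) p * ((\<Prod>k<\<alpha>. scale_y (w (Suc k)) p) - y_norm \<alpha> p) = 0"
      by (simp add: yn right_diff_distrib)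
    moreover have "scale_y (w 0) p = p"
      by (intro poly_eqI) (simp add: coeff_scale_y w_def)
    moreover have "y_norm \<alpha> p = 0 \<and> (\<Prod>k<\<alpha>. scale_y (w (Suc k)) p) = 0" if "p = 0"
      using that assms(1) by (auto simp: y_norm_def hom_0[OF is_hom_scale_y])
    ultimately show ?thesis
      by (cases "p = 0") auto
  qed
  finally have eq: "scale_y (w 1) (y_norm \<alpha> p) = y_norm \<alpha> p" .
  have "w 1 ^ j = w j"
  proof (induction j)
    case (Suc j)
    then show ?case
      by (simp only: power_Suc2 w_Suc)
  qed (simp add: w_def)
  also have "\<dots> \<noteq> 1"
    using assms complex_root_unity_eq_1[of \<alpha> j] by (simp add: w_def)
  finally have "w 1 ^ j \<noteq> 1" .
  moreover have "w 1 ^ j * coeff (coeff (y_norm \<alpha> p) j) i = coeff (coeff (y_norm \<alpha> p) j) i" for i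
    using coeff_scale_y[of "w 1" "y_norm \<alpha> p" j i] eq by simp
  ultimately have "coeff (coeff (y_norm \<alpha> p) j) i = 0" for i
    by (metis mult_cancel_right1)
  then show ?thesis
    by (intro poly_eqI) simp
qed

text \<open>Without terms of weight below \<open>W\<close>, the power \<open>W\<close> of the outer
  variable can be taken out; the cofactor at 0 is the initial form.\<close>

lemma wsubst_initial:
  assumes "\<alpha> > 0" "\<And>i j. coeff (coeff p j) i \<noteq> 0 \<Longrightarrow> W \<le> \<alpha> * i + \<beta> * j"
  obtains q where "wsubst \<alpha> \<beta> p = monom 1 W * q"
    "\<And>i j. \<alpha> * i + \<beta> * j = W \<Longrightarrow> coeff (coeff q 0) j = coeff (coeff p j) i"
proof -
  have "coeff (wsubst \<alpha> \<beta> p) k = 0" if "k < W" for k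
  proof (rule poly_eqI)
    fix j
    have "coeff (coeff (wsubst \<alpha> \<beta> p) k) j = 0"
    proof (rule ccontr)
      assume "coeff (coeff (wsubst \<alpha> \<beta> p) k) j \<noteq> 0"
      then obtain i where "k = \<alpha> * i + \<beta> * j" "coeff (coeff p j) i \<noteq> 0"
        by (rule coeff_wsubst_nonzero[OF assms(1)])
      then show False
        using assms(2)[of j i] that by simp
    qed
    then show "coeff (coeff (wsubst \<alpha> \<beta> p) k) j = coeff 0 j"
      by simp
  qed
  then have "monom 1 W dvd wsubst \<alpha> \<beta> p"
    by (simp add: monom_1_dvd_iff')
  then obtain q where q: "wsubst \<alpha> \<beta> p = monom 1 W * q"
    by blast
  moreover have "coeff q 0 = coeff (wsubst \<alpha> \<beta> p) W"
    using q coeff_monom_mult[of 1 W q W] by simp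
  ultimately show thesis
    using that coeff_wsubst[OF assms(1), of \<beta> p] by metis
qed

text \<open>Initial forms are multiplicative, so the norm has no terms of weight less than \<open>\<alpha> W\<close>, and some of weight \<open>\<alpha> W\<close>.\<close>

lemma y_norm_initial:
  assumes "\<alpha> > 0" and W: "\<And>i j. coeff (coeff p j) i \<noteq> 0 \<Longrightarrow> W \<le> \<alpha> * i + \<beta> * j"
    and nz: "coeff (coeff p j0) i0 \<noteq> 0" "\<alpha> * i0 + \<beta> * j0 = W"
  shows "coeff (coeff (y_norm \<alpha> p) j) i \<noteq> 0 \<Longrightarrow> \<alpha> * W \<le> \<alpha> * i + \<beta> * j"
    and "\<exists>i j. coeff (coeff (y_norm \<alpha> p) j) i \<noteq> 0 \<and> \<alpha> * i + \<beta> * j = \<alpha> * W"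
proof -
  have "\<exists>q. wsubst \<alpha> \<beta> (scale_y c p) = monom 1 W * q \<and> coeff q 0 \<noteq> 0" if "c \<noteq> 0" for c
  proof -
    obtain q where "wsubst \<alpha> \<beta> (scale_y c p) = monom 1 W * q"
      "\<And>i j. \<alpha> * i + \<beta> * j = W \<Longrightarrow> coeff (coeff q 0) j = coeff (coeff (scale_y c p) j) i"
      using wsubst_initial[OF assms(1), of "scale_y c p" W \<beta>] W by (auto simp: coeff_scale_y)
    moreover from this(2)[OF nz(2)] have "coeff (coeff q 0) j0 \<noteq> 0"
      using nz(1) that by (simp add: coeff_scale_y)
    ultimately show ?thesis
      by auto
  qed
  then have "\<forall>k. \<exists>q. wsubst \<alpha> \<beta> (scale_y (exp (2 * of_real pi * \<i> * (of_nat k / of_nat \<alpha>))) p) =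
      monom 1 W * q \<and> coeff q 0 \<noteq> 0"
    by auto
  then obtain q where q: "\<And>k. wsubst \<alpha> \<beta> (scale_y (exp (2 * of_real pi * \<i> * (of_nat k / of_nat \<alpha>))) p) =
      monom 1 W * q k" "\<And>k. coeff (q k) 0 \<noteq> 0"
    by metis
  have N: "wsubst \<alpha> \<beta> (y_norm \<alpha> p) = monom 1 (\<alpha> * W) * (\<Prod>k<\<alpha>. q k)"
    unfolding y_norm_def hom_prod[OF is_hom_wsubst] q prod.distrib
    by (simp add: monom_power mult.commute)
  show "\<alpha> * W \<le> \<alpha> * i + \<beta> * j" if "coeff (coeff (y_norm \<alpha> p) j) i \<noteq> 0"
  proof (rule ccontr)
    assume "\<not> ?thesis"
    then have "coeff (wsubst \<alpha> \<beta> (y_norm \<alpha> p)) (\<alpha> * i + \<beta> * j) = 0"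
      unfolding N by (simp add: coeff_monom_mult)
    then show False
      using coeff_wsubst[OF assms(1), of \<beta> "y_norm \<alpha> p" i j] that by simp
  qed
  have "coeff (wsubst \<alpha> \<beta> (y_norm \<alpha> p)) (\<alpha> * W) = (\<Prod>k<\<alpha>. coeff (q k) 0)"
  proof -
    have "coeff (\<Prod>k<\<alpha>. q k) 0 = (\<Prod>k<\<alpha>. coeff (q k) 0)"
      by (simp only: poly_0_coeff_0[symmetric] poly_prod)
    then show ?thesis
      by (simp add: N coeff_monom_mult)
  qed
  also have "\<dots> \<noteq> 0"
    using q by simp
  finally have "coeff (wsubst \<alpha> \<beta> (y_norm \<alpha> p)) (\<alpha> * W) \<noteq> 0" .
  from leading_coeff_neq_0[OF this] obtain j where "coeff (coeff (wsubst \<alpha> \<beta> (y_norm \<alpha> p)) (\<alpha> * W)) j \<noteq> 0"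
    by blast
  then obtain i where "\<alpha> * W = \<alpha> * i + \<beta> * j" "coeff (coeff (y_norm \<alpha> p) j) i \<noteq> 0"
    by (rule coeff_wsubst_nonzero[OF assms(1)])
  then show "\<exists>i j. coeff (coeff (y_norm \<alpha> p) j) i \<noteq> 0 \<and> \<alpha> * i + \<beta> * j = \<alpha> * W"
    by metis
qed

section \<open>Affine coordinates at the point as elements of the local rings\<close>

locale plane_curve = plane_basis v a b v' a' b' for v a b v' a' b' +
  fixes F :: form and d :: nat
  assumes hom_F: "homogeneous d F" and irr: "irreducible F" and F_v: "peval v F = 0" and d2: "d \<ge> 2"
begin

sublocale curve_at F d v
proof
  show "\<not> F dvd 1"
    using irr by (simp add: Factorial_Ring.irreducible_def)
qed (use hom_F F_v irreducible_dvd_mult[OF irr] in auto)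

definition x where "x = fr L1 / fr L0"
definition y where "y = fr L2 / fr L0"

lemma peval_L: "peval v L0 = 1" "peval v L1 = 0" "peval v L2 = 0"
  by (simp_all add: peval_lin dual)

lemma L0_at: "L0 \<in> dens_at v" "L0 ^ k \<in> dens_at v"
  by (simp_all add: dens_at_def peval_L hom_power[OF is_hom_peval])

lemma L0_nz: "L0 \<noteq> 0"
  using L0_at mult_set_0[OF mult_set_at[of v]] by auto

lemma xy_mB: "x \<in> mB" "y \<in> mB"
  unfolding mB_def x_def y_def using homogeneous_lin L0_at peval_L by blast+

lemma xy_B: "x \<in> B" "y \<in> B"
  using xy_mB mB_subset by auto

lemma xy_O: "x \<in> Og" "y \<in> Og"
  using xy_B B_subset_O by auto

text \<open>Degrees: \<open>F\<close> is a form of degree at least 2. Consequently \<open>x\<close>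
  and \<open>y\<close> are nonzero in the function field.\<close>

lemma not_dvd_lin:
  assumes "pairing c w \<noteq> 0"
  shows "\<not> F dvd lin c"
proof
  assume "F dvd lin c"
  then obtain G where G: "lin c = F * G"
    by blast
  have nz: "lin c \<noteq> 0"
    using assms peval_lin[of w c] hom_0[OF is_hom_peval, of w] by auto
  then have nz': "F \<noteq> 0" "G \<noteq> 0"
    using G by auto
  have "homogeneous 1 (F * G)"
    using homogeneous_lin[of c] G by simp
  then obtain i j where ij: "homogeneous i F" "homogeneous j G" "i + j = 1"
    by (rule homogeneous_factor[OF _ nz'])
  have "i = d"
    by (rule homogeneous_unique[OF ij(1) hom_F nz'(1)])
  then show False
    using d2 ij(3) by simp
qed

lemma not_dvd_L: "\<not> F dvd L0" "\<not> F dvd L1" "\<not> F dvd L2"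
  using not_dvd_lin[of v' v] not_dvd_lin[of a' a] not_dvd_lin[of b' b] by (simp_all add: dual)

lemma xy_I: "x \<notin> I" "y \<notin> I"
  using I_frac[of L0] not_dvd_L by (auto simp: x_def y_def dens_gen_def)

lemma xy_nz: "x \<noteq> 0" "y \<noteq> 0"
  using xy_I I_0 by auto

lemma xy_inverse: "inverse x \<in> Og" "inverse y \<in> Og"
  using O_inverse xy_O xy_I by auto

lemma fr_homogeneous:
  assumes "homogeneous k G"
  shows "fr G / fr L0 ^ k = (\<Sum>(i, j)\<in>triangle k. const (cf G i j) * (x ^ i * y ^ j))"
proof -
  have "fr G = (\<Sum>(i, j)\<in>triangle k. const (cf G i j) * fr (mon k i j))"
    by (subst of_cf_cf[OF assms, symmetric])
      (simp add: of_cf_def hom_sum[OF is_hom_fr] hom_mult[OF is_hom_fr] const_def split_beta)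
  then have "fr G / fr L0 ^ k = (\<Sum>p\<in>triangle k. const (cf G (fst p) (snd p)) * (fr (mon k (fst p) (snd p)) / fr L0 ^ k))"
    by (simp add: sum_divide_distrib split_beta)
  moreover have "fr (mon k i j) / fr L0 ^ k = x ^ i * y ^ j" if "i + j \<le> k" for i j
  proof -
    have "fr L0 ^ k = fr L0 ^ i * fr L0 ^ j * fr L0 ^ (k - i - j)"
      using that by (simp flip: power_add)
    then show ?thesis
      using L0_nz by (simp add: mon_def hom_simps[OF is_hom_fr] x_def y_def power_divide)
  qed
  moreover have "fst p + snd p \<le> k" if "p \<in> triangle k" for p
    using that by (simp add: triangle_def split_beta)
  ultimately show ?thesis
    by (simp add: split_beta cong: sum.cong)
qed

definition ev where "ev = pev (pev const x) y"

lemma is_hom_ev: "is_hom ev"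
  unfolding ev_def by (intro is_hom_pev is_hom_const)

lemma ev_monom: "ev (monom (monom c i) j) = const c * (x ^ i * y ^ j)"
  by (simp add: ev_def pev_monom is_hom_pev is_hom_const)

lemma ev_B: "ev p \<in> B"
  by (induction p rule: biv_induct) (auto simp: hom_add[OF is_hom_ev] ev_monom
      intro!: rc_add[OF ring_B] rc_mult[OF ring_B] rc_power[OF ring_B] const_B xy_B)

lemma ev_aff:
  assumes "homogeneous k G"
  shows "ev (aff G) = fr G / fr L0 ^ k"
proof -
  have "ev (aff G) = ev (aff (of_cf k (cf G)))"
    by (simp add: of_cf_cf[OF assms])
  also have "\<dots> = (\<Sum>(i, j)\<in>triangle k. const (cf G i j) * (x ^ i * y ^ j))"
  proof -
    have "ev (aff (Const c)) = const c" for c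
      using ev_monom[of c 0 0] by (simp add: aff_Const monom_0)
    then show ?thesis
      by (simp add: of_cf_def hom_sum[OF is_hom_aff] hom_sum[OF is_hom_ev] hom_mult[OF is_hom_aff]
          hom_mult[OF is_hom_ev] aff_mon ev_monom hom_1[OF is_hom_const] split_beta)
  qed
  finally show ?thesis
    by (simp add: fr_homogeneous[OF assms])
qed

lemma ev_F: "ev (aff F) \<in> I"
proof -
  have "homogeneous (1 * d) (L0 ^ d)"
    by (intro homogeneous_power homogeneous_lin)
  moreover have "L0 ^ d \<in> dens_gen F"
    using L0_at at_subset_gen by auto
  ultimately show ?thesis
    unfolding ev_aff[OF hom_F] I_def hom_power[OF is_hom_fr, symmetric]
    using mult_set_0[OF mult_set_gen] by (intro hloc_idealI[of d]) (auto intro: hom_F)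
qed

text \<open>The factor for \<open>k = 0\<close> is the equation of the curve itself.\<close>

lemma ev_y_norm: "\<alpha> > 0 \<Longrightarrow> ev (y_norm \<alpha> (aff F)) \<in> I"
proof -
  assume "\<alpha> > 0"
  have "scale_y (exp (2 * of_real pi * \<i> * (of_nat 0 / of_nat \<alpha>))) (aff F) = aff F"
    by (intro poly_eqI) (simp add: coeff_scale_y)
  then have "ev (y_norm \<alpha> (aff F)) = ev (aff F) * ev (\<Prod>k\<in>{..<\<alpha>} - {0}.
      scale_y (exp (2 * of_real pi * \<i> * (of_nat k / of_nat \<alpha>))) (aff F))"
    using \<open>\<alpha> > 0\<close> unfolding y_norm_def by (subst prod.remove[of _ 0]) (simp_all add: hom_mult[OF is_hom_ev])
  then show ?thesis
    using I_mult[OF ev_F] ev_B B_subset_O by auto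
qed

lemma mB_0: "0 \<in> mB"
  using mB_mult[OF xy_mB(1) rc_0[OF ring_B]] by simp

lemma mB_sum: "(\<And>i. i \<in> A \<Longrightarrow> f i \<in> mB) \<Longrightarrow> sum f A \<in> mB"
  by (induction A rule: infinite_finite_induct) (auto intro: mB_0 mB_add)

text \<open>The norm gives an equation for \<open>y\<^sup>\<alpha> / x\<^sup>\<beta>\<close> with a unit among its coefficients.\<close>

lemma local_quotient:
  assumes loc: "local_in S" and \<alpha>: "\<alpha> > 0" and W: "\<And>i j. cf F i j \<noteq> 0 \<Longrightarrow> W \<le> \<alpha> * i + \<beta> * j"
    and nz: "cf F i0 j0 \<noteq> 0" "\<alpha> * i0 + \<beta> * j0 = W"
  shows "y ^ \<alpha> / x ^ \<beta> \<in> S \<or> x ^ \<beta> / y ^ \<alpha> \<in> S"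
proof -
  define Q where "Q = y_norm \<alpha> (aff F)"
  define q where "q i j = coeff (coeff Q j) i" for i j
  define z where "z = y ^ \<alpha> / x ^ \<beta>"
  have ini1: "\<alpha> * W \<le> \<alpha> * i + \<beta> * j" if "q i j \<noteq> 0" for i j
    using y_norm_initial(1)[OF \<alpha>, of "aff F" W \<beta> j0 i0 j i] W nz that unfolding cf_def q_def Q_def by blast
  have ini2: "\<exists>i j. q i j \<noteq> 0 \<and> \<alpha> * i + \<beta> * j = \<alpha> * W"
    using y_norm_initial(2)[OF \<alpha>, of "aff F" W \<beta> j0 i0] W nz unfolding cf_def q_def Q_def by blast
  have q_dvd: "q i j = 0" if "\<not> \<alpha> dvd j" for i j
    using coeff_y_norm[OF \<alpha> that] by (simp add: q_def Q_def)
  obtain i1 j1 where ij1: "q i1 j1 \<noteq> 0" "\<alpha> * i1 + \<beta> * j1 = \<alpha> * W"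
    using ini2 by blast
  obtain j2 where j2: "j1 = \<alpha> * j2"
    using q_dvd ij1(1) by blast
  have "\<alpha> * (i1 + \<beta> * j2) = \<alpha> * W"
    using ij1(2) by (simp add: j2 algebra_simps)
  then have W1: "i1 + \<beta> * j2 = W"
    using \<alpha> by simp
  have W2: "W \<le> i + \<beta> * j" if "q i (\<alpha> * j) \<noteq> 0" for i j
  proof -
    have "\<alpha> * W \<le> \<alpha> * (i + \<beta> * j)"
      using ini1[OF that] by (simp add: algebra_simps)
    then show ?thesis
      using \<alpha> by simp
  qed
  define N where "N = degree Q"
  define M where "M = Max ((\<lambda>j. degree (coeff Q j)) ` {..\<alpha> * N})"
  have M: "degree (coeff Q j) \<le> M" if "j \<le> \<alpha> * N" for j
    unfolding M_def using that by (intro Max_ge) auto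
  have Qsum: "Q = (\<Sum>j\<le>\<alpha> * N. \<Sum>i\<le>M. monom (monom (q i j) i) j)"
  proof -
    have "Q = (\<Sum>j\<le>\<alpha> * N. monom (coeff Q j) j)"
      by (rule poly_as_sum_of_monoms'[symmetric]) (use \<alpha> in \<open>simp add: N_def\<close>)
    also have "\<dots> = (\<Sum>j\<le>\<alpha> * N. monom (\<Sum>i\<le>M. monom (q i j) i) j)"
      unfolding q_def by (intro sum.cong refl) (simp add: poly_as_sum_of_monoms' M)
    finally show ?thesis
      by (simp add: monom_hom.hom_sum)
  qed
  \<comment> \<open>Coefficients after division by \<open>x ^ W\<close>, with
    \<open>y ^ \<alpha>\<close> written as \<open>x ^ \<beta> * z\<close>. By \<open>W2\<close> the
    natural subtraction truncates only where \<open>q\<close> vanishes.\<close>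
  define c where "c j = (\<Sum>i\<le>M. const (q i (\<alpha> * j)) * x ^ (i + \<beta> * j - W))" for j
  have term_eq: "const (q i (\<alpha> * j)) * (x ^ i * y ^ (\<alpha> * j)) =
      x ^ W * (const (q i (\<alpha> * j)) * x ^ (i + \<beta> * j - W) * z ^ j)" for i j
  proof (cases "q i (\<alpha> * j) = 0")
    case False
    then have "x ^ W * x ^ (i + \<beta> * j - W) = x ^ i * x ^ (\<beta> * j)"
      using W2 by (simp flip: power_add)
    then have "x ^ W * x ^ (i + \<beta> * j - W) * z ^ j = x ^ i * y ^ (\<alpha> * j)"
      using xy_nz by (simp add: z_def power_divide power_mult)
    then show ?thesis
      by (simp add: mult_ac)
  qed (simp add: hom_0[OF is_hom_const])
  have "ev Q = (\<Sum>j\<le>\<alpha> * N. \<Sum>i\<le>M. const (q i j) * (x ^ i * y ^ j))"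
    by (subst Qsum) (simp add: hom_sum[OF is_hom_ev] ev_monom)
  also have "\<dots> = (\<Sum>j\<in>(\<lambda>j. \<alpha> * j) ` {..N}. \<Sum>i\<le>M. const (q i j) * (x ^ i * y ^ j))"
  proof (rule sum.mono_neutral_right)
    show "\<forall>j\<in>{..\<alpha> * N} - (\<lambda>j. \<alpha> * j) ` {..N}. (\<Sum>i\<le>M. const (q i j) * (x ^ i * y ^ j)) = 0"
    proof
      fix j assume j: "j \<in> {..\<alpha> * N} - (\<lambda>j. \<alpha> * j) ` {..N}"
      have "\<not> \<alpha> dvd j"
      proof
        assume "\<alpha> dvd j"
        then obtain k where "j = \<alpha> * k"
          by blast
        then show False
          using j \<alpha> by auto
      qed
      then show "(\<Sum>i\<le>M. const (q i j) * (x ^ i * y ^ j)) = 0"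
        using q_dvd by (simp add: hom_0[OF is_hom_const])
    qed
  qed auto
  also have "\<dots> = (\<Sum>j\<le>N. \<Sum>i\<le>M. const (q i (\<alpha> * j)) * (x ^ i * y ^ (\<alpha> * j)))"
    using \<alpha> by (subst sum.reindex) (auto simp: inj_on_def)
  also have "\<dots> = x ^ W * (\<Sum>j\<le>N. c j * z ^ j)"
    by (simp only: term_eq c_def sum_distrib_left sum_distrib_right mult.assoc)
  finally have evQ: "ev Q = x ^ W * (\<Sum>j\<le>N. c j * z ^ j)" .
  define e where "e = ev Q * inverse x ^ W"
  have e: "e \<in> I" "(\<Sum>j\<le>N. c j * z ^ j) = e"
    using ev_y_norm[OF \<alpha>] rc_power[OF ring_O xy_inverse(1)] xy_nz
    by (auto simp: e_def Q_def[symmetric] evQ power_inverse intro: I_mult)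
  have cB: "c j \<in> B" for j
    unfolding c_def by (intro rc_sum[OF ring_B] rc_mult[OF ring_B] rc_power[OF ring_B] const_B xy_B)
  \<comment> \<open>The relation holds up to \<open>e\<close> in \<open>I\<close>. Since
    \<open>S\<close> contains \<open>I\<close>, this error goes into the constant
    coefficient.\<close>
  let ?c = "\<lambda>j. if j = 0 then c 0 - e else c j"
  have "e \<in> S" "c j \<in> S" for j
    using cB[of j] e(1) B_subset_B' I_subset_B' B'_subset_S by blast+
  then have "?c j \<in> S" for j
    using rc_diff[OF ring_S] by simp
  moreover have "(\<Sum>j\<le>N. ?c j * z ^ j) = 0"
  proof -
    have "(\<Sum>j\<le>N. ?c j * z ^ j) = (\<Sum>j\<le>N. c j * z ^ j - (if j = 0 then e else 0))"
      by (intro sum.cong) auto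
    then show ?thesis
      using e(2) by (simp add: sum_subtractf)
  qed
  moreover have "j2 \<le> N"
  proof -
    have "j1 \<le> N"
      using ij1(1) unfolding q_def N_def by (intro le_degree) auto
    then show ?thesis
      using \<alpha> j2 by (cases \<alpha>) auto
  qed
  \<comment> \<open>The term of lowest weight contributes a nonzero constant, and every other term
    of this coefficient has a positive power of \<open>x\<close> or is zero.\<close>
  moreover have "unit_in S (?c j2)"
  proof -
    have "c j2 = const (q i1 j1) + (\<Sum>i\<in>{..M} - {i1}. const (q i (\<alpha> * j2)) * x ^ (i + \<beta> * j2 - W))"
    proof -
      have "j1 \<le> \<alpha> * N"
        using \<open>j2 \<le> N\<close> j2 by simp
      then have "i1 \<le> M"
        using M[of j1] le_degree[of "coeff Q j1" i1] ij1(1) unfolding q_def by linarith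
      then show ?thesis
        unfolding c_def by (subst sum.remove[of _ i1]) (auto simp: j2 W1)
    qed
    moreover have "(\<Sum>i\<in>{..M} - {i1}. const (q i (\<alpha> * j2)) * x ^ (i + \<beta> * j2 - W)) \<in> mB"
    proof (rule mB_sum)
      fix i assume i: "i \<in> {..M} - {i1}"
      show "const (q i (\<alpha> * j2)) * x ^ (i + \<beta> * j2 - W) \<in> mB"
      proof (cases "q i (\<alpha> * j2) = 0")
        case False
        then have "i + \<beta> * j2 - W \<noteq> 0"
          using W2[OF False] W1 i by auto
        then have "x ^ (i + \<beta> * j2 - W) = x * x ^ (i + \<beta> * j2 - W - 1)"
          by (subst power_eq_if) simp
        then have eq: "const (q i (\<alpha> * j2)) * x ^ (i + \<beta> * j2 - W) =
            x * (const (q i (\<alpha> * j2)) * x ^ (i + \<beta> * j2 - W - 1))"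
          by (simp only: mult.left_commute)
        show ?thesis
          unfolding eq by (intro mB_mult[OF xy_mB(1)] rc_mult[OF ring_B] const_B rc_power[OF ring_B] xy_B(1))
      qed (simp add: hom_0[OF is_hom_const] mB_0)
    qed
    moreover have "(if j2 = 0 then - e else 0) \<in> I"
      using e(1) I_uminus I_0 by simp
    ultimately have "unit_in B' (c j2 + (if j2 = 0 then - e else 0))"
      using unit_B'[OF ij1(1)] by simp
    moreover have "c j2 + (if j2 = 0 then - e else 0) = ?c j2"
      by simp
    ultimately show ?thesis
      using unit_B'_imp_S by metis
  qed
  moreover have "z \<in> Og"
    unfolding z_def divide_inverse power_inverse[symmetric]
    by (intro rc_mult[OF ring_O] rc_power[OF ring_O] xy_O xy_inverse)
  ultimately have "z \<in> S \<or> z \<noteq> 0 \<and> inverse z \<in> S"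
    using local_unit_coefficient[OF ring_S loc S_subset_O ring_O S_closed, of z N ?c] by blast
  then show ?thesis
    by (auto simp: z_def)
qed

end

lemma wsubst_order:
  fixes q p r :: "complex poly poly"
  assumes "monom 1 n dvd q * r" "coeff q 0 \<noteq> 0"
  shows "monom 1 n dvd r"
proof (cases "r = 0")
  case False
  have q: "q \<noteq> 0" "order 0 q = 0"
    using assms(2) by (auto simp: poly_0_coeff_0 intro: order_0I)
  have "q * r \<noteq> 0"
    using q False by simp
  then show ?thesis
    using assms(1) q False by (simp add: monom_1_dvd_iff order_mult)
qed simp

lemma integral_over_ex:
  "integral_over B g \<Longrightarrow> \<exists>n a. (\<forall>i. a i \<in> B) \<and> g ^ n + (\<Sum>i<n. a i * g ^ i) = 0"
  by (elim integral_overE_sum) blast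

lemma is_hom_at: "is_hom (\<lambda>p :: complex poly poly. poly (coeff p 0) t)"
  unfolding poly_0_coeff_0[symmetric] by (rule is_hom_comp[OF is_hom_poly is_hom_poly])

section \<open>Specialization along a weighted branch\<close>

context plane_curve
begin

definition ini :: "nat \<Rightarrow> nat \<Rightarrow> nat \<Rightarrow> complex \<Rightarrow> complex \<Rightarrow> complex"
  where "ini \<alpha> \<beta> W s t = (\<Sum>p\<in>triangle d. if \<alpha> * fst p + \<beta> * snd p = W
    then cf F (fst p) (snd p) * s ^ fst p * t ^ snd p else 0)"

lemma aff_F: "aff F = (\<Sum>p\<in>triangle d. monom (monom (cf F (fst p) (snd p)) (fst p)) (snd p))"
proof -
  have "[:[:c:]:] * monom (monom 1 i) j = monom (monom c i) j" for c :: complex and i j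
    by (simp add: smult_monom)
  then have "aff (of_cf d (cf F)) = (\<Sum>p\<in>triangle d. monom (monom (cf F (fst p) (snd p)) (fst p)) (snd p))"
    by (simp add: of_cf_def hom_sum[OF is_hom_aff] hom_mult[OF is_hom_aff] aff_Const aff_mon split_beta
        del: mult_pCons_left)
  then show ?thesis
    by (simp add: of_cf_cf[OF hom_F])
qed

lemma poly_ini: "poly (coeff (wsubst \<alpha> \<beta> (aff F)) W) t = ini \<alpha> \<beta> W 1 t"
  by (simp add: aff_F hom_sum[OF is_hom_wsubst] wsubst_monom coeff_sum poly_sum ini_def poly_monom
      if_distrib[of "\<lambda>q. poly q t"] cong: if_cong)

lemma ini_scale: "ini \<alpha> \<beta> W (\<tau> ^ \<alpha> * s) (\<tau> ^ \<beta> * t) = \<tau> ^ W * ini \<alpha> \<beta> W s t"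
  unfolding ini_def sum_distrib_left
  by (intro sum.cong) (auto simp: power_mult_distrib power_mult[symmetric] power_add mult_ac)

abbreviation "Phi \<alpha> \<beta> G \<equiv> wsubst \<alpha> \<beta> (aff G)"

lemma is_hom_Phi: "is_hom (\<lambda>G. Phi \<alpha> \<beta> G)"
  by (rule is_hom_comp[OF is_hom_wsubst is_hom_aff])

lemma Phi_L: "Phi \<alpha> \<beta> L0 = 1" "Phi \<alpha> \<beta> L1 = monom 1 \<alpha>" "Phi \<alpha> \<beta> L2 = monom (monom 1 1) \<beta>"
  "Phi \<alpha> \<beta> (Const c) = [:[:c:]:]"
proof -
  have "aff L0 = monom (monom 1 0) 0" "aff L1 = monom (monom 1 1) 0" "aff L2 = monom (monom 1 0) 1"
    "aff (Const c) = monom (monom c 0) 0"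
    by (simp_all add: aff_def lsubst_L[OF is_hom_emb] lsubst_Const[OF is_hom_emb] monom_0 monom_altdef one_pCons)
  then show "Phi \<alpha> \<beta> L0 = 1" "Phi \<alpha> \<beta> L1 = monom 1 \<alpha>" "Phi \<alpha> \<beta> L2 = monom (monom 1 1) \<beta>"
    "Phi \<alpha> \<beta> (Const c) = [:[:c:]:]"
    by (simp_all only: wsubst_monom) (simp_all add: monom_0 one_pCons)
qed

text \<open>With positive weights the substituted point becomes \<open>v\<close> when the outer
  variable is 0. Hence every element of \<open>B\<close> has a value, see
  \<open>vl_B\<close>.\<close>

lemma Phi_at_0:
  assumes "\<alpha> > 0" "\<beta> > 0"
  shows "poly (coeff (Phi \<alpha> \<beta> G) 0) t = peval v G"
proof -
  have h: "is_hom (\<lambda>G. poly (coeff (Phi \<alpha> \<beta> G) 0) t)"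
    by (rule is_hom_comp[OF is_hom_at is_hom_Phi])
  have "poly (coeff (Phi \<alpha> \<beta> G) 0) t = lsubst (\<lambda>c. poly (coeff (Phi \<alpha> \<beta> (Const c)) 0) t)
      (poly (coeff (Phi \<alpha> \<beta> L0) 0) t) (poly (coeff (Phi \<alpha> \<beta> L1) 0) t) (poly (coeff (Phi \<alpha> \<beta> L2) 0) t) G"
    by (rule hom_eq_lsubst[OF h])
  also have "\<dots> = lsubst (\<lambda>c. c) 1 0 0 G"
    using assms by (simp add: Phi_L)
  also have "\<dots> = peval v G"
    using peval_lsubst[of 1 0 0 G] by simp
  finally show ?thesis .
qed

text \<open>The value at \<open>t\<close> of the fraction obtained by substituting \<open>x = \<tau>\<^sup>\<alpha>\<close>, \<open>y = t \<tau>\<^sup>\<beta>\<close> and \<open>\<tau> = 0\<close>.\<close>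

definition vl :: "nat \<Rightarrow> nat \<Rightarrow> complex \<Rightarrow> form fract \<Rightarrow> complex \<Rightarrow> bool"
  where "vl \<alpha> \<beta> t g c \<longleftrightarrow> (\<exists>P H k e Pr Hr. homogeneous k P \<and> homogeneous k H \<and> g = fr P / fr H \<and>
    Phi \<alpha> \<beta> P = monom 1 e * Pr \<and> Phi \<alpha> \<beta> H = monom 1 e * Hr \<and>
    poly (coeff Hr 0) t \<noteq> 0 \<and> c = poly (coeff Pr 0) t / poly (coeff Hr 0) t)"

lemma vlI:
  assumes "homogeneous k P" "homogeneous k H" "g = fr P / fr H" "Phi \<alpha> \<beta> P = monom 1 e * Pr"
    "Phi \<alpha> \<beta> H = monom 1 e * Hr" "poly (coeff Hr 0) t \<noteq> 0" "c = poly (coeff Pr 0) t / poly (coeff Hr 0) t"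
  shows "vl \<alpha> \<beta> t g c"
  unfolding vl_def using assms by blast

lemma vlE:
  assumes "vl \<alpha> \<beta> t g c"
  obtains P H k e Pr Hr where "homogeneous k P" "homogeneous k H" "H \<noteq> 0" "g = fr P / fr H"
    "Phi \<alpha> \<beta> P = monom 1 e * Pr" "Phi \<alpha> \<beta> H = monom 1 e * Hr"
    "poly (coeff Hr 0) t \<noteq> 0" "c = poly (coeff Pr 0) t / poly (coeff Hr 0) t"
proof -
  obtain P H k e Pr Hr where *: "homogeneous k P" "homogeneous k H" "g = fr P / fr H"
    "Phi \<alpha> \<beta> P = monom 1 e * Pr" "Phi \<alpha> \<beta> H = monom 1 e * Hr"
    "poly (coeff Hr 0) t \<noteq> 0" "c = poly (coeff Pr 0) t / poly (coeff Hr 0) t"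
    using assms unfolding vl_def by blast
  moreover have "H \<noteq> 0"
  proof
    assume "H = 0"
    then have "monom 1 e * Hr = 0"
      using *(5) by (simp add: hom_0[OF is_hom_Phi])
    then show False
      using *(6) by (simp add: monom_eq_0_iff)
  qed
  ultimately show thesis
    using that by blast
qed

lemma vl_mult:
  assumes "vl \<alpha> \<beta> t g c" "vl \<alpha> \<beta> t g' c'"
  shows "vl \<alpha> \<beta> t (g * g') (c * c')"
proof -
  obtain P H k e Pr Hr where 1: "homogeneous k P" "homogeneous k H" "H \<noteq> 0" "g = fr P / fr H"
    "Phi \<alpha> \<beta> P = monom 1 e * Pr" "Phi \<alpha> \<beta> H = monom 1 e * Hr"
    "poly (coeff Hr 0) t \<noteq> 0" "c = poly (coeff Pr 0) t / poly (coeff Hr 0) t"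
    by (rule vlE[OF assms(1)])
  obtain P' H' k' e' Pr' Hr' where 2: "homogeneous k' P'" "homogeneous k' H'" "H' \<noteq> 0" "g' = fr P' / fr H'"
    "Phi \<alpha> \<beta> P' = monom 1 e' * Pr'" "Phi \<alpha> \<beta> H' = monom 1 e' * Hr'"
    "poly (coeff Hr' 0) t \<noteq> 0" "c' = poly (coeff Pr' 0) t / poly (coeff Hr' 0) t"
    by (rule vlE[OF assms(2)])
  have m: "monom 1 e * A * (monom 1 e' * B) = monom 1 (e + e') * (A * B)" for A B :: "complex poly poly"
  proof -
    have "monom 1 (e + e') = monom 1 e * (monom 1 e' :: complex poly poly)"
      by (simp add: mult_monom)
    then show ?thesis
      by (simp only: mult_ac)
  qed
  show ?thesis
  proof (rule vlI[where P = "P * P'" and H = "H * H'" and e = "e + e'" and Pr = "Pr * Pr'" and Hr = "Hr * Hr'"])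
    show "homogeneous (k + k') (P * P')" "homogeneous (k + k') (H * H')"
      using 1 2 homogeneous_mult by blast+
    show "g * g' = fr (P * P') / fr (H * H')"
      by (simp only: 1(4) 2(4) frac_mult)
    show "Phi \<alpha> \<beta> (P * P') = monom 1 (e + e') * (Pr * Pr')" "Phi \<alpha> \<beta> (H * H') = monom 1 (e + e') * (Hr * Hr')"
      by (simp_all only: hom_mult[OF is_hom_Phi] 1 2 m)
  qed (use 1 2 in \<open>simp_all add: hom_mult[OF is_hom_at]\<close>)
qed

lemma vl_add:
  assumes "vl \<alpha> \<beta> t g c" "vl \<alpha> \<beta> t g' c'"
  shows "vl \<alpha> \<beta> t (g + g') (c + c')"
proof -
  obtain P H k e Pr Hr where 1: "homogeneous k P" "homogeneous k H" "H \<noteq> 0" "g = fr P / fr H"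
    "Phi \<alpha> \<beta> P = monom 1 e * Pr" "Phi \<alpha> \<beta> H = monom 1 e * Hr"
    "poly (coeff Hr 0) t \<noteq> 0" "c = poly (coeff Pr 0) t / poly (coeff Hr 0) t"
    by (rule vlE[OF assms(1)])
  obtain P' H' k' e' Pr' Hr' where 2: "homogeneous k' P'" "homogeneous k' H'" "H' \<noteq> 0" "g' = fr P' / fr H'"
    "Phi \<alpha> \<beta> P' = monom 1 e' * Pr'" "Phi \<alpha> \<beta> H' = monom 1 e' * Hr'"
    "poly (coeff Hr' 0) t \<noteq> 0" "c' = poly (coeff Pr' 0) t / poly (coeff Hr' 0) t"
    by (rule vlE[OF assms(2)])
  have m: "monom 1 e * A * (monom 1 e' * B) = monom 1 (e + e') * (A * B)"
    "monom 1 e' * B * (monom 1 e * A) = monom 1 (e + e') * (B * A)" for A B :: "complex poly poly"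
  proof -
    have "monom 1 (e + e') = monom 1 e * (monom 1 e' :: complex poly poly)"
      by (simp add: mult_monom)
    then show "monom 1 e * A * (monom 1 e' * B) = monom 1 (e + e') * (A * B)"
      "monom 1 e' * B * (monom 1 e * A) = monom 1 (e + e') * (B * A)"
      by (simp_all only: mult_ac)
  qed
  show ?thesis
  proof (rule vlI[where P = "P * H' + P' * H" and H = "H * H'" and e = "e + e'"
        and Pr = "Pr * Hr' + Pr' * Hr" and Hr = "Hr * Hr'"])
    show "homogeneous (k + k') (H * H')" "homogeneous (k + k') (P * H' + P' * H)"
      using 1 2 homogeneous_mult[of k P k' H'] homogeneous_mult[of k' P' k H] homogeneous_mult[of k H k' H']
      by (auto simp: add.commute intro: homogeneous_add)
    show "g + g' = fr (P * H' + P' * H) / fr (H * H')"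
      using 1(3) 2(3) by (simp add: 1(4) 2(4) frac_add)
    show "Phi \<alpha> \<beta> (P * H' + P' * H) = monom 1 (e + e') * (Pr * Hr' + Pr' * Hr)"
      "Phi \<alpha> \<beta> (H * H') = monom 1 (e + e') * (Hr * Hr')"
      by (simp_all only: hom_mult[OF is_hom_Phi] hom_add[OF is_hom_Phi] 1 2 m distrib_left)
  qed (use 1 2 in \<open>simp_all add: hom_mult[OF is_hom_at] hom_add[OF is_hom_at] add_frac_eq\<close>)
qed

lemma vl_const: "vl \<alpha> \<beta> t (const c) c"
  by (rule vlI[where P = "Const c" and H = 1 and k = 0 and e = 0 and Pr = "[:[:c:]:]" and Hr = 1])
    (simp_all add: const_def hom_1[OF is_hom_fr] Phi_L hom_1[OF is_hom_Phi])

lemma vl_sum: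
  assumes "finite A" "\<And>i. i \<in> A \<Longrightarrow> vl \<alpha> \<beta> t (f i) (c i)"
  shows "vl \<alpha> \<beta> t (sum f A) (sum c A)"
  using assms
proof (induction A)
  case empty
  show ?case
    using vl_const[of \<alpha> \<beta> t 0] by (simp add: hom_0[OF is_hom_const])
qed (auto intro: vl_add)

lemma vl_power: "vl \<alpha> \<beta> t g c \<Longrightarrow> vl \<alpha> \<beta> t (g ^ n) (c ^ n)"
proof (induction n)
  case 0
  show ?case
    using vl_const[of \<alpha> \<beta> t 1] by (simp add: hom_1[OF is_hom_const])
qed (auto intro: vl_mult)

lemma vl_B:
  assumes "\<alpha> > 0" "\<beta> > 0" "g \<in> B"
  shows "\<exists>c. vl \<alpha> \<beta> t g c"
proof -
  obtain p q k where *: "homogeneous k p" "homogeneous k q" "q \<in> dens_at v" "q \<noteq> 0" "g = fr p / fr q"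
    using assms(3) unfolding B_def by (elim hfracE[OF _ mult_set_0[OF mult_set_at]]) blast
  have "vl \<alpha> \<beta> t g (poly (coeff (Phi \<alpha> \<beta> p) 0) t / poly (coeff (Phi \<alpha> \<beta> q) 0) t)"
    using * by (intro vlI[where P = p and H = q and e = 0]) (auto simp: Phi_at_0[OF assms(1,2)] dens_at_def)
  then show ?thesis
    by blast
qed

lemma vl_quotient: "vl \<alpha> \<beta> t (y ^ \<alpha> / x ^ \<beta>) (t ^ \<alpha>)"
proof (rule vlI[where P = "L2 ^ \<alpha> * L0 ^ \<beta>" and H = "L1 ^ \<beta> * L0 ^ \<alpha>" and k = "\<alpha> + \<beta>" and e = "\<alpha> * \<beta>"
      and Pr = "[:monom 1 \<alpha>:]" and Hr = 1])
  show "homogeneous (\<alpha> + \<beta>) (L2 ^ \<alpha> * L0 ^ \<beta>)" "homogeneous (\<alpha> + \<beta>) (L1 ^ \<beta> * L0 ^ \<alpha>)"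
    using homogeneous_mult[OF homogeneous_power[OF homogeneous_lin] homogeneous_power[OF homogeneous_lin]]
    by (auto simp: add.commute) (metis add.commute mult_1)
  show "y ^ \<alpha> / x ^ \<beta> = fr (L2 ^ \<alpha> * L0 ^ \<beta>) / fr (L1 ^ \<beta> * L0 ^ \<alpha>)"
    using L0_nz by (simp add: x_def y_def hom_simps[OF is_hom_fr] power_divide)
  show "Phi \<alpha> \<beta> (L2 ^ \<alpha> * L0 ^ \<beta>) = monom 1 (\<alpha> * \<beta>) * [:monom 1 \<alpha>:]"
    by (simp add: hom_simps[OF is_hom_Phi] Phi_L monom_power smult_monom mult.commute)
  show "Phi \<alpha> \<beta> (L1 ^ \<beta> * L0 ^ \<alpha>) = monom 1 (\<alpha> * \<beta>) * 1"
    by (simp add: hom_simps[OF is_hom_Phi] Phi_L monom_power)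
qed (simp_all add: poly_monom)

context
  fixes \<alpha> \<beta> W i0 j0 :: nat and t :: complex
  assumes \<alpha>: "\<alpha> > 0" and \<beta>: "\<beta> > 0" and W: "\<And>i j. cf F i j \<noteq> 0 \<Longrightarrow> W \<le> \<alpha> * i + \<beta> * j"
    and nz: "cf F i0 j0 \<noteq> 0" "\<alpha> * i0 + \<beta> * j0 = W" and root: "ini \<alpha> \<beta> W 1 t = 0"
begin

text \<open>The lowest part of the image of \<open>F\<close> is the initial form, nonzero as a
  polynomial but zero at \<open>t\<close>. So any power of the outer variable beyond
  \<open>W\<close> in the image of a multiple of \<open>F\<close> comes from the cofactor, and the
  factor that vanishes at \<open>t\<close> remains.\<close>

lemma dvd_at_root:
  assumes "F dvd P" "Phi \<alpha> \<beta> P = monom 1 e * Pr"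
  shows "poly (coeff Pr 0) t = 0"
proof -
  obtain Q where Q: "P = F * Q"
    using assms(1) by blast
  obtain q where q: "Phi \<alpha> \<beta> F = monom 1 W * q"
    "\<And>i j. \<alpha> * i + \<beta> * j = W \<Longrightarrow> coeff (coeff q 0) j = coeff (coeff (aff F) j) i"
    using wsubst_initial[OF \<alpha>, of "aff F" W \<beta>] W unfolding cf_def by blast
  have "coeff (coeff q 0) j0 \<noteq> 0"
    using q(2)[OF nz(2)] nz(1) by (simp add: cf_def)
  then have q0: "coeff q 0 \<noteq> 0"
    by auto
  have "coeff q 0 = coeff (Phi \<alpha> \<beta> F) W"
    by (simp add: q(1) coeff_monom_mult)
  then have qt: "poly (coeff q 0) t = 0"
    using root by (simp add: poly_ini)
  have eq: "monom 1 e * Pr = monom 1 W * (q * Phi \<alpha> \<beta> Q)"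
    using assms(2) by (simp add: Q hom_mult[OF is_hom_Phi] q(1) mult.assoc)
  have mm: "monom 1 (i + j) = monom 1 i * monom (1 :: complex poly) j" for i j
    by (simp add: mult_monom)
  show ?thesis
  proof (cases "e < W")
    case True
    then have "monom 1 e * Pr = monom 1 e * (monom 1 (W - e) * (q * Phi \<alpha> \<beta> Q))"
      using mm[of e "W - e"] by (simp add: eq mult.assoc)
    then have "Pr = monom 1 (W - e) * (q * Phi \<alpha> \<beta> Q)"
      by (simp add: monom_eq_0_iff)
    then show ?thesis
      using True by (simp add: coeff_monom_mult)
  next
    case False
    then have "monom 1 W * (monom 1 (e - W) * Pr) = monom 1 W * (q * Phi \<alpha> \<beta> Q)"
      using mm[of W "e - W"] by (simp flip: eq add: mult.assoc)
    then have eq2: "monom 1 (e - W) * Pr = q * Phi \<alpha> \<beta> Q"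
      by (simp add: monom_eq_0_iff)
    have "monom 1 (e - W) dvd Phi \<alpha> \<beta> Q"
    proof (rule wsubst_order[OF _ q0])
      show "monom 1 (e - W) dvd q * Phi \<alpha> \<beta> Q"
        unfolding eq2[symmetric] by (rule dvd_triv_left)
    qed
    then obtain R where "Phi \<alpha> \<beta> Q = monom 1 (e - W) * R"
      by blast
    then have "monom 1 (e - W) * Pr = monom 1 (e - W) * (q * R)"
      using eq2 by (simp add: mult_ac)
    then have "Pr = q * R"
      by (simp add: monom_eq_0_iff)
    then show ?thesis
      using qt by (simp add: hom_mult[OF is_hom_at])
  qed
qed

text \<open>The lowest part of the denominator does not vanish at \<open>t\<close>, so
  \<open>F\<close> does not divide the denominator and must divide the numerator.\<close>

lemma vl_I:
  assumes "g \<in> I" "vl \<alpha> \<beta> t g c"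
  shows "c = 0"
proof -
  obtain P H k e Pr Hr where 1: "homogeneous k P" "homogeneous k H" "H \<noteq> 0" "g = fr P / fr H"
    "Phi \<alpha> \<beta> P = monom 1 e * Pr" "Phi \<alpha> \<beta> H = monom 1 e * Hr"
    "poly (coeff Hr 0) t \<noteq> 0" "c = poly (coeff Pr 0) t / poly (coeff Hr 0) t"
    by (rule vlE[OF assms(2)])
  have "H \<in> dens_gen F"
    using dvd_at_root[OF _ 1(6)] 1(7) by (auto simp: dens_gen_def)
  then have "F dvd P"
    using assms(1) I_frac[of H P] 1(4) by blast
  then show ?thesis
    using dvd_at_root[OF _ 1(5)] 1(8) by simp
qed

text \<open>An integral equation for the inverse \<open>u\<close> of \<open>w = y\<^sup>\<alpha> / x\<^sup>\<beta> - t\<^sup>\<alpha>\<close> would give an element of \<open>I\<close> with value 1.\<close>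

lemma quotient_not_unit: "\<not> unit_in S (y ^ \<alpha> / x ^ \<beta> - const (t ^ \<alpha>))"
proof
  define w where "w = y ^ \<alpha> / x ^ \<beta> - const (t ^ \<alpha>)"
  assume "unit_in S (y ^ \<alpha> / x ^ \<beta> - const (t ^ \<alpha>))"
  then have u: "w \<in> S" "w \<noteq> 0" "inverse w \<in> S"
    by (auto simp: unit_in_def w_def)
  then have io: "integral_over B' (inverse w)"
    by (simp add: S_def)
  obtain n c where cc: "(\<forall>i. c i \<in> B') \<and> inverse w ^ n + (\<Sum>i<n. c i * inverse w ^ i) = 0"
    using integral_over_ex[OF io] by (elim exE)
  then have c: "\<And>i. c i \<in> B'" "inverse w ^ n + (\<Sum>i<n. c i * inverse w ^ i) = 0"
    by auto
  have "\<exists>b\<in>B. c i - b \<in> I" for i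
  proof -
    obtain b e where "c i = b + e" "b \<in> B" "e \<in> I"
      using c(1)[of i] by (auto simp: B'_def)
    then show ?thesis
      by (intro bexI[of _ b]) auto
  qed
  then obtain b where b: "\<And>i. b i \<in> B" "\<And>i. c i - b i \<in> I"
    by metis
  have "c i * inverse w ^ i * w ^ n = c i * w ^ (n - i)" if "i < n" for i
  proof -
    have "w ^ n = w ^ i * w ^ (n - i)"
      using that by (simp flip: power_add)
    then show ?thesis
      using u(2) by (simp add: power_inverse)
  qed
  then have "(\<Sum>i<n. c i * inverse w ^ i) * w ^ n = (\<Sum>i<n. c i * w ^ (n - i))"
    unfolding sum_distrib_right by (intro sum.cong) auto
  moreover have "(inverse w ^ n + (\<Sum>i<n. c i * inverse w ^ i)) * w ^ n =
      inverse w ^ n * w ^ n + (\<Sum>i<n. c i * inverse w ^ i) * w ^ n"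
    by (simp only: distrib_right)
  ultimately have "1 + (\<Sum>i<n. c i * w ^ (n - i)) = 0"
    using u(2) by (simp only: c(2)) (simp add: power_inverse)
  then have "1 + (\<Sum>i<n. b i * w ^ (n - i)) = - (\<Sum>i<n. (c i - b i) * w ^ (n - i))"
    by (simp add: left_diff_distrib sum_subtractf algebra_simps)
  moreover have "(\<Sum>i\<in>A. (c i - b i) * w ^ (n - i)) \<in> I" for A
    using b u(1) S_subset_O by (induction A rule: infinite_finite_induct)
      (auto intro!: I_0 I_add I_mult rc_power[OF ring_O])
  ultimately have I: "1 + (\<Sum>i<n. b i * w ^ (n - i)) \<in> I"
    using I_uminus by simp
  have w: "vl \<alpha> \<beta> t w 0"
    using vl_add[OF vl_quotient[of \<alpha> \<beta> t] vl_const[of \<alpha> \<beta> t "- (t ^ \<alpha>)"]]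
    by (simp add: w_def hom_uminus[OF is_hom_const])
  obtain e where e: "\<And>i. vl \<alpha> \<beta> t (b i) (e i)"
    using vl_B[OF \<alpha> \<beta> b(1)] by metis
  have "vl \<alpha> \<beta> t (b i * w ^ (n - i)) 0" if "i < n" for i
    using vl_mult[OF e[of i] vl_power[OF w, of "n - i"]] that by (simp add: power_0_left)
  then have "vl \<alpha> \<beta> t (\<Sum>i<n. b i * w ^ (n - i)) (\<Sum>i<n. 0)"
    by (intro vl_sum) auto
  from vl_add[OF vl_const[of \<alpha> \<beta> t 1] this]
  have "vl \<alpha> \<beta> t (1 + (\<Sum>i<n. b i * w ^ (n - i))) 1"
    by (simp add: hom_1[OF is_hom_const])
  from vl_I[OF I this] show False
    by simp
qed

end

lemma plane_curve_swap: "plane_curve v b a v' b' a' F d"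
proof -
  interpret s: plane_basis v b a v' b' a'
    by (rule plane_basis_swap) unfold_locales
  show ?thesis
    by unfold_locales (use hom_F irr F_v d2 in auto)
qed

lemma swap_sum: "(\<Sum>p\<in>triangle d. f (fst p) (snd p)) = (\<Sum>p\<in>triangle d. f (snd p) (fst p))"
  by (rule sum.reindex_bij_witness[of _ prod.swap prod.swap]) (auto simp: triangle_def)

lemma cf_swap: "plane_basis.cf v b a F j i = cf F i j"
proof -
  interpret s: plane_curve v b a v' b' a' F d
    by (rule plane_curve_swap)
  have mon: "s.mon k j i = mon k i j" for k i j
    by (simp add: s.mon_def mon_def diff_diff_eq add.commute mult_ac)
  have "s.of_cf d (\<lambda>j i. cf F i j) = of_cf d (cf F)"
    unfolding s.of_cf_def of_cf_def split_beta mon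
    by (rule swap_sum[of "\<lambda>i j. Const (cf F j i) * mon d j i"])
  then show ?thesis
    using s.cf_of_cf[of d "\<lambda>j i. cf F i j" j i] cf_eq_0[OF hom_F, of i j]
    by (simp add: of_cf_cf[OF hom_F] add.commute not_le split: if_splits)
qed

text \<open>The same with exchanged coordinates. It covers a root of the edge form at
  \<open>x = 0\<close>, which the chart \<open>x = 1\<close> misses.\<close>

lemma quotient_not_unit':
  assumes \<alpha>: "\<alpha> > 0" and \<beta>: "\<beta> > 0" and W: "\<And>i j. cf F i j \<noteq> 0 \<Longrightarrow> W \<le> \<alpha> * i + \<beta> * j"
    and nz: "cf F i0 j0 \<noteq> 0" "\<alpha> * i0 + \<beta> * j0 = W" and root: "ini \<alpha> \<beta> W t 1 = 0"
  shows "\<not> unit_in S (x ^ \<beta> / y ^ \<alpha> - const (t ^ \<beta>))"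
proof -
  interpret s: plane_curve v b a v' b' a' F d
    by (rule plane_curve_swap)
  note cf = cf_swap
  have "s.ini \<beta> \<alpha> W 1 t = ini \<alpha> \<beta> W t 1"
    unfolding s.ini_def ini_def cf
    using swap_sum[of "\<lambda>i j. if \<beta> * i + \<alpha> * j = W then cf F j i * 1 ^ i * t ^ j else 0"]
    by (simp add: add.commute cong: if_cong)
  moreover have "s.x = y" "s.y = x"
    by (simp_all add: s.x_def s.y_def x_def y_def)
  ultimately show ?thesis
    using s.quotient_not_unit[OF \<beta> \<alpha>, of W j0 i0 t] W nz root cf by (simp add: add.commute)
qed

end

lemma complex_root_ex: "n > 0 \<Longrightarrow> \<exists>w. w ^ n = (z :: complex)"
  by (metis exists_complex_root less_not_refl)

section \<open>The Newton polygon when the integral closure is local\<close>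

context plane_curve
begin

text \<open>One of the two fractions is in \<open>S\<close>. It is the sum of a nonzero constant,
  its residue, and a nonunit, so locality makes it a unit.\<close>

lemma quotient_in_S:
  assumes loc: "local_in S" and \<alpha>: "\<alpha> > 0" and \<beta>: "\<beta> > 0"
    and W: "\<And>i j. cf F i j \<noteq> 0 \<Longrightarrow> W \<le> \<alpha> * i + \<beta> * j"
    and nz: "cf F i0 j0 \<noteq> 0" "\<alpha> * i0 + \<beta> * j0 = W"
    and t: "t \<noteq> 0" "ini \<alpha> \<beta> W 1 t = 0"
  shows "y ^ \<alpha> / x ^ \<beta> \<in> S" "x ^ \<beta> / y ^ \<alpha> \<in> S"
proof -
  define z where "z = y ^ \<alpha> / x ^ \<beta>"
  define z' where "z' = x ^ \<beta> / y ^ \<alpha>"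
  have zz: "inverse z = z'" "inverse z' = z" "z \<noteq> 0" "z' \<noteq> 0"
    using xy_nz by (auto simp: z_def z'_def)
  have step: "unit_in S w" if w: "w \<in> S" "\<not> unit_in S (w - const c)" "c \<noteq> 0" for w c
  proof -
    have cS: "const c \<in> S"
      using unit_const[OF w(3)] by (simp add: unit_in_def)
    have "- (w - const c) \<in> S"
      using rc_uminus[OF ring_S rc_diff[OF ring_S w(1) cS]] .
    moreover have "unit_in S (w + (- (w - const c)))"
      using unit_const[OF w(3)] by simp
    ultimately have "unit_in S w \<or> unit_in S (- (w - const c))"
      using loc w(1) unfolding local_in_def by blast
    then show ?thesis
      using w(2) unit_in_uminus[OF ring_S] by blast
  qed
  \<comment> \<open>By weighted homogeneity the root \<open>(1, t)\<close> of the initial form can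
    be moved to a root with second coordinate 1, as the inverse fraction requires.\<close>
  obtain \<tau> where \<tau>: "\<tau> ^ \<beta> = inverse t"
    using complex_root_ex[OF \<beta>, of "inverse t"] by (elim exE)
  have "\<tau> \<noteq> 0"
  proof
    assume "\<tau> = 0"
    then show False
      using \<tau> t(1) \<beta> by (simp add: power_0_left)
  qed
  then have \<tau>0: "\<tau> ^ \<alpha> \<noteq> 0"
    by simp
  have "ini \<alpha> \<beta> W (\<tau> ^ \<alpha>) 1 = 0"
    using ini_scale[of \<alpha> \<beta> W \<tau> 1 t] t by (simp add: \<tau>)
  then have n': "\<not> unit_in S (z' - const ((\<tau> ^ \<alpha>) ^ \<beta>))"
    unfolding z'_def by (intro quotient_not_unit'[OF \<alpha> \<beta> W nz]) auto
  have n: "\<not> unit_in S (z - const (t ^ \<alpha>))"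
    unfolding z_def by (intro quotient_not_unit[OF \<alpha> \<beta> W nz t(2)]) auto
  have "z \<in> S \<or> z' \<in> S"
    using local_quotient[OF loc \<alpha> W nz] by (auto simp: z_def z'_def)
  then have "z \<in> S \<and> z' \<in> S"
  proof
    assume "z \<in> S"
    then have "unit_in S z"
      by (rule step[OF _ n]) (use t in simp)
    then show ?thesis
      by (simp add: unit_in_def zz)
  next
    assume "z' \<in> S"
    then have "unit_in S z'"
      by (rule step[OF _ n']) (use \<tau>0 in simp)
    then show ?thesis
      by (simp add: unit_in_def zz)
  qed
  then show "y ^ \<alpha> / x ^ \<beta> \<in> S" "x ^ \<beta> / y ^ \<alpha> \<in> S"
    by (auto simp: z_def z'_def)
qed

text \<open>Otherwise the fraction minus either residue would be a nonunit, while the two differ by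
  a nonzero constant.\<close>

lemma roots_equal:
  assumes loc: "local_in S" and \<alpha>: "\<alpha> > 0" and \<beta>: "\<beta> > 0"
    and W: "\<And>i j. cf F i j \<noteq> 0 \<Longrightarrow> W \<le> \<alpha> * i + \<beta> * j"
    and nz: "cf F i0 j0 \<noteq> 0" "\<alpha> * i0 + \<beta> * j0 = W"
    and t: "t \<noteq> 0" "ini \<alpha> \<beta> W 1 t = 0" and u: "ini \<alpha> \<beta> W 1 u = 0"
  shows "t ^ \<alpha> = u ^ \<alpha>"
proof (rule ccontr)
  assume neq: "t ^ \<alpha> \<noteq> u ^ \<alpha>"
  define z where "z = y ^ \<alpha> / x ^ \<beta>"
  have zS: "z \<in> S"
    unfolding z_def by (rule quotient_in_S(1)[OF loc \<alpha> \<beta> W nz t])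
  have cS: "const c \<in> S" for c
    using const_B B_subset_B' B'_subset_S by blast
  have "unit_in S (const (u ^ \<alpha> - t ^ \<alpha>))"
    using neq by (intro unit_const) simp
  then have "unit_in S ((z - const (t ^ \<alpha>)) + (- (z - const (u ^ \<alpha>))))"
    by (simp add: hom_diff[OF is_hom_const])
  moreover have "z - const (t ^ \<alpha>) \<in> S" "- (z - const (u ^ \<alpha>)) \<in> S"
    using rc_diff[OF ring_S zS cS] rc_uminus[OF ring_S] by blast+
  ultimately have "unit_in S (z - const (t ^ \<alpha>)) \<or> unit_in S (- (z - const (u ^ \<alpha>)))"
    using loc unfolding local_in_def by blast
  moreover have "\<not> unit_in S (z - const (t ^ \<alpha>))"
    unfolding z_def by (rule quotient_not_unit[OF \<alpha> \<beta> W nz t(2)])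
  moreover have "\<not> unit_in S (z - const (u ^ \<alpha>))"
    unfolding z_def by (rule quotient_not_unit[OF \<alpha> \<beta> W nz u])
  ultimately show False
    using unit_in_uminus[OF ring_S] by blast
qed

text \<open>A root at \<open>x = 0\<close> would make \<open>x ^ \<beta> / y ^ \<alpha>\<close> a
  nonunit, but the nonzero root already makes it a unit.\<close>

lemma ini_0_1_nonzero:
  assumes loc: "local_in S" and \<alpha>: "\<alpha> > 0" and \<beta>: "\<beta> > 0"
    and W: "\<And>i j. cf F i j \<noteq> 0 \<Longrightarrow> W \<le> \<alpha> * i + \<beta> * j"
    and nz: "cf F i0 j0 \<noteq> 0" "\<alpha> * i0 + \<beta> * j0 = W"
    and t: "t \<noteq> 0" "ini \<alpha> \<beta> W 1 t = 0"
  shows "ini \<alpha> \<beta> W 0 1 \<noteq> 0"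
proof
  assume 0: "ini \<alpha> \<beta> W 0 1 = 0"
  have "\<not> unit_in S (x ^ \<beta> / y ^ \<alpha> - const (0 ^ \<beta>))"
    by (rule quotient_not_unit'[OF \<alpha> \<beta> W nz 0])
  then have "\<not> unit_in S (x ^ \<beta> / y ^ \<alpha>)"
    using \<beta> by (simp add: power_0_left hom_0[OF is_hom_const])
  moreover note quotient_in_S[OF loc \<alpha> \<beta> W nz t]
  ultimately show False
    using xy_nz by (auto simp: unit_in_def)
qed

definition ini_poly :: "nat \<Rightarrow> nat \<Rightarrow> nat \<Rightarrow> complex poly"
  where "ini_poly \<alpha> \<beta> W = coeff (wsubst \<alpha> \<beta> (aff F)) W"

lemma coeff_ini_poly: "\<alpha> > 0 \<Longrightarrow> coeff (ini_poly \<alpha> \<beta> (\<alpha> * i + \<beta> * j)) j = cf F i j"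
  by (simp add: ini_poly_def coeff_wsubst cf_def)

text \<open>Otherwise the edge of the Newton polygon at \<open>x\<^sup>n\<close> does not reach the \<open>y\<close>-axis, and its initial form
  has a nonzero root together with the root \<open>x = 0\<close>.\<close>

lemma newton_lower:
  assumes loc: "local_in S" and mn: "m > 0" "n > 0"
    and row: "\<And>i. i < n \<Longrightarrow> cf F i 0 = 0" "cf F n 0 \<noteq> 0"
    and col: "\<And>j. j < m \<Longrightarrow> cf F 0 j = 0" "cf F 0 m \<noteq> 0"
    and ij: "cf F i j \<noteq> 0"
  shows "m * n \<le> m * i + n * j"
proof (rule ccontr)
  assume bad: "\<not> m * n \<le> m * i + n * j"
  have "m * i + n * j < m * n"
    using bad by (rule not_le_imp_less)
  then have "m * i < m * n"
    by linarith
  then have i_n: "i < n"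
    by simp
  have j0: "j \<noteq> 0"
    using row(1)[OF i_n] ij by (cases j) auto
  \<comment> \<open>Among the points of the support to the left of \<open>n\<close>, one is chosen
    whose segment to \<open>(n, 0)\<close> is flattest, that is, with \<open>s\<close> maximal. All
    of the support then lies on or above the line through this segment.\<close>
  define T where "T = {p \<in> triangle d. cf F (fst p) (snd p) \<noteq> 0 \<and> fst p < n \<and> snd p \<noteq> 0}"
  define s where "s p = (real n - real (fst p)) / real (snd p)" for p :: "nat \<times> nat"
  have finT: "finite T"
    by (simp add: T_def)
  have "i + j \<le> d"
    using ij cf_eq_0[OF hom_F, of i j] by (meson not_le)
  then have ijT: "(i, j) \<in> T"
    using ij i_n j0 by (simp add: T_def)
  then have "Max (s ` T) \<in> s ` T"
    using finT by (intro Max_in) auto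
  then obtain p where p: "p \<in> T" "s p = Max (s ` T)"
    by auto
  have max: "s q \<le> s p" if "q \<in> T" for q
    using that finT unfolding p(2) by (intro Max_ge) auto
  define i1 where "i1 = fst p"
  define j1 where "j1 = snd p"
  have 1: "cf F i1 j1 \<noteq> 0" "i1 < n" "j1 > 0"
    using p(1) by (auto simp: T_def i1_def j1_def)
  define \<beta> where "\<beta> = n - i1"
  have \<beta>: "\<beta> > 0" "\<beta> + i1 = n"
    using 1 by (auto simp: \<beta>_def)
  have nr: "real n = real \<beta> + real i1"
    using \<beta>(2) by simp
  have s_le: "s (k, l) \<le> s p \<longleftrightarrow> (real n - real k) * real j1 \<le> (real n - real i1) * real l" if "l > 0" for k l
    using that 1(3) unfolding s_def i1_def[symmetric] j1_def[symmetric]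
    by (simp add: divide_le_eq pos_le_divide_eq times_divide_eq_left)
  have W: "j1 * n \<le> j1 * k + \<beta> * l" if "cf F k l \<noteq> 0" for k l
  proof (cases "k < n")
    case False
    then show ?thesis
      by (simp add: trans_le_add1)
  next
    case True
    then have "l \<noteq> 0"
      using row(1)[OF True] that by (cases l) auto
    moreover have "k + l \<le> d"
      using that cf_eq_0[OF hom_F, of k l] by (meson not_le)
    ultimately have "s (k, l) \<le> s p"
      using True that by (intro max) (simp add: T_def)
    then have "(real n - real k) * real j1 \<le> (real n - real i1) * real l"
      using \<open>l \<noteq> 0\<close> 1(3) s_le[of l k] by simp
    then have "real j1 * real n \<le> real j1 * real k + real \<beta> * real l"
      using nr by (simp add: algebra_simps)
    then have "real (j1 * n) \<le> real (j1 * k + \<beta> * l)"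
      by simp
    then show ?thesis
      by (simp only: of_nat_le_iff)
  qed
  have "s (i, j) \<le> s p"
    by (rule max[OF ijT])
  then have "(real n - real i) * real j1 \<le> real \<beta> * real j"
    using j0 s_le[of j i] nr by simp
  moreover have "real n * real j < real m * (real n - real i)"
  proof -
    have "real (m * i + n * j) < real (m * n)"
      using bad by (simp only: of_nat_less_iff not_le)
    then show ?thesis
      by (simp add: algebra_simps)
  qed
  ultimately have "real n * real j * real j1 < real m * (real \<beta> * real j)"
  proof -
    have "real n * real j * real j1 < real m * (real n - real i) * real j1"
      using \<open>real n * real j < real m * (real n - real i)\<close> 1(3) by simp
    also have "\<dots> \<le> real m * (real \<beta> * real j)"
      using mult_left_mono[OF \<open>(real n - real i) * real j1 \<le> real \<beta> * real j\<close>, of "real m"] by (simp add: mult.assoc)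
    finally show ?thesis .
  qed
  then have "real j * (real n * real j1) < real j * (real m * real \<beta>)"
    by (simp add: mult_ac)
  then have "real n * real j1 < real m * real \<beta>"
    using j0 by simp
  then have "real (n * j1) < real (m * \<beta>)"
    by simp
  then have "n * j1 < m * \<beta>"
    by (simp only: of_nat_less_iff)
  \<comment> \<open>The line through \<open>(n, 0)\<close> and the chosen point meets the
    \<open>y\<close>-axis below height \<open>m\<close>.\<close>
  then have steep: "j1 * n < \<beta> * m"
    by (simp only: mult.commute)
  have edge: "j1 * n + \<beta> * 0 = j1 * n" "j1 * i1 + \<beta> * j1 = j1 * n"
    unfolding \<beta>(2)[symmetric] by (simp_all add: algebra_simps)
  \<comment> \<open>Nonzero constant coefficient and positive degree: the edge form has a nonzero
    root.\<close>
  have c0: "coeff (ini_poly j1 \<beta> (j1 * n)) 0 \<noteq> 0"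
    using coeff_ini_poly[OF 1(3), of \<beta> n 0] row(2) by simp
  have c1: "coeff (ini_poly j1 \<beta> (j1 * n)) j1 \<noteq> 0"
    using coeff_ini_poly[OF 1(3), of \<beta> i1 j1] 1(1) unfolding edge by simp
  have "degree (ini_poly j1 \<beta> (j1 * n)) \<noteq> 0"
    using le_degree[OF c1] 1(3) by simp
  then have "\<not> constant (poly (ini_poly j1 \<beta> (j1 * n)))"
    by (simp add: constant_degree)
  then obtain t where t: "poly (ini_poly j1 \<beta> (j1 * n)) t = 0"
    using fundamental_theorem_of_algebra by blast
  have t0: "t \<noteq> 0"
    using t c0 by (auto simp: poly_0_coeff_0)
  have t1: "ini j1 \<beta> (j1 * n) 1 t = 0"
    using t by (simp add: ini_poly_def poly_ini)
  have "ini j1 \<beta> (j1 * n) 0 1 \<noteq> 0"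
    by (rule ini_0_1_nonzero[OF loc 1(3) \<beta>(1) W row(2) edge(1) t0 t1])
  \<comment> \<open>A pure power of \<open>y\<close> on this line would have height below
    \<open>m\<close>, where the column of coefficients is zero.\<close>
  then obtain q where q: "q \<in> triangle d"
    "(if j1 * fst q + \<beta> * snd q = j1 * n then cf F (fst q) (snd q) * 0 ^ fst q * 1 ^ snd q else 0) \<noteq> 0"
    unfolding ini_def by (rule sum.not_neutral_contains_not_neutral)
  then have "fst q = 0" "\<beta> * snd q = j1 * n" "cf F 0 (snd q) \<noteq> 0"
    by (auto simp: power_0_left split: if_splits)
  moreover from this(3) have "m \<le> snd q"
    using col(1)[of "snd q"] by (meson not_le)
  ultimately show False
    using steep mult_le_mono2[of m "snd q" \<beta>] by simp
qed

lemma single_root_power: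
  fixes G :: "complex poly"
  assumes "degree G > 0" "\<And>s t. poly G s = 0 \<Longrightarrow> poly G t = 0 \<Longrightarrow> s = t"
  obtains r where "G = Polynomial.smult (lead_coeff G) ([:- r, 1:] ^ degree G)"
proof -
  have "\<not> constant (poly G)"
    using assms(1) by (simp add: constant_degree)
  then obtain r where "poly G r = 0"
    using fundamental_theorem_of_algebra by blast
  then have "{z. poly G z = 0} = {r}"
    using assms(2) by auto
  then have G: "G = Polynomial.smult (lead_coeff G) ([:- r, 1:] ^ order r G)"
    using complex_poly_decompose[of G] by simp
  have "lead_coeff G \<noteq> 0"
    using assms(1) by auto
  then have "degree (Polynomial.smult (lead_coeff G) ([:- r, 1:] ^ order r G)) = order r G"
    by (simp add: degree_linear_power)
  then have "degree G = order r G"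
    using G by simp
  then show thesis
    using that[of r] G by simp
qed

text \<open>The form on the edge is a constant times the \<open>c\<close>-th power of
  \<open>X - r\<close>. Eliminating \<open>r\<close> between its \<open>k\<close>-th and its first
  coefficient gives this relation, homogeneous of degree \<open>k\<close> in the coefficients of
  \<open>F\<close>.\<close>

lemma newton_edge:
  assumes loc: "local_in S" and c: "c > 0" "m = m' * c" "n = n' * c" "coprime m' n'" "m > 0" "n > 0"
    and row: "\<And>i. i < n \<Longrightarrow> cf F i 0 = 0" "cf F n 0 \<noteq> 0"
    and col: "\<And>j. j < m \<Longrightarrow> cf F 0 j = 0" "cf F 0 m \<noteq> 0"
    and k: "0 < k" "k \<le> c"
  shows "cf F (n' * k) (m' * (c - k)) * cf F 0 m ^ (k - 1) =
    of_nat (c choose k) / of_nat c ^ k * cf F n' (m' * (c - 1)) ^ k"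
proof -
  define W where "W = m' * n"
  define e where "e k = cf F (n' * k) (m' * (c - k))" for k
  have m': "m' > 0" and n': "n' > 0"
    using c by auto
  have W: "W \<le> m' * i + n' * j" if "cf F i j \<noteq> 0" for i j
  proof -
    have "c * (m' * n) \<le> c * (m' * i + n' * j)"
      using newton_lower[OF loc c(5,6) row col that] by (simp add: c(2,3) algebra_simps)
    then show ?thesis
      using c(1) by (simp add: W_def)
  qed
  have edge: "m' * n + n' * 0 = W"
    by (simp add: W_def)
  have wk: "m' * (n' * k) + n' * (m' * (c - k)) = W" if "k \<le> c" for k
  proof -
    have "m' * (n' * k) + n' * (m' * (c - k)) = m' * n' * (k + (c - k))"
      by (simp only: distrib_left mult_ac)
    then show ?thesis
      using that by (simp add: W_def c(3) mult_ac)
  qed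
  \<comment> \<open>The lattice points of the edge make the initial form at \<open>x = 1\<close> a
    polynomial \<open>G\<close> in \<open>t ^ m'\<close>. These powers are what
    \<open>roots_equal\<close> compares, so \<open>G\<close> has a single root.\<close>
  define G where "G = (\<Sum>k\<le>c. monom (e k) (c - k))"
  have coeffG: "coeff G l = (if l \<le> c then e (c - l) else 0)" for l
  proof -
    have "coeff G l = (\<Sum>k\<le>c. if c - k = l then e k else 0)"
      by (simp add: G_def coeff_sum)
    also have "\<dots> = (\<Sum>k\<le>c. if k = c - l \<and> l \<le> c then e k else 0)"
      by (intro sum.cong) auto
    finally show ?thesis
      by (auto simp: if_distrib cong: if_cong)
  qed
  have e0: "e 0 = cf F 0 m" "e c = cf F n 0"
    by (simp_all add: e_def c(2,3))
  have degG: "degree G = c"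
    by (intro antisym degree_le le_degree) (auto simp: coeffG e0 col(2))
  have ini_G: "ini m' n' W 1 t = poly G (t ^ m')" for t
  proof -
    define g where "g p = (if m' * fst p + n' * snd p = W then cf F (fst p) (snd p) * t ^ snd p else 0)" for p
    let ?h = "\<lambda>k. (n' * k, m' * (c - k))"
    have inj: "inj_on ?h {..c}"
      using n' by (auto simp: inj_on_def)
    have "ini m' n' W 1 t = sum g (triangle d)"
      by (simp add: ini_def g_def cong: if_cong)
    also have "\<dots> = sum g (triangle d \<union> ?h ` {..c})"
    proof (rule sum.mono_neutral_left)
      show "\<forall>p\<in>(triangle d \<union> ?h ` {..c}) - triangle d. g p = 0"
        using cf_eq_0[OF hom_F] by (auto simp: g_def triangle_def not_le)
    qed auto
    also have "\<dots> = sum g (?h ` {..c})"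
    proof (rule sum.mono_neutral_right)
      show "\<forall>p\<in>(triangle d \<union> ?h ` {..c}) - ?h ` {..c}. g p = 0"
      proof
        fix p assume p: "p \<in> (triangle d \<union> ?h ` {..c}) - ?h ` {..c}"
        show "g p = 0"
        proof (rule ccontr)
          assume "g p \<noteq> 0"
          then have w: "m' * fst p + n' * snd p = m' * n' * c"
            by (auto simp: g_def W_def c(3) mult.assoc split: if_splits)
          then have "n' dvd m' * fst p"
            by (metis dvd_add_left_iff dvd_triv_left dvd_mult2 dvd_triv_right)
          then have "n' dvd fst p"
            using c(4) by (simp add: coprime_commute coprime_dvd_mult_right_iff)
          then obtain k where k: "fst p = n' * k"
            by blast
          have "n' * (m' * k + snd p) = n' * (m' * c)"
            using w by (simp add: k algebra_simps)
          then have k2: "m' * k + snd p = m' * c"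
            using n' by simp
          then have "m' * k \<le> m' * c"
            by linarith
          then have "k \<le> c"
            using m' by simp
          moreover have "snd p = m' * (c - k)"
            using k2 by (simp add: diff_mult_distrib2)
          ultimately have "p \<in> ?h ` {..c}"
            using k by (intro image_eqI[of _ _ k]) (auto simp: prod_eq_iff)
          then show False
            using p by blast
        qed
      qed
    qed auto
    also have "\<dots> = (\<Sum>k\<le>c. g (?h k))"
      using inj by (simp add: sum.reindex)
    also have "\<dots> = poly G (t ^ m')"
      by (simp add: G_def g_def wk e_def poly_sum poly_monom power_mult)
    finally show ?thesis .
  qed
  have roots: "s = t" if st: "poly G s = 0" "poly G t = 0" for s t
  proof -
    have nz: "u \<noteq> 0" if "poly G u = 0" for u
      using that row(2) coeffG[of 0] e0 by (auto simp: poly_0_coeff_0)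
    obtain s1 where s1: "s1 ^ m' = s"
      using complex_root_ex[OF m', of s] by (elim exE)
    obtain t1 where t1: "t1 ^ m' = t"
      using complex_root_ex[OF m', of t] by (elim exE)
    have "s1 \<noteq> 0"
      using nz[OF st(1)] s1 m' by (auto simp: power_0_left)
    moreover have "ini m' n' W 1 s1 = 0" "ini m' n' W 1 t1 = 0"
      using st by (simp_all add: ini_G s1 t1)
    ultimately have "s1 ^ m' = t1 ^ m'"
      by (intro roots_equal[OF loc m' n' W row(2) edge])
    then show ?thesis
      by (simp add: s1 t1)
  qed
  obtain r where r: "G = Polynomial.smult (lead_coeff G) ([:- r, 1:] ^ degree G)"
    by (rule single_root_power[OF _ roots]) (use degG c(1) in auto)
  have lc: "lead_coeff G = e 0"
    by (simp add: degG coeffG)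
  have ek: "e k = e 0 * (of_nat (c choose k) * (- r) ^ k)" if "k \<le> c" for k
  proof -
    have "e k = coeff G (c - k)"
      using that by (simp add: coeffG)
    also have "\<dots> = e 0 * coeff ([:- r, 1:] ^ c) (c - k)"
      using r by (metis coeff_smult degG lc)
    also have "coeff ([:- r, 1:] ^ c) (c - k) = of_nat (c choose k) * (- r) ^ k"
      using that by (simp add: coeff_linear_poly_power binomial_symmetric[symmetric])
    finally show ?thesis .
  qed
  have e1: "e 1 = e 0 * (of_nat c * (- r))"
    using ek[of 1] c(1) by simp
  have pw: "e 0 ^ k = e 0 * e 0 ^ (k - 1)"
    using k(1) by (subst power_eq_if) simp
  have "e 1 ^ k = of_nat c ^ k * (e 0 ^ k * (- r) ^ k)"
    unfolding e1 power_mult_distrib by (simp only: mult_ac)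
  then have "of_nat (c choose k) / of_nat c ^ k * e 1 ^ k = of_nat (c choose k) * (e 0 ^ k * (- r) ^ k)"
    using c(1) by simp
  also have "\<dots> = e k * e 0 ^ (k - 1)"
    unfolding ek[OF k(2)] pw by (simp only: mult_ac)
  finally show ?thesis
    unfolding e0(1) by (simp only: e_def mult_1_right)
qed

end

section \<open>Branches along a Newton edge without interior lattice points\<close>

context plane_curve
begin

lemma ev_decomp: "ev p - const (coeff (coeff p 0) 0) \<in> mB"
proof (induction p rule: biv_induct)
  case (add p q)
  have "ev (p + q) - const (coeff (coeff (p + q) 0) 0) =
      (ev p - const (coeff (coeff p 0) 0)) + (ev q - const (coeff (coeff q 0) 0))"
    by (simp add: hom_add[OF is_hom_ev] hom_add[OF is_hom_const])
  then show ?case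
    using mB_add[OF add] by simp
next
  case (monom c i j)
  have B: "const c * (x ^ k * y ^ l) \<in> B" for k l
    by (intro rc_mult[OF ring_B] rc_power[OF ring_B] const_B xy_B)
  consider "i = 0" "j = 0" | k where "i = Suc k" | k where "i = 0" "j = Suc k"
    by (cases i; cases j) auto
  then show ?case
  proof cases
    case 1
    then show ?thesis
      by (simp add: ev_monom mB_0)
  next
    case 2
    have "x * (const c * (x ^ k * y ^ j)) \<in> mB"
      by (rule mB_mult[OF xy_mB(1) B])
    moreover have "coeff (coeff (monom (monom c i) j) 0) 0 = 0"
      using 2 by simp
    ultimately show ?thesis
      by (simp add: ev_monom hom_0[OF is_hom_const] 2 mult_ac)
  next
    case 3
    have "y * (const c * (x ^ i * y ^ k)) \<in> mB"
      by (rule mB_mult[OF xy_mB(2) B])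
    moreover have "coeff (coeff (monom (monom c i) j) 0) 0 = 0"
      using 3 by simp
    ultimately show ?thesis
      by (simp add: ev_monom hom_0[OF is_hom_const] 3 mult_ac)
  qed
qed

lemma unit_ev: "coeff (coeff p 0) 0 \<noteq> 0 \<Longrightarrow> unit_in S (ev p)"
  using unit_B'_imp_S[OF unit_B'[OF _ ev_decomp I_0, of "coeff (coeff p 0) 0" p]] by simp

definition yaxis :: "complex poly poly \<Rightarrow> complex poly"
  where "yaxis = pev (\<lambda>q. [:poly q 0:]) [:0, 1:]"

lemma is_hom_yaxis: "is_hom yaxis"
  unfolding yaxis_def by (intro is_hom_pev is_hom_comp[OF is_hom_pCons is_hom_poly])

lemma coeff_yaxis: "coeff (yaxis p) j = coeff (coeff p j) 0"
proof (induction p rule: biv_induct)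
  case (monom c i k)
  have "yaxis (monom (monom c i) k) = [:poly (monom c i) 0:] * [:0, 1:] ^ k"
    unfolding yaxis_def by (rule pev_monom[OF is_hom_comp[OF is_hom_pCons is_hom_poly]])
  then show ?case
    by (simp add: poly_0_coeff_0 X_power coeff_monom_mult)
qed (simp add: hom_add[OF is_hom_yaxis])

text \<open>On \<open>x = 0\<close> each of the \<open>m\<close> conjugate factors starts with a
  nonzero multiple of \<open>y ^ m\<close>.\<close>

lemma y_norm_yaxis:
  assumes col: "\<And>j. j < m \<Longrightarrow> cf F 0 j = 0" "cf F 0 m \<noteq> 0"
  shows "coeff (coeff (y_norm m (aff F)) (m * m)) 0 \<noteq> 0"
proof -
  have "\<exists>g. yaxis (scale_y c (aff F)) = monom 1 m * g \<and> coeff g 0 \<noteq> 0" if "c \<noteq> 0" for c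
  proof -
    have co: "coeff (yaxis (scale_y c (aff F))) j = c ^ j * cf F 0 j" for j
      by (simp add: coeff_yaxis coeff_scale_y cf_def)
    have "monom 1 m dvd yaxis (scale_y c (aff F))"
      unfolding monom_1_dvd_iff' by (simp add: co col)
    then obtain g where g: "yaxis (scale_y c (aff F)) = monom 1 m * g"
      by (elim dvdE)
    have "coeff g 0 = c ^ m * cf F 0 m"
      using co[of m] by (simp add: g coeff_monom_mult)
    then show ?thesis
      using g that col(2) by auto
  qed
  then have "\<forall>k. \<exists>g. yaxis (scale_y (exp (2 * of_real pi * \<i> * (of_nat k / of_nat m))) (aff F)) =
      monom 1 m * g \<and> coeff g 0 \<noteq> 0"
    by auto
  then obtain g where g: "\<And>k. yaxis (scale_y (exp (2 * of_real pi * \<i> * (of_nat k / of_nat m))) (aff F)) =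
      monom 1 m * g k" "\<And>k. coeff (g k) 0 \<noteq> 0"
    by metis
  have N: "yaxis (y_norm m (aff F)) = monom 1 (m * m) * (\<Prod>k<m. g k)"
    unfolding y_norm_def hom_prod[OF is_hom_yaxis] g prod.distrib
    by (simp add: monom_power)
  have "coeff (\<Prod>k<m. g k) 0 = (\<Prod>k<m. coeff (g k) 0)"
    by (simp only: poly_0_coeff_0[symmetric] poly_prod)
  also have "\<dots> \<noteq> 0"
    using g(2) by simp
  finally show ?thesis
    unfolding coeff_yaxis[symmetric] N by (simp add: coeff_monom_mult)
qed

text \<open>This serves the converse, where locality is the goal. After division of the norm by
  \<open>x ^ (n * m)\<close>, all terms from \<open>y ^ (m * m)\<close> on are gathered into the
  coefficient of \<open>z ^ m\<close>. The pure term \<open>y ^ (m * m)\<close> makes it a unit, so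
  the equation becomes monic of degree \<open>m\<close>, as in Weierstrass preparation.\<close>

lemma edge_quotient_integral:
  assumes mn: "m > 0" "n > 0" and W: "\<And>i j. cf F i j \<noteq> 0 \<Longrightarrow> m * n \<le> m * i + n * j" and m0: "cf F 0 m \<noteq> 0"
  shows "y ^ m / x ^ n \<in> S"
proof -
  define Q where "Q = y_norm m (aff F)"
  define q where "q i j = coeff (coeff Q j) i" for i j
  define z where "z = y ^ m / x ^ n"
  have col: "cf F 0 j = 0" if "j < m" for j
    using W[of 0 j] that mn(2) by (cases "cf F 0 j = 0") (auto simp: mult.commute)
  have nz: "q 0 (m * m) \<noteq> 0"
    using y_norm_yaxis[OF col m0] by (simp add: q_def Q_def)
  have q_dvd: "q i j = 0" if "\<not> m dvd j" for i j
    using coeff_y_norm[OF mn(1) that] by (simp add: q_def Q_def)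
  have W2: "m * n \<le> i + n * j" if "q i (m * j) \<noteq> 0" for i j
  proof -
    have "m * (m * n) \<le> m * i + n * (m * j)"
      using y_norm_initial(1)[OF mn(1), of "aff F" "m * n" n m 0 "m * j" i] W m0 that
      unfolding cf_def q_def Q_def by (simp add: mult.commute)
    then have "m * (m * n) \<le> m * (i + n * j)"
      by (simp add: algebra_simps)
    then show ?thesis
      using mn by simp
  qed
  define N where "N = degree Q"
  define M where "M = Max ((\<lambda>j. degree (coeff Q j)) ` {..m * N})"
  have M: "degree (coeff Q j) \<le> M" if "j \<le> m * N" for j
    unfolding M_def using that by (intro Max_ge) auto
  have Qsum: "Q = (\<Sum>j\<le>m * N. \<Sum>i\<le>M. monom (monom (q i j) i) j)"
  proof -
    have "Q = (\<Sum>j\<le>m * N. monom (coeff Q j) j)"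
      by (rule poly_as_sum_of_monoms'[symmetric]) (use mn in \<open>simp add: N_def\<close>)
    also have "\<dots> = (\<Sum>j\<le>m * N. monom (\<Sum>i\<le>M. monom (q i j) i) j)"
      unfolding q_def by (intro sum.cong refl) (simp add: poly_as_sum_of_monoms' M)
    finally show ?thesis
      by (simp add: monom_hom.hom_sum)
  qed
  have "coeff Q (m * m) \<noteq> 0"
    using nz by (auto simp: q_def)
  then have "m * m \<le> N"
    unfolding N_def by (rule le_degree)
  moreover have "m * 1 \<le> m * m"
    using mn by (intro mult_le_mono2) simp
  ultimately have mN: "m \<le> N"
    by (simp only: mult_1_right order_trans)
  \<comment> \<open>\<open>r j\<close> is the coefficient of \<open>y ^ (m * j)\<close> as a
    polynomial in \<open>x\<close>. For \<open>j < m\<close>, \<open>r'\<close> is what remains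
    after removing the power of \<open>x\<close> that the Newton edge guarantees.\<close>
  define r where "r j = (\<Sum>i\<le>M. const (q i (m * j)) * x ^ i)" for j
  define r' where "r' j = (\<Sum>i\<le>M. const (q i (m * j)) * x ^ (i - n * (m - j)))" for j
  define P where "P = (\<Sum>j\<in>{m..N}. \<Sum>i\<le>M. monom (monom (q i (m * j)) i) (m * (j - m)))"
  have evP: "ev P = (\<Sum>j\<in>{m..N}. r j * y ^ (m * (j - m)))"
    by (simp add: P_def hom_sum[OF is_hom_ev] ev_monom r_def sum_distrib_right mult.assoc)
  \<comment> \<open>Only the term with \<open>j = m\<close> and \<open>i = 0\<close> is free of both
    coordinates.\<close>
  have "coeff (coeff P 0) 0 = (\<Sum>j\<in>{m..N}. \<Sum>i\<le>M. if j = m \<and> i = 0 then q 0 (m * m) else 0)"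
    unfolding P_def coeff_sum using mn by (intro sum.cong) auto
  also have "\<dots> = (\<Sum>j\<in>{m..N}. if j = m then q 0 (m * m) else 0)"
    by (intro sum.cong) (auto simp: if_distrib cong: if_cong)
  also have "\<dots> = q 0 (m * m)"
    using mN by simp
  finally have uP: "unit_in S (ev P)"
    using nz by (intro unit_ev) simp
  have r_r': "r j = x ^ (n * (m - j)) * r' j" if "j < m" for j
  proof -
    have st: "const (q i (m * j)) * x ^ i = x ^ (n * (m - j)) * (const (q i (m * j)) * x ^ (i - n * (m - j)))" for i
    proof (cases "q i (m * j) = 0")
      case False
      then have "n * (m - j) \<le> i"
        using W2[OF False] that by (simp add: diff_mult_distrib2 mult.commute)
      then have "x ^ i = x ^ (n * (m - j)) * x ^ (i - n * (m - j))"
        by (simp flip: power_add)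
      then show ?thesis
        by (simp add: mult.left_commute)
    qed (simp add: hom_0[OF is_hom_const])
    show ?thesis
      unfolding r_def r'_def sum_distrib_left by (intro sum.cong refl st)
  qed
  have zx: "y ^ (m * j) = x ^ (n * j) * z ^ j" for j
    using xy_nz by (simp add: z_def power_divide power_mult)
  have low: "r j * y ^ (m * j) = x ^ (n * m) * (r' j * z ^ j)" if "j < m" for j
  proof -
    have "x ^ (n * (m - j)) * x ^ (n * j) = x ^ (n * m)"
      using that by (simp flip: power_add distrib_left)
    then show ?thesis
      unfolding r_r'[OF that] zx by (simp only: mult_ac)
  qed
  have high: "r j * y ^ (m * j) = x ^ (n * m) * (r j * y ^ (m * (j - m)) * z ^ m)" if "m \<le> j" for j
  proof -
    have "y ^ (m * j) = y ^ (m * (j - m)) * y ^ (m * m)"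
      using that by (simp flip: power_add distrib_left)
    then show ?thesis
      unfolding zx[of m] by (simp only: mult_ac)
  qed
  have "ev Q = (\<Sum>j\<le>m * N. \<Sum>i\<le>M. const (q i j) * (x ^ i * y ^ j))"
    by (subst Qsum) (simp add: hom_sum[OF is_hom_ev] ev_monom)
  also have "\<dots> = (\<Sum>j\<in>(\<lambda>j. m * j) ` {..N}. \<Sum>i\<le>M. const (q i j) * (x ^ i * y ^ j))"
  proof (rule sum.mono_neutral_right)
    show "\<forall>j\<in>{..m * N} - (\<lambda>j. m * j) ` {..N}. (\<Sum>i\<le>M. const (q i j) * (x ^ i * y ^ j)) = 0"
    proof
      fix j assume j: "j \<in> {..m * N} - (\<lambda>j. m * j) ` {..N}"
      have "\<not> m dvd j"
      proof
        assume "m dvd j"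
        then obtain k where "j = m * k"
          by blast
        then show False
          using j mn by auto
      qed
      then show "(\<Sum>i\<le>M. const (q i j) * (x ^ i * y ^ j)) = 0"
        using q_dvd by (simp add: hom_0[OF is_hom_const])
    qed
  qed auto
  also have "\<dots> = (\<Sum>j\<le>N. r j * y ^ (m * j))"
    using mn by (subst sum.reindex) (auto simp: inj_on_def r_def sum_distrib_right mult.assoc)
  also have "{..N} = {..<m} \<union> {m..N}"
    using mN by auto
  also have "(\<Sum>j\<in>{..<m} \<union> {m..N}. r j * y ^ (m * j)) =
      (\<Sum>j<m. r j * y ^ (m * j)) + (\<Sum>j\<in>{m..N}. r j * y ^ (m * j))"
    by (intro sum.union_disjoint) auto
  also have "(\<Sum>j<m. r j * y ^ (m * j)) = x ^ (n * m) * (\<Sum>j<m. r' j * z ^ j)"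
    unfolding sum_distrib_left by (intro sum.cong) (auto intro: low)
  also have "(\<Sum>j\<in>{m..N}. r j * y ^ (m * j)) = x ^ (n * m) * (ev P * z ^ m)"
    unfolding sum_distrib_left sum_distrib_right evP by (intro sum.cong refl high) simp
  finally have evQ: "ev Q = x ^ (n * m) * ((\<Sum>j<m. r' j * z ^ j) + ev P * z ^ m)"
    by (simp only: distrib_left)
  define e where "e = ev Q * inverse x ^ (n * m)"
  have eI: "e \<in> I"
    unfolding e_def Q_def by (intro I_mult ev_y_norm mn rc_power[OF ring_O] xy_inverse)
  have e: "(\<Sum>j<m. r' j * z ^ j) + ev P * z ^ m = e"
    using xy_nz by (simp add: e_def evQ power_inverse)
  have uP': "inverse (ev P) \<in> S" "ev P \<noteq> 0"
    using uP by (auto simp: unit_in_def)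
  have eS: "e \<in> S"
    using eI I_subset_B' B'_subset_S by blast
  have r'S: "r' j \<in> S" for j
  proof -
    have "r' j \<in> B"
      unfolding r'_def by (intro rc_sum[OF ring_B] rc_mult[OF ring_B] rc_power[OF ring_B] const_B xy_B)
    then have "r' j \<in> B'"
      by (rule subsetD[OF B_subset_B'])
    then show ?thesis
      by (rule subsetD[OF B'_subset_S])
  qed
  let ?a = "\<lambda>j. inverse (ev P) * (r' j - (if j = 0 then e else 0))"
  have "integral_over S z"
  proof (rule integral_overI_sum[OF ring_S, of m ?a])
    show "?a j \<in> S" for j
      using rc_mult[OF ring_S uP'(1) rc_diff[OF ring_S r'S[of j]], of "if j = 0 then e else 0"] eS rc_0[OF ring_S] by simp
    have "(\<Sum>j<m. (if j = 0 then e else 0) * z ^ j) = (\<Sum>j<m. if j = 0 then e else 0)"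
      by (intro sum.cong) auto
    also have "\<dots> = e"
      using mn by simp
    finally have *: "(\<Sum>j<m. (if j = 0 then e else 0) * z ^ j) = e" .
    have "(\<Sum>j<m. ?a j * z ^ j) = inverse (ev P) * ((\<Sum>j<m. r' j * z ^ j) - (\<Sum>j<m. (if j = 0 then e else 0) * z ^ j))"
      by (simp only: sum_distrib_left sum_subtractf[symmetric] left_diff_distrib mult.assoc)
    also have "(\<Sum>j<m. r' j * z ^ j) = e - ev P * z ^ m"
      using e by (simp add: algebra_simps)
    finally show "z ^ m + (\<Sum>j<m. ?a j * z ^ j) = 0"
      using uP'(2) unfolding * by simp
  qed
  moreover have "z \<in> Og"
    unfolding z_def divide_inverse power_inverse[symmetric]
    by (intro rc_mult[OF ring_O] rc_power[OF ring_O] xy_O xy_inverse)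
  ultimately show ?thesis
    using S_closed by (simp add: z_def)
qed

subsection \<open>Algebraicity over the rational functions in \<open>x\<close>\<close>

definition xp where "xp = pev const x"

lemma is_hom_xp: "is_hom xp"
  unfolding xp_def by (rule is_hom_pev[OF is_hom_const])

lemma ev_monom_xp: "ev (monom p j) = xp p * y ^ j"
  unfolding ev_def xp_def by (rule pev_monom[OF is_hom_pev[OF is_hom_const]])

lemma xp_ev: "xp p = ev [:p:]"
  using ev_monom_xp[of p 0] by (simp add: monom_0)

lemma xp_B: "xp p \<in> B"
  unfolding xp_ev by (rule ev_B)

lemma xp_O: "xp p \<in> Og"
  using xp_B B_subset_O by blast

lemma xp_monom: "xp (monom c i) = const c * x ^ i"
  unfolding xp_def by (rule pev_monom[OF is_hom_const])

text \<open>\<open>x - r\<close> is represented by a linear form, which \<open>F\<close> does not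
  divide.\<close>

lemma xp_linear: "xp [:- r, 1:] \<notin> I"
proof
  assume I: "xp [:- r, 1:] \<in> I"
  define c where "c i = a' i - r * v' i" for i
  have c: "lin c = L1 - Const r * L0"
    by (simp add: lin_def c_def hom_simps[OF is_hom_Const] sum_subtractf sum_distrib_left algebra_simps)
  have "[:- r, 1:] = monom 1 1 - monom r 0"
    by (simp add: monom_altdef)
  then have "xp [:- r, 1:] = x - const r"
    by (simp only: hom_diff[OF is_hom_xp] xp_monom) (simp add: hom_1[OF is_hom_const])
  also have "\<dots> = fr (lin c) / fr L0"
    using L0_nz by (simp add: c x_def const_def hom_diff[OF is_hom_fr] hom_mult[OF is_hom_fr] diff_divide_distrib)
  finally have "fr (lin c) / fr L0 \<in> I"
    using I by simp
  then have "F dvd lin c"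
    using not_dvd_L by (intro I_frac) (auto simp: dens_gen_def)
  moreover have "pairing c a = 1"
    using dual by (simp add: pairing_def c_def left_diff_distrib sum_subtractf mult.assoc sum_distrib_left[symmetric])
  ultimately show False
    using not_dvd_lin[of c a] by simp
qed

text \<open>Over the complex numbers the polynomial splits into linear factors, and \<open>I\<close>
  is prime. So \<open>x\<close> is transcendental in the function field.\<close>

lemma xp_I: "p \<noteq> 0 \<Longrightarrow> xp p \<notin> I"
proof (induction "degree p" arbitrary: p)
  case 0
  then obtain c where p: "p = [:c:]"
    by (metis degree_eq_zeroE)
  have "xp p = const c"
    using xp_monom[of c 0] by (simp add: p monom_0)
  moreover have "c \<noteq> 0"
    using 0 p by simp
  ultimately have u: "unit_in S (xp p)"
    using unit_const by simp
  show ?case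
  proof
    assume "xp p \<in> I"
    then have "xp p * inverse (xp p) \<in> I"
      using u S_subset_O by (intro I_mult) (auto simp: unit_in_def)
    then show False
      using u I_1 by (simp add: unit_in_def)
  qed
next
  case (Suc k)
  have "\<not> constant (poly p)"
    using Suc(2) by (simp add: constant_degree)
  then obtain r where "poly p r = 0"
    using fundamental_theorem_of_algebra by blast
  then obtain q where q: "p = [:- r, 1:] * q"
    by (auto simp: poly_eq_0_iff_dvd)
  have "q \<noteq> 0"
    using Suc(3) q by auto
  then have "degree p = 1 + degree q"
    unfolding q by (subst degree_mult_eq) auto
  then have "xp q \<notin> I"
    using Suc(1)[of q] Suc(2) \<open>q \<noteq> 0\<close> by simp
  show ?case
  proof
    assume "xp p \<in> I"
    then have "xp [:- r, 1:] * xp q \<in> I"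
      by (simp only: q hom_mult[OF is_hom_xp])
    then show False
      using I_prime[OF xp_O xp_O] xp_linear \<open>xp q \<notin> I\<close> by blast
  qed
qed

text \<open>The preimage in \<open>Og\<close> of the field of rational functions in
  \<open>x\<close>.\<close>

definition Kx where "Kx = {g \<in> Og. \<exists>p q. q \<noteq> 0 \<and> g * xp q - xp p \<in> I}"

lemma KxI: "g \<in> Og \<Longrightarrow> q \<noteq> 0 \<Longrightarrow> g * xp q - xp p \<in> I \<Longrightarrow> g \<in> Kx"
  by (auto simp: Kx_def)

lemma ring_Kx: "ring_closed Kx"
proof (rule ring_closedI)
  show "1 \<in> Kx"
    by (rule KxI[of _ 1 1]) (simp_all add: rc_1[OF ring_O] I_0)
next
  fix g h assume "g \<in> Kx" "h \<in> Kx"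
  then obtain p q r s where *: "g \<in> Og" "h \<in> Og" "q \<noteq> 0" "s \<noteq> 0" "g * xp q - xp p \<in> I" "h * xp s - xp r \<in> I"
    unfolding Kx_def by blast
  have "(g * xp q - xp p) * xp s - (h * xp s - xp r) * xp q \<in> I"
    by (intro I_diff I_mult * xp_O)
  moreover have "(g - h) * xp (q * s) - xp (p * s - r * q) = (g * xp q - xp p) * xp s - (h * xp s - xp r) * xp q"
    by (simp add: hom_simps[OF is_hom_xp] algebra_simps)
  ultimately show "g - h \<in> Kx"
    using * by (intro KxI[of _ "q * s" "p * s - r * q"]) (auto intro: rc_diff[OF ring_O])
  have "(g * xp q - xp p) * (h * xp s) + (h * xp s - xp r) * xp p \<in> I"
    by (intro I_add I_mult * xp_O rc_mult[OF ring_O])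
  moreover have "(g * h) * xp (q * s) - xp (p * r) = (g * xp q - xp p) * (h * xp s) + (h * xp s - xp r) * xp p"
    by (simp add: hom_simps[OF is_hom_xp] algebra_simps)
  ultimately show "g * h \<in> Kx"
    using * by (intro KxI[of _ "q * s" "p * r"]) (auto intro: rc_mult[OF ring_O])
qed

lemma I_Kx: "g \<in> I \<Longrightarrow> g \<in> Kx"
  using I_subset_O by (intro KxI[of _ 1 0]) (auto simp: hom_simps[OF is_hom_xp])

lemma xp_Kx: "xp p \<in> Kx"
  using I_0 xp_O by (intro KxI[of _ 1 p]) (auto simp: hom_simps[OF is_hom_xp])

lemma inverse_xp_Kx: "p \<noteq> 0 \<Longrightarrow> inverse (xp p) \<in> Kx"
  using I_0 xp_I[of p] O_inverse[OF xp_O[of p]] by (intro KxI[of _ p 1]) (auto simp: hom_simps[OF is_hom_xp])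

text \<open>The equation of the curve divided by its leading coefficient in \<open>y\<close>; the
  pure power of \<open>y\<close> guarantees positive degree. Its value, an element of
  \<open>I\<close>, is put into the constant coefficient.\<close>

lemma integral_y:
  assumes m0: "cf F 0 m \<noteq> 0" "m > 0"
  shows "integral_over Kx y"
proof -
  define D where "D = degree (aff F)"
  define l where "l = coeff (aff F) D"
  have "coeff (aff F) m \<noteq> 0"
    using m0 by (auto simp: cf_def)
  then have "m \<le> D"
    unfolding D_def by (rule le_degree)
  then have D: "D > 0"
    using m0 by simp
  then have l: "l \<noteq> 0"
    unfolding l_def D_def by auto
  have lx: "xp l \<noteq> 0"
    using xp_I[OF l] I_0 by metis
  define e where "e = ev (aff F) * inverse (xp l)"
  have eK: "e \<in> Kx"
    unfolding e_def by (intro I_Kx I_mult ev_F O_inverse xp_O xp_I l)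
  have "aff F = (\<Sum>j\<le>D. monom (coeff (aff F) j) j)"
    unfolding D_def by (rule poly_as_sum_of_monoms[symmetric])
  then have "ev (aff F) = ev (\<Sum>j\<le>D. monom (coeff (aff F) j) j)"
    by (rule arg_cong)
  also have "\<dots> = (\<Sum>j\<le>D. xp (coeff (aff F) j) * y ^ j)"
    by (simp add: hom_sum[OF is_hom_ev] ev_monom_xp)
  also have "\<dots> = xp l * y ^ D + (\<Sum>j<D. xp (coeff (aff F) j) * y ^ j)"
    by (simp add: l_def lessThan_Suc_atMost[symmetric])
  finally have ev: "ev (aff F) = xp l * y ^ D + (\<Sum>j<D. xp (coeff (aff F) j) * y ^ j)" .
  let ?a = "\<lambda>j. inverse (xp l) * xp (coeff (aff F) j) - (if j = 0 then e else 0)"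
  show ?thesis
  proof (rule integral_overI_sum[OF ring_Kx, of D ?a])
    show "?a j \<in> Kx" for j
      by (intro rc_diff[OF ring_Kx] rc_mult[OF ring_Kx] inverse_xp_Kx l xp_Kx) (simp add: eK rc_0[OF ring_Kx])
    have "(\<Sum>j<D. (if j = 0 then e else 0) * y ^ j) = (\<Sum>j<D. if j = 0 then e else 0)"
      by (intro sum.cong) auto
    also have "\<dots> = e"
      using D by simp
    finally have *: "(\<Sum>j<D. (if j = 0 then e else 0) * y ^ j) = e" .
    have "(\<Sum>j<D. ?a j * y ^ j) = inverse (xp l) * (\<Sum>j<D. xp (coeff (aff F) j) * y ^ j) - (\<Sum>j<D. (if j = 0 then e else 0) * y ^ j)"
      by (simp only: sum_distrib_left sum_subtractf[symmetric] left_diff_distrib mult.assoc)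
    also have "(\<Sum>j<D. xp (coeff (aff F) j) * y ^ j) = ev (aff F) - xp l * y ^ D"
      using ev by (simp add: algebra_simps)
    finally show "y ^ D + (\<Sum>j<D. ?a j * y ^ j) = 0"
      unfolding * using lx by (simp add: e_def right_diff_distrib mult.commute)
  qed
qed

lemma integral_ev:
  assumes m0: "cf F 0 m \<noteq> 0" "m > 0"
  shows "integral_over Kx (ev p)"
proof (induction p rule: biv_induct)
  note ring = integral_over_ring[OF ring_Kx]
  {
    case (add p q)
    then show ?case
      using rc_add[OF ring] by (simp add: hom_add[OF is_hom_ev])
  next
    case (monom c i j)
    have "integral_over Kx (xp (monom c i))"
      by (rule integral_over_mem[OF ring_Kx xp_Kx])
    moreover have "integral_over Kx (y ^ j)"
      using rc_power[OF ring, of y j] integral_y[OF m0] by simp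
    ultimately show ?case
      using rc_mult[OF ring] by (simp add: ev_monom_xp)
  }
qed

text \<open>Take an equation of least degree over the rational functions in \<open>x\<close> and
  clear denominators: modulo \<open>I\<close> its constant coefficient is a multiple of
  \<open>ev p\<close>. This will bound the order of \<open>ev p\<close> in \<open>t\<close>, since
  the order of a polynomial in \<open>x\<close> is known.\<close>

lemma elimination:
  assumes m0: "cf F 0 m \<noteq> 0" "m > 0" and p: "ev p \<notin> I"
  shows "\<exists>w q. w \<in> B \<and> q \<noteq> 0 \<and> ev p * w + xp q \<in> I"
proof -
  define g where "g = ev p"
  have gO: "g \<in> Og"
    using ev_B B_subset_O by (auto simp: g_def)
  define Pr where "Pr N \<longleftrightarrow> (\<exists>u. (\<forall>i. u i \<in> Kx) \<and> g ^ N + (\<Sum>i<N. u i * g ^ i) \<in> I)" for N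
  obtain N0 u0 where "\<forall>i. u0 i \<in> Kx" "g ^ N0 + (\<Sum>i<N0. u0 i * g ^ i) = 0"
    using integral_over_ex[OF integral_ev[OF m0, of p]] unfolding g_def[symmetric] by (elim exE conjE)
  then have "Pr N0"
    unfolding Pr_def using I_0 by (intro exI[of _ u0]) simp
  \<comment> \<open>Minimality keeps the constant coefficient out of \<open>I\<close>: otherwise
    \<open>g\<close> could be cancelled and the degree lowered.\<close>
  define N where "N = (LEAST N. Pr N)"
  have "Pr N"
    unfolding N_def by (rule LeastI[of Pr, OF \<open>Pr N0\<close>])
  then obtain u where u: "\<And>i. u i \<in> Kx" "g ^ N + (\<Sum>i<N. u i * g ^ i) \<in> I"
    unfolding Pr_def by blast
  have uO: "u i \<in> Og" for i
    using u(1)[of i] by (simp add: Kx_def)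
  have "N \<noteq> 0"
    using u(2) I_1 by (intro notI) simp
  then obtain K where K: "N = Suc K"
    by (cases N) auto
  have split: "g ^ N + (\<Sum>i<N. u i * g ^ i) = g * (g ^ K + (\<Sum>i<K. u (Suc i) * g ^ i)) + u 0"
    unfolding K sum.lessThan_Suc_shift by (simp add: sum_distrib_left algebra_simps del: sum.lessThan_Suc)
  have u0: "u 0 \<notin> I"
  proof
    assume "u 0 \<in> I"
    then have "g * (g ^ K + (\<Sum>i<K. u (Suc i) * g ^ i)) \<in> I"
      using I_diff[OF u(2), of "u 0"] by (simp add: split)
    moreover have "g ^ K + (\<Sum>i<K. u (Suc i) * g ^ i) \<in> Og"
      by (intro rc_add[OF ring_O] rc_sum[OF ring_O] rc_mult[OF ring_O] rc_power[OF ring_O] uO gO)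
    ultimately have "g ^ K + (\<Sum>i<K. u (Suc i) * g ^ i) \<in> I"
      using I_prime[OF gO] p by (auto simp: g_def)
    then have "Pr K"
      unfolding Pr_def using u(1) by (intro exI[of _ "\<lambda>i. u (Suc i)"]) simp
    then have "N \<le> K"
      unfolding N_def by (rule Least_le)
    then show False
      by (simp add: K)
  qed
  have "\<forall>i. \<exists>p. snd p \<noteq> 0 \<and> u i * xp (snd p) - xp (fst p) \<in> I"
    using u(1) by (simp add: Kx_def split_paired_Ex)
  from choice[OF this] obtain f where f: "\<forall>i. snd (f i) \<noteq> 0 \<and> u i * xp (snd (f i)) - xp (fst (f i)) \<in> I"
    by (elim exE)
  define r where "r i = fst (f i)" for i
  define s where "s i = snd (f i)" for i
  have rs: "s i \<noteq> 0" "u i * xp (s i) - xp (r i) \<in> I" for i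
    using f by (simp_all add: r_def s_def)
  \<comment> \<open>A common denominator; \<open>E i\<close> is the corresponding numerator of
    \<open>u i\<close>.\<close>
  define D where "D = (\<Prod>i<N. s i)"
  define E where "E i = r i * (\<Prod>l\<in>{..<N} - {i}. s l)" for i
  have DE: "xp D * u i - xp (E i) \<in> I" if "i < N" for i
  proof -
    have "D = s i * (\<Prod>l\<in>{..<N} - {i}. s l)"
      unfolding D_def using that by (intro prod.remove) auto
    then have "xp D * u i - xp (E i) = (u i * xp (s i) - xp (r i)) * xp (\<Prod>l\<in>{..<N} - {i}. s l)"
      by (simp add: E_def hom_mult[OF is_hom_xp] algebra_simps)
    then show ?thesis
      using I_mult[OF rs(2)[of i] xp_O] by simp
  qed
  define w where "w = xp D * g ^ K + (\<Sum>i<K. xp (E (Suc i)) * g ^ i)"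
  have wB: "w \<in> B"
    unfolding w_def g_def
    by (intro rc_add[OF ring_B] rc_sum[OF ring_B] rc_mult[OF ring_B] rc_power[OF ring_B] xp_B ev_B)
  have "g * w + xp (E 0) = xp D * (g * (g ^ K + (\<Sum>i<K. u (Suc i) * g ^ i)) + u 0)
      - ((\<Sum>i<K. (xp D * u (Suc i) - xp (E (Suc i))) * (g * g ^ i)) + (xp D * u 0 - xp (E 0)))"
    by (simp add: w_def sum_subtractf sum_distrib_left algebra_simps)
  also have "\<dots> \<in> I"
  proof (rule I_diff[OF _ I_add])
    show "xp D * (g * (g ^ K + (\<Sum>i<K. u (Suc i) * g ^ i)) + u 0) \<in> I"
      using I_mult[OF u(2) xp_O[of D]] by (simp add: split mult.commute)
    have "(xp D * u (Suc i) - xp (E (Suc i))) * (g * g ^ i) \<in> I" if "i < K" for i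
      using that K by (intro I_mult DE rc_mult[OF ring_O] rc_power[OF ring_O] gO) simp
    then have "\<forall>i\<in>A. (xp D * u (Suc i) - xp (E (Suc i))) * (g * g ^ i) \<in> I \<Longrightarrow>
        (\<Sum>i\<in>A. (xp D * u (Suc i) - xp (E (Suc i))) * (g * g ^ i)) \<in> I" for A
      by (induction A rule: infinite_finite_induct) (auto intro: I_0 I_add)
    then show "(\<Sum>i<K. (xp D * u (Suc i) - xp (E (Suc i))) * (g * g ^ i)) \<in> I"
      using \<open>\<And>i. i < K \<Longrightarrow> (xp D * u (Suc i) - xp (E (Suc i))) * (g * g ^ i) \<in> I\<close> by simp
    show "xp D * u 0 - xp (E 0) \<in> I"
      by (rule DE) (simp add: K)
  qed
  finally have gw: "g * w + xp (E 0) \<in> I" .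
  have "r 0 \<noteq> 0"
  proof
    assume "r 0 = 0"
    then have "u 0 * xp (s 0) \<in> I"
      using rs(2)[of 0] by (simp add: hom_0[OF is_hom_xp])
    then show False
      using I_prime[OF uO xp_O] u0 xp_I[OF rs(1)] by blast
  qed
  moreover have "(\<Prod>l\<in>{..<N} - {0}. s l) \<noteq> 0"
    using rs(1) by simp
  ultimately have "E 0 \<noteq> 0"
    unfolding E_def by (simp only: mult_eq_0_iff simp_thms)
  then show ?thesis
    using wB gw unfolding g_def by blast
qed

end

lemma Bezout_coprime_int:
  fixes m n :: nat
  assumes "coprime m n"
  shows "\<exists>\<alpha> \<beta>. int m * \<alpha> + int n * \<beta> = 1"
  using bezout_int[of "int m" "int n"] assms by (auto simp: mult.commute)

section \<open>A monomial of weight one and its residues, for coprime exponents\<close>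

context plane_curve
begin

context
  fixes m n :: nat
  assumes mn: "m > 0" "n > 0" "coprime m n"
    and W: "\<And>i j. cf F i j \<noteq> 0 \<Longrightarrow> m * n \<le> m * i + n * j"
    and n0: "cf F n 0 \<noteq> 0" and m0: "cf F 0 m \<noteq> 0"
begin

definition z where "z = y ^ m / x ^ n"

text \<open>Both memberships come from \<open>edge_quotient_integral\<close>, the second with
  exchanged coordinates.\<close>

lemma z_S: "z \<in> S" "inverse z \<in> S"
proof -
  show "z \<in> S"
    unfolding z_def by (rule edge_quotient_integral[OF mn(1,2) W m0])
  interpret s: plane_curve v b a v' b' a' F d
    by (rule plane_curve_swap)
  have "s.y ^ n / s.x ^ m \<in> S"
  proof (rule s.edge_quotient_integral[OF mn(2,1)])
    show "n * m \<le> n * j + m * i" if "s.cf F j i \<noteq> 0" for i j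
      using W[of i j] that by (simp add: cf_swap mult.commute add.commute)
    show "s.cf F 0 n \<noteq> 0"
      using n0 by (simp add: cf_swap)
  qed
  moreover have "s.x = y" "s.y = x"
    by (simp_all add: s.x_def s.y_def x_def y_def)
  ultimately show "inverse z \<in> S"
    by (simp add: z_def)
qed

lemma z_nz: "z \<noteq> 0"
  using xy_nz by (simp add: z_def)

definition \<alpha> where "\<alpha> = (SOME \<alpha>. \<exists>\<beta>. int m * \<alpha> + int n * \<beta> = 1)"
definition \<beta> where "\<beta> = (SOME \<beta>. int m * \<alpha> + int n * \<beta> = 1)"

lemma \<alpha>\<beta>: "int m * \<alpha> + int n * \<beta> = 1"
  unfolding \<beta>_def using someI_ex[OF Bezout_coprime_int[OF mn(3)], folded \<alpha>_def] by (rule someI_ex)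

definition mono :: "int \<Rightarrow> int \<Rightarrow> form fract"
  where "mono i j = power_int x i * power_int y j"

definition t where "t = mono \<alpha> \<beta>"

lemma mono_add: "mono (i + k) (j + l) = mono i j * mono k l"
  using xy_nz by (simp add: mono_def power_int_add)

lemma mono_power: "power_int (mono i j) k = mono (i * k) (j * k)"
  by (simp add: mono_def power_int_mult_distrib power_int_mult)

lemma z_mono: "z = mono (- int n) (int m)"
  using xy_nz by (simp add: z_def mono_def power_int_minus divide_inverse mult.commute)

text \<open>By the Bezout relation the exponent vectors of \<open>t\<close> and \<open>z\<close>
  have determinant 1 and form a basis of the lattice of Laurent monomials; \<open>z\<close> has
  weight 0.\<close>

lemma mono_eq: "mono i j = power_int t (int m * i + int n * j) * power_int z (\<alpha> * j - \<beta> * i)"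
proof -
  have "\<alpha> * (int m * i + int n * j) + - int n * (\<alpha> * j - \<beta> * i) = (int m * \<alpha> + int n * \<beta>) * i"
    "\<beta> * (int m * i + int n * j) + int m * (\<alpha> * j - \<beta> * i) = (int m * \<alpha> + int n * \<beta>) * j"
    by (simp_all add: algebra_simps)
  then show ?thesis
    unfolding t_def z_mono mono_power mono_add[symmetric] by (simp add: \<alpha>\<beta>)
qed

lemma t_nz: "t \<noteq> 0"
  using xy_nz by (simp add: t_def mono_def)

lemma power_int_O: "power_int x i \<in> Og" "power_int y i \<in> Og"
  unfolding power_int_def by (auto intro: rc_power[OF ring_O] xy_O xy_inverse)

lemma t_O: "t \<in> Og" "inverse t \<in> Og"
proof -
  have "inverse t = mono (- \<alpha>) (- \<beta>)"
    by (simp add: t_def mono_def power_int_minus)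
  then show "t \<in> Og" "inverse t \<in> Og"
    unfolding t_def mono_def using rc_mult[OF ring_O] power_int_O by simp_all
qed

lemma z_power_int_S: "power_int z k \<in> S"
  unfolding power_int_def by (auto intro: rc_power[OF ring_S] z_S)

lemma x_eq: "x = t ^ m * power_int z (- \<beta>)"
  using mono_eq[of 1 0] by (simp add: mono_def)

lemma y_eq: "y = t ^ n * power_int z \<alpha>"
  using mono_eq[of 0 1] by (simp add: mono_def)

lemma t_power: "t ^ m = x * power_int z \<beta>"
proof -
  have "power_int z (- \<beta>) * power_int z \<beta> = 1"
    using z_nz by (simp add: power_int_minus)
  then show ?thesis
    unfolding x_eq by (simp add: mult.assoc)
qed

lemma xy_S: "x \<in> S" "y \<in> S"
  using xy_B B_subset_B' B'_subset_S by blast+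

text \<open>\<open>t\<close> is a root of a monic polynomial of degree \<open>m\<close> whose only
  lower coefficient is minus \<open>x * power_int z \<beta>\<close>, an element of
  \<open>S\<close>.\<close>

lemma t_S: "t \<in> S"
proof -
  have "t ^ m \<in> S"
    unfolding t_power by (intro rc_mult[OF ring_S] xy_S z_power_int_S)
  moreover have "(\<Sum>i<m. (if i = 0 then - (t ^ m) else 0) * t ^ i) = - (t ^ m)"
  proof -
    have "(\<Sum>i<m. (if i = 0 then - (t ^ m) else 0) * t ^ i) = (\<Sum>i<m. if i = 0 then - (t ^ m) else 0)"
      by (intro sum.cong) auto
    then show ?thesis
      using mn(1) by simp
  qed
  ultimately have "integral_over S t"
    by (intro integral_overI_sum[OF ring_S, of m "\<lambda>i. if i = 0 then - (t ^ m) else 0"])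
      (auto intro: rc_uminus[OF ring_S] rc_0[OF ring_S])
  then show ?thesis
    by (rule S_closed[OF t_O(1)])
qed

text \<open>\<open>t ^ m\<close> is a multiple of \<open>x\<close>. So with
  \<open>r = - (t * s)\<close> the element \<open>1 - r ^ m\<close> is a unit by
  \<open>unit_1_plus\<close>, and \<open>1 - r\<close> divides it.\<close>

lemma unit_1_plus_t:
  assumes s: "s \<in> S"
  shows "unit_in S (1 + t * s)"
proof -
  define r where "r = - (t * s)"
  have rS: "r \<in> S"
    unfolding r_def by (intro rc_uminus[OF ring_S] rc_mult[OF ring_S] t_S s)
  have "(- 1) ^ m * (power_int z \<beta> * s ^ m) \<in> S"
    by (intro rc_mult[OF ring_S] rc_power[OF ring_S] rc_uminus[OF ring_S] rc_1[OF ring_S] z_power_int_S s)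
  then have u: "unit_in S (1 + x * - ((- 1) ^ m * (power_int z \<beta> * s ^ m)))"
    by (intro unit_1_plus xy_mB rc_uminus[OF ring_S])
  have "r ^ m = (- 1) ^ m * (t ^ m * s ^ m)"
    unfolding r_def by (simp add: power_minus[of "t * s"] power_mult_distrib)
  then have "1 + x * - ((- 1) ^ m * (power_int z \<beta> * s ^ m)) = 1 - r ^ m"
    unfolding t_power by (simp add: mult_ac)
  also have "\<dots> = (1 - r) * (\<Sum>i<m. r ^ i)"
    by (rule one_diff_power_eq)
  finally have eq: "unit_in S ((1 - r) * (\<Sum>i<m. r ^ i))"
    using u by simp
  have "(\<Sum>i<m. r ^ i) \<in> S"
    by (intro rc_sum[OF ring_S] rc_power[OF ring_S] rS)
  from unit_in_factor[OF ring_S rc_diff[OF ring_S rc_1[OF ring_S] rS] this eq]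
  show ?thesis
    by (simp add: r_def)
qed

lemma const_S: "const c \<in> S"
  using const_B B_subset_B' B'_subset_S by blast

lemma unit_const_plus_t:
  assumes "c \<noteq> 0" "s \<in> S"
  shows "unit_in S (const c + t * s)"
proof -
  have "unit_in S (1 + t * (const (inverse c) * s))"
    by (intro unit_1_plus_t rc_mult[OF ring_S] const_S assms)
  from unit_in_mult[OF ring_S unit_const[OF assms(1)] this]
  have "unit_in S (const c + (const c * const (inverse c)) * (t * s))"
    by (simp add: distrib_left mult_ac)
  moreover have "const c * const (inverse c) = 1"
    using assms(1) by (simp add: hom_1[OF is_hom_const] flip: hom_mult[OF is_hom_const])
  ultimately show ?thesis
    by simp
qed

lemma I_S: "g \<in> I \<Longrightarrow> g \<in> S"
  using I_subset_B' B'_subset_S by blast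

lemma unit_not_I: "unit_in S u \<Longrightarrow> u \<notin> I"
proof
  assume u: "unit_in S u" "u \<in> I"
  then have "u * inverse u \<in> I"
    using S_subset_O by (intro I_mult) (auto simp: unit_in_def)
  then show False
    using u I_1 by (simp add: unit_in_def)
qed

lemma I_div_t: "g \<in> I \<Longrightarrow> g / t ^ k \<in> I"
  unfolding divide_inverse power_inverse[symmetric] by (intro I_mult rc_power[OF ring_O] t_O)

text \<open>An auxiliary ring inside \<open>S\<close> where residues modulo \<open>t\<close> are
  found by induction on the construction of an element, with remainders again in the ring. By
  \<open>ev_R\<close> it contains every polynomial in \<open>x\<close> and \<open>y\<close>.\<close>

inductive_set Rt where
  const_R: "const c \<in> Rt"
| I_R: "g \<in> I \<Longrightarrow> g \<in> Rt"
| t_R: "t \<in> Rt"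
| z_R: "z \<in> Rt"
| iz_R: "inverse z \<in> Rt"
| add_R: "g \<in> Rt \<Longrightarrow> h \<in> Rt \<Longrightarrow> g + h \<in> Rt"
| mult_R: "g \<in> Rt \<Longrightarrow> h \<in> Rt \<Longrightarrow> g * h \<in> Rt"

lemma R_S: "g \<in> Rt \<Longrightarrow> g \<in> S"
  by (induction rule: Rt.induct)
    (auto intro: const_S I_S t_S z_S rc_add[OF ring_S] rc_mult[OF ring_S])

lemma power_R: "g \<in> Rt \<Longrightarrow> g ^ k \<in> Rt"
  using const_R[of 1] by (induction k) (auto simp: hom_1[OF is_hom_const] intro: mult_R)

lemma power_int_z_R: "power_int z k \<in> Rt"
  unfolding power_int_def by (auto intro: power_R z_R iz_R)

lemma zero_R: "0 \<in> Rt"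
  using I_R[OF I_0] .

lemma sum_R: "(\<And>i. i \<in> A \<Longrightarrow> f i \<in> Rt) \<Longrightarrow> sum f A \<in> Rt"
  by (induction A rule: infinite_finite_induct) (auto intro: add_R zero_R)

lemma ev_R: "ev p \<in> Rt"
proof -
  have "x \<in> Rt" "y \<in> Rt"
    unfolding x_eq y_eq by (intro mult_R power_R t_R power_int_z_R)+
  then show ?thesis
    by (induction p rule: biv_induct) (auto simp: hom_add[OF is_hom_ev] ev_monom intro!: add_R mult_R power_R const_R)
qed

text \<open>The residue of \<open>z\<close>: modulo \<open>t\<close> the two end terms of the edge
  must cancel.\<close>

definition \<zeta> where "\<zeta> = - cf F n 0 / cf F 0 m"

lemma \<zeta>_nz: "\<zeta> \<noteq> 0"
  using n0 m0 by (simp add: \<zeta>_def)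

lemma mono_tR:
  assumes "m * n < m * i + n * j"
  shows "\<exists>r\<in>Rt. x ^ i * y ^ j / x ^ n = t * r"
proof -
  define w where "w = m * i + n * j - m * n"
  have w: "w > 0" "int w = int m * (int i - int n) + int n * int j"
    using assms by (auto simp: w_def of_nat_diff algebra_simps)
  have "x ^ i * y ^ j / x ^ n = mono (int i - int n) (int j)"
    using xy_nz by (simp add: mono_def power_int_diff)
  also have "\<dots> = t ^ w * power_int z (\<alpha> * int j - \<beta> * (int i - int n))"
    unfolding mono_eq w(2)[symmetric] by simp
  also have "t ^ w = t * t ^ (w - 1)"
    using w(1) by (simp add: power_eq_if)
  finally show ?thesis
    by (intro bexI[of _ "t ^ (w - 1) * power_int z (\<alpha> * int j - \<beta> * (int i - int n))"])
      (auto simp: mult.assoc intro: mult_R power_R t_R power_int_z_R)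
qed

lemma edge_points:
  assumes "m * i + n * j = m * n"
  shows "(i, j) = (n, 0) \<or> (i, j) = (0, m)"
proof -
  have "n dvd m * i + n * j" "n dvd n * j"
    using assms by simp_all
  then have "n dvd m * i"
    using dvd_add_left_iff by blast
  then have "n dvd i"
    using mn(3) by (simp add: coprime_commute coprime_dvd_mult_right_iff)
  then obtain k where k: "i = n * k"
    by blast
  have "n * (m * k + j) = n * m"
    using assms by (simp add: k algebra_simps)
  then have kj: "m * k + j = m"
    using mn by simp
  then have "m * k \<le> m * 1"
    by linarith
  then have "k \<le> 1"
    using mn by (simp only: nat_mult_le_cancel1)
  then consider "k = 0" | "k = 1"
    by linarith
  then show ?thesis
    using kj k by cases auto
qed

text \<open>In the equation divided by \<open>x ^ n\<close>, the end points of the edge give a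
  linear polynomial in \<open>z\<close>. Every other term has weight above \<open>m * n\<close> and
  is a multiple of \<open>t\<close>.\<close>

lemma z_residue: "\<exists>r\<in>Rt. z = const \<zeta> + t * r"
proof -
  define T where "T = triangle d - {(n, 0), (0, m)}"
  have nd: "n \<le> d" "m \<le> d"
using n0 m0 cf_eq_0[OF hom_F, of n 0] cf_eq_0[OF hom_F, of 0 m] by (auto simp: not_le[symmetric])
  define g where "g p = const (cf F (fst p) (snd p)) * (x ^ fst p * y ^ snd p / x ^ n)" for p
  have "\<exists>r\<in>Rt. g p = t * r" if "p \<in> T" for p
  proof (cases "cf F (fst p) (snd p) = 0")
    case True
    then show ?thesis
      using zero_R by (intro bexI[of _ 0]) (auto simp: g_def hom_0[OF is_hom_const])
  next
    case False
    have "m * fst p + n * snd p \<noteq> m * n"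
      using that edge_points[of "fst p" "snd p"] by (auto simp: T_def)
    then have "m * n < m * fst p + n * snd p"
      using W[OF False] by linarith
    from mono_tR[OF this] obtain r where "r \<in> Rt" "x ^ fst p * y ^ snd p / x ^ n = t * r"
      by (elim bexE)
    then show ?thesis
      by (intro bexI[of _ "const (cf F (fst p) (snd p)) * r"]) (auto simp: g_def intro: mult_R const_R)
  qed
  then obtain r where r: "\<And>p. p \<in> T \<Longrightarrow> r p \<in> Rt" "\<And>p. p \<in> T \<Longrightarrow> g p = t * r p"
    by metis
  have "ev (aff F) = (\<Sum>p\<in>triangle d. const (cf F (fst p) (snd p)) * (x ^ fst p * y ^ snd p))"
    by (simp add: aff_F hom_sum[OF is_hom_ev] ev_monom)
  then have "ev (aff F) / x ^ n = sum g (triangle d)"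
    by (simp add: g_def sum_divide_distrib)
  also have "triangle d = insert (n, 0) (insert (0, m) T)"
    using nd by (auto simp: T_def)
  also have "sum g \<dots> = g (n, 0) + (g (0, m) + sum g T)"
    using mn by (simp add: T_def)
  also have "sum g T = t * sum r T"
    using r(2) by (simp add: sum_distrib_left)
  also have "g (n, 0) = const (cf F n 0)"
    using xy_nz by (simp add: g_def)
  also have "g (0, m) = const (cf F 0 m) * z"
    by (simp add: g_def z_def)
  finally have *: "ev (aff F) / x ^ n = const (cf F n 0) + (const (cf F 0 m) * z + t * sum r T)" .
  define e where "e = ev (aff F) / x ^ n"
  have "e \<in> I"
    unfolding e_def divide_inverse power_inverse[symmetric] by (intro I_mult ev_F rc_power[OF ring_O] xy_inverse)
  then have e: "e / t \<in> I"
    using I_div_t[of e 1] by simp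
  define k where "k = const (inverse (cf F 0 m))"
  have k: "k * const (cf F 0 m) = 1"
    using m0 by (simp add: k_def hom_1[OF is_hom_const] flip: hom_mult[OF is_hom_const])
  have k\<zeta>: "const \<zeta> = - (k * const (cf F n 0))"
    by (simp add: k_def \<zeta>_def divide_inverse mult.commute flip: hom_mult[OF is_hom_const] hom_uminus[OF is_hom_const])
  have te: "t * (e / t) = e"
    using t_nz by simp
  have "const (cf F 0 m) * z = - const (cf F n 0) + t * (e / t + const (- 1) * sum r T)"
    unfolding distrib_left te using * by (simp add: e_def[symmetric] hom_simps[OF is_hom_const] algebra_simps)
  then have "k * (const (cf F 0 m) * z) = k * (- const (cf F n 0) + t * (e / t + const (- 1) * sum r T))"
    by simp
  then have "z = const \<zeta> + t * (k * (e / t + const (- 1) * sum r T))"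
    unfolding mult.assoc[symmetric, of k] k k\<zeta> by (simp only: mult_1_left distrib_left mult_minus_right mult.left_commute)
  moreover have "k * (e / t + const (- 1) * sum r T) \<in> Rt"
    unfolding k_def by (intro mult_R add_R const_R I_R e sum_R r(1))
  ultimately show ?thesis
    by blast
qed

lemma R_residue: "g \<in> Rt \<Longrightarrow> \<exists>c. \<exists>r\<in>Rt. g = const c + t * r"
proof (induction rule: Rt.induct)
  case (const_R c)
  then show ?case
    using zero_R by (intro exI[of _ c] bexI[of _ 0]) auto
next
  case (I_R g)
  then show ?case
    using I_div_t[of g 1] t_nz Rt.I_R by (intro exI[of _ 0] bexI[of _ "g / t"]) (auto simp: hom_0[OF is_hom_const])
next
  case t_R
  show ?case
    using Rt.const_R[of 1] by (intro exI[of _ 0] bexI[of _ 1]) (auto simp: hom_simps[OF is_hom_const])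
next
  case z_R
  show ?case
    using z_residue by blast
next
  case iz_R
  obtain r where r: "r \<in> Rt" "z = const \<zeta> + t * r"
    using z_residue by blast
  define k where "k = const (inverse \<zeta>)"
  have k: "k * const \<zeta> = 1"
    using \<zeta>_nz by (simp add: k_def hom_1[OF is_hom_const] flip: hom_mult[OF is_hom_const])
  \<comment> \<open>The residue formula for \<open>z\<close> is multiplied by
    \<open>inverse z\<close> and solved for it, so only the nonzero residue has to be
    inverted.\<close>
  have "k * (z * inverse z) = k * ((const \<zeta> + t * r) * inverse z)"
    using r(2) by simp
  also have "\<dots> = (k * const \<zeta>) * inverse z + t * (k * r * inverse z)"
    by (simp only: distrib_left distrib_right mult_ac)
  finally have "inverse z = k + t * (const (- 1) * (k * r * inverse z))"
    using z_nz by (simp add: k hom_simps[OF is_hom_const] eq_diff_eq)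
  moreover have "const (- 1) * (k * r * inverse z) \<in> Rt"
    unfolding k_def by (intro Rt.mult_R Rt.const_R r Rt.iz_R)
  ultimately show ?case
    unfolding k_def by blast
next
  case (add_R g h)
  then obtain c c' r r' where "r \<in> Rt" "r' \<in> Rt" "g = const c + t * r" "h = const c' + t * r'"
    by blast
  then show ?case
    by (intro exI[of _ "c + c'"] bexI[of _ "r + r'"])
      (auto simp: hom_simps[OF is_hom_const] algebra_simps intro: Rt.add_R)
next
  case (mult_R g h)
  then obtain c c' r r' where *: "r \<in> Rt" "r' \<in> Rt" "g = const c + t * r" "h = const c' + t * r'"
    by blast
  have "const c * r' + r * h \<in> Rt"
    by (intro Rt.add_R Rt.mult_R * Rt.const_R mult_R)
  then show ?case
    by (intro exI[of _ "c * c'"] bexI[of _ "const c * r' + r * h"])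
      (auto simp: * hom_simps[OF is_hom_const] algebra_simps)
qed

text \<open>Residues are split off repeatedly: either a nonzero one appears, or one more factor
  \<open>t\<close> can be taken out. That the second case ends is a separate question.\<close>

lemma R_order:
  assumes "g \<in> Rt"
  shows "(\<exists>k c. \<exists>r\<in>Rt. c \<noteq> 0 \<and> g = t ^ k * (const c + t * r)) \<or> (\<exists>r\<in>Rt. g = t ^ k * r)"
proof (induction k)
  case 0
  then show ?case
    using assms by auto
next
  case (Suc k)
  show ?case
  proof (rule disjE[OF Suc.IH])
    assume "\<exists>r\<in>Rt. g = t ^ k * r"
    then obtain r where r: "r \<in> Rt" "g = t ^ k * r"
      by blast
    obtain c s where s: "s \<in> Rt" "r = const c + t * s"
      using R_residue[OF r(1)] by blast
    show ?thesis
    proof (cases "c = 0")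
      case True
      then have "g = t ^ Suc k * s"
        by (simp add: r s hom_0[OF is_hom_const] mult_ac)
      then show ?thesis
        using s(1) by blast
    next
      case False
      then show ?thesis
        using r(2) s by blast
    qed
  qed blast
qed

text \<open>Modulo \<open>I\<close>, a multiple of \<open>ev p\<close> is minus a nonzero polynomial
  in \<open>x\<close>, and this has order \<open>m * N\<close> in \<open>t\<close>. If
  \<open>t\<close> divided \<open>ev p\<close> to a higher power, a unit would lie in
  \<open>I\<close>.\<close>

lemma ev_order:
  assumes "ev p \<notin> I"
  shows "\<exists>k c. \<exists>r\<in>Rt. c \<noteq> 0 \<and> ev p = t ^ k * (const c + t * r)"
proof -
  obtain w q where wq: "w \<in> B" "q \<noteq> 0" "ev p * w + xp q \<in> I"
    using elimination[OF m0 mn(1) assms] by blast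
  \<comment> \<open>The power of \<open>x\<close> is split off; the cofactor has a nonzero constant
    term and is a unit of \<open>S\<close>.\<close>
  obtain N q' where q': "q = monom 1 N * q'" "coeff q' 0 \<noteq> 0"
  proof -
    obtain h where h: "q = [:- 0, 1:] ^ order 0 q * h" "\<not> [:- 0, 1:] dvd h"
      using order_decomp[OF wq(2), of 0] by blast
    show thesis
      using h poly_eq_0_iff_dvd[of h 0] by (intro that[of "order 0 q" h]) (auto simp: X_power poly_0_coeff_0)
  qed
  define u where "u = power_int z (- \<beta>) ^ N * xp q'"
  have "unit_in S (power_int z (- \<beta>))"
    using z_nz z_power_int_S[of "- \<beta>"] z_power_int_S[of \<beta>] by (simp add: unit_in_def power_int_minus)
  moreover have "unit_in S (xp q')"
    unfolding xp_ev using q'(2) by (intro unit_ev) simp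
  ultimately have u: "unit_in S u"
    unfolding u_def by (intro unit_in_mult[OF ring_S] unit_in_power[OF ring_S])
  have "xp q = (t ^ m * power_int z (- \<beta>)) ^ N * xp q'"
    unfolding q'(1) hom_mult[OF is_hom_xp] xp_monom x_eq[symmetric] by (simp add: hom_1[OF is_hom_const])
  also have "\<dots> = t ^ (m * N) * u"
    unfolding u_def power_mult_distrib power_mult by (simp only: mult.assoc)
  finally have xq: "xp q = t ^ (m * N) * u" .
  have "\<not> (\<exists>r\<in>Rt. ev p = t ^ Suc (m * N) * r)"
  proof
    assume "\<exists>r\<in>Rt. ev p = t ^ Suc (m * N) * r"
    then obtain r where r: "r \<in> Rt" "ev p = t ^ Suc (m * N) * r"
      by blast
    have uS: "u \<noteq> 0" "inverse u \<in> S"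
      using u by (auto simp: unit_in_def)
    have "w \<in> S"
      using wq(1) B_subset_B' B'_subset_S by blast
    then have "unit_in S (1 + t * (r * w * inverse u))"
      by (intro unit_1_plus_t rc_mult[OF ring_S] uS R_S[OF r(1)])
    moreover have "u * (1 + t * (r * w * inverse u)) = u + (u * inverse u) * (t * (r * w))"
      by (simp add: distrib_left mult_ac)
    ultimately have "unit_in S (u + t * (r * w))"
      using unit_in_mult[OF ring_S u, of "1 + t * (r * w * inverse u)"] uS by simp
    moreover have "ev p * w + xp q = t ^ (m * N) * (u + t * (r * w))"
      by (simp only: xq r(2) power_Suc distrib_left mult_ac add.commute)
    then have "(ev p * w + xp q) / t ^ (m * N) = u + t * (r * w)"
      using t_nz by simp
    ultimately show False
      using I_div_t[OF wq(3), of "m * N"] unit_not_I[of "u + t * (r * w)"] by simp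
  qed
  then show ?thesis
    using R_order[OF ev_R[of p], of "Suc (m * N)"] by blast
qed

lemma homogeneous_order:
  assumes "homogeneous k p" "\<not> F dvd p"
  shows "\<exists>l c. \<exists>r\<in>Rt. c \<noteq> 0 \<and> fr p / fr L0 ^ k = t ^ l * (const c + t * r)"
proof -
  have L: "L0 ^ k \<in> dens_gen F"
    using L0_at at_subset_gen by auto
  have "ev (aff p) \<notin> I"
  proof
    assume "ev (aff p) \<in> I"
    then have "fr p / fr (L0 ^ k) \<in> I"
      by (simp only: ev_aff[OF assms(1)] hom_power[OF is_hom_fr])
    then show False
      using I_frac[OF L] assms(2) by simp
  qed
  from ev_order[OF this] show ?thesis
    by (simp only: ev_aff[OF assms(1)])
qed

text \<open>Numerator and denominator are powers of \<open>t\<close> times units with a constant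
  residue. A larger power in the denominator would make \<open>t\<close> a unit of
  \<open>S\<close>.\<close>

lemma S_residue:
  assumes s: "s \<in> S"
  shows "\<exists>c. \<exists>r\<in>S. s = const c + t * r"
proof (cases "s \<in> I")
  case True
  obtain c r where "r \<in> Rt" "s = const c + t * r"
    using R_residue[OF I_R[OF True]] by (elim exE bexE)
  then show ?thesis
    by (intro exI[of _ c] bexI[of _ r] R_S)
next
  case False
  have D0: "0 \<notin> dens_gen F"
    by (rule mult_set_0[OF mult_set_gen])
  have sO: "s \<in> hfrac (dens_gen F)"
    using s S_subset_O unfolding Og_def by blast
  obtain p q k where pq: "homogeneous k p" "homogeneous k q" "q \<in> dens_gen F" "q \<noteq> 0" "s = fr p / fr q"
    by (rule hfracE[OF sO D0])
  have ndp: "\<not> F dvd p"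
    using False hloc_idealI[OF pq(1,2,3) D0] by (auto simp: I_def pq(5))
  have ndq: "\<not> F dvd q"
    using pq(3) by (simp add: dens_gen_def)
  obtain l c r where r: "r \<in> Rt" "c \<noteq> 0" "fr p / fr L0 ^ k = t ^ l * (const c + t * r)"
    using homogeneous_order[OF pq(1) ndp] by (elim exE bexE conjE)
  obtain l' c' r' where r': "r' \<in> Rt" "c' \<noteq> 0" "fr q / fr L0 ^ k = t ^ l' * (const c' + t * r')"
    using homogeneous_order[OF pq(2) ndq] by (elim exE bexE conjE)
  define u where "u = const c + t * r"
  define u' where "u' = const c' + t * r'"
  have u: "unit_in S u" "unit_in S u'"
    unfolding u_def u'_def using r r' by (auto intro: unit_const_plus_t R_S)
  have u_nz: "u \<noteq> 0" "u' \<noteq> 0" "inverse u' \<in> S" "inverse u \<in> S"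
    using u by (auto simp: unit_in_def)
  have "fr L0 \<noteq> 0"
    using L0_nz by simp
  then have "s = (fr p / fr L0 ^ k) / (fr q / fr L0 ^ k)"
    by (simp add: pq(5))
  then have s_eq: "s * t ^ l' = t ^ l * (u / u')"
    unfolding r(3) r'(3) u_def[symmetric] u'_def[symmetric] using t_nz u_nz by (simp add: field_simps)
  show ?thesis
  proof (cases "l < l'")
    case True
    then have "t ^ l' = t ^ l * (t * t ^ (l' - l - 1))"
      by (simp flip: power_Suc power_add)
    then have "t ^ l * (t * (s * t ^ (l' - l - 1))) = t ^ l * (u / u')"
      using s_eq by (simp add: mult_ac)
    then have q: "t * (s * t ^ (l' - l - 1)) = u / u'"
      by (rule iffD1[OF mult_left_cancel[OF power_not_zero[OF t_nz]]])
    have "t * (s * t ^ (l' - l - 1) * (u' * inverse u)) = (t * (s * t ^ (l' - l - 1))) * (u' * inverse u)"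
      by (simp only: mult.assoc)
    also have "\<dots> = 1"
      unfolding q using u_nz by (simp add: field_simps)
    finally have "1 + t * - (s * t ^ (l' - l - 1) * (u' * inverse u)) = 0"
      by simp
    moreover have "unit_in S (1 + t * - (s * t ^ (l' - l - 1) * (u' * inverse u)))"
      using u by (intro unit_1_plus_t rc_uminus[OF ring_S] rc_mult[OF ring_S] rc_power[OF ring_S] s t_S u_nz)
        (simp add: unit_in_def)
    ultimately show ?thesis
      by (simp add: unit_in_def)
  next
    case False
    then have "t ^ l = t ^ (l - l') * t ^ l'"
      by (simp flip: power_add)
    then have "s * t ^ l' = (t ^ (l - l') * (u / u')) * t ^ l'"
      using s_eq by (simp add: mult_ac)
    then have s2: "s = t ^ (l - l') * (u / u')"
      by (rule iffD1[OF mult_right_cancel[OF power_not_zero[OF t_nz]]])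
    show ?thesis
    proof (cases "l = l'")
      case True
      define k where "k = const (inverse c')"
      have k: "k * const c' = 1"
        using r'(2) by (simp add: k_def hom_1[OF is_hom_const] flip: hom_mult[OF is_hom_const])
      have "u' * (const (c * inverse c') + t * ((r - const c * k * r') * inverse u')) =
          u' * (const c * k) + t * (r - const c * k * r')"
        using u_nz by (simp add: k_def hom_mult[OF is_hom_const] distrib_left mult_ac)
      also have "\<dots> = const c * (k * const c') + t * r"
        unfolding u'_def by (simp add: algebra_simps)
      also have "\<dots> = u"
        by (simp add: k u_def)
      finally have "s = const (c * inverse c') + t * ((r - const c * k * r') * inverse u')"
        using s2 True u_nz by (simp add: divide_eq_eq mult.commute)
      moreover have "(r - const c * k * r') * inverse u' \<in> S"
        unfolding k_def by (intro rc_mult[OF ring_S] rc_diff[OF ring_S] R_S r r' const_S u_nz)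
      ultimately show ?thesis
        by blast
    next
      case False
      then have "l - l' > 0"
        using \<open>\<not> l < l'\<close> by simp
      then have "t ^ (l - l') = t * t ^ (l - l' - 1)"
        by (subst power_eq_if) simp
      then have "s = const 0 + t * (t ^ (l - l' - 1) * (u * inverse u'))"
        using s2 by (simp add: hom_0[OF is_hom_const] divide_inverse mult.assoc)
      moreover have "t ^ (l - l' - 1) * (u * inverse u') \<in> S"
        using u by (intro rc_mult[OF ring_S] rc_power[OF ring_S] t_S u_nz) (simp add: unit_in_def)
      ultimately show ?thesis
        by blast
    qed
  qed
qed

text \<open>If both residues are 0, the sum is divisible by the nonunit \<open>t\<close>.\<close>

lemma local_in_S: "local_in S"
  unfolding local_in_def
proof (intro ballI impI)
  fix g h assume gh: "g \<in> S" "h \<in> S" "unit_in S (g + h)"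
  obtain c r where r: "r \<in> S" "g = const c + t * r"
    using S_residue[OF gh(1)] by blast
  obtain c' r' where r': "r' \<in> S" "h = const c' + t * r'"
    using S_residue[OF gh(2)] by blast
  have "c \<noteq> 0 \<or> c' \<noteq> 0"
  proof (rule ccontr)
    assume "\<not> ?thesis"
    then have eq: "g + h = t * (r + r')"
      by (simp add: r r' hom_0[OF is_hom_const] distrib_left)
    have "t * ((r + r') * inverse (g + h)) = (g + h) * inverse (g + h)"
      by (simp only: eq mult.assoc)
    also have "\<dots> = 1"
      using gh(3) by (intro right_inverse) (simp add: unit_in_def)
    finally have "1 + t * - ((r + r') * inverse (g + h)) = 0"
      by simp
    moreover have "unit_in S (1 + t * - ((r + r') * inverse (g + h)))"
      using gh(3) by (intro unit_1_plus_t rc_uminus[OF ring_S] rc_mult[OF ring_S] rc_add[OF ring_S] r r')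
        (simp add: unit_in_def)
    ultimately show False
      by (simp add: unit_in_def)
  qed
  then show "unit_in S g \<or> unit_in S h"
    using unit_const_plus_t r r' by auto
qed

end

end

section \<open>Irreducible closed sets and chains\<close>

definition proj_point :: "('i \<Rightarrow> complex) \<Rightarrow> ('i \<Rightarrow> complex) set"
  where "proj_point v = {\<lambda>i. c * v i | c. c \<noteq> 0}"

definition coord_vectors :: "'i set \<Rightarrow> ('i \<Rightarrow> complex) set"
  where "coord_vectors I = {v. (\<exists>i. v i \<noteq> 0) \<and> (\<forall>i. i \<notin> I \<longrightarrow> v i = 0)}"

lemma proj_space_eq: "proj_space I = proj_point ` coord_vectors I"
  by (auto simp: proj_space_def proj_point_def coord_vectors_def)

lemma proj_point_self: "v \<in> proj_point v"
  unfolding proj_point_def by (auto intro!: exI[of _ 1])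

lemma proj_point_mem: "v \<in> coord_vectors I \<Longrightarrow> w \<in> proj_point v \<Longrightarrow> w \<in> coord_vectors I"
  by (auto simp: proj_point_def coord_vectors_def)

lemma proj_zeros_iff:
  assumes "v \<in> coord_vectors I" "\<forall>p\<in>S. \<exists>k. homogeneous k p"
  shows "proj_point v \<in> proj_zeros I S \<longleftrightarrow> (\<forall>p\<in>S. peval v p = 0)"
proof
  assume "proj_point v \<in> proj_zeros I S"
  then show "\<forall>p\<in>S. peval v p = 0"
    using proj_point_self by (auto simp: proj_zeros_def)
next
  assume "\<forall>p\<in>S. peval v p = 0"
  moreover have "proj_point v \<in> proj_space I"
    using assms(1) by (simp add: proj_space_eq)
  ultimately show "proj_point v \<in> proj_zeros I S"
    unfolding proj_zeros_def using assms(2) by (auto simp: proj_point_def) (metis mult_zero_right peval_scale)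
qed

lemma peval_curve: "\<exists>r. \<forall>t. poly r t = peval (\<lambda>i. poly (\<gamma> i :: complex poly) t) p"
proof (intro exI allI)
  fix t
  show "poly (psubst (\<lambda>c. [:c:]) \<gamma> p) t = peval (\<lambda>i. poly (\<gamma> i) t) p"
    using hom_psubst[OF is_hom_poly[of t], of "\<lambda>c. [:c:]" \<gamma> p] by (simp add: peval_def)
qed

lemma peval_Var: "peval v (Var i) = v i"
  by (simp add: peval_def psubst_Var is_hom_def)

text \<open>If neither closed piece contains the family, some form of each piece is nonzero at a
  point of \<open>U\<close>. Along a polynomial curve joining these two points both forms stay
  nonzero outside finitely many parameters, so a point of the family is in neither piece.\<close>

lemma irreducible_closure:
  assumes U: "U \<noteq> {}" "U \<subseteq> coord_vectors I"
    and curve: "\<And>v w. v \<in> U \<Longrightarrow> w \<in> U \<Longrightarrow> \<exists>\<gamma>. (\<forall>i. poly (\<gamma> i) 0 = v i) \<and> (\<forall>i. poly (\<gamma> i) 1 = w i) \<and>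
      finite {t. (\<lambda>i. poly (\<gamma> i) t) \<notin> U}"
  shows "irreducible_closed (zariski I) (zariski I closure_of (proj_point ` U))"
  unfolding irreducible_closed_def
proof (intro conjI allI impI)
  let ?Y = "zariski I closure_of (proj_point ` U)"
  have sub: "proj_point ` U \<subseteq> topspace (zariski I)"
    using U(2) by (auto simp: topspace_zariski proj_space_eq)
  then have UY: "proj_point ` U \<subseteq> ?Y"
    by (rule closure_of_subset)
  then show "?Y \<noteq> {}"
    using U(1) by auto
  fix A B assume AB: "closedin (zariski I) A \<and> closedin (zariski I) B \<and> ?Y = A \<union> B"
  obtain S T where S: "\<forall>p\<in>S. \<exists>k. homogeneous k p" "A = proj_zeros I S"
      and T: "\<forall>p\<in>T. \<exists>k. homogeneous k p" "B = proj_zeros I T"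
    using AB unfolding closedin_zariski by blast
  show "?Y = A \<or> ?Y = B"
  proof (rule ccontr)
    assume neq: "\<not> (?Y = A \<or> ?Y = B)"
    have "\<not> proj_point ` U \<subseteq> A" "\<not> proj_point ` U \<subseteq> B"
      using neq AB closure_of_minimal[of "proj_point ` U" A] closure_of_minimal[of "proj_point ` U" B] by blast+
    then obtain v w where vw: "v \<in> U" "proj_point v \<notin> A" "w \<in> U" "proj_point w \<notin> B"
      by blast
    have co: "v \<in> coord_vectors I" "w \<in> coord_vectors I"
      using vw U(2) by auto
    obtain p q where pq: "p \<in> S" "peval v p \<noteq> 0" "q \<in> T" "peval w q \<noteq> 0"
      using vw(2,4) unfolding S(2) T(2) proj_zeros_iff[OF co(1) S(1)] proj_zeros_iff[OF co(2) T(1)] by auto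
    obtain \<gamma> where "(\<forall>i. poly (\<gamma> i) 0 = v i) \<and> (\<forall>i. poly (\<gamma> i) 1 = w i) \<and>
        finite {t. (\<lambda>i. poly (\<gamma> i) t) \<notin> U}"
      using curve[OF vw(1,3)] by (elim exE)
    then have \<gamma>: "\<And>i. poly (\<gamma> i) 0 = v i" "\<And>i. poly (\<gamma> i) 1 = w i"
        "finite {t. (\<lambda>i. poly (\<gamma> i) t) \<notin> U}"
      by simp_all
    obtain r where r: "\<forall>t. poly r t = peval (\<lambda>i. poly (\<gamma> i) t) p"
      using peval_curve[of \<gamma> p] by (elim exE)
    obtain s where s: "\<forall>t. poly s t = peval (\<lambda>i. poly (\<gamma> i) t) q"
      using peval_curve[of \<gamma> q] by (elim exE)
    have "poly r 0 \<noteq> 0" "poly s 1 \<noteq> 0"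
      using pq by (simp_all add: r s \<gamma>)
    then have "r \<noteq> 0" "s \<noteq> 0"
      by auto
    then have fin: "finite ({t. poly r t = 0} \<union> {t. poly s t = 0} \<union> {t. (\<lambda>i. poly (\<gamma> i) t) \<notin> U})"
      using \<gamma>(3) by (auto intro: poly_roots_finite)
    obtain t where t: "t \<notin> {t. poly r t = 0} \<union> {t. poly s t = 0} \<union> {t. (\<lambda>i. poly (\<gamma> i) t) \<notin> U}"
      using ex_new_if_finite[OF infinite_UNIV_char_0 fin] by (elim exE)
    define u where "u = (\<lambda>i. poly (\<gamma> i) t)"
    have u: "u \<in> U" "peval u p \<noteq> 0" "peval u q \<noteq> 0"
      using t by (simp_all add: u_def r s)
    then have "u \<in> coord_vectors I"
      using U(2) by blast
    then have "proj_point u \<notin> A" "proj_point u \<notin> B"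
      unfolding S(2) T(2) using proj_zeros_iff[OF _ S(1)] proj_zeros_iff[OF _ T(1)] pq u by auto
    moreover have "proj_point u \<in> A \<union> B"
      using UY AB u(1) by auto
    ultimately show False
      by simp
  qed
qed (simp add: closedin_closure_of)

section \<open>Hilbert functions and the length of chains\<close>

definition vanishes :: "('i \<Rightarrow> complex) set set \<Rightarrow> 'i mpoly \<Rightarrow> bool"
  where "vanishes Z p \<longleftrightarrow> (\<forall>x\<in>Z. \<forall>v\<in>x. peval v p = 0)"

lemma irreducible_vanishes_mult:
  assumes Z: "irreducible_closed (zariski I) Z" and p: "homogeneous k p" and q: "homogeneous l q"
    and pq: "vanishes Z (p * q)"
  shows "vanishes Z p \<or> vanishes Z q"
proof -
  obtain S where S: "\<forall>p\<in>S. \<exists>k. homogeneous k p" "Z = proj_zeros I S"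
    using Z unfolding irreducible_closed_def closedin_zariski by blast
  have cl: "closedin (zariski I) (proj_zeros I (insert r S))" if "homogeneous j r" for r j
    unfolding closedin_zariski using S(1) that by (intro exI[of _ "insert r S"]) auto
  have "Z \<subseteq> proj_zeros I (insert p S) \<union> proj_zeros I (insert q S)"
  proof
    fix x assume x: "x \<in> Z"
    then have xs: "x \<in> proj_space I"
      using S(2) by (simp add: proj_zeros_def)
    have "(\<forall>v\<in>x. peval v p = 0) \<or> (\<forall>v\<in>x. peval v q = 0)"
    proof (rule ccontr)
      assume "\<not> ?thesis"
      then obtain v w where "v \<in> x" "peval v p \<noteq> 0" "w \<in> x" "peval w q \<noteq> 0"
        by blast
      then show False
        using peval_proj_nonzero[OF xs _ _ q, of w v] pq x by (auto simp: vanishes_def peval_mult)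
    qed
    then show "x \<in> proj_zeros I (insert p S) \<union> proj_zeros I (insert q S)"
      using x S(2) by (auto simp: proj_zeros_def)
  qed
  moreover have "proj_zeros I (insert p S) \<union> proj_zeros I (insert q S) \<subseteq> Z"
    using S(2) by (auto simp: proj_zeros_def)
  ultimately have "Z = proj_zeros I (insert p S) \<or> Z = proj_zeros I (insert q S)"
    using Z cl[OF p] cl[OF q] unfolding irreducible_closed_def by blast
  then show ?thesis
    unfolding vanishes_def proj_zeros_def by blast
qed

text \<open>The value of the Hilbert function of \<open>Z\<close> in degree \<open>D\<close> is at least \<open>k\<close>.\<close>

definition hilbert_ge :: "('i \<Rightarrow> complex) set set \<Rightarrow> nat \<Rightarrow> nat \<Rightarrow> bool"
  where "hilbert_ge Z D k \<longleftrightarrow> (\<exists>f. (\<forall>i<k. homogeneous D (f i)) \<and>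
    (\<forall>a. vanishes Z (\<Sum>i<k. Const (a i) * f i) \<longrightarrow> (\<forall>i<k. a i = 0)))"

lemma hilbert_ge_mono:
  assumes "hilbert_ge Z D k" "l \<le> k"
  shows "hilbert_ge Z D l"
proof -
  obtain f where f: "\<And>i. i < k \<Longrightarrow> homogeneous D (f i)"
      "\<And>a. vanishes Z (\<Sum>i<k. Const (a i) * f i) \<Longrightarrow> \<forall>i<k. a i = 0"
    using assms(1) unfolding hilbert_ge_def by blast
  have "\<forall>i<l. a i = 0" if "vanishes Z (\<Sum>i<l. Const (a i) * f i)" for a
  proof -
    let ?a = "\<lambda>i. if i < l then a i else 0"
    have "(\<Sum>i<k. Const (?a i) * f i) = (\<Sum>i<l. Const (?a i) * f i)"
      using assms(2) by (intro sum.mono_neutral_right) (auto simp: hom_0[OF is_hom_Const])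
    also have "\<dots> = (\<Sum>i<l. Const (a i) * f i)"
      by (intro sum.cong) auto
    finally have a0: "\<forall>i<k. ?a i = 0"
      using f(2)[of ?a] that by simp
    show ?thesis
    proof (intro allI impI)
      fix i assume "i < l"
      then show "a i = 0"
        using a0[rule_format, of i] assms(2) by simp
    qed
  qed
  then show ?thesis
    unfolding hilbert_ge_def using f(1) assms(2) by (intro exI[of _ f]) auto
qed

lemma vanishes_mono: "Z \<subseteq> Z' \<Longrightarrow> vanishes Z' p \<Longrightarrow> vanishes Z p"
  by (auto simp: vanishes_def)

lemma vanishes_add_iff: "vanishes Z q \<Longrightarrow> vanishes Z (p + q) \<longleftrightarrow> vanishes Z p"
  by (simp add: vanishes_def hom_add[OF is_hom_peval])

lemma vanishes_mult: "vanishes Z p \<Longrightarrow> vanishes Z (p * q)"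
  by (simp add: vanishes_def peval_mult)

text \<open>Multiples of \<open>g\<close> vanish on \<open>Z\<close>, so they do not disturb
  independence there. On the irreducible set \<open>Z'\<close> the factor \<open>g\<close> can be
  cancelled from a vanishing product.\<close>

lemma hilbert_ge_add:
  assumes Z: "Z \<subseteq> Z'" "irreducible_closed (zariski I) Z'"
    and g: "homogeneous e g" "vanishes Z g" "\<not> vanishes Z' g"
    and k: "hilbert_ge Z (D + e) k" and l: "hilbert_ge Z' D l"
  shows "hilbert_ge Z' (D + e) (k + l)"
proof -
  obtain f where f: "\<And>i. i < k \<Longrightarrow> homogeneous (D + e) (f i)"
      "\<And>a. vanishes Z (\<Sum>i<k. Const (a i) * f i) \<Longrightarrow> \<forall>i<k. a i = 0"
    using k unfolding hilbert_ge_def by blast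
  obtain h where h: "\<And>i. i < l \<Longrightarrow> homogeneous D (h i)"
      "\<And>a. vanishes Z' (\<Sum>i<l. Const (a i) * h i) \<Longrightarrow> \<forall>i<l. a i = 0"
    using l unfolding hilbert_ge_def by blast
  define F where "F i = (if i < k then f i else g * h (i - k))" for i
  have "homogeneous (D + e) (F i)" if "i < k + l" for i
    using that f(1)[of i] homogeneous_mult[OF g(1) h(1)[of "i - k"]] by (auto simp: F_def add.commute)
  moreover have "\<forall>i<k + l. a i = 0" if a: "vanishes Z' (\<Sum>i<k + l. Const (a i) * F i)" for a
  proof -
    have split: "(\<Sum>i<k + l. Const (a i) * F i) =
        (\<Sum>i<k. Const (a i) * f i) + g * (\<Sum>i<l. Const (a (k + i)) * h i)"
    proof -
      have "(\<Sum>i<k + l. Const (a i) * F i) = (\<Sum>i<k. Const (a i) * F i) + (\<Sum>i\<in>{k..<k + l}. Const (a i) * F i)"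
        using sum.atLeastLessThan_concat[of 0 k "k + l" "\<lambda>i. Const (a i) * F i"] by (simp add: atLeast0LessThan)
      also have "(\<Sum>i\<in>{k..<k + l}. Const (a i) * F i) = (\<Sum>i<l. Const (a (k + i)) * F (k + i))"
        using sum.shift_bounds_nat_ivl[of "\<lambda>i. Const (a i) * F i" 0 k l]
        by (simp add: atLeast0LessThan add.commute)
      finally show ?thesis
        by (simp add: F_def sum_distrib_left mult_ac)
    qed
    have "vanishes Z (\<Sum>i<k. Const (a i) * f i)"
      using vanishes_mono[OF Z(1) a] vanishes_mult[OF g(2)] unfolding split by (simp add: vanishes_add_iff)
    then have 1: "\<forall>i<k. a i = 0"
      by (rule f(2))
    then have "vanishes Z' (g * (\<Sum>i<l. Const (a (k + i)) * h i))"
      using a unfolding split by (simp add: hom_0[OF is_hom_Const])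
    moreover have "homogeneous D (\<Sum>i<l. Const (a (k + i)) * h i)"
      using h(1) by (intro homogeneous_sum homogeneous_Const_mult) auto
    ultimately have "vanishes Z' (\<Sum>i<l. Const (a (k + i)) * h i)"
      using irreducible_vanishes_mult[OF Z(2) g(1)] g(3) by blast
    then have 2: "\<forall>i<l. a (k + i) = 0"
      by (rule h(2))
    show ?thesis
      proof (intro allI impI)
        fix i assume "i < k + l"
        then show "a i = 0"
          using 1 2[rule_format, of "i - k"] by (cases "i < k") auto
      qed
  qed
  ultimately show ?thesis
    unfolding hilbert_ge_def by (intro exI[of _ F]) auto
qed

lemma irreducible_point:
  assumes "irreducible_closed (zariski I) Z"
  obtains v where "v \<in> coord_vectors I" "proj_point v \<in> Z"
proof -
  obtain x where "x \<in> Z"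
    using assms by (auto simp: irreducible_closed_def)
  moreover have "Z \<subseteq> proj_space I"
    using assms closedin_subset[of "zariski I" Z] by (simp add: irreducible_closed_def topspace_zariski)
  ultimately show thesis
    using that by (auto simp: proj_space_eq)
qed

lemma hilbert_ge_1:
  assumes "irreducible_closed (zariski I) Z"
  shows "hilbert_ge Z D 1"
proof -
  obtain v where v: "v \<in> coord_vectors I" "proj_point v \<in> Z"
    by (rule irreducible_point[OF assms])
  then obtain i where i: "v i \<noteq> 0"
    by (auto simp: coord_vectors_def)
  have "homogeneous D (Var i ^ D)"
    using homogeneous_power[OF homogeneous_Var, of D i] by simp
  moreover have "peval v (Var i ^ D) \<noteq> 0"
    using i by (simp add: hom_power[OF is_hom_peval] peval_Var)
  then have "a 0 = 0" if "vanishes Z (Const (a 0) * Var i ^ D)" for a :: "nat \<Rightarrow> complex"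
    using that v(2) proj_point_self[of v] by (auto simp: vanishes_def peval_mult)
  ultimately show ?thesis
    unfolding hilbert_ge_def by (intro exI[of _ "\<lambda>_. Var i ^ D"]) auto
qed

text \<open>A form of the smaller set that does not vanish on the larger one. It is not constant,
  since the smaller set is nonempty; positive degree is what lets the Hilbert function grow.\<close>

lemma chain_separator:
  assumes Z: "irreducible_closed (zariski I) Z" and Z': "irreducible_closed (zariski I) Z'" and sub: "Z \<subset> Z'"
  obtains e g where "e > 0" "homogeneous e g" "vanishes Z g" "\<not> vanishes Z' g"
proof -
  obtain S where S: "\<forall>p\<in>S. \<exists>k. homogeneous k p" "Z = proj_zeros I S"
    using Z unfolding irreducible_closed_def closedin_zariski by blast
  have "Z' \<subseteq> proj_space I"
    using Z' closedin_subset[of "zariski I" Z'] by (simp add: irreducible_closed_def topspace_zariski)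
  then obtain g x v where g: "g \<in> S" "x \<in> Z'" "v \<in> x" "peval v g \<noteq> 0"
    using sub S(2) by (auto simp: proj_zeros_def)
  obtain e where e: "homogeneous e g"
    using S(1) g(1) by blast
  have vZ: "vanishes Z g"
    using g(1) S(2) by (auto simp: vanishes_def proj_zeros_def)
  have "e \<noteq> 0"
  proof
    assume "e = 0"
    then obtain c where c: "g = Const c"
      using e homogeneous_degree_0 by blast
    obtain w where "proj_point w \<in> Z"
      using irreducible_point[OF Z] by blast
    then have "peval w g = 0"
      using vZ proj_point_self[of w] by (auto simp: vanishes_def)
    then show False
      using g(4) c by simp
  qed
  moreover have "\<not> vanishes Z' g"
    using g by (auto simp: vanishes_def)
  ultimately show thesis
    using that[of e g] e vZ by blast
qed

text \<open>\<open>hilbert_ge_add\<close> matches Pascal's rule, so each member of the chain raises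
  the degree of growth by one. Control in degrees divisible by \<open>e\<close> suffices for
  comparing growth.\<close>

lemma chain_hilbert:
  assumes "\<And>i. i \<le> r \<Longrightarrow> irreducible_closed (zariski I) (Z i)" "\<And>i. i < r \<Longrightarrow> Z i \<subset> Z (Suc i)"
  shows "\<exists>e>0. \<forall>k. hilbert_ge (Z r) (e * k) ((k + r) choose r)"
  using assms
proof (induction r)
  case 0
  then show ?case
    using hilbert_ge_1[of I "Z 0"] by (intro exI[of _ 1]) simp
next
  case (Suc r)
  have "\<exists>e>0. \<forall>k. hilbert_ge (Z r) (e * k) ((k + r) choose r)"
    by (rule Suc.IH) (use Suc.prems in auto)
  then obtain e where e: "e > 0" "\<And>k. hilbert_ge (Z r) (e * k) ((k + r) choose r)"
    by auto
  have irr: "irreducible_closed (zariski I) (Z r)" "irreducible_closed (zariski I) (Z (Suc r))"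
    and sub: "Z r \<subset> Z (Suc r)"
    using Suc.prems by auto
  obtain e0 g where g: "e0 > 0" "homogeneous e0 g" "vanishes (Z r) g" "\<not> vanishes (Z (Suc r)) g"
    by (rule chain_separator[OF irr sub])
  \<comment> \<open>The \<open>e\<close>-th power has a degree divisible by \<open>e\<close>, so the
    induction hypothesis applies in the degrees that occur.\<close>
  have ge: "homogeneous (e0 * e) (g ^ e)" "vanishes (Z r) (g ^ e)"
    using homogeneous_power[OF g(2)] g(3) e(1) by (auto simp: vanishes_def hom_power[OF is_hom_peval])
  have ge': "\<not> vanishes (Z (Suc r)) (g ^ e)"
    using g(4) by (auto simp: vanishes_def hom_power[OF is_hom_peval])
  have "hilbert_ge (Z (Suc r)) (e0 * e * k) ((k + Suc r) choose Suc r)" for k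
  proof (induction k)
    case 0
    show ?case
      using hilbert_ge_1[OF irr(2), of 0] by simp
  next
    case (Suc k)
    have "1 * Suc k \<le> e0 * Suc k"
      using g(1) by (intro mult_le_mono1) simp
    then have "Suc k + r \<le> e0 * Suc k + r"
      by simp
    then have "(Suc k + r) choose r \<le> (e0 * Suc k + r) choose r"
      by (rule binomial_right_mono)
    then have "hilbert_ge (Z r) (e * (e0 * Suc k)) ((Suc k + r) choose r)"
      using hilbert_ge_mono[OF e(2)] by blast
    moreover have "e * (e0 * Suc k) = e0 * e * k + e0 * e"
      by (simp add: algebra_simps)
    ultimately have "hilbert_ge (Z (Suc r)) (e0 * e * k + e0 * e) (((Suc k + r) choose r) + ((k + Suc r) choose Suc r))"
      using hilbert_ge_add[OF _ irr(2) ge ge' _ Suc] sub by auto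
    then show ?case
      by (simp add: algebra_simps)
  qed
  then show ?case
    using g(1) e(1) by (intro exI[of _ "e0 * e"]) auto
qed

text \<open>Gaussian elimination: an unknown with a nonzero coefficient in one equation is expressed
  by the others.\<close>

lemma homogeneous_system_solution:
  fixes c :: "'k \<Rightarrow> 'm \<Rightarrow> complex"
  assumes "finite M" "finite K" "card M < card K"
  shows "\<exists>a. (\<exists>i\<in>K. a i \<noteq> 0) \<and> (\<forall>e\<in>M. (\<Sum>i\<in>K. a i * c i e) = 0)"
  using assms
proof (induction M arbitrary: K c rule: finite_induct)
  case empty
  then show ?case
    by (intro exI[of _ "\<lambda>_. 1"]) (auto simp: card_gt_0_iff)
next
  case (insert e M)
  show ?case
  proof (cases "\<forall>i\<in>K. c i e = 0")
    case True
    obtain a where "\<exists>i\<in>K. a i \<noteq> 0" "\<forall>e\<in>M. (\<Sum>i\<in>K. a i * c i e) = 0"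
      using insert.IH[of K c] insert.prems insert.hyps by auto
    then show ?thesis
      using True by (intro exI[of _ a]) auto
  next
    case False
    then obtain p where p: "p \<in> K" "c p e \<noteq> 0"
      by blast
    let ?K = "K - {p}"
    let ?c = "\<lambda>i f. c i f - (c i e / c p e) * c p f"
    have "card M < card ?K"
      using insert.prems insert.hyps p by (simp add: card_Diff_singleton)
    then obtain a where a: "\<exists>i\<in>?K. a i \<noteq> 0" "\<forall>f\<in>M. (\<Sum>i\<in>?K. a i * ?c i f) = 0"
      using insert.IH[of ?K ?c] insert.prems by auto
    define s where "s = (\<Sum>i\<in>?K. a i * c i e) / c p e"
    let ?a = "a(p := - s)"
    have sum: "(\<Sum>i\<in>K. ?a i * c i f) = (\<Sum>i\<in>?K. a i * c i f) - s * c p f" for f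
      using p insert.prems by (subst sum.remove[of K p]) (auto intro!: sum.cong)
    have "(\<Sum>i\<in>?K. a i * ?c i f) = (\<Sum>i\<in>?K. a i * c i f) - s * c p f" for f
      by (simp add: s_def sum_subtractf right_diff_distrib sum_distrib_left sum_distrib_right
        sum_divide_distrib mult_ac)
    then have "\<forall>f\<in>M. (\<Sum>i\<in>K. ?a i * c i f) = 0"
      using a(2) sum by simp
    moreover have "(\<Sum>i\<in>K. ?a i * c i e) = 0"
      unfolding sum using p by (simp add: s_def)
    moreover have "\<exists>i\<in>K. ?a i \<noteq> 0"
      using a(1) by auto
    ultimately show ?thesis
      by (intro exI[of _ ?a]) blast
  qed
qed

text \<open>All exponents but one determine a monomial of degree \<open>D\<close>, and each is at
  most \<open>D\<close>. This crude bound already has the right order of growth.\<close>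

lemma card_monomials_le:
  assumes "finite I" "i0 \<in> I"
  shows "finite {e. Poly_Mapping.keys e \<subseteq> I \<and> mdeg e = D}"
    and "card {e. Poly_Mapping.keys e \<subseteq> I \<and> mdeg e = D} \<le> Suc D ^ (card I - 1)"
proof -
  let ?M = "{e. Poly_Mapping.keys e \<subseteq> I \<and> mdeg e = D}"
  let ?J = "I - {i0}"
  let ?r = "\<lambda>e. restrict (Poly_Mapping.lookup e) ?J"
  have deg: "(\<Sum>i\<in>I. Poly_Mapping.lookup e i) = D" if "e \<in> ?M" for e
    using that mdeg_superset[OF assms(1), of e] by simp
  have "?r ` ?M \<subseteq> PiE ?J (\<lambda>_. {..D})"
  proof
    fix h assume "h \<in> ?r ` ?M"
    then obtain e where e: "e \<in> ?M" "h = ?r e"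
      by blast
    have "Poly_Mapping.lookup e i \<le> D" if "i \<in> I" for i
      using deg[OF e(1)] member_le_sum[OF that, of "Poly_Mapping.lookup e"] assms(1) by simp
    then show "h \<in> PiE ?J (\<lambda>_. {..D})"
      using e by auto
  qed
  moreover have "inj_on ?r ?M"
  proof (rule inj_onI)
    fix e f assume ef: "e \<in> ?M" "f \<in> ?M" "?r e = ?r f"
    have J: "Poly_Mapping.lookup e i = Poly_Mapping.lookup f i" if "i \<in> ?J" for i
      using fun_cong[OF ef(3), of i] that by (simp add: restrict_def split: if_splits)
    have "(\<Sum>i\<in>I. Poly_Mapping.lookup e i) = (\<Sum>i\<in>I. Poly_Mapping.lookup f i)"
      using deg ef by simp
    then have i0: "Poly_Mapping.lookup e i0 = Poly_Mapping.lookup f i0"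
      using sum.remove[OF assms, of "Poly_Mapping.lookup e"] sum.remove[OF assms, of "Poly_Mapping.lookup f"]
        sum.cong[of ?J ?J "Poly_Mapping.lookup e" "Poly_Mapping.lookup f"] J by simp
    show "e = f"
    proof (rule poly_mapping_eqI)
      fix i
      show "Poly_Mapping.lookup e i = Poly_Mapping.lookup f i"
      proof (cases "i \<in> I")
        case False
        show ?thesis
        proof -
          have "i \<notin> Poly_Mapping.keys e" "i \<notin> Poly_Mapping.keys f"
            using ef(1,2) False by auto
          then show ?thesis
            by (simp add: in_keys_iff)
        qed
      qed (use J i0 in auto)
    qed
  qed
  moreover have "finite (PiE ?J (\<lambda>_. {..D}))"
    using assms(1) by (intro finite_PiE) auto
  moreover have "card (PiE ?J (\<lambda>_. {..D})) = Suc D ^ (card I - 1)"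
    using assms by (simp add: card_PiE card_Diff_singleton)
  ultimately show "finite ?M" "card ?M \<le> Suc D ^ (card I - 1)"
    using inj_on_finite[of ?r ?M "PiE ?J (\<lambda>_. {..D})"] card_inj_on_le[of ?r ?M "PiE ?J (\<lambda>_. {..D})"] by simp_all
qed

lemma lookup_Const_mult: "Poly_Mapping.lookup (Const c * p) e = c * Poly_Mapping.lookup p e"
proof -
  have "Const c * p = (\<Sum>f\<in>Poly_Mapping.keys p. Poly_Mapping.single f (c * Poly_Mapping.lookup p f))"
    by (subst (1) mpoly_sum_single[of p]) (simp add: sum_distrib_left Const_def mult_single)
  then show ?thesis
    by (simp add: lookup_sum lookup_single when_def in_keys_iff)
qed

text \<open>More forms than monomials satisfy a linear relation. Only monomials in the variables of
  \<open>I\<close> count, as the others vanish at every coordinate vector.\<close>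

lemma hilbert_bound:
  assumes I: "finite I" "I \<noteq> {}" and Z: "Z \<subseteq> proj_space I" and k: "hilbert_ge Z D k"
  shows "k \<le> Suc D ^ (card I - 1)"
proof (rule ccontr)
  assume "\<not> k \<le> Suc D ^ (card I - 1)"
  let ?M = "{e. Poly_Mapping.keys e \<subseteq> I \<and> mdeg e = D}"
  obtain i0 where "i0 \<in> I"
    using I(2) by blast
  note M = card_monomials_le[OF I(1) this, of D]
  obtain f where f: "\<And>i. i < k \<Longrightarrow> homogeneous D (f i)"
      "\<And>a. vanishes Z (\<Sum>i<k. Const (a i) * f i) \<Longrightarrow> \<forall>i<k. a i = 0"
    using k unfolding hilbert_ge_def by blast
  have "card ?M < card {..<k}"
    using M(2) \<open>\<not> k \<le> _\<close> by simp
  then obtain a where a: "\<exists>i\<in>{..<k}. a i \<noteq> 0" "\<forall>e\<in>?M. (\<Sum>i<k. a i * Poly_Mapping.lookup (f i) e) = 0"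
    using homogeneous_system_solution[OF M(1), of "{..<k}" "\<lambda>i e. Poly_Mapping.lookup (f i) e"] by auto
  let ?g = "\<Sum>i<k. Const (a i) * f i"
  have "peval v ?g = 0" if v: "v \<in> coord_vectors I" for v
    unfolding peval_def psubst_def
  proof (rule sum.neutral, rule ballI)
    fix e assume e: "e \<in> Poly_Mapping.keys ?g"
    have "homogeneous D ?g"
      using f(1) by (intro homogeneous_sum homogeneous_Const_mult) auto
    then have D: "mdeg e = D"
      using e by (auto simp: homogeneous_def)
    show "Poly_Mapping.lookup ?g e * (\<Prod>i\<in>Poly_Mapping.keys e. v i ^ Poly_Mapping.lookup e i) = 0"
    proof (cases "Poly_Mapping.keys e \<subseteq> I")
      case True
      have "Poly_Mapping.lookup (Const c * p) e = c * Poly_Mapping.lookup p e" for c and p :: "'a mpoly"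
        by (rule lookup_Const_mult)
      then show ?thesis
        using a(2) True D e by (simp add: lookup_sum in_keys_iff)
    next
      case False
      then obtain i where "i \<in> Poly_Mapping.keys e" "i \<notin> I"
        by blast
      then have "(\<Prod>i\<in>Poly_Mapping.keys e. v i ^ Poly_Mapping.lookup e i) = 0"
        using v by (intro prod_zero) (auto simp: coord_vectors_def in_keys_iff intro!: bexI[of _ i])
      then show ?thesis
        by simp
    qed
  qed
  then have "vanishes Z ?g"
    using Z proj_point_mem unfolding vanishes_def proj_space_eq by fast
  then show False
    using f(2) a(1) by auto
qed

text \<open>A chain of length \<open>r\<close> forces growth like \<open>k ^ r\<close>, while the
  space allows only growth like \<open>k ^ N\<close> with \<open>N = card I - 1\<close>.\<close>

lemma chain_length_le:
  assumes I: "finite I" "I \<noteq> {}"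
    and Z: "\<And>i. i \<le> r \<Longrightarrow> irreducible_closed (zariski I) (Z i)" "\<And>i. i < r \<Longrightarrow> Z i \<subset> Z (Suc i)"
  shows "r \<le> card I - 1"
proof (rule ccontr)
  assume "\<not> r \<le> card I - 1"
  define N where "N = card I - 1"
  have rN: "r > N"
    using \<open>\<not> r \<le> card I - 1\<close> by (simp add: N_def)
  have "\<exists>e>0. \<forall>k. hilbert_ge (Z r) (e * k) ((k + r) choose r)"
    by (rule chain_hilbert[of r I Z, OF Z])
  then obtain e where e: "e > 0" "\<And>k. hilbert_ge (Z r) (e * k) ((k + r) choose r)"
    by auto
  have "Z r \<subseteq> proj_space I"
    using Z(1)[of r] closedin_subset[of "zariski I" "Z r"] by (simp add: irreducible_closed_def topspace_zariski)
  then have le: "(k + r) choose r \<le> Suc (e * k) ^ N" for k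
    unfolding N_def by (rule hilbert_bound[OF I _ e(2)])
  \<comment> \<open>The factors come from bounding the binomial coefficient below by
    \<open>(k / r) ^ r\<close> and \<open>e * k + 1\<close> above by
    \<open>(e + 1) * k\<close>.\<close>
  define C where "C = real r ^ r * real (Suc e) ^ N"
  have bound: "real k \<le> C" if "k > 0" for k
  proof -
    have "(real (k + r) / real r) ^ r \<le> real ((k + r) choose r)"
      using binomial_ge_n_over_k_pow_k[of r "k + r", where 'a = real] by simp
    also have "\<dots> \<le> real (Suc (e * k)) ^ N"
      using le[of k] by (metis of_nat_le_iff of_nat_power)
    also have "\<dots> \<le> (real (Suc e) * real k) ^ N"
    proof (intro power_mono)
      have "Suc (e * k) \<le> Suc e * k"
        using that by simp
      then show "real (Suc (e * k)) \<le> real (Suc e) * real k"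
        by (metis of_nat_le_iff of_nat_mult)
    qed simp
    finally have 1: "(real (k + r) / real r) ^ r \<le> real (Suc e) ^ N * real k ^ N"
      by (simp only: power_mult_distrib)
    have "(real k / real r) ^ r \<le> (real (k + r) / real r) ^ r"
      by (intro power_mono divide_right_mono) auto
    then have "(real k / real r) ^ r \<le> real (Suc e) ^ N * real k ^ N"
      using 1 by (rule order_trans)
    then have "real k ^ r / real r ^ r \<le> real (Suc e) ^ N * real k ^ N"
      by (simp only: power_divide)
    moreover have "real r ^ r > 0"
      using rN by simp
    ultimately have "real k ^ r \<le> (real (Suc e) ^ N * real k ^ N) * real r ^ r"
      by (simp only: pos_divide_le_eq)
    then have "real k ^ r \<le> C * real k ^ N"
      by (simp only: C_def mult_ac)
    moreover have "real k ^ N * real k \<le> real k ^ r"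
      using that rN power_increasing[of "Suc N" r "real k"] by (simp add: mult.commute)
    ultimately have "real k ^ N * real k \<le> real k ^ N * C"
      by (simp add: mult.commute)
    then show ?thesis
      using that by simp
  qed
  obtain k where "real k > max C 0"
    using reals_Archimedean2 by blast
  then have "real k > C" "k > 0"
    by auto
  then show False
    using bound[of k] by simp
qed

section \<open>Intersection numbers with a line\<close>

context plane_curve
begin

text \<open>Restriction to the line \<open>L2 = 0\<close>, as a polynomial in
  \<open>x\<close>.\<close>

definition restr :: "form \<Rightarrow> complex poly"
  where "restr G = coeff (aff G) 0"

lemma is_hom_restr: "is_hom restr"
  unfolding restr_def poly_0_coeff_0[symmetric] by (rule is_hom_comp[OF is_hom_poly is_hom_aff])

lemma coeff_restr: "coeff (restr G) i = cf G i 0"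
  by (simp add: restr_def cf_def)

lemma restr_L: "restr L0 = 1" "restr L1 = monom 1 1" "restr L2 = 0" "restr (Const c) = [:c:]"
  by (simp_all add: restr_def aff_def lsubst_L[OF is_hom_emb] lsubst_Const[OF is_hom_emb] monom_altdef)

lemma restr_at_0: "homogeneous k G \<Longrightarrow> coeff (restr G) 0 = peval v G"
  by (simp add: coeff_restr peval_v)

text \<open>Elements of \<open>B\<close> whose restriction to the line vanishes at the point to
  order at least \<open>r\<close>. These ideals filter \<open>B\<close> with one-dimensional
  quotients.\<close>

definition ord_ge :: "nat \<Rightarrow> form fract set"
  where "ord_ge r = {fr p / fr q | p q k. homogeneous k p \<and> homogeneous k q \<and> q \<in> dens_at v \<and>
    monom 1 r dvd restr p}"

lemma ord_geI:
  "homogeneous k p \<Longrightarrow> homogeneous k q \<Longrightarrow> q \<in> dens_at v \<Longrightarrow> monom 1 r dvd restr p \<Longrightarrow> fr p / fr q \<in> ord_ge r"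
  unfolding ord_ge_def by blast

lemma ord_geE:
  assumes "g \<in> ord_ge r"
  obtains p q k where "homogeneous k p" "homogeneous k q" "q \<in> dens_at v" "q \<noteq> 0"
    "monom 1 r dvd restr p" "g = fr p / fr q"
proof -
  obtain p q k where *: "homogeneous k p" "homogeneous k q" "q \<in> dens_at v" "monom 1 r dvd restr p" "g = fr p / fr q"
    using assms unfolding ord_ge_def by blast
  moreover have "q \<noteq> 0"
    using *(3) mult_set_0[OF mult_set_at[of v]] by auto
  ultimately show thesis
    using that by blast
qed

lemma ord_ge_0: "ord_ge 0 = B"
proof
  show "ord_ge 0 \<subseteq> B"
    unfolding ord_ge_def B_def using mult_set_0[OF mult_set_at[of v]] by (auto intro: hfracI)
  show "B \<subseteq> ord_ge 0"
  proof
    fix g assume "g \<in> B"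
    then obtain p q k where "homogeneous k p" "homogeneous k q" "q \<in> dens_at v" "q \<noteq> 0" "g = fr p / fr q"
      unfolding B_def by (elim hfracE[OF _ mult_set_0[OF mult_set_at]]) blast
    then show "g \<in> ord_ge 0"
      by (simp add: ord_geI)
  qed
qed

lemma ord_ge_subset_B: "ord_ge r \<subseteq> B"
  unfolding ord_ge_def B_def using mult_set_0[OF mult_set_at[of v]] by (auto intro: hfracI)

lemma ord_ge_mono: "r \<le> s \<Longrightarrow> ord_ge s \<subseteq> ord_ge r"
proof
  fix g assume "r \<le> s" "g \<in> ord_ge s"
  then obtain p q k where *: "homogeneous k p" "homogeneous k q" "q \<in> dens_at v" "q \<noteq> 0"
    "monom 1 s dvd restr p" "g = fr p / fr q"
    by (elim ord_geE)
  moreover have "monom 1 r dvd restr p"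
    using *(5) \<open>r \<le> s\<close> by (auto simp: monom_1_dvd_iff')
  ultimately show "g \<in> ord_ge r"
    by (auto intro: ord_geI)
qed

lemma ord_ge_add:
  assumes "g \<in> ord_ge r" "h \<in> ord_ge r"
  shows "g + h \<in> ord_ge r"
proof -
  obtain p q k where 1: "homogeneous k p" "homogeneous k q" "q \<in> dens_at v" "q \<noteq> 0"
    "monom 1 r dvd restr p" "g = fr p / fr q"
    by (rule ord_geE[OF assms(1)])
  obtain p' q' k' where 2: "homogeneous k' p'" "homogeneous k' q'" "q' \<in> dens_at v" "q' \<noteq> 0"
    "monom 1 r dvd restr p'" "h = fr p' / fr q'"
    by (rule ord_geE[OF assms(2)])
  have "g + h = fr (p * q' + p' * q) / fr (q * q')"
    using 1(4) 2(4) by (simp add: 1(6) 2(6) frac_add)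
  also have "\<dots> \<in> ord_ge r"
  proof (rule ord_geI)
    show "homogeneous (k + k') (p * q' + p' * q)" "homogeneous (k + k') (q * q')"
      using 1 2 homogeneous_mult[of k p k' q'] homogeneous_mult[of k' p' k q] homogeneous_mult[of k q k' q']
      by (auto simp: add.commute intro: homogeneous_add)
    show "q * q' \<in> dens_at v"
      by (rule mult_set_mult[OF mult_set_at 1(3) 2(3)])
    show "monom 1 r dvd restr (p * q' + p' * q)"
      using 1(5) 2(5) by (simp add: hom_add[OF is_hom_restr] hom_mult[OF is_hom_restr])
  qed
  finally show ?thesis .
qed

lemma ord_ge_mult:
  assumes "g \<in> ord_ge r" "h \<in> B"
  shows "g * h \<in> ord_ge r"
proof -
  obtain p q k where 1: "homogeneous k p" "homogeneous k q" "q \<in> dens_at v" "q \<noteq> 0"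
    "monom 1 r dvd restr p" "g = fr p / fr q"
    by (rule ord_geE[OF assms(1)])
  obtain p' q' k' where 2: "homogeneous k' p'" "homogeneous k' q'" "q' \<in> dens_at v" "q' \<noteq> 0" "h = fr p' / fr q'"
    using assms(2) unfolding ord_ge_0[symmetric] by (elim ord_geE)
  have "g * h = fr (p * p') / fr (q * q')"
    by (simp only: 1(6) 2(5) frac_mult)
  also have "\<dots> \<in> ord_ge r"
  proof (rule ord_geI)
    show "homogeneous (k + k') (p * p')" "homogeneous (k + k') (q * q')"
      using 1 2 homogeneous_mult by blast+
    show "q * q' \<in> dens_at v"
      by (rule mult_set_mult[OF mult_set_at 1(3) 2(3)])
    show "monom 1 r dvd restr (p * p')"
      using 1(5) by (simp add: hom_mult[OF is_hom_restr])
  qed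
  finally show ?thesis .
qed

lemma x_power_ord_ge: "x ^ r \<in> ord_ge r" "x ^ r \<notin> ord_ge (Suc r)"
proof -
  have h: "homogeneous (1 * r) (L1 ^ r)" "homogeneous (1 * r) (L0 ^ r)"
    by (intro homogeneous_power homogeneous_lin)+
  have x: "x ^ r = fr (L1 ^ r) / fr (L0 ^ r)"
    by (simp add: x_def power_divide hom_power[OF is_hom_fr])
  have rL1: "restr (L1 ^ r) = monom 1 r"
    by (simp add: hom_power[OF is_hom_restr] restr_L monom_power)
  show "x ^ r \<in> ord_ge r"
    unfolding x by (rule ord_geI[OF h L0_at(2)]) (simp add: rL1)
  show "x ^ r \<notin> ord_ge (Suc r)"
  proof
    assume "x ^ r \<in> ord_ge (Suc r)"
    then obtain p q k where *: "homogeneous k p" "homogeneous k q" "q \<in> dens_at v" "q \<noteq> 0"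
      "monom 1 (Suc r) dvd restr p" "x ^ r = fr p / fr q"
      by (rule ord_geE)
    then have "fr (L1 ^ r * q) = fr (p * L0 ^ r)"
      using L0_nz by (simp add: x frac_eq_eq hom_mult[OF is_hom_fr] hom_power[OF is_hom_fr])
    then have "L1 ^ r * q = p * L0 ^ r"
      by simp
    then have "restr (L1 ^ r) * restr q = restr p * restr (L0 ^ r)"
      by (metis hom_mult[OF is_hom_restr])
    moreover have "restr (L0 ^ r) = 1"
      by (simp add: hom_power[OF is_hom_restr] restr_L)
    ultimately have eq: "monom 1 r * restr q = restr p"
      by (simp only: rL1 mult_1_right)
    have "coeff (restr p) r = coeff (restr q) 0"
      by (simp add: coeff_monom_mult flip: eq)
    moreover have "coeff (restr p) r = 0"
      using *(5) by (simp add: monom_1_dvd_iff')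
    ultimately show False
      using *(2,3) by (simp add: restr_at_0 dens_at_def)
  qed
qed

lemma ord_ge_decomp:
  assumes "g \<in> ord_ge r"
  obtains c h where "h \<in> ord_ge (Suc r)" "g = const c * x ^ r + h"
proof -
  obtain p q k where 1: "homogeneous k p" "homogeneous k q" "q \<in> dens_at v" "q \<noteq> 0"
    "monom 1 r dvd restr p" "g = fr p / fr q"
    by (rule ord_geE[OF assms])
  obtain w where w: "restr p = monom 1 r * w"
    using 1(5) by blast
  have qv: "peval v q \<noteq> 0"
    using 1(3) by (simp add: dens_at_def)
  define c where "c = coeff w 0 / peval v q"
  define P where "P = p * L0 ^ r - Const c * (L1 ^ r * q)"
  have h: "homogeneous (1 * r) (L1 ^ r)" "homogeneous (1 * r) (L0 ^ r)"
    by (intro homogeneous_power homogeneous_lin)+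
  have "fr P / fr (q * L0 ^ r) \<in> ord_ge (Suc r)"
  proof (rule ord_geI)
    show "homogeneous (k + 1 * r) P"
      unfolding P_def using homogeneous_mult[OF 1(1) h(2)] homogeneous_mult[OF h(1) 1(2)]
      by (intro homogeneous_diff homogeneous_Const_mult) (simp_all add: add.commute)
    show "homogeneous (k + 1 * r) (q * L0 ^ r)"
      by (rule homogeneous_mult[OF 1(2) h(2)])
    show "q * L0 ^ r \<in> dens_at v"
      by (rule mult_set_mult[OF mult_set_at 1(3) L0_at(2)])
    have "restr P = monom 1 r * (w - [:c:] * restr q)"
      by (simp add: P_def hom_diff[OF is_hom_restr] hom_mult[OF is_hom_restr] hom_power[OF is_hom_restr]
          restr_L w monom_power algebra_simps)
    moreover have "coeff (w - [:c:] * restr q) 0 = 0"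
      using qv by (simp add: c_def restr_at_0[OF 1(2)])
    then have "monom 1 1 dvd w - [:c:] * restr q"
      by (simp add: monom_1_dvd_iff' del: mult_pCons_left)
    ultimately show "monom 1 (Suc r) dvd restr P"
      using mult_dvd_mono[of "monom 1 r" "monom 1 r" "monom 1 1"] by (simp add: mult_monom)
  qed
  moreover have "g = const c * x ^ r + fr P / fr (q * L0 ^ r)"
    using 1(4) L0_nz by (simp add: 1(6) P_def const_def x_def field_simps hom_simps[OF is_hom_fr])
  ultimately show thesis
    using that by blast
qed

lemma L2_dvd:
  assumes "homogeneous k G" "restr G = 0"
  shows "L2 dvd G"
proof -
  have "L2 dvd Const (cf G i j) * mon k i j" for i j
  proof (cases j)
    case 0
    then show ?thesis
      using assms(2) coeff_restr[of G i] by (simp add: hom_0[OF is_hom_Const])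
  next
    case (Suc l)
    then show ?thesis
      by (simp add: mon_def)
  qed
  then have "L2 dvd of_cf k (cf G)"
    unfolding of_cf_def by (intro dvd_sum) auto
  then show ?thesis
    by (simp add: of_cf_cf[OF assms(1)])
qed

lemma restr_lift:
  assumes "degree u \<le> k"
  shows "\<exists>U. homogeneous k U \<and> restr U = u"
proof (intro exI conjI)
  show "homogeneous k (of_cf k (\<lambda>i j. if j = 0 then coeff u i else 0))"
    by (rule homogeneous_of_cf)
  show "restr (of_cf k (\<lambda>i j. if j = 0 then coeff u i else 0)) = u"
    using assms by (intro poly_eqI) (auto simp: coeff_restr cf_of_cf coeff_eq_0)
qed

lemma degree_restr: "homogeneous k G \<Longrightarrow> degree (restr G) \<le> k"
  by (rule degree_le) (simp add: coeff_restr cf_eq_0)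

context
  fixes n :: nat and \<kappa> :: complex
  assumes row: "\<And>i. i < n \<Longrightarrow> cf F i 0 = 0" "cf F n 0 \<noteq> 0" and \<kappa>: "\<kappa> \<noteq> 0"
begin

abbreviation "RB \<equiv> type_subring B"
text \<open>The factor \<kappa> is there because the equation of a line is determined only up to a
  constant.\<close>

definition J where "J = hloc_ideal (dens_at v) F <+>\<^bsub>RB\<^esub> hloc_ideal (dens_at v) (Const \<kappa> * L2)"

lemma restr_F: "monom 1 n dvd restr F"
  using row(1) by (simp add: monom_1_dvd_iff' coeff_restr)

text \<open>On the line \<open>F\<close> is \<open>x ^ n\<close> times a unit, so an element of
  order at least \<open>n\<close> agrees there with a multiple of \<open>F\<close>. The difference
  vanishes on the line and is a multiple of \<open>L2\<close>.\<close>

lemma J_eq: "J = ord_ge n"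
proof
  have F: "hloc_ideal (dens_at v) F \<subseteq> ord_ge n"
  proof
    fix g assume "g \<in> hloc_ideal (dens_at v) F"
    then obtain p q k where *: "homogeneous k p" "homogeneous k q" "q \<in> dens_at v" "F dvd p" "g = fr p / fr q"
      by (elim hloc_idealE[OF _ mult_set_0[OF mult_set_at]]) blast
    moreover have "monom 1 n dvd restr p"
      using *(4) restr_F by (auto simp: hom_mult[OF is_hom_restr] elim!: dvdE[of F])
    ultimately show "g \<in> ord_ge n"
      by (auto intro: ord_geI)
  qed
  have L: "hloc_ideal (dens_at v) (Const \<kappa> * L2) \<subseteq> ord_ge n"
  proof
    fix g assume "g \<in> hloc_ideal (dens_at v) (Const \<kappa> * L2)"
    then obtain p q k where *: "homogeneous k p" "homogeneous k q" "q \<in> dens_at v" "Const \<kappa> * L2 dvd p" "g = fr p / fr q"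
      by (elim hloc_idealE[OF _ mult_set_0[OF mult_set_at]]) blast
    moreover have "restr p = 0"
      using *(4) by (auto simp: hom_mult[OF is_hom_restr] restr_L elim!: dvdE)
    ultimately show "g \<in> ord_ge n"
      by (auto intro: ord_geI)
  qed
  show "J \<subseteq> ord_ge n"
    unfolding J_def set_add_def' by (auto intro!: ord_ge_add dest: subsetD[OF F] subsetD[OF L])
next
  show "ord_ge n \<subseteq> J"
  proof
    fix g assume "g \<in> ord_ge n"
    then obtain p q k where 1: "homogeneous k p" "homogeneous k q" "q \<in> dens_at v" "q \<noteq> 0"
      "monom 1 n dvd restr p" "g = fr p / fr q"
      by (rule ord_geE)
    obtain h where h: "restr p = monom 1 n * h"
      using 1(5) by blast
    obtain u where u: "restr F = monom 1 n * u"
      using restr_F by blast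
    have "coeff (restr F) n = coeff u 0"
      by (simp add: u coeff_monom_mult)
    then have u0: "coeff u 0 \<noteq> 0" "u \<noteq> 0"
      using row(2) by (auto simp: coeff_restr)
    have "degree (restr F) = n + degree u"
      using u0 by (simp add: u degree_mult_eq degree_monom_eq monom_eq_0_iff)
    then have nd: "n + degree u \<le> d"
      using degree_restr[OF hom_F] by simp
    then have du: "degree u \<le> d - n"
      by simp
    \<comment> \<open>Instead of dividing by \<open>u\<close>, numerator and denominator are
      multiplied by a form \<open>U\<close> that restricts to \<open>u\<close> and does not vanish
      at the point.\<close>
    obtain U where U: "homogeneous (d - n) U" "restr U = u"
      using restr_lift[OF du] by (elim exE conjE)
    have "\<exists>H. homogeneous (k + (d - n)) (F * H) \<and> restr H = h"
    proof (cases "h = 0")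
      case True
      then show ?thesis
        by (intro exI[of _ 0]) (simp add: hom_0[OF is_hom_restr])
    next
      case False
      then have "degree (restr p) = n + degree h"
        by (simp add: h degree_mult_eq degree_monom_eq monom_eq_0_iff)
      then have nk: "n + degree h \<le> k"
        using degree_restr[OF 1(1)] by simp
      then have dh: "degree h \<le> k - n"
        by simp
      obtain H where H: "homogeneous (k - n) H" "restr H = h"
        using restr_lift[OF dh] by (elim exE conjE)
      have "d + (k - n) = k + (d - n)"
        using nk nd by simp
      then have "homogeneous (k + (d - n)) (F * H)"
        using homogeneous_mult[OF hom_F H(1)] by simp
      then show ?thesis
        using H(2) by (intro exI[of _ H]) simp
    qed
    then obtain H where H: "homogeneous (k + (d - n)) (F * H)" "restr H = h"
      by (elim exE conjE)
    have "homogeneous (k + (d - n)) (p * U - F * H)"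
      by (intro homogeneous_diff homogeneous_mult 1 U H)
    moreover have "restr (p * U - F * H) = 0"
      by (simp add: hom_diff[OF is_hom_restr] hom_mult[OF is_hom_restr] h u U H)
    ultimately have "L2 dvd p * U - F * H"
      by (rule L2_dvd)
    then obtain G where G: "p * U - F * H = L2 * G"
      by blast
    have Uat: "U \<in> dens_at v"
      using u0 restr_at_0[OF U(1)] by (simp add: dens_at_def U)
    then have U0: "U \<noteq> 0"
      using mult_set_0[OF mult_set_at[of v]] by auto
    have qU: "q * U \<in> dens_at v" "homogeneous (k + (d - n)) (q * U)"
      using mult_set_mult[OF mult_set_at 1(3) Uat] homogeneous_mult[OF 1(2) U(1)] by auto
    have D0: "0 \<notin> dens_at v"
      by (rule mult_set_0[OF mult_set_at])
    have "homogeneous (k + (d - n)) (L2 * G)"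
      unfolding G[symmetric] by (intro homogeneous_diff homogeneous_mult 1 U H)
    moreover have "Const \<kappa> * Const (inverse \<kappa>) = (1 :: form)"
      using \<kappa> by (simp add: hom_1[OF is_hom_Const] flip: hom_mult[OF is_hom_Const])
    then have "(Const \<kappa> * Const (inverse \<kappa>)) * (L2 * G) = L2 * G"
      by simp
    then have "(Const \<kappa> * L2) * (Const (inverse \<kappa>) * G) = L2 * G"
      by (simp only: mult_ac)
    then have "Const \<kappa> * L2 dvd L2 * G"
      by (rule dvdI[OF sym])
    ultimately have 2: "fr (L2 * G) / fr (q * U) \<in> hloc_ideal (dens_at v) (Const \<kappa> * L2)"
      by (intro hloc_idealI[OF _ qU(2,1) D0])
    have 3: "fr (F * H) / fr (q * U) \<in> hloc_ideal (dens_at v) F"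
      using hloc_idealI[OF H(1) qU(2,1) D0] by simp
    have "g = fr (p * U) / fr (q * U)"
      using U0 by (simp add: 1(6) hom_mult[OF is_hom_fr])
    also have "p * U = F * H + L2 * G"
      using G by (simp add: algebra_simps)
    finally have "g = fr (F * H) / fr (q * U) + fr (L2 * G) / fr (q * U)"
      by (simp add: hom_add[OF is_hom_fr] add_divide_distrib)
    then show "g \<in> J"
      unfolding J_def set_add_def' using 2 3 by auto
  qed
qed

lemma ideal_J: "ideal J RB"
  unfolding J_eq
proof (rule ideal_type_subring[OF ring_B ord_ge_subset_B])
  show "0 \<in> ord_ge n"
    using ord_geI[OF homogeneous_0 homogeneous_1 mult_set_1[OF mult_set_at]]
    by (simp add: hom_0[OF is_hom_restr] hom_0[OF is_hom_fr])
qed (auto intro: ord_ge_add ord_ge_mult)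

definition csB where "csB g = J +>\<^bsub>RB\<^esub> g"

lemma csB_hom: "ring_hom_ring RB (RB Quot J) csB"
  using ideal.rcos_ring_hom_ring[OF ideal_J] by (simp add: csB_def[abs_def])

lemma csB_eq_iff: "g \<in> B \<Longrightarrow> h \<in> B \<Longrightarrow> csB g = csB h \<longleftrightarrow> g - h \<in> ord_ge n"
  using ring.quotient_eq_iff_same_a_r_cos[OF cring.axioms(1)[OF cring_type_subring[OF ring_B]] ideal_J, of g h]
  by (simp add: csB_def a_minus_type_subring[OF ring_B] J_eq)

text \<open>Descent along the filtration: from order \<open>r + 1\<close> to order \<open>r\<close>
  only the class of \<open>x ^ r\<close> is added.\<close>

lemma dimension_ord_ge:
  "j \<le> n \<Longrightarrow> ring.dimension (RB Quot J) j (csB ` range const) (csB ` ord_ge (n - j))"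
proof (induction j)
  interpret h: ring_hom_ring RB "RB Quot J" csB
    by (rule csB_hom)
  have zero: "csB 0 = \<zero>\<^bsub>RB Quot J\<^esub>"
    using h.hom_zero by simp
  {
    case 0
    have "0 \<in> ord_ge n"
      using additive_subgroup.zero_closed[OF ideal.axioms(1)[OF ideal_J]] by (simp add: J_eq)
    moreover have "csB g = csB 0" if "g \<in> ord_ge n" for g
      using that csB_eq_iff[of g 0] ord_ge_subset_B rc_0[OF ring_B] by auto
    ultimately have "csB ` ord_ge n = {\<zero>\<^bsub>RB Quot J\<^esub>}"
      by (auto simp: zero image_iff)
    then show ?case
      using h.S.dimension.zero_dim by simp
  next
    case (Suc j)
    define r where "r = n - Suc j"
    have r: "n - j = Suc r" "r < n"
      using Suc.prems by (auto simp: r_def)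
    have IH: "h.S.dimension j (csB ` range const) (csB ` ord_ge (Suc r))"
      using Suc r by simp
    have xB: "x ^ r \<in> B"
      by (rule rc_power[OF ring_B xy_B(1)])
    have "csB (x ^ r) \<notin> csB ` ord_ge (Suc r)"
    proof
      assume "csB (x ^ r) \<in> csB ` ord_ge (Suc r)"
      then obtain g where g: "g \<in> ord_ge (Suc r)" "csB (x ^ r) = csB g"
        by blast
      then have "x ^ r - g \<in> ord_ge n"
        using csB_eq_iff[OF xB] ord_ge_subset_B by blast
      then have "x ^ r - g \<in> ord_ge (Suc r)"
        using ord_ge_mono[of "Suc r" n] r(2) by auto
      then have "(x ^ r - g) + g \<in> ord_ge (Suc r)"
        by (rule ord_ge_add[OF _ g(1)])
      then show False
        using x_power_ord_ge(2)[of r] by simp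
    qed
    moreover have "csB (x ^ r) \<in> carrier (RB Quot J)"
      using h.hom_closed xB by simp
    ultimately have "h.S.dimension (Suc j) (csB ` range const)
        (h.S.line_extension (csB ` range const) (csB (x ^ r)) (csB ` ord_ge (Suc r)))"
      using IH by (intro h.S.dimension.Suc_dim)
    moreover have "h.S.line_extension (csB ` range const) (csB (x ^ r)) (csB ` ord_ge (Suc r)) = csB ` ord_ge r"
    proof -
      have eq: "csB (const c) \<otimes>\<^bsub>RB Quot J\<^esub> csB (x ^ r) \<oplus>\<^bsub>RB Quot J\<^esub> csB g = csB (const c * x ^ r + g)"
        if "g \<in> ord_ge (Suc r)" for c g
      proof -
        have "g \<in> B"
          using that ord_ge_subset_B by blast
        then show ?thesis
          using h.hom_mult[of "const c" "x ^ r"] h.hom_add[of "const c * x ^ r" g] xB const_B rc_mult[OF ring_B]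
          by simp
      qed
      have "const c * x ^ r + g \<in> ord_ge r" if "g \<in> ord_ge (Suc r)" for c g
        using that ord_ge_mono[of r "Suc r"] ord_ge_mult[OF x_power_ord_ge(1) const_B, of r c]
        by (intro ord_ge_add) (auto simp: mult.commute)
      note in_r = this
      show ?thesis
      proof (intro equalityI subsetI)
        fix u assume "u \<in> h.S.line_extension (csB ` range const) (csB (x ^ r)) (csB ` ord_ge (Suc r))"
        then obtain c g where "g \<in> ord_ge (Suc r)"
            "u = csB (const c) \<otimes>\<^bsub>RB Quot J\<^esub> csB (x ^ r) \<oplus>\<^bsub>RB Quot J\<^esub> csB g"
          unfolding h.S.line_extension_mem_iff by (elim bexE imageE) simp
        then show "u \<in> csB ` ord_ge r"
          using eq in_r by simp
      next
        fix u assume "u \<in> csB ` ord_ge r"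
        then obtain f where f: "f \<in> ord_ge r" "u = csB f"
          by (elim imageE)
        obtain c g where g: "g \<in> ord_ge (Suc r)" "f = const c * x ^ r + g"
          by (rule ord_ge_decomp[OF f(1)])
        show "u \<in> h.S.line_extension (csB ` range const) (csB (x ^ r)) (csB ` ord_ge (Suc r))"
          unfolding h.S.line_extension_mem_iff
          by (rule bexI[of _ "csB (const c)"], rule bexI[of _ "csB g"]) (simp_all add: f(2) g eq)
      qed
    qed
    ultimately show ?case
      by (simp add: r_def)
  }
qed

text \<open>The dimension over a subfield is unique, so the relation holds for one number only.
  Positivity of \<open>n\<close> keeps the quotient ring nonzero.\<close>

lemma intersection_number_iff:
  assumes "n > 0"
  shows "has_intersection_number F (Const \<kappa> * L2) v k \<longleftrightarrow> k = n"
proof -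
  interpret h: ring_hom_ring RB "RB Quot J" csB
    by (rule csB_hom)
  have carr: "carrier (RB Quot J) = csB ` B"
    by (auto simp: FactRing_def A_RCOSETS_def' csB_def)
  have K: "csB ` range const = (\<lambda>c. J +>\<^bsub>RB\<^esub> Fraction_Field.Fract (Const c) 1) ` UNIV"
    by (simp add: image_image csB_def const_def)
  have iff: "has_intersection_number F (Const \<kappa> * L2) v k \<longleftrightarrow>
      h.S.dimension k (csB ` range const) (csB ` B)"
    unfolding has_intersection_number_def Let_def carr[symmetric] K hloc_eq B_def[symmetric] J_def[symmetric] ..
  have dim: "h.S.dimension n (csB ` range const) (csB ` B)"
    using dimension_ord_ge[of n] by (simp add: ord_ge_0)
  have "subfield (range const) RB"
  proof -
    have "ring_closed (range const)"
      by (intro ring_closedI) (auto simp: image_iff hom_simps[OF is_hom_const, symmetric])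
    then interpret C: cring "type_subring (range const)"
      by (rule cring_type_subring)
    have "field (type_subring (range const))"
    proof (rule C.cring_fieldI2)
      fix g assume "g \<in> carrier (type_subring (range const))" "g \<noteq> \<zero>\<^bsub>type_subring (range const)\<^esub>"
      then obtain c where c: "g = const c"
        by auto
      have "c \<noteq> 0"
        using \<open>g \<noteq> \<zero>\<^bsub>type_subring (range const)\<^esub>\<close> c by (auto simp: hom_0[OF is_hom_const])
      then have "g * const (inverse c) = 1"
        by (simp add: c hom_1[OF is_hom_const] flip: hom_mult[OF is_hom_const])
      then show "\<exists>h\<in>carrier (type_subring (range const)). g \<otimes>\<^bsub>type_subring (range const)\<^esub> h = \<one>\<^bsub>type_subring (range const)\<^esub>"
        by auto
    qed simp
    then show ?thesis
      using h.R.subfield_iff(1)[of "range const"] const_B by auto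
  qed
  moreover have "\<one>\<^bsub>RB Quot J\<^esub> \<noteq> \<zero>\<^bsub>RB Quot J\<^esub>"
  proof
    assume "\<one>\<^bsub>RB Quot J\<^esub> = \<zero>\<^bsub>RB Quot J\<^esub>"
    then have "csB 1 = csB 0"
      using h.hom_one h.hom_zero by simp
    then have "x ^ 0 \<in> ord_ge n"
      using csB_eq_iff[OF rc_1[OF ring_B] rc_0[OF ring_B]] by simp
    then show False
      using x_power_ord_ge(2)[of 0] ord_ge_mono[of "Suc 0" n] assms by auto
  qed
  ultimately have sf: "subfield (csB ` range const) (RB Quot J)"
    by (rule h.img_is_subfield(2))
  show ?thesis
    unfolding iff
  proof
    assume "h.S.dimension k (csB ` range const) (csB ` B)"
    then show "k = n"
      by (rule h.S.dimension_is_inj[OF sf _ dim])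
  next
    assume "k = n"
    then show "h.S.dimension k (csB ` range const) (csB ` B)"
      by (simp only: dim)
  qed
qed

end

end

section \<open>Irreducible perturbations\<close>

text \<open>Bolzano-Weierstrass, one coordinate after the other.\<close>

lemma bounded_subsequence:
  fixes f :: "nat \<Rightarrow> 'e \<Rightarrow> complex"
  assumes "finite M" "\<And>e. e \<in> M \<Longrightarrow> bounded (range (\<lambda>k. f k e))"
  shows "\<exists>r l. strict_mono r \<and> (\<forall>e\<in>M. (\<lambda>k. f (r k) e) \<longlonglongrightarrow> l e)"
  using assms
proof (induction M rule: finite_induct)
  case empty
  then show ?case
    by (intro exI[of _ id]) (simp add: strict_mono_def)
next
  case (insert e M)
  obtain r l where r: "strict_mono r" "\<forall>e\<in>M. (\<lambda>k. f (r k) e) \<longlonglongrightarrow> l e"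
    using insert by auto
  have "bounded (range (\<lambda>k. f (r k) e))"
    using insert.prems[of e] by (rule bounded_subset) auto
  from bounded_imp_convergent_subsequence[OF this]
  obtain z s where s: "strict_mono s" "((\<lambda>k. f (r k) e) \<circ> s) \<longlonglongrightarrow> z"
    by (elim exE conjE)
  have 1: "strict_mono (\<lambda>k. r (s k))"
    using strict_mono_o[OF r(1) s(1)] by (simp add: o_def)
  have 2: "(\<lambda>k. f (r (s k)) e') \<longlonglongrightarrow> l e'" if "e' \<in> M" for e'
    using LIMSEQ_subseq_LIMSEQ[OF bspec[OF r(2) that] s(1)] by (simp add: o_def)
  have "(\<lambda>k. f (r (s k)) e') \<longlonglongrightarrow> (l(e := z)) e'" if "e' \<in> insert e M" for e'
    using that 2[of e'] s(2) insert.hyps(2) by (cases "e' = e") (auto simp: o_def)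
  then show ?case
    using 1 by blast
qed

lemma Const_unit: "c \<noteq> 0 \<Longrightarrow> (Const c :: form) dvd 1"
proof -
  assume "c \<noteq> 0"
  then have "Const c * Const (inverse c) = (1 :: form)"
    by (simp add: hom_1[OF is_hom_Const] flip: hom_mult[OF is_hom_Const])
  then show ?thesis
    by (intro dvdI[of _ _ "Const (inverse c)"]) simp
qed

text \<open>Factors of a form are forms, so only factorizations into forms of positive degree have
  to be excluded.\<close>

lemma irreducible_form:
  fixes F :: form
  assumes F: "homogeneous d F" "F \<noteq> 0" "d > 0"
    and no: "\<And>i j A B. i > 0 \<Longrightarrow> j > 0 \<Longrightarrow> i + j = d \<Longrightarrow> homogeneous i A \<Longrightarrow> homogeneous j B \<Longrightarrow> F \<noteq> A * B"
  shows "irreducible F"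
proof (rule Factorial_Ring.irreducibleI)
  show "F \<noteq> 0"
    by (rule F)
  show "\<not> F dvd 1"
  proof
    assume "F dvd 1"
    then obtain G where G: "1 = F * G"
      by (elim dvdE)
    then have "G \<noteq> 0"
      by auto
    have "homogeneous 0 (F * G)"
      using homogeneous_1 G by simp
    from homogeneous_factor[OF this F(2) \<open>G \<noteq> 0\<close>] obtain i j where "homogeneous i F" "i + j = 0"
      by blast
    then show False
      using homogeneous_unique[OF F(1) _ F(2), of i] F(3) by simp
  qed
next
  fix A B assume AB: "F = A * B"
  then have nz: "A \<noteq> 0" "B \<noteq> 0"
    using F(2) by auto
  have "homogeneous d (A * B)"
    using F(1) AB by simp
  from homogeneous_factor[OF this nz] obtain i j where ij: "homogeneous i A" "homogeneous j B" "i + j = d"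
    by blast
  have unit: "G dvd 1" if G: "homogeneous 0 G" "G \<noteq> 0" for G :: form
  proof -
    obtain c where c: "G = Const c"
      using homogeneous_degree_0[OF G(1)] by blast
    then have "c \<noteq> 0"
      using G(2) by (auto simp: hom_0[OF is_hom_Const])
    then show ?thesis
      unfolding c by (rule Const_unit)
  qed
  show "A dvd 1 \<or> B dvd 1"
    using no[OF _ _ ij(3,1,2)] AB unit[of A] unit[of B] ij nz by (cases "i = 0"; cases "j = 0") auto
qed

context plane_basis
begin

definition pv :: "form \<Rightarrow> complex \<Rightarrow> complex \<Rightarrow> complex"
  where "pv F s t = lsubst (\<lambda>c. c) 1 s t F"

lemma is_hom_pv: "is_hom (\<lambda>F. pv F s t)"
  unfolding pv_def by (rule is_hom_lsubst[OF is_hom_id])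

lemma pv_sum:
  assumes "homogeneous d F"
  shows "pv F s t = (\<Sum>p\<in>triangle d. cf F (fst p) (snd p) * (s ^ fst p * t ^ snd p))"
  unfolding pv_def lsubst_homogeneous[OF is_hom_id assms] by (simp add: case_prod_beta)

lemma pv_aff: "pv F s t = poly (poly (aff F) [:t:]) s"
proof -
  have h: "is_hom (\<lambda>p :: complex poly poly. poly (poly p [:t:]) s)"
    by (rule is_hom_comp[OF is_hom_poly is_hom_poly])
  show ?thesis
    unfolding aff_def pv_def by (subst hom_lsubst[OF h]) simp
qed

lemma pv_eq_0:
  assumes F: "homogeneous d F" and 0: "\<And>s t. pv F s t = 0"
  shows "F = 0"
proof -
  have "poly (aff F) [:t:] = 0" for t
    using 0 poly_all_0_iff_0[of "poly (aff F) [:t:]"] by (simp add: pv_aff)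
  then have "range (\<lambda>t. [:t:]) \<subseteq> {p. poly (aff F) p = 0}"
    by auto
  moreover have "infinite (range (\<lambda>t :: complex. [:t:]))"
    using infinite_UNIV_char_0[where 'a = complex] by (simp add: finite_image_iff inj_on_def)
  ultimately have "aff F = 0"
    using poly_roots_finite[of "aff F"] finite_subset by blast
  then show ?thesis
    using F by (intro homogeneous_eqI[of d F 0]) (auto simp: cf_def hom_0[OF is_hom_aff])
qed

lemma peval_eq_0:
  fixes F :: form
  assumes "homogeneous d F" "\<And>w. peval w F = 0"
  shows "F = 0"
  using assms(2) by (intro pv_eq_0[OF assms(1)]) (simp add: pv_def flip: peval_lsubst)

text \<open>After normalization of the factors, compactness gives limits \<open>P\<close> and
  \<open>Q\<close> of norm 1, whose product is nonzero. The scalar is recovered at a point where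
  this product does not vanish.\<close>

lemma limit_factor:
  assumes A: "\<And>k. homogeneous i (A k)" and B: "\<And>k. homogeneous j (B k)" and F: "homogeneous (i + j) F" "F \<noteq> 0"
    and lim: "\<And>p q. (\<lambda>k. cf (A k * B k) p q) \<longlonglongrightarrow> cf F p q"
  shows "\<exists>A B. homogeneous i A \<and> homogeneous j B \<and> F = A * B"
proof -
  have "\<exists>p q. cf F p q \<noteq> 0"
  proof (rule ccontr)
    assume "\<not> ?thesis"
    then have "F = 0"
      by (intro homogeneous_eqI[OF F(1) homogeneous_0]) (auto simp: cf_def hom_0[OF is_hom_aff])
    then show False
      using F(2) by blast
  qed
  then obtain p0 q0 where "cf F p0 q0 \<noteq> 0"
    by blast
  then have "eventually (\<lambda>k. cf (A k * B k) p0 q0 \<noteq> 0) sequentially"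
    using lim by (intro tendsto_imp_eventually_ne)
  \<comment> \<open>Some coefficient of the limit is nonzero, so from \<open>N\<close> on both
    factors are nonzero and can be normalized.\<close>
  then obtain N where N: "\<And>k. k \<ge> N \<Longrightarrow> cf (A k * B k) p0 q0 \<noteq> 0"
    unfolding eventually_sequentially by blast
  define nA where "nA k = (\<Sum>p\<in>triangle i. cmod (cf (A (k + N)) (fst p) (snd p)))" for k
  define nB where "nB k = (\<Sum>p\<in>triangle j. cmod (cf (B (k + N)) (fst p) (snd p)))" for k
  have ne: "nrm \<noteq> 0" if "nrm = (\<Sum>p\<in>triangle e. cmod (cf G (fst p) (snd p)))" "homogeneous e G" "G \<noteq> 0" for nrm G e
  proof
    assume "nrm = 0"
    then have z: "\<forall>p\<in>triangle e. cf G (fst p) (snd p) = 0"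
      using that(1) by (simp add: sum_nonneg_eq_0_iff)
    have "cf G p q = cf 0 p q" if "p + q \<le> e" for p q
      using bspec[OF z, of "(p, q)"] that by (simp add: cf_def[of 0] hom_0[OF is_hom_aff])
    then have "G = 0"
      by (rule homogeneous_eqI[OF that(2) homogeneous_0])
    then show False
      using that(3) by blast
  qed
  have AB0: "A (k + N) \<noteq> 0" "B (k + N) \<noteq> 0" for k
    using N[of "k + N"] by (auto simp: cf_def hom_0[OF is_hom_aff])
  have n0: "nA k \<noteq> 0" "nB k \<noteq> 0" for k
    using ne[OF nA_def A AB0(1)] ne[OF nB_def B AB0(2)] by auto
  have npos: "nA k \<ge> 0" "nB k \<ge> 0" for k
    by (auto simp: nA_def nB_def intro: sum_nonneg)
  define A' where "A' k = Const (inverse (of_real (nA k))) * A (k + N)" for k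
  define B' where "B' k = Const (inverse (of_real (nB k))) * B (k + N)" for k
  have hA': "homogeneous i (A' k)" and hB': "homogeneous j (B' k)" for k
    unfolding A'_def B'_def by (intro homogeneous_Const_mult A B)+
  have n1: "(\<Sum>p\<in>triangle i. cmod (cf (A' k) (fst p) (snd p))) = 1"
      "(\<Sum>p\<in>triangle j. cmod (cf (B' k) (fst p) (snd p))) = 1" for k
    using n0[of k] npos[of k]
    by (simp_all add: A'_def B'_def cf_Const_mult norm_mult norm_inverse flip: sum_distrib_left nA_def nB_def)
  have le: "cmod (cf G p q) \<le> 1" if "homogeneous e G" "(\<Sum>p\<in>triangle e. cmod (cf G (fst p) (snd p))) = 1" for G e p q
  proof (cases "p + q \<le> e")
    case True
    then show ?thesis
      using member_le_sum[of "(p, q)" "triangle e" "\<lambda>p. cmod (cf G (fst p) (snd p))"] that(2) by simp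
  next
    case False
    then show ?thesis
      using cf_eq_0[OF that(1)] by simp
  qed
  define f where "f k e = (if fst e then cf (A' k) (fst (snd e)) (snd (snd e)) else cf (B' k) (fst (snd e)) (snd (snd e)))"
    for k and e :: "bool \<times> nat \<times> nat"
  have "\<exists>r l. strict_mono r \<and> (\<forall>e\<in>UNIV \<times> triangle (i + j). (\<lambda>k. f (r k) e) \<longlonglongrightarrow> l e)"
  proof (rule bounded_subsequence)
    show "bounded (range (\<lambda>k. f k e))" for e
      unfolding bounded_iff f_def using le[OF hA' n1(1)] le[OF hB' n1(2)] by (intro exI[of _ 1]) auto
  qed auto
  then obtain r l where r: "strict_mono r" and l: "\<And>e. snd e \<in> triangle (i + j) \<Longrightarrow> (\<lambda>k. f (r k) e) \<longlonglongrightarrow> l e"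
    by fastforce
  have lA: "(\<lambda>k. cf (A' (r k)) (fst p) (snd p)) \<longlonglongrightarrow> l (True, p)" if "p \<in> triangle i" for p
    using l[of "(True, p)"] that by (cases p) (simp add: f_def)
  have lB: "(\<lambda>k. cf (B' (r k)) (fst p) (snd p)) \<longlonglongrightarrow> l (False, p)" if "p \<in> triangle j" for p
    using l[of "(False, p)"] that by (cases p) (simp add: f_def)
  define P where "P = of_cf i (\<lambda>p q. l (True, (p, q)))"
  define Q where "Q = of_cf j (\<lambda>p q. l (False, (p, q)))"
  have hP: "homogeneous i P" "homogeneous j Q"
    by (simp_all add: P_def Q_def homogeneous_of_cf)
  have cP: "cf P (fst p) (snd p) = l (True, p)" if "p \<in> triangle i" for p
    using that by (cases p) (simp add: P_def cf_of_cf)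
  have cQ: "cf Q (fst p) (snd p) = l (False, p)" if "p \<in> triangle j" for p
    using that by (cases p) (simp add: Q_def cf_of_cf)
  have "(\<lambda>k. \<Sum>p\<in>triangle i. cmod (cf (A' (r k)) (fst p) (snd p))) \<longlonglongrightarrow> (\<Sum>p\<in>triangle i. cmod (l (True, p)))"
    by (intro tendsto_sum tendsto_norm lA)
  then have sP: "(\<Sum>p\<in>triangle i. cmod (l (True, p))) = 1"
    unfolding n1 by (simp add: LIMSEQ_const_iff)
  have "(\<lambda>k. \<Sum>p\<in>triangle j. cmod (cf (B' (r k)) (fst p) (snd p))) \<longlonglongrightarrow> (\<Sum>p\<in>triangle j. cmod (l (False, p)))"
    by (intro tendsto_sum tendsto_norm lB)
  then have sQ: "(\<Sum>p\<in>triangle j. cmod (l (False, p))) = 1"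
    unfolding n1 by (simp add: LIMSEQ_const_iff)
  have "P \<noteq> 0"
  proof
    assume "P = 0"
    then have "l (True, p) = 0" if "p \<in> triangle i" for p
      using cP[OF that] by (simp add: cf_def hom_0[OF is_hom_aff])
    then show False
      using sP by simp
  qed
  moreover have "Q \<noteq> 0"
  proof
    assume "Q = 0"
    then have "l (False, p) = 0" if "p \<in> triangle j" for p
      using cQ[OF that] by (simp add: cf_def hom_0[OF is_hom_aff])
    then show False
      using sQ by simp
  qed
  ultimately have "P * Q \<noteq> 0"
    by simp
  then obtain s0 t0 where s0: "pv (P * Q) s0 t0 \<noteq> 0"
    using pv_eq_0[OF homogeneous_mult[OF hP]] by blast
  have lim_A': "(\<lambda>k. pv (A' (r k)) s t) \<longlonglongrightarrow> pv P s t" for s t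
    unfolding pv_sum[OF hA'] pv_sum[OF hP(1)] by (intro tendsto_sum tendsto_mult tendsto_const) (simp add: cP lA)
  have lim_B': "(\<lambda>k. pv (B' (r k)) s t) \<longlonglongrightarrow> pv Q s t" for s t
    unfolding pv_sum[OF hB'] pv_sum[OF hP(2)] by (intro tendsto_sum tendsto_mult tendsto_const) (simp add: cQ lB)
  define G where "G k = A (r k + N) * B (r k + N)" for k
  have "(\<lambda>k. cf (G k) p q) \<longlonglongrightarrow> cf F p q" for p q
  proof -
    have "(\<lambda>k. cf (A (k + N) * B (k + N)) p q) \<longlonglongrightarrow> cf F p q"
      using lim by (rule LIMSEQ_ignore_initial_segment)
    from LIMSEQ_subseq_LIMSEQ[OF this r] show ?thesis
      by (simp add: o_def G_def)
  qed
  moreover have hG: "homogeneous (i + j) (G k)" for k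
    unfolding G_def by (intro homogeneous_mult A B)
  ultimately have lim_G: "(\<lambda>k. pv (G k) s t) \<longlonglongrightarrow> pv F s t" for s t
    unfolding pv_sum[OF F(1)] pv_sum[OF hG]
    by (intro tendsto_sum tendsto_mult tendsto_const)
  have GAB: "pv (G k) s t = of_real (nA (r k) * nB (r k)) * (pv (A' (r k)) s t * pv (B' (r k)) s t)" for k s t
  proof -
    have "pv (Const c) s t = c" for c
      by (simp add: pv_def lsubst_Const[OF is_hom_id])
    then show ?thesis
      using n0[of "r k"] by (simp add: G_def A'_def B'_def hom_mult[OF is_hom_pv] field_simps)
  qed
  \<comment> \<open>Cross multiplication removes the norms, about whose limits nothing is
    known.\<close>
  have eq: "pv (G k) s t * (pv (A' (r k)) s0 t0 * pv (B' (r k)) s0 t0) =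
      pv (G k) s0 t0 * (pv (A' (r k)) s t * pv (B' (r k)) s t)" for k s t
    unfolding GAB by (simp only: mult_ac)
  have lim_eq: "pv F s t * (pv P s0 t0 * pv Q s0 t0) = pv F s0 t0 * (pv P s t * pv Q s t)" for s t
  proof (rule LIMSEQ_unique)
    show "(\<lambda>k. pv (G k) s t * (pv (A' (r k)) s0 t0 * pv (B' (r k)) s0 t0)) \<longlonglongrightarrow> pv F s t * (pv P s0 t0 * pv Q s0 t0)"
      by (intro tendsto_mult lim_G lim_A' lim_B')
    show "(\<lambda>k. pv (G k) s t * (pv (A' (r k)) s0 t0 * pv (B' (r k)) s0 t0)) \<longlonglongrightarrow> pv F s0 t0 * (pv P s t * pv Q s t)"
      unfolding eq by (intro tendsto_mult lim_G lim_A' lim_B')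
  qed
  define c where "c = pv F s0 t0 / (pv P s0 t0 * pv Q s0 t0)"
  have "F - (Const c * P) * Q = 0"
  proof (rule pv_eq_0[of "i + j"])
    show "homogeneous (i + j) (F - (Const c * P) * Q)"
      by (intro homogeneous_diff F homogeneous_mult homogeneous_Const_mult hP)
    fix s t
    have pc: "pv (Const c) s t = c"
      by (simp add: pv_def lsubst_Const[OF is_hom_id])
    have "pv F s t = c * (pv P s t * pv Q s t)"
      using lim_eq[of s t] s0 unfolding c_def by (simp add: hom_mult[OF is_hom_pv] field_simps)
    then show "pv (F - (Const c * P) * Q) s t = 0"
      by (simp add: hom_diff[OF is_hom_pv] hom_mult[OF is_hom_pv] pc mult.assoc)
  qed
  then show ?thesis
    using hP by (intro exI[of _ "Const c * P"] exI[of _ Q]) (auto intro: homogeneous_Const_mult)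
qed

text \<open>If \<open>m < n\<close> and \<open>n \<le> d\<close>, none of its monomials lies below
  the Newton edge, so adding a multiple preserves the vanishing conditions. The last summand makes
  the coefficient of \<open>x ^ n\<close> equal to 1 also when \<open>n < d\<close>.\<close>

definition flex :: "nat \<Rightarrow> nat \<Rightarrow> form"
  where "flex d n = mon d d 0 + mon d 0 (d - 1) + (if n < d then mon d n 0 else 0)"

lemma homogeneous_flex: "homogeneous d (flex d n)"
  by (auto simp: flex_def intro!: homogeneous_add homogeneous_mon)

lemma cf_flex: "n \<le> d \<Longrightarrow> d \<ge> 2 \<Longrightarrow> cf (flex d n) i j =
    (if i = d \<and> j = 0 then 1 else 0) + (if i = 0 \<and> j = d - 1 then 1 else 0) + (if n < d \<and> i = n \<and> j = 0 then 1 else 0)"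
  by (auto simp: flex_def cf_add cf_mon cf_def[of 0] hom_0[OF is_hom_aff])

text \<open>The line \<open>L0 = 0\<close> meets \<open>flex d n\<close> only in the point \<open>b\<close>, where this curve is smooth.
  So two factors of positive degree would both vanish at \<open>b\<close>.\<close>

lemma flex_no_factor:
  assumes dn: "d \<ge> 2" "n > 0" and ij: "i > 0" "j > 0" "i + j = d" and A: "homogeneous i A" and B: "homogeneous j B"
  shows "flex d n \<noteq> A * B"
proof
  assume eq: "flex d n = A * B"
  have h: "is_hom (\<lambda>c :: complex. [:c:])"
    by (rule is_hom_pCons)
  \<comment> \<open>\<open>g\<close> restricts to the line \<open>L0 = 0\<close> and
    \<open>k\<close> to the line \<open>L1 = 0\<close>; in both parametrizations 0 corresponds to
    the point \<open>b\<close>.\<close>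
  define g where "g = lsubst (\<lambda>c. [:c:]) 0 [:0, 1:] (1 :: complex poly)"
  define k where "k = lsubst (\<lambda>c. [:c:]) [:0, 1:] 0 (1 :: complex poly)"
  have hg: "is_hom g" and hk: "is_hom k"
    unfolding g_def k_def by (intro is_hom_lsubst h)+
  have "g (flex d n) = [:0, 1:] ^ d"
    using dn unfolding flex_def by (simp add: hom_add[OF hg]) (simp add: g_def lsubst_mon[OF h] hom_0[OF is_hom_lsubst[OF h]])
  then have gAB: "g A * g B = [:0, 1:] ^ d"
    by (simp add: eq hom_mult[OF hg])
  have "k (flex d n) = [:0, 1:]"
    using dn unfolding flex_def
    by (simp add: hom_add[OF hk]) (simp add: k_def lsubst_mon[OF h] hom_0[OF is_hom_lsubst[OF h]] power_0_left)
  then have kAB: "k A * k B = [:0, 1:]"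
    by (simp add: eq hom_mult[OF hk])
  have dg: "degree (g G) \<le> e" if "homogeneous e G" for e G
  proof -
    have "degree ([:cf G p q:] * ([:0, 1:] ^ p * 1 ^ q * 0 ^ (e - p - q))) \<le> e" if "p + q \<le> e" for p q
    proof (cases "e - p - q = 0")
      case True
      have "degree ([:cf G p q:] * [:0, 1 :: complex:] ^ p) \<le> 0 + p"
        by (rule order_trans[OF degree_mult_le add_mono]) (auto intro: order_trans[OF degree_power_le])
      then show ?thesis
        using True that by simp
    qed (simp add: power_0_left)
    then show ?thesis
      unfolding g_def lsubst_homogeneous[OF h that] by (intro degree_sum_le) auto
  qed
  have "degree (g A * g B) = d"
    by (simp add: gAB degree_linear_power)
  moreover have nz: "g A \<noteq> 0" "g B \<noteq> 0"
    using gAB by auto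
  ultimately have "degree (g A) + degree (g B) = d"
    by (simp add: degree_mult_eq)
  then have deg: "degree (g A) > 0" "degree (g B) > 0"
    using dg[OF A] dg[OF B] ij by linarith+
  have root: "poly p 0 = 0" if p: "degree p > 0" "p dvd [:0, 1 :: complex:] ^ d" for p
  proof -
    have "\<not> constant (poly p)"
      using p(1) by (simp add: constant_degree)
    then obtain z where z: "poly p z = 0"
      using fundamental_theorem_of_algebra by blast
    obtain p' where "[:0, 1:] ^ d = p * p'"
      using p(2) by (elim dvdE)
    then have "poly ([:0, 1:] ^ d) z = poly (p * p') z"
      by simp
    then have "z ^ d = 0"
      using z by (simp add: poly_power)
    then show ?thesis
      using z by simp
  qed
  have gk: "poly (g G) 0 = poly (k G) 0" for G
    unfolding g_def k_def by (simp add: hom_lsubst[OF is_hom_poly])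
  have "poly (k A) 0 = 0" "poly (k B) 0 = 0"
    using root[OF deg(1)] root[OF deg(2)] gAB unfolding gk[symmetric] by (metis dvd_triv_left dvd_triv_right)+
  then have "coeff (k A) 0 = 0" "coeff (k B) 0 = 0"
    by (simp_all add: poly_0_coeff_0)
  \<comment> \<open>Two factors vanishing at \<open>b\<close> give a product of order at least 2 on
    the line, but \<open>flex d n\<close> has order 1 there.\<close>
  then have "coeff (k A * k B) 1 = 0"
    by (simp add: coeff_mult)
  then show False
    by (simp add: kAB)
qed

text \<open>Otherwise \<open>flex d n + G / k\<close> factors for almost all \<open>k\<close>. Along
  a subsequence with constant degrees of the factors it tends to \<open>flex d n\<close>, which
  would then factor by \<open>limit_factor\<close>.\<close>

lemma infinite_irreducible:
  assumes G: "homogeneous d G" and dn: "d \<ge> 2" "0 < n" "n \<le> d"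
  shows "infinite {k :: nat. irreducible (G + Const (of_nat k) * flex d n)}"
proof
  assume fin: "finite {k :: nat. irreducible (G + Const (of_nat k) * flex d n)}"
  define T where "T = {k :: nat. k > 0 \<and> \<not> irreducible (G + Const (of_nat k) * flex d n)}"
  have "UNIV = T \<union> insert 0 {k :: nat. irreducible (G + Const (of_nat k) * flex d n)}"
    by (auto simp: T_def)
  then have "infinite T"
    using fin infinite_UNIV_nat by (metis finite_Un finite_insert)
  have ex: "\<forall>k\<in>T. \<exists>x. fst x > 0 \<and> fst x < d \<and> homogeneous (fst x) (fst (snd x)) \<and> homogeneous (d - fst x) (snd (snd x)) \<and>
      flex d n + Const (inverse (of_nat k)) * G = fst (snd x) * snd (snd x)"
  proof
    fix k assume k: "k \<in> T"
    define H where "H = G + Const (of_nat k) * flex d n"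
    have hH: "homogeneous d H"
      unfolding H_def by (intro homogeneous_add G homogeneous_Const_mult homogeneous_flex)
    have k0: "k \<noteq> 0" "\<not> irreducible H"
      using k by (auto simp: T_def H_def)
    have "Const (inverse (of_nat k)) * Const (of_nat k) = (1 :: form)"
      using k0 by (simp add: hom_1[OF is_hom_Const] flip: hom_mult[OF is_hom_Const])
    then have kH: "flex d n + Const (inverse (of_nat k)) * G = Const (inverse (of_nat k)) * H"
      by (simp add: H_def distrib_left mult.assoc[symmetric])
    show "\<exists>x. fst x > 0 \<and> fst x < d \<and> homogeneous (fst x) (fst (snd x)) \<and> homogeneous (d - fst x) (snd (snd x)) \<and>
      flex d n + Const (inverse (of_nat k)) * G = fst (snd x) * snd (snd x)"
    proof (cases "H = 0")
      case True
      then show ?thesis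
        using dn unfolding kH by (intro exI[of _ "(1, 0, 0)"]) simp
    next
      case False
      have "\<exists>i j A B. i > 0 \<and> j > 0 \<and> i + j = d \<and> homogeneous i A \<and> homogeneous j B \<and> H = A * B"
      proof (rule ccontr)
        assume no: "\<not> ?thesis"
        have "irreducible H"
        proof (rule irreducible_form[OF hH False])
          fix i j and A B :: form
          assume "i > 0" "j > 0" "i + j = d" "homogeneous i A" "homogeneous j B"
          with no show "H \<noteq> A * B"
            by blast
        qed (use dn in simp)
        then show False
          using k0(2) by blast
      qed
      then obtain i j A B where ij: "i > 0" "j > 0" "i + j = d" "homogeneous i A" "homogeneous j B" "H = A * B"
        by (elim exE conjE)
      have "d - i = j" "i < d"
        using ij by simp_all
      then show ?thesis
        unfolding kH using ij by (intro exI[of _ "(i, Const (inverse (of_nat k)) * A, B)"])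
          (simp add: homogeneous_Const_mult mult.assoc)
    qed
  qed
  from bchoice[OF ex] obtain x where xx: "\<forall>k\<in>T. fst (x k) > 0 \<and> fst (x k) < d \<and> homogeneous (fst (x k)) (fst (snd (x k))) \<and> homogeneous (d - fst (x k)) (snd (snd (x k))) \<and>
      flex d n + Const (inverse (of_nat k)) * G = fst (snd (x k)) * snd (snd (x k))"
    by (elim exE)
  have x: "fst (x k) > 0 \<and> fst (x k) < d \<and> homogeneous (fst (x k)) (fst (snd (x k))) \<and> homogeneous (d - fst (x k)) (snd (snd (x k))) \<and>
      flex d n + Const (inverse (of_nat k)) * G = fst (snd (x k)) * snd (snd (x k))" if "k \<in> T" for k
    by (rule bspec[OF xx that])
  have "finite ((\<lambda>k. fst (x k)) ` T)"
    by (rule finite_subset[of _ "{..<d}"]) (use x in auto)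
  from pigeonhole_infinite[OF \<open>infinite T\<close> this]
  obtain k0 where k0: "k0 \<in> T" "infinite {k \<in> T. fst (x k) = fst (x k0)}"
    by (elim bexE)
  from infinite_enumerate[OF k0(2)] obtain r :: "nat \<Rightarrow> nat" where r0: "strict_mono r" "\<forall>k. r k \<in> {k \<in> T. fst (x k) = fst (x k0)}"
    by (elim exE conjE)
  note r = r0(1) spec[OF r0(2)]
  define i where "i = fst (x k0)"
  have i: "0 < i" "i < d"
    using x[OF k0(1)] by (auto simp: i_def)
  have xr: "homogeneous i (fst (snd (x (r k))))" "homogeneous (d - i) (snd (snd (x (r k))))"
    "flex d n + Const (inverse (of_nat (r k))) * G = fst (snd (x (r k))) * snd (snd (x (r k)))" for k
    using r(2)[of k] x[of "r k"] by (simp_all add: i_def)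
  have lim0: "(\<lambda>k. inverse (of_nat (r k)) :: complex) \<longlonglongrightarrow> 0"
    using LIMSEQ_subseq_LIMSEQ[OF lim_inverse_n r(1)] by (simp add: o_def)
  have id: "i + (d - i) = d"
    using i by simp
  have "flex d n \<noteq> 0"
    using cf_flex[OF dn(3,1), of d 0] dn by (auto simp: cf_def hom_0[OF is_hom_aff] split: if_splits)
  have "\<exists>A B. homogeneous i A \<and> homogeneous (d - i) B \<and> flex d n = A * B"
  proof (rule limit_factor[OF xr(1,2)])
    show "homogeneous (i + (d - i)) (flex d n)"
      unfolding id by (rule homogeneous_flex)
    show "(\<lambda>k. cf (fst (snd (x (r k))) * snd (snd (x (r k)))) p q) \<longlonglongrightarrow> cf (flex d n) p q" for p q
      using tendsto_add[OF tendsto_const tendsto_mult[OF lim0 tendsto_const], of "cf (flex d n) p q" "cf G p q"]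
      unfolding xr(3)[symmetric] by (simp add: cf_add cf_Const_mult)
  qed fact
  then show False
    using flex_no_factor[OF dn(1,2) i(1) _ id] i by auto
qed

end

section \<open>Multiplicity and tangent cone\<close>

text \<open>Choose a functional dual to \<open>v\<close> and a vector dual to \<open>l\<close>, and
  take cross products for the third pair. Orthogonality is automatic, and the pairing of the two
  cross products is a 2 by 2 determinant of pairings, equal to 1.\<close>

lemma plane_basis_ex:
  assumes v: "v \<noteq> (\<lambda>_. 0)" and l: "l \<noteq> (\<lambda>_. 0)" and lv: "pairing l v = 0"
  shows "\<exists>a b v' a'. plane_basis v a b v' a' l"
proof -
  have P: "pairing c w = c 1 * w 1 + c 2 * w 2 + c 3 * w 3" for c w
    by (simp add: pairing_def sum_3)
  have ex: "\<exists>u. pairing u w = 1" if w: "w \<noteq> (\<lambda>_. 0)" for w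
  proof -
    obtain i where i: "w i \<noteq> 0"
      using w by blast
    have "pairing (\<lambda>j. if j = i then 1 / w i else 0) w = (\<Sum>j\<in>UNIV. if j = i then 1 / w i * w i else 0)"
      unfolding pairing_def by (intro sum.cong) auto
    also have "\<dots> = 1"
      using i by simp
    finally show ?thesis
      by blast
  qed
  obtain u where u: "pairing u v = 1"
    using ex[OF v] by blast
  obtain b0 where "pairing b0 l = 1"
    using ex[OF l] by blast
  then have b0: "pairing l b0 = 1"
    by (simp add: P mult.commute)
  define b where "b i = b0 i - pairing u b0 * v i" for i
  have pb: "pairing f b = pairing f b0 - pairing u b0 * pairing f v" for f
    unfolding P[of f b] P[of f b0] P[of f v] b_def by (simp add: algebra_simps)
  have lb: "pairing l b = 1" and ub: "pairing u b = 0"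
    by (simp_all add: pb b0 lv u)
  have n3: "(2 :: 3) \<noteq> 1" "(3 :: 3) \<noteq> 1" "(3 :: 3) \<noteq> 2"
    using vector_3[of "0 :: nat" 1 2] by auto
  note n3 = n3 n3[symmetric]
  define cr where "cr f g i = (if i = 1 then f 2 * g 3 - f 3 * g 2 else if i = 2 then f 3 * g 1 - f 1 * g 3
    else f 1 * g 2 - f 2 * g 1)" for f g :: "3 \<Rightarrow> complex" and i :: 3
  have cr: "cr f g 1 = f 2 * g 3 - f 3 * g 2" "cr f g 2 = f 3 * g 1 - f 1 * g 3" "cr f g 3 = f 1 * g 2 - f 2 * g 1" for f g
    by (simp_all add: cr_def n3)
  define a where "a = cr u l"
  define a' where "a' = cr v b"
  have ua: "pairing u a = 0" "pairing l a = 0" "pairing a' v = 0" "pairing a' b = 0"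
    by (simp_all add: a_def a'_def P cr algebra_simps)
  note D = u ua(1) ub ua(3,4) lv ua(2) lb
  have "pairing a' a = pairing u v * pairing l b - pairing l v * pairing u b"
    by (simp add: a_def a'_def P cr algebra_simps)
  then have D': "pairing a' a = 1"
    by (simp add: D)
  define R where "R = (\<chi> (i :: 3) (j :: 3). if i = 1 then u j else if i = 2 then a' j else l j)"
  define C where "C = (\<chi> (i :: 3) (j :: 3). if j = 1 then v i else if j = 2 then a i else b i)"
  have mm: "vec_nth (vec_nth (A ** A') i) j = vec_nth (vec_nth A i) 1 * vec_nth (vec_nth A' 1) j + vec_nth (vec_nth A i) 2 * vec_nth (vec_nth A' 2) j + vec_nth (vec_nth A i) 3 * vec_nth (vec_nth A' 3) j"
    for A A' :: "((complex, 3) Finite_Cartesian_Product.vec, 3) Finite_Cartesian_Product.vec" and i j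
    by (simp add: matrix_matrix_mult_def sum_3)
  have mat1: "vec_nth (vec_nth (Finite_Cartesian_Product.mat 1 :: ((complex, 3) Finite_Cartesian_Product.vec, 3) Finite_Cartesian_Product.vec) i) j = (if i = j then 1 else 0)" for i j
    by (simp add: Finite_Cartesian_Product.mat_def)
  have R: "vec_nth (vec_nth R 1) j = u j" "vec_nth (vec_nth R 2) j = a' j" "vec_nth (vec_nth R 3) j = l j" for j
    by (simp_all add: R_def n3)
  have C: "vec_nth (vec_nth C i) 1 = v i" "vec_nth (vec_nth C i) 2 = a i" "vec_nth (vec_nth C i) 3 = b i" for i
    by (simp_all add: C_def n3)
  note Pr = D[unfolded P] D'[unfolded P]
  \<comment> \<open>Duality says that \<open>R\<close> is a left inverse of \<open>C\<close>;
    \<open>complete\<close> is the statement that it is a right inverse.\<close>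
  have "R ** C = Finite_Cartesian_Product.mat 1"
    unfolding Finite_Cartesian_Product.vec_eq_iff forall_3 mm mat1 R C Pr by (simp only: n3 simp_thms if_True if_False)
  then have CR: "C ** R = Finite_Cartesian_Product.mat 1"
    by (rule iffD1[OF matrix_left_right_inverse])
  have "v i * u j + a i * a' j + b i * l j = (if i = j then 1 else 0)" for i j
    using mm[of C R i j] unfolding CR mat1 R C by simp
  then have "plane_basis v a b u a' l"
    using D D' by (unfold_locales) simp_all
  then show ?thesis
    by blast
qed

text \<open>The locus allows any coordinate vector of the point. Scaling the whole basis follows
  that choice and multiplies all coefficients of a form by one constant.\<close>

lemma plane_basis_scale:
  assumes "plane_basis v a b v' a' b'" "\<tau> \<noteq> 0"
  shows "plane_basis (\<lambda>i. \<tau> * v i) (\<lambda>i. \<tau> * a i) (\<lambda>i. \<tau> * b i) (\<lambda>i. v' i / \<tau>) (\<lambda>i. a' i / \<tau>) (\<lambda>i. b' i / \<tau>)"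
proof -
  interpret plane_basis v a b v' a' b'
    by (rule assms)
  have "pairing (\<lambda>i. c i / \<tau>) (\<lambda>i. \<tau> * w i) = pairing c w" for c w
    using assms(2) by (simp add: pairing_def)
  moreover have "\<tau> * v i * (v' j / \<tau>) + \<tau> * a i * (a' j / \<tau>) + \<tau> * b i * (b' j / \<tau>) =
      v i * v' j + a i * a' j + b i * b' j" for i j
    using assms(2) by simp
  ultimately show ?thesis
    by unfold_locales (simp_all add: dual complete)
qed

lemma lin_scale: "lin (\<lambda>i. c i / \<tau>) = Const (1 / \<tau>) * lin c"
  by (simp add: lin_def sum_distrib_left divide_inverse hom_mult[OF is_hom_Const] mult_ac)

lemma peval_translate: "peval w (translate v F) = peval (\<lambda>i. w i + v i) F"
  unfolding translate_def hom_psubst[OF is_hom_peval]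
  by (simp add: hom_add[OF is_hom_peval] peval_Var) (simp add: peval_def)

lemma peval_hom_parts:
  obtains N where "\<And>M s. M \<ge> N \<Longrightarrow> peval (\<lambda>i. s * w i) G = (\<Sum>k\<le>M. s ^ k * peval w (hom_part k G))"
proof -
  obtain N where N: "\<And>M. M \<ge> N \<Longrightarrow> G = (\<Sum>k\<le>M. hom_part k G)"
    using sum_hom_part[of G] by blast
  have "peval (\<lambda>i. s * w i) G = (\<Sum>k\<le>M. s ^ k * peval w (hom_part k G))" if "M \<ge> N" for M s
  proof -
    have "peval (\<lambda>i. s * w i) G = peval (\<lambda>i. s * w i) (\<Sum>k\<le>M. hom_part k G)"
      using N[OF that] by simp
    also have "\<dots> = (\<Sum>k\<le>M. s ^ k * peval w (hom_part k G))"
      by (simp add: hom_sum[OF is_hom_peval] peval_scale[OF homogeneous_hom_part])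
    finally show ?thesis .
  qed
  then show thesis
    by (rule that)
qed

context plane_basis
begin

lemma cf_scale:
  assumes "\<tau> \<noteq> 0" "homogeneous d F"
  shows "plane_basis.cf (\<lambda>i. \<tau> * v i) (\<lambda>i. \<tau> * a i) (\<lambda>i. \<tau> * b i) F i j = \<tau> ^ d * cf F i j"
proof -
  interpret s: plane_basis "\<lambda>i. \<tau> * v i" "\<lambda>i. \<tau> * a i" "\<lambda>i. \<tau> * b i" "\<lambda>i. v' i / \<tau>" "\<lambda>i. a' i / \<tau>" "\<lambda>i. b' i / \<tau>"
    by (rule plane_basis_scale[OF plane_basis_axioms assms(1)])
  have mon: "mon d i j = Const (\<tau> ^ d) * s.mon d i j" if "i + j \<le> d" for i j
  proof -
    have "\<tau> ^ d = \<tau> ^ i * \<tau> ^ j * \<tau> ^ (d - i - j)"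
      using that by (simp flip: power_add)
    then have "Const (\<tau> ^ d) * (Const (1 / \<tau>) ^ i * Const (1 / \<tau>) ^ j * Const (1 / \<tau>) ^ (d - i - j)) = (1 :: form)"
      using assms(1) by (simp add: power_one_over hom_1[OF is_hom_Const] flip: hom_power[OF is_hom_Const] hom_mult[OF is_hom_Const])
    then have "mon d i j = Const (\<tau> ^ d) * (Const (1 / \<tau>) ^ i * Const (1 / \<tau>) ^ j * Const (1 / \<tau>) ^ (d - i - j)) * mon d i j"
      by simp
    then show ?thesis
      unfolding s.mon_def mon_def lin_scale power_mult_distrib by (simp only: mult_ac)
  qed
  have "F = of_cf d (cf F)"
    using of_cf_cf[OF assms(2)] by simp
  also have "\<dots> = s.of_cf d (\<lambda>i j. \<tau> ^ d * cf F i j)"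
    unfolding of_cf_def s.of_cf_def
    by (intro sum.cong) (auto simp: mon hom_mult[OF is_hom_Const] mult_ac)
  finally have F: "F = s.of_cf d (\<lambda>i j. \<tau> ^ d * cf F i j)" .
  have "s.cf F i j = s.cf (s.of_cf d (\<lambda>i j. \<tau> ^ d * cf F i j)) i j"
    using F by simp
  then show ?thesis
    using cf_eq_0[OF assms(2), of i j] by (simp add: s.cf_of_cf not_le)
qed

lemma coordinates: "w i = pairing v' w * v i + pairing a' w * a i + pairing b' w * b i"
proof -
  have "peval w (Var i) = peval w (Const (v i) * L0 + Const (a i) * L1 + Const (b i) * L2)"
    by (subst Var_eq) simp
  then show ?thesis
    by (simp add: peval_Var hom_add[OF is_hom_peval] hom_mult[OF is_hom_peval] peval_lin mult.commute)
qed

text \<open>The value of \<open>F\<close> at \<open>v + s w\<close> as a polynomial in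
  \<open>s\<close>, expressed through the dual coordinates of \<open>w\<close>.\<close>

definition taylor :: "nat \<Rightarrow> form \<Rightarrow> (3 \<Rightarrow> complex) \<Rightarrow> complex poly"
  where "taylor d F w = (\<Sum>p\<in>triangle d. monom (cf F (fst p) (snd p) * (pairing a' w ^ fst p * pairing b' w ^ snd p))
    (fst p + snd p) * [:1, pairing v' w:] ^ (d - fst p - snd p))"

lemma peval_hom_part_translate:
  assumes F: "homogeneous d F"
  shows "peval w (hom_part k (translate v F)) = coeff (taylor d F w) k"
proof -
  obtain N where N: "\<And>M s. M \<ge> N \<Longrightarrow> peval (\<lambda>i. s * w i) (translate v F) =
      (\<Sum>k\<le>M. s ^ k * peval w (hom_part k (translate v F)))"
    by (rule peval_hom_parts[where w = w and G = "translate v F"]) blast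
  define M where "M = max N k"
  define Q where "Q = (\<Sum>k\<le>M. monom (peval w (hom_part k (translate v F))) k)"
  have "poly Q s = poly (taylor d F w) s" for s
  proof -
    have "poly Q s = peval (\<lambda>i. s * w i) (translate v F)"
      using N[of M s] by (simp add: Q_def M_def poly_sum poly_monom mult.commute)
    also have "\<dots> = peval (\<lambda>i. (1 + s * pairing v' w) * v i + (s * pairing a' w) * a i + (s * pairing b' w) * b i) F"
      unfolding peval_translate
      by (intro arg_cong[of _ _ "\<lambda>u. peval u F"] ext, subst coordinates[of w]) (simp add: algebra_simps)
    also have "\<dots> = poly (taylor d F w) s"
      unfolding peval_lsubst lsubst_homogeneous[OF is_hom_id F]
      by (simp add: taylor_def poly_sum poly_monom case_prod_beta power_mult_distrib power_add mult_ac)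
    finally show ?thesis .
  qed
  then have "Q = taylor d F w"
    by (simp add: poly_eq_poly_eq_iff[symmetric] ext)
  moreover have "coeff Q k = peval w (hom_part k (translate v F))"
    by (simp add: Q_def coeff_sum M_def)
  ultimately show ?thesis
    by simp
qed

lemma peval_hom_part_translate_b:
  assumes F: "homogeneous d F"
  shows "peval b (hom_part k (translate v F)) = cf F 0 k"
proof -
  have "coeff (taylor d F b) k = (\<Sum>p\<in>triangle d. if p = (0, k) then cf F 0 k else 0)"
    unfolding taylor_def coeff_sum
    by (intro sum.cong) (auto simp: dual power_0_left prod_eq_iff coeff_monom_mult simp flip: one_pCons split: if_splits)
  also have "\<dots> = (if 0 + k \<le> d then cf F 0 k else 0)"
    by (rule triangle_delta)
  finally show ?thesis
    using cf_eq_0[OF F, of 0 k] by (simp add: peval_hom_part_translate[OF F])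
qed

text \<open>As \<open>m < n\<close>, points on or above the edge satisfy
  \<open>i + j \<ge> m\<close>, with equality only at \<open>(0, m)\<close>. So the lowest Taylor
  part is a multiple of the \<open>m\<close>-th power of the line.\<close>

lemma newton_multiplicity:
  assumes F: "homogeneous d F" and mn: "0 < m" "m < n" "m \<le> d"
    and W: "\<And>i j. cf F i j \<noteq> 0 \<Longrightarrow> m * n \<le> m * i + n * j" and m0: "cf F 0 m \<noteq> 0"
  shows "multiplicity_at F v = m" "peval w (hom_part m (translate v F)) = cf F 0 m * pairing b' w ^ m"
proof -
  have low: "m < i + j \<or> (i, j) = (0, m)" if "cf F i j \<noteq> 0" for i j
  proof (rule ccontr)
    assume "\<not> ?thesis"
    then have ij: "i + j \<le> m" "(i, j) \<noteq> (0, m)"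
      by auto
    then have "j < m"
      by auto
    have le: "m * i + m * j \<le> m * m"
      using mult_le_mono2[OF ij(1), of m] by (simp only: distrib_left)
    obtain e where e: "n = m + e" "e > 0"
      using mn(2) less_imp_add_positive by blast
    have lt: "e * j < e * m"
      using e(2) \<open>j < m\<close> by simp
    have "m * (m + e) \<le> m * i + (m + e) * j"
      using W[OF that] by (simp only: e(1))
    then have "m * m + e * m \<le> m * i + m * j + e * j"
      by (simp only: distrib_left distrib_right mult.commute[of m e] add.assoc)
    then show False
      using le lt by linarith
  qed
  have co: "coeff (taylor d F w) k = (if k = m then cf F 0 m * pairing b' w ^ m else 0)" if "k \<le> m" for k w
  proof -
    have "coeff (taylor d F w) k = (\<Sum>p\<in>triangle d. if p = (0, m) then (if k = m then cf F 0 m * pairing b' w ^ m else 0) else 0)"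
      unfolding taylor_def coeff_sum
    proof (intro sum.cong refl)
      fix p assume "p \<in> triangle d"
      show "coeff (monom (cf F (fst p) (snd p) * (pairing a' w ^ fst p * pairing b' w ^ snd p)) (fst p + snd p) *
          [:1, pairing v' w:] ^ (d - fst p - snd p)) k =
        (if p = (0, m) then (if k = m then cf F 0 m * pairing b' w ^ m else 0) else 0)"
        using low[of "fst p" "snd p"] that m0
        by (cases "cf F (fst p) (snd p) = 0")
          (auto simp: coeff_monom_mult prod_eq_iff poly_0_coeff_0[symmetric] poly_power)
    qed
    also have "\<dots> = (if 0 + m \<le> d then (if k = m then cf F 0 m * pairing b' w ^ m else 0) else 0)"
      by (rule triangle_delta)
    finally show ?thesis
      using mn(3) by simp
  qed
  show top: "peval w (hom_part m (translate v F)) = cf F 0 m * pairing b' w ^ m" for w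
    by (simp add: peval_hom_part_translate[OF F] co)
  show "multiplicity_at F v = m"
    unfolding multiplicity_at_def
  proof (rule Least_equality)
    show "hom_part m (translate v F) \<noteq> 0"
      using top[of b] m0 by (auto simp: dual hom_0[OF is_hom_peval])
    fix k assume k: "hom_part k (translate v F) \<noteq> 0"
    show "m \<le> k"
    proof (rule ccontr)
      assume "\<not> m \<le> k"
      then have "hom_part k (translate v F) = 0"
        by (intro peval_eq_0[OF homogeneous_hom_part]) (simp add: peval_hom_part_translate[OF F] co)
      then show False
        using k by blast
    qed
  qed
qed

text \<open>The point \<open>b\<close> is off the line, hence not in the tangent cone, and the
  lowest Taylor part has the coefficient of \<open>y ^ m\<close> as its value at
  \<open>b\<close>.\<close>

lemma multiplicity_column:
  assumes F: "homogeneous d F" and m: "multiplicity_at F v = m"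
    and tc: "tangent_cone F v \<subseteq> {x. \<forall>w\<in>x. peval w L2 = 0}"
  shows "j < m \<Longrightarrow> cf F 0 j = 0" "cf F 0 m \<noteq> 0"
proof -
  show "cf F 0 j = 0" if "j < m" for j
  proof -
    have "hom_part j (translate v F) = 0"
      using not_less_Least[of j "\<lambda>k. hom_part k (translate v F) \<noteq> 0"] that m by (simp add: multiplicity_at_def)
    then show ?thesis
      using peval_hom_part_translate_b[OF F, of j] by (simp add: hom_0[OF is_hom_peval])
  qed
  show "cf F 0 m \<noteq> 0"
  proof
    assume "cf F 0 m = 0"
    then have "peval b (hom_part m (translate v F)) = 0"
      by (simp add: peval_hom_part_translate_b[OF F])
    moreover have bI: "b \<in> coord_vectors UNIV"
    proof -
      have "\<exists>i. b i \<noteq> 0"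
      proof (rule ccontr)
        assume "\<not> ?thesis"
        then have "pairing b' b = 0"
          by (simp add: pairing_def)
        then show False
          using dual(9) by simp
      qed
      then show ?thesis
        by (simp add: coord_vectors_def)
    qed
    ultimately have "proj_point b \<in> tangent_cone F v"
      using proj_zeros_iff[OF bI, of "{hom_part m (translate v F)}"] homogeneous_hom_part
      unfolding tangent_cone_def m by blast
    then have "peval b L2 = 0"
      using tc proj_point_self by blast
    then show False
      by (simp add: peval_lin dual)
  qed
qed

end

section \<open>Chains of closed sets\<close>

lemma proj_point_eq: "w \<in> proj_point v \<Longrightarrow> proj_point w = proj_point v"
proof -
  assume "w \<in> proj_point v"
  then obtain c where c: "c \<noteq> 0" "w = (\<lambda>i. c * v i)"
    unfolding proj_point_def by blast
  show ?thesis
  proof (intro equalityI subsetI)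
    fix u assume "u \<in> proj_point w"
    then obtain e where "e \<noteq> 0" "u = (\<lambda>i. e * (c * v i))"
      unfolding proj_point_def c(2) by blast
    then have "u = (\<lambda>i. (e * c) * v i)" "e * c \<noteq> 0"
      using c(1) by (auto simp: mult.assoc)
    then show "u \<in> proj_point v"
      unfolding proj_point_def by blast
  next
    fix u assume "u \<in> proj_point v"
    then obtain e where "e \<noteq> 0" "u = (\<lambda>i. e * v i)"
      unfolding proj_point_def by blast
    then have "u = (\<lambda>i. (e / c) * w i)" "e / c \<noteq> 0"
      using c by auto
    then show "u \<in> proj_point w"
      unfolding proj_point_def by blast
  qed
qed

lemma equations_proj_point: "equations (proj_point (Poly_Mapping.lookup F)) = {Const c * F | c. c \<noteq> 0}"
proof (intro equalityI subsetI)
  fix G assume "G \<in> equations (proj_point (Poly_Mapping.lookup F))"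
  then obtain c where c: "c \<noteq> 0" "Poly_Mapping.lookup G = (\<lambda>i. c * Poly_Mapping.lookup F i)"
    unfolding equations_def proj_point_def by blast
  have "G = Const c * F"
    by (intro poly_mapping_eqI) (simp add: c(2) lookup_Const_mult)
  then show "G \<in> {Const c * F | c. c \<noteq> 0}"
    using c(1) by blast
next
  fix G assume "G \<in> {Const c * F | c. c \<noteq> 0}"
  then obtain c where c: "c \<noteq> 0" "G = Const c * F"
    by blast
  have "Poly_Mapping.lookup G = (\<lambda>i. c * Poly_Mapping.lookup F i)"
    by (intro ext) (simp add: c(2) lookup_Const_mult)
  then show "G \<in> equations (proj_point (Poly_Mapping.lookup F))"
    using c(1) unfolding equations_def proj_point_def by blast
qed

lemma closure_vanishes:
  assumes P: "homogeneous k P" and A: "A \<subseteq> coord_vectors I" "\<And>v. v \<in> A \<Longrightarrow> peval v P = 0"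
    and w: "proj_point w \<in> zariski I closure_of (proj_point ` A)" "w \<in> coord_vectors I"
  shows "peval w P = 0"
proof -
  have hom: "\<forall>p\<in>{P}. \<exists>k. homogeneous k p"
    using P by blast
  have "proj_point ` A \<subseteq> proj_zeros I {P}"
  proof
    fix x assume "x \<in> proj_point ` A"
    then obtain v where v: "v \<in> A" "x = proj_point v"
      by blast
    have "v \<in> coord_vectors I"
      using v(1) A(1) by blast
    from proj_zeros_iff[OF this hom] show "x \<in> proj_zeros I {P}"
      using A(2)[OF v(1)] by (simp add: v(2))
  qed
  moreover have "closedin (zariski I) (proj_zeros I {P})"
    unfolding closedin_zariski using hom by blast
  ultimately have "zariski I closure_of (proj_point ` A) \<subseteq> proj_zeros I {P}"
    by (rule closure_of_minimal)
  then show ?thesis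
    using w(1) proj_zeros_iff[OF w(2) hom] by blast
qed

definition closed_chain :: "'a topology \<Rightarrow> nat \<Rightarrow> 'a set \<Rightarrow> 'a set \<Rightarrow> bool"
  where "closed_chain T k A B \<longleftrightarrow> (\<exists>W. W 0 = A \<and> W k = B \<and> (\<forall>i\<le>k. irreducible_closed T (W i)) \<and>
    (\<forall>i<k. W i \<subset> W (Suc i)))"

lemma closed_chain_0: "irreducible_closed T A \<Longrightarrow> closed_chain T 0 A A"
  unfolding closed_chain_def by (intro exI[of _ "\<lambda>_. A"]) simp

lemma closed_chain_append:
  assumes "closed_chain T k A B" "closed_chain T l B C"
  shows "closed_chain T (k + l) A C"
proof -
  obtain V where V: "V 0 = A" "V k = B" "\<forall>i\<le>k. irreducible_closed T (V i)" "\<forall>i<k. V i \<subset> V (Suc i)"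
    using assms(1) unfolding closed_chain_def by (elim exE conjE)
  obtain W where W: "W 0 = B" "W l = C" "\<forall>i\<le>l. irreducible_closed T (W i)" "\<forall>i<l. W i \<subset> W (Suc i)"
    using assms(2) unfolding closed_chain_def by (elim exE conjE)
  let ?Z = "\<lambda>i. if i \<le> k then V i else W (i - k)"
  have "?Z i \<subset> ?Z (Suc i)" if "i < k + l" for i
  proof -
    consider "i < k" | "i = k" | "i > k"
      by linarith
    then show ?thesis
    proof cases
      case 1
      then show ?thesis
        using V(4) by simp
    next
      case 2
      then show ?thesis
        using W(1) V(2) W(4)[rule_format, of 0] that by simp
    next
      case 3
      then have "Suc i - k = Suc (i - k)" "i - k < l"
        using that by simp_all
      then show ?thesis
        using 3 W(4)[rule_format, of "i - k"] by simp
    qed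
  qed
  moreover have "irreducible_closed T (?Z i)" if "i \<le> k + l" for i
    using V(3) W(3)[rule_format, of "i - k"] that by auto
  moreover have "?Z (k + l) = C"
    using V(2) W(1,2) by (cases l) auto
  ultimately show ?thesis
    unfolding closed_chain_def using V(1) by (intro exI[of _ ?Z] conjI allI impI) auto
qed

lemma closed_chain_1:
  assumes "irreducible_closed T A" "irreducible_closed T B" "A \<subset> B"
  shows "closed_chain T 1 A B"
  unfolding closed_chain_def using assms
  by (intro exI[of _ "\<lambda>i. if i = 0 then A else B"]) auto

text \<open>\<open>Y\<close> takes the place of the first member of the chain.\<close>

lemma codim_irreducible_ge:
  assumes "closed_chain T k A B" "irreducible_closed T Y" "Y \<subseteq> A"
  shows "enat k \<le> codim_irreducible T Y"
proof -
  obtain W where W: "W 0 = A" "W k = B" "\<forall>i\<le>k. irreducible_closed T (W i)" "\<forall>i<k. W i \<subset> W (Suc i)"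
    using assms(1) unfolding closed_chain_def by (elim exE conjE)
  let ?Z = "\<lambda>i. if i = 0 then Y else W i"
  have "?Z i \<subset> ?Z (Suc i)" if "i < k" for i
    using W(4)[rule_format, OF that] W(1) assms(3) by (cases i) auto
  moreover have "irreducible_closed T (?Z i)" if "i \<le> k" for i
    using W(3) assms(2) that by simp
  ultimately have "\<exists>Z. Z 0 = Y \<and> (\<forall>i\<le>k. irreducible_closed T (Z i)) \<and> (\<forall>i<k. Z i \<subset> Z (Suc i))"
    by (intro exI[of _ ?Z] conjI allI impI) simp_all
  then show ?thesis
    unfolding codim_irreducible_def by (intro Sup_upper) blast
qed

section \<open>Equations with a given Newton polygon\<close>

text \<open>\<open>m1\<close> and \<open>n1\<close> are the steps between neighbouring lattice
  points of the edge, so \<open>c\<close> is the greatest common divisor of \<open>m\<close> and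
  \<open>n\<close>.\<close>

locale newton_setup = plane_basis v a b v' a' b' for v a b v' a' b' +
  fixes d m n c m1 n1 :: nat
  assumes par: "c > 0" "m = m1 * c" "n = n1 * c" "coprime m1 n1" "0 < m" "m < n" "n \<le> d"
begin

lemma pos: "m1 > 0" "n1 > 0"
  using par by (auto intro: Nat.gr0I)

lemma d2: "d \<ge> 2"
  using par(5-7) by linarith

lemma m_le_d: "m \<le> d"
  using par(6,7) by linarith

definition frm :: "(nat \<times> nat \<Rightarrow> complex) \<Rightarrow> form"
  where "frm u = of_cf d (\<lambda>i j. u (i, j))"

text \<open>The coordinates of the parameter space are coefficients in the original variables,
  whereas \<open>u\<close> prescribes them in the adapted ones.\<close>

definition vec :: "(nat \<times> nat \<Rightarrow> complex) \<Rightarrow> (3 \<Rightarrow>\<^sub>0 nat) \<Rightarrow> complex"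
  where "vec u = Poly_Mapping.lookup (frm u)"

lemma homogeneous_frm: "homogeneous d (frm u)"
  unfolding frm_def by (rule homogeneous_of_cf)

lemma cf_frm: "cf (frm u) i j = (if i + j \<le> d then u (i, j) else 0)"
  by (simp add: frm_def cf_of_cf)

lemma lookup_coord:
  assumes F: "homogeneous d F" "F \<noteq> (0 :: form)"
  shows "Poly_Mapping.lookup F \<in> coord_vectors (monomials d)"
proof -
  have "\<exists>e. Poly_Mapping.lookup F e \<noteq> 0"
  proof (rule ccontr)
    assume "\<not> ?thesis"
    then have "F = 0"
      by (intro poly_mapping_eqI) simp
    then show False
      using F(2) by blast
  qed
  moreover have "Poly_Mapping.lookup F e = 0" if "e \<notin> monomials d" for e
    using F(1) that by (auto simp: homogeneous_def in_keys_iff)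
  ultimately show ?thesis
    unfolding coord_vectors_def by blast
qed

lemma vec_coord: "u (0, m) \<noteq> 0 \<Longrightarrow> vec u \<in> coord_vectors (monomials d)"
proof -
  assume "u (0, m) \<noteq> 0"
  then have "cf (frm u) 0 m \<noteq> 0"
    using m_le_d by (simp add: cf_frm)
  then have "frm u \<noteq> 0"
    by (auto simp: cf_def hom_0[OF is_hom_aff])
  then show ?thesis
    unfolding vec_def by (intro lookup_coord homogeneous_frm)
qed

lemma finite_monomials: "finite (monomials d)"
  using card_monomials_le(1)[of "UNIV :: 3 set" 1 d] by simp

text \<open>The change of coordinates in the other direction: a linear form on the parameter space
  that reads off one adapted coefficient.\<close>

definition coord_form :: "nat \<times> nat \<Rightarrow> (3 \<Rightarrow>\<^sub>0 nat) mpoly"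
  where "coord_form p = (\<Sum>e\<in>monomials d. Const (cf (Poly_Mapping.single e 1) (fst p) (snd p)) * Var e)"

lemma homogeneous_coord_form: "homogeneous 1 (coord_form p)"
  unfolding coord_form_def by (intro homogeneous_sum homogeneous_Const_mult homogeneous_Var)

lemma peval_coord_form: "peval (vec u) (coord_form (i, j)) = (if i + j \<le> d then u (i, j) else 0)"
proof -
  have "frm u = (\<Sum>e\<in>monomials d. Const (vec u e) * Poly_Mapping.single e 1)"
  proof (rule poly_mapping_eqI)
    fix k
    have "(\<Sum>e\<in>monomials d. Poly_Mapping.lookup (Const (vec u e) * Poly_Mapping.single e 1) k) =
        (\<Sum>e\<in>monomials d. if e = k then vec u k else 0)"
      by (intro sum.cong) (auto simp: lookup_Const_mult lookup_single when_def)
    also have "\<dots> = (if k \<in> monomials d then vec u k else 0)"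
      using finite_monomials by (rule sum.delta)
    also have "\<dots> = Poly_Mapping.lookup (frm u) k"
      using homogeneous_frm[of u] by (auto simp: vec_def homogeneous_def in_keys_iff)
    finally show "Poly_Mapping.lookup (frm u) k =
        Poly_Mapping.lookup (\<Sum>e\<in>monomials d. Const (vec u e) * Poly_Mapping.single e 1) k"
      by (simp add: lookup_sum)
  qed
  then have "cf (frm u) i j = cf (\<Sum>e\<in>monomials d. Const (vec u e) * Poly_Mapping.single e 1) i j"
    by (rule arg_cong)
  then have eq: "(\<Sum>e\<in>monomials d. vec u e * cf (Poly_Mapping.single e 1) i j) = (if i + j \<le> d then u (i, j) else 0)"
    unfolding cf_frm cf_sum cf_Const_mult by simp
  have "peval (vec u) (coord_form (i, j)) = (\<Sum>e\<in>monomials d. cf (Poly_Mapping.single e 1) i j * vec u e)"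
    by (simp add: coord_form_def hom_sum[OF is_hom_peval] hom_mult[OF is_hom_peval] peval_Var)
  also have "\<dots> = (\<Sum>e\<in>monomials d. vec u e * cf (Poly_Mapping.single e 1) i j)"
    by (simp only: mult.commute)
  finally show ?thesis
    by (simp only: eq)
qed

text \<open>The lattice points of the Newton edge, from \<open>(0, m)\<close> at
  \<open>k = 0\<close> to \<open>(n, 0)\<close> at \<open>k = c\<close>.\<close>

definition edge :: "nat \<Rightarrow> nat \<times> nat"
  where "edge k = (n1 * k, m1 * (c - k))"

text \<open>The constant of \<open>newton_edge\<close>: in the \<open>c\<close>-th power of a monic
  binomial the \<open>k\<close>-th coefficient is \<open>kap k\<close> times the \<open>k\<close>-th
  power of the first.\<close>

definition kap :: "nat \<Rightarrow> complex"
  where "kap k = of_nat (c choose k) / of_nat c ^ k"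

text \<open>The edge points with a prescribed coefficient. The range starts at 2 because
  \<open>k = 0\<close> is normalized and \<open>k = 1\<close> is free.\<close>

definition bent :: "nat \<Rightarrow> nat \<times> nat \<Rightarrow> bool"
  where "bent r p \<longleftrightarrow> 2 \<le> fst p div n1 \<and> fst p div n1 \<le> r \<and> p = edge (fst p div n1)"

text \<open>Separate parameters for the two kinds of conditions, so that the zeros in
  \<open>E\<close> and the binomial law up to \<open>r\<close> can be relaxed one at a time. The
  projective scaling is used up by the coefficient of \<open>y ^ m\<close>.\<close>

definition phi :: "(nat \<times> nat) set \<Rightarrow> nat \<Rightarrow> (nat \<times> nat \<Rightarrow> complex) \<Rightarrow> nat \<times> nat \<Rightarrow> complex"
  where "phi E r u p = (if p = (0, m) then 1 else if p \<in> E then 0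
    else if bent r p then kap (fst p div n1) * u (edge 1) ^ (fst p div n1) else u p)"

lemma edge_div: "fst (edge k) div n1 = k"
  using pos by (simp add: edge_def)

lemma edge_ne: "k \<ge> 1 \<Longrightarrow> edge k \<noteq> (0, m)"
  using pos by (simp add: edge_def)

lemma bent_edge: "bent r (edge k) \<longleftrightarrow> 2 \<le> k \<and> k \<le> r"
  by (simp add: bent_def edge_div)

lemma edge_triangle: "k \<le> c \<Longrightarrow> n1 * k + m1 * (c - k) \<le> d"
proof -
  assume k: "k \<le> c"
  have "m1 * c < n1 * c"
    using par by simp
  then have "m1 \<le> n1"
    by simp
  then have "m1 * (c - k) \<le> n1 * (c - k)"
    by (rule mult_le_mono1)
  moreover have "n1 * k + n1 * (c - k) = n"
    using k par by (simp flip: distrib_left)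
  ultimately show ?thesis
    using par by linarith
qed

section \<open>Irreducible families and the chain of their closures\<close>

definition VV where "VV E r = range (\<lambda>u. vec (phi E r u))"
definition ZZ where "ZZ E r = zariski (monomials d) closure_of (proj_point ` VV E r)"

lemma phi_0m: "phi E r u (0, m) = 1"
  by (simp add: phi_def)

lemma VV_coord: "VV E r \<subseteq> coord_vectors (monomials d)"
  unfolding VV_def using vec_coord phi_0m by auto

text \<open>The family is a polynomial image of an affine space: a straight line between two
  parameters gives a polynomial curve that stays in the family.\<close>

lemma irreducible_ZZ: "irreducible_closed (zariski (monomials d)) (ZZ E r)"
  unfolding ZZ_def
proof (rule irreducible_closure[OF _ VV_coord])
  show "VV E r \<noteq> {}"
    by (simp add: VV_def)
  fix x y assume "x \<in> VV E r" "y \<in> VV E r"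
  then obtain f g where fg: "x = vec (phi E r f)" "y = vec (phi E r g)"
    unfolding VV_def by blast
  define h where "h p = [:f p, g p - f p:]" for p
  define H where "H p = (if p = (0, m) then 1 else if p \<in> E then 0
    else if bent r p then Polynomial.smult (kap (fst p div n1)) (h (edge 1) ^ (fst p div n1)) else h p)" for p
  define \<gamma> where "\<gamma> i = (\<Sum>p\<in>triangle d. Polynomial.smult (Poly_Mapping.lookup (mon d (fst p) (snd p)) i) (H p))" for i
  have H: "poly (H p) t = phi E r (\<lambda>p. poly (h p) t) p" for p t
    by (simp add: H_def phi_def poly_power)
  have \<gamma>: "poly (\<gamma> i) t = vec (phi E r (\<lambda>p. poly (h p) t)) i" for i t
    unfolding \<gamma>_def vec_def frm_def of_cf_def poly_sum lookup_sum
    by (intro sum.cong) (auto simp: H lookup_Const_mult)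
  have "(\<lambda>p. poly (h p) 0) = f" "(\<lambda>p. poly (h p) 1) = g"
    by (auto simp: h_def)
  then have "poly (\<gamma> i) 0 = x i" "poly (\<gamma> i) 1 = y i" for i
    by (simp_all add: \<gamma> fg)
  moreover have "(\<lambda>i. poly (\<gamma> i) t) \<in> VV E r" for t
  proof -
    have "(\<lambda>i. poly (\<gamma> i) t) = vec (phi E r (\<lambda>p. poly (h p) t))"
      using \<gamma> by (intro ext)
    then show ?thesis
      unfolding VV_def by simp
  qed
  ultimately show "\<exists>\<gamma>. (\<forall>i. poly (\<gamma> i) 0 = x i) \<and> (\<forall>i. poly (\<gamma> i) 1 = y i) \<and>
      finite {t. (\<lambda>i. poly (\<gamma> i) t) \<notin> VV E r}"
    by (intro exI[of _ \<gamma>]) simp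
qed

text \<open>\<open>phi\<close> for the weaker conditions fixes every vector that satisfies the
  stronger ones. At bent points this requires that neither the point nor \<open>edge 1\<close> has
  been set to zero.\<close>

lemma VV_mono:
  assumes "E' \<subseteq> E" "r' \<le> r" and e: "\<And>k. 1 \<le> k \<Longrightarrow> k \<le> r \<Longrightarrow> r \<ge> 2 \<Longrightarrow> edge k \<notin> E"
  shows "VV E r \<subseteq> VV E' r'"
proof
  fix x assume "x \<in> VV E r"
  then obtain u where u: "x = vec (phi E r u)"
    unfolding VV_def by blast
  have "phi E' r' (phi E r u) p = phi E r u p" for p
  proof (cases "bent r' p \<and> p \<noteq> (0, m) \<and> p \<notin> E'")
    case True
    define k where "k = fst p div n1"
    have k: "p = edge k" "2 \<le> k" "k \<le> r'"
      using True by (simp_all add: bent_def k_def)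
    have nE: "edge k \<notin> E" "edge 1 \<notin> E"
      using e[of k] e[of 1] k assms(2) by simp_all
    then have nE': "edge k \<notin> E'"
      using assms(1) by (rule_tac contra_subsetD)
    have b: "bent r (edge k)" "bent r' (edge k)" "\<not> bent r (edge 1)"
      using k(2,3) assms(2) by (simp_all add: bent_edge)
    have ne: "edge k \<noteq> (0, m)" "edge 1 \<noteq> (0, m)"
      using edge_ne[of k] edge_ne[of 1] k(2) by simp_all
    have "phi E r u (edge 1) = u (edge 1)"
      by (simp only: phi_def ne nE b if_False)
    then have "phi E' r' (phi E r u) (edge k) = phi E r u (edge k)"
      unfolding phi_def[of E'] phi_def[of E r u "edge k"] by (simp only: ne nE nE' b if_False if_True)
    then show ?thesis
      by (simp only: k(1))
  next
    case False
    then have "\<not> bent r' p \<or> p = (0, m) \<or> p \<in> E'"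
      by blast
    then show ?thesis
      using subsetD[OF assms(1), of p] by (elim disjE) (simp_all add: phi_def)
  qed
  then have "phi E' r' (phi E r u) = phi E r u"
    by (rule ext)
  then have "x = vec (phi E' r' (phi E r u))"
    by (simp add: u)
  then show "x \<in> VV E' r'"
    unfolding VV_def by blast
qed

text \<open>Strictness is detected by a form \<open>P\<close> that vanishes on the smaller family
  and therefore on its closure.\<close>

lemma ZZ_psubset:
  assumes sub: "VV E r \<subseteq> VV E' r'" and P: "homogeneous k P" "\<And>u. peval (vec (phi E r u)) P = 0" "peval (vec (phi E' r' u1)) P \<noteq> 0"
  shows "ZZ E r \<subset> ZZ E' r'"
proof
  show "ZZ E r \<subseteq> ZZ E' r'"
    unfolding ZZ_def by (intro closure_of_mono image_mono sub)
  show "ZZ E r \<noteq> ZZ E' r'"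
  proof
    assume eq: "ZZ E r = ZZ E' r'"
    have u1: "vec (phi E' r' u1) \<in> VV E' r'"
      by (simp add: VV_def)
    have "proj_point ` VV E' r' \<subseteq> ZZ E' r'"
      unfolding ZZ_def using VV_coord by (intro closure_of_subset) (auto simp: topspace_zariski proj_space_eq)
    then have pp: "proj_point (vec (phi E' r' u1)) \<in> zariski (monomials d) closure_of (proj_point ` VV E r)"
      using u1 eq unfolding ZZ_def by blast
    have v0: "peval v P = 0" if "v \<in> VV E r" for v
      using that P(2) unfolding VV_def by (elim rangeE) simp
    have "vec (phi E' r' u1) \<in> coord_vectors (monomials d)"
      using VV_coord u1 by (rule subsetD)
    with P(1) VV_coord v0 pp have "peval (vec (phi E' r' u1)) P = 0"
      by (rule closure_vanishes)
    then show False
      using P(3) by blast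
  qed
qed

lemma not_bent_1: "\<not> bent 1 p"
  by (auto simp: bent_def)

text \<open>The coefficient at the dropped point separates neighbouring families; the test vector
  has all free coefficients 1. With \<open>r = 1\<close> no point is bent.\<close>

lemma chain_zero_conditions:
  assumes "finite D" "D \<inter> E = {}" "D \<subseteq> triangle d - {(0, m)}"
  shows "closed_chain (zariski (monomials d)) (card D) (ZZ (D \<union> E) 1) (ZZ E 1)"
  using assms
proof (induction D rule: finite_induct)
  case empty
  then show ?case
    by (simp add: closed_chain_0 irreducible_ZZ)
next
  case (insert p D)
  have p: "p \<notin> D \<union> E" "p \<noteq> (0, m)" "fst p + snd p \<le> d"
    using insert by (auto simp: triangle_def)
  have "ZZ (insert p (D \<union> E)) 1 \<subset> ZZ (D \<union> E) 1"
  proof (rule ZZ_psubset[OF _ homogeneous_coord_form[of p], where ?u1.0 = "\<lambda>_. 1"])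
    show "VV (insert p (D \<union> E)) 1 \<subseteq> VV (D \<union> E) 1"
      by (rule VV_mono) auto
    show "peval (vec (phi (insert p (D \<union> E)) 1 u)) (coord_form p) = 0" for u
      using peval_coord_form[of "phi (insert p (D \<union> E)) 1 u" "fst p" "snd p"] p by (simp add: phi_def)
    show "peval (vec (phi (D \<union> E) 1 (\<lambda>_. 1))) (coord_form p) \<noteq> 0"
      using peval_coord_form[of "phi (D \<union> E) 1 (\<lambda>_. 1)" "fst p" "snd p"] p not_bent_1 by (simp add: phi_def)
  qed
  from closed_chain_append[OF closed_chain_1[OF irreducible_ZZ irreducible_ZZ this] insert.IH]
  show ?case
    using insert by simp
qed

definition Bl where "Bl = {p. m * fst p + n * snd p < m * n}"

lemma Bl_bound: "p \<in> Bl \<Longrightarrow> fst p < n \<and> snd p < m"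
proof -
  assume "p \<in> Bl"
  then have w: "m * fst p + n * snd p < m * n"
    by (simp add: Bl_def)
  then have "m * fst p < m * n"
    by linarith
  moreover have "n * snd p < n * m"
    unfolding mult.commute[of n m] using w by linarith
  ultimately show ?thesis
    by simp
qed

lemma Bl_triangle: "Bl \<subseteq> triangle d - {(0, m)}"
proof
  fix p assume p: "p \<in> Bl"
  have 1: "m * snd p \<le> n * snd p"
    using par(6) by (intro mult_le_mono1) simp
  have 2: "m * fst p + n * snd p < m * n"
    using p by (simp add: Bl_def)
  have "m * (fst p + snd p) < m * n"
    unfolding distrib_left using 1 2 by linarith
  then have "fst p + snd p < n"
    by simp
  moreover have "p \<noteq> (0, m)"
    using Bl_bound[OF p] by auto
  ultimately show "p \<in> triangle d - {(0, m)}"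
    using par(7) by (cases p) auto
qed

lemma finite_Bl: "finite Bl"
  using Bl_triangle finite_triangle by (meson finite_Diff finite_subset)

lemma edge_weight: "k \<le> c \<Longrightarrow> m * (n1 * k) + n * (m1 * (c - k)) = m * n"
proof -
  assume k: "k \<le> c"
  have "m * (n1 * k) + n * (m1 * (c - k)) = m1 * n1 * c * (k + (c - k))"
    unfolding par(2,3) by (simp only: distrib_left mult_ac)
  then show ?thesis
    using k by (simp add: par(2,3) mult_ac)
qed

lemma edge_Bl: "k \<le> c \<Longrightarrow> edge k \<notin> Bl"
  using edge_weight[of k] by (simp add: Bl_def edge_def)

lemma chain_edge_conditions:
  "Suc k \<le> c \<Longrightarrow> closed_chain (zariski (monomials d)) k (ZZ Bl (Suc k)) (ZZ Bl 1)"
proof (induction k)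
  case 0
  then show ?case
    using closed_chain_0[OF irreducible_ZZ] by simp
next
  case (Suc k)
  define r where "r = Suc (Suc k)"
  \<comment> \<open>The relation of \<open>newton_edge\<close> for the next edge point, made
    homogeneous of degree \<open>r\<close> by the coefficient of \<open>y ^ m\<close>.\<close>
  define P where "P = coord_form (edge r) * coord_form (0, m) ^ Suc k - Const (kap r) * coord_form (edge 1) ^ r"
  have rc: "r \<le> c" "m \<le> d" "1 \<le> c"
    using Suc.prems m_le_d by (auto simp: r_def)
  have ev: "peval (vec u) P = u (edge r) * u (0, m) ^ Suc k - kap r * u (edge 1) ^ r" for u
    using peval_coord_form[of u 0 m] peval_coord_form[of u "n1 * r" "m1 * (c - r)"] peval_coord_form[of u "n1 * 1" "m1 * (c - 1)"]
      edge_triangle[OF rc(1)] edge_triangle[OF rc(3)] rc(2)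
    by (simp add: P_def hom_diff[OF is_hom_peval] hom_mult[OF is_hom_peval] hom_power[OF is_hom_peval] edge_def)
  have nB: "edge i \<notin> Bl" if "i \<le> r" for i
    using that rc by (intro edge_Bl) simp
  have ne: "edge r \<noteq> (0, m)" "edge 1 \<noteq> (0, m)" "edge r \<noteq> edge 1"
    using edge_ne[of r] edge_ne[of 1] edge_div[of r] edge_div[of 1] by (auto simp: r_def)
  have b: "bent r (edge r)" "\<not> bent r (edge 1)" "\<not> bent (Suc k) (edge r)" "\<not> bent (Suc k) (edge 1)"
    by (simp_all add: bent_edge r_def)
  have "ZZ Bl r \<subset> ZZ Bl (Suc k)"
  \<comment> \<open>The test vector has 0 at \<open>edge 1\<close> and 1 at the other free points,
    so \<open>P\<close> takes the value 1.\<close>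
  proof (rule ZZ_psubset[where P = P and k = r and ?u1.0 = "\<lambda>p. if p = edge 1 then 0 else 1"])
    show "VV Bl r \<subseteq> VV Bl (Suc k)"
    proof (rule VV_mono)
      show "edge i \<notin> Bl" if "1 \<le> i" "i \<le> r" "2 \<le> r" for i
        by (rule nB[OF that(2)])
    qed (simp_all add: r_def)
    have "homogeneous (1 + 1 * Suc k) (coord_form (edge r) * coord_form (0, m) ^ Suc k)"
      by (intro homogeneous_mult homogeneous_power homogeneous_coord_form)
    moreover have "homogeneous (1 * r) (Const (kap r) * coord_form (edge 1) ^ r)"
      by (intro homogeneous_Const_mult homogeneous_power homogeneous_coord_form)
    ultimately show "homogeneous r P"
      unfolding P_def by (intro homogeneous_diff) (simp_all add: r_def)
    show "peval (vec (phi Bl r u)) P = 0" for u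
      unfolding ev using ne b nB[of r] nB[of 1] by (simp add: phi_def edge_div r_def)
    show "peval (vec (phi Bl (Suc k) (\<lambda>p. if p = edge 1 then 0 else 1))) P \<noteq> 0"
      unfolding ev using ne b nB[of r] nB[of 1] by (simp add: phi_def r_def)
  qed
  from closed_chain_append[OF closed_chain_1[OF irreducible_ZZ irreducible_ZZ this] Suc.IH] show ?case
    using Suc.prems by (simp add: r_def)
qed

lemma chain_all_conditions:
  "closed_chain (zariski (monomials d)) (c - 1 + card Bl) (ZZ Bl c) (ZZ {} 1)"
proof (rule closed_chain_append)
  show "closed_chain (zariski (monomials d)) (c - 1) (ZZ Bl c) (ZZ Bl 1)"
    using chain_edge_conditions[of "c - 1"] par by simp
  show "closed_chain (zariski (monomials d)) (card Bl) (ZZ Bl 1) (ZZ {} 1)"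
    using chain_zero_conditions[OF finite_Bl _ Bl_triangle, of "{}"] by simp
qed

text \<open>Every irreducible closed subset of the closure lies in the lowest member of the chain
  and can replace it.\<close>

lemma codim_ge:
  assumes "U \<subseteq> proj_point ` VV Bl c"
  shows "enat (c - 1 + card Bl) \<le> codim (zariski (monomials d)) (zariski (monomials d) closure_of U)"
  unfolding codim_def
proof (rule INF_greatest)
  fix Y assume Y: "Y \<in> {Y. irreducible_closed (zariski (monomials d)) Y \<and> Y \<subseteq> zariski (monomials d) closure_of U}"
  have "zariski (monomials d) closure_of U \<subseteq> ZZ Bl c"
    unfolding ZZ_def by (rule closure_of_mono[OF assms])
  then show "enat (c - 1 + card Bl) \<le> codim_irreducible (zariski (monomials d)) Y"
    using Y by (intro codim_irreducible_ge[OF chain_all_conditions]) auto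
qed

lemma card_monomials: "card (monomials d) \<le> card (triangle d)"
proof (rule card_inj_on_le)
  have deg: "mdeg e = Poly_Mapping.lookup e 1 + Poly_Mapping.lookup e 2 + Poly_Mapping.lookup e 3" for e :: "3 \<Rightarrow>\<^sub>0 nat"
    using mdeg_superset[of UNIV e] by (simp add: sum_3)
  show "(\<lambda>e. (Poly_Mapping.lookup e 1, Poly_Mapping.lookup e 2)) ` monomials d \<subseteq> triangle d"
    by (auto simp: deg)
  show "inj_on (\<lambda>e. (Poly_Mapping.lookup e 1, Poly_Mapping.lookup e 2)) (monomials d)"
  proof (rule inj_onI)
    fix e f :: "3 \<Rightarrow>\<^sub>0 nat"
    assume ef: "e \<in> monomials d" "f \<in> monomials d"
      "(Poly_Mapping.lookup e 1, Poly_Mapping.lookup e 2) = (Poly_Mapping.lookup f 1, Poly_Mapping.lookup f 2)"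
    then have "\<forall>i. Poly_Mapping.lookup e i = Poly_Mapping.lookup f i"
      unfolding forall_3 by (simp add: deg)
    then show "e = f"
      by (intro poly_mapping_eqI) blast
  qed
qed simp

text \<open>A chain above \<open>ZZ Bl 1\<close> is prolonged downwards by letting the remaining
  coefficients vanish one by one. The whole chain is no longer than the dimension of the parameter
  space, of which the lower part leaves only \<open>card Bl\<close>.\<close>

lemma codim_le:
  assumes sub: "proj_point ` VV Bl 1 \<subseteq> zariski (monomials d) closure_of U"
  shows "codim (zariski (monomials d)) (zariski (monomials d) closure_of U) \<le> enat (card Bl)"
proof -
  let ?T = "zariski (monomials d)"
  let ?E = "triangle d - {(0, m)}"
  have "ZZ Bl 1 \<subseteq> ?T closure_of U"
    unfolding ZZ_def by (rule closure_of_minimal[OF sub closedin_closure_of])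
  then have "codim ?T (?T closure_of U) \<le> codim_irreducible ?T (ZZ Bl 1)"
    unfolding codim_def by (intro INF_lower) (simp add: irreducible_ZZ)
  also have "\<dots> \<le> enat (card Bl)"
    unfolding codim_irreducible_def
  proof (rule Sup_least)
    fix x assume "x \<in> {enat k | k. \<exists>Z. Z 0 = ZZ Bl 1 \<and> (\<forall>i\<le>k. irreducible_closed ?T (Z i)) \<and> (\<forall>i<k. Z i \<subset> Z (Suc i))}"
    then obtain k Z where Z: "x = enat k" "Z 0 = ZZ Bl 1" "\<forall>i\<le>k. irreducible_closed ?T (Z i)" "\<forall>i<k. Z i \<subset> Z (Suc i)"
      by blast
    have 1: "closed_chain ?T k (ZZ Bl 1) (Z k)"
      unfolding closed_chain_def using Z by (intro exI[of _ Z]) simp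
    have 2: "closed_chain ?T (card (?E - Bl)) (ZZ ((?E - Bl) \<union> Bl) 1) (ZZ Bl 1)"
      by (rule chain_zero_conditions) auto
    obtain W where W: "\<forall>i\<le>card (?E - Bl) + k. irreducible_closed ?T (W i)" "\<forall>i<card (?E - Bl) + k. W i \<subset> W (Suc i)"
      using closed_chain_append[OF 2 1] unfolding closed_chain_def by (elim exE conjE)
    have "Poly_Mapping.single (1 :: 3) d \<in> monomials d"
      by (cases "d = 0") (simp_all add: mdeg_def)
    then have ne: "monomials d \<noteq> {}"
      by blast
    have "card (?E - Bl) + k \<le> card (monomials d) - 1"
    proof (rule chain_length_le[OF finite_monomials ne])
      show "irreducible_closed ?T (W i)" if "i \<le> card (?E - Bl) + k" for i
        by (rule W(1)[rule_format, OF that])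
      show "W i \<subset> W (Suc i)" if "i < card (?E - Bl) + k" for i
        by (rule W(2)[rule_format, OF that])
    qed
    moreover have "card (?E - Bl) = card ?E - card Bl"
      by (rule card_Diff_subset[OF finite_Bl Bl_triangle])
    moreover have "card ?E = card (triangle d) - 1"
      using m_le_d by (intro card_Diff_singleton) simp
    moreover have "card Bl \<le> card ?E"
      by (rule card_mono[OF _ Bl_triangle]) simp
    ultimately show "x \<le> enat (card Bl)"
      using card_monomials by (simp add: Z(1))
  qed
  finally show ?thesis .
qed

text \<open>Equally many points of the rectangle lie on both sides of the diagonal, and
  \<open>c + 1\<close> lie on it.\<close>

lemma card_Bl: "2 * card Bl + c + 1 = (n + 1) * (m + 1)"
proof -
  define wt where "wt p = m * fst p + n * snd p" for p :: "nat \<times> nat"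
  define Re where "Re = {..n} \<times> {..m}"
  define Gt where "Gt = {p \<in> Re. m * n < wt p}"
  define Eq where "Eq = {p \<in> Re. wt p = m * n}"
  define \<sigma> where "\<sigma> p = (n - fst p, m - snd p)" for p :: "nat \<times> nat"
  have BlR: "p \<in> Re" if "p \<in> Bl" for p
    using Bl_bound[OF that] by (cases p) (simp add: Re_def)
  have wt: "wt p + wt (\<sigma> p) = 2 * (m * n)" if p: "p \<in> Re" for p
  proof -
    have le: "fst p \<le> n" "snd p \<le> m"
      using p by (simp_all add: Re_def mem_Times_iff)
    have "m * fst p + m * (n - fst p) = m * (fst p + (n - fst p))"
      "n * snd p + n * (m - snd p) = n * (snd p + (m - snd p))"
      by (simp_all only: distrib_left)
    then show ?thesis
      using le by (simp add: wt_def \<sigma>_def mult.commute[of n m])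
  qed
  have \<sigma>: "\<sigma> p \<in> Re" "\<sigma> (\<sigma> p) = p" if "p \<in> Re" for p
    using that by (simp_all add: Re_def \<sigma>_def mem_Times_iff)
  have "bij_betw \<sigma> Bl Gt"
  proof (rule bij_betw_byWitness[where f' = \<sigma>])
    show "\<forall>p\<in>Bl. \<sigma> (\<sigma> p) = p" "\<forall>p\<in>Gt. \<sigma> (\<sigma> p) = p"
      using \<sigma>(2) BlR by (auto simp: Gt_def)
    show "\<sigma> ` Bl \<subseteq> Gt"
    proof
      fix q assume "q \<in> \<sigma> ` Bl"
      then obtain p where p: "p \<in> Bl" "q = \<sigma> p"
        by blast
      then show "q \<in> Gt"
        using wt[OF BlR[OF p(1)]] \<sigma>(1)[OF BlR[OF p(1)]] by (simp add: Gt_def Bl_def wt_def[of p])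
    qed
    show "\<sigma> ` Gt \<subseteq> Bl"
    proof
      fix q assume "q \<in> \<sigma> ` Gt"
      then obtain p where p: "p \<in> Re" "m * n < wt p" "q = \<sigma> p"
        by (auto simp: Gt_def)
      then show "q \<in> Bl"
        using wt[OF p(1)] by (simp add: Bl_def wt_def[of "\<sigma> p"])
    qed
  qed
  then have GB: "card Gt = card Bl"
    by (rule bij_betw_same_card[symmetric])
  have "Eq = edge ` {..c}"
  proof (intro equalityI subsetI)
    fix p assume p: "p \<in> Eq"
    then have "m1 * fst p * c + n1 * snd p * c = m1 * n1 * c * c"
      by (simp add: Eq_def wt_def par(2,3) mult_ac)
    then have "(m1 * fst p + n1 * snd p) * c = (m1 * n1 * c) * c"
      by (simp add: distrib_right)
    then have w: "m1 * fst p + n1 * snd p = m1 * n1 * c"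
      using par(1) by simp
    have "n1 dvd m1 * fst p + n1 * snd p" "n1 dvd n1 * snd p"
      unfolding w by simp_all
    then have "n1 dvd m1 * fst p"
      using dvd_add_left_iff by blast
    then have "n1 dvd fst p"
      using par(4) by (simp add: coprime_commute coprime_dvd_mult_right_iff)
    then obtain k where k: "fst p = n1 * k"
      by blast
    have "n1 * (m1 * k + snd p) = n1 * (m1 * c)"
      using w by (simp add: k algebra_simps)
    then have k2: "m1 * k + snd p = m1 * c"
      using pos by simp
    then have "m1 * k \<le> m1 * c"
      by linarith
    then have "k \<le> c"
      using pos by simp
    moreover have "snd p = m1 * (c - k)"
      using k2 by (simp add: diff_mult_distrib2)
    ultimately show "p \<in> edge ` {..c}"
      using k by (intro image_eqI[of _ _ k]) (auto simp: edge_def prod_eq_iff)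
  next
    fix p assume "p \<in> edge ` {..c}"
    then obtain k where k: "k \<le> c" "p = edge k"
      by blast
    have "n1 * k \<le> n" "m1 * (c - k) \<le> m"
      using k(1) unfolding par(2,3) by (intro mult_le_mono2, simp)+
    then show "p \<in> Eq"
      using edge_weight[OF k(1)] by (simp add: k(2) Eq_def Re_def wt_def edge_def)
  qed
  moreover have "inj_on edge {..c}"
    using edge_div by (metis inj_onI)
  ultimately have Eqc: "card Eq = c + 1"
    by (simp add: card_image)
  have finR: "finite Re" "card Re = (n + 1) * (m + 1)"
    by (simp_all add: Re_def)
  have "Re = Bl \<union> (Gt \<union> Eq)"
    using BlR by (auto simp: Gt_def Eq_def Bl_def wt_def)
  moreover have "finite Gt" "finite Eq"
    using finR by (auto simp: Gt_def Eq_def)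
  moreover have "Bl \<inter> (Gt \<union> Eq) = {}" "Gt \<inter> Eq = {}"
    by (auto simp: Gt_def Eq_def Bl_def wt_def)
  ultimately have "card Re = card Bl + (card Gt + card Eq)"
    using finite_Bl by (simp add: card_Un_disjoint)
  then show ?thesis
    using GB Eqc finR by simp
qed

end

section \<open>The locus of unibranch points\<close>

context newton_setup
begin

lemma v_coord: "v \<in> coord_vectors UNIV"
proof -
  have "\<exists>i. v i \<noteq> 0"
  proof (rule ccontr)
    assume "\<not> ?thesis"
    then have "pairing v' v = 0"
      by (simp add: pairing_def)
    then show False
      using dual(1) by simp
  qed
  then show ?thesis
    by (simp add: coord_vectors_def)
qed

lemma curve_points_L2:
  assumes "w \<in> coord_vectors UNIV"
  shows "proj_point w \<in> curve_points (proj_point (Poly_Mapping.lookup L2)) \<longleftrightarrow> pairing b' w = 0"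
proof -
  have hom: "\<forall>p\<in>{Const c * L2 | c. c \<noteq> 0}. \<exists>k. homogeneous k p"
    using homogeneous_Const_mult[OF homogeneous_lin] by blast
  have "(\<forall>p\<in>{Const c * L2 | c. c \<noteq> 0}. peval w p = 0) \<longleftrightarrow> (\<forall>c. c \<noteq> 0 \<longrightarrow> c * pairing b' w = 0)"
    by (auto simp: hom_mult[OF is_hom_peval] peval_lin)
  also have "\<dots> \<longleftrightarrow> pairing b' w = 0"
    by (auto intro: exI[of _ 1])
  finally show ?thesis
    unfolding curve_points_def equations_proj_point using proj_zeros_iff[OF assms hom] by blast
qed

text \<open>The tangent cone determines the column of pure powers of \<open>y\<close>, the
  intersection number the row of pure powers of \<open>x\<close>, and unibranchness the conditions
  below and on the edge.\<close>

lemma locus_subset: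
  "unibranch_locus d m n (proj_point (Poly_Mapping.lookup L2)) (proj_point v) \<subseteq> proj_point ` VV Bl c"
proof
  fix C assume "C \<in> unibranch_locus d m n (proj_point (Poly_Mapping.lookup L2)) (proj_point v)"
  then obtain F l w where C: "C \<in> plane_curves d" and F: "F \<in> equations C"
      and l: "l \<in> equations (proj_point (Poly_Mapping.lookup L2))" and w: "w \<in> proj_point v"
      and irr: "irreducible F" and qC: "proj_point v \<in> curve_points C" and uni: "unibranch F w"
      and mult: "multiplicity_at F w = m" and tc: "tangent_cone F w = curve_points (proj_point (Poly_Mapping.lookup L2))"
      and int: "has_intersection_number F l w n"
    unfolding unibranch_locus_def by blast
  obtain x where x: "x \<in> coord_vectors (monomials d)" "C = proj_point x"
    using C unfolding plane_curves_def proj_space_eq by blast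
  have FC: "Poly_Mapping.lookup F \<in> proj_point x"
    using F by (simp add: equations_def x(2))
  then have "Poly_Mapping.lookup F \<in> coord_vectors (monomials d)"
    by (rule proj_point_mem[OF x(1)])
  then have hF: "homogeneous d F"
    by (auto simp: coord_vectors_def homogeneous_def in_keys_iff)
  have CF: "C = proj_point (Poly_Mapping.lookup F)"
    using proj_point_eq[OF FC] by (simp add: x(2))
  obtain \<tau> where \<tau>: "\<tau> \<noteq> 0" "w = (\<lambda>i. \<tau> * v i)"
    using w unfolding proj_point_def by blast
  obtain \<kappa> where \<kappa>: "\<kappa> \<noteq> 0" "l = Const \<kappa> * L2"
    using l unfolding equations_proj_point by blast
  have pwF: "peval w F = 0"
    using qC F w unfolding curve_points_def proj_zeros_def by blast
  \<comment> \<open>The coordinate vector \<open>w\<close> of the point is a multiple of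
    \<open>v\<close>, so everything is applied in the basis scaled by \<tau>.\<close>
  interpret s: plane_basis "\<lambda>i. \<tau> * v i" "\<lambda>i. \<tau> * a i" "\<lambda>i. \<tau> * b i" "\<lambda>i. v' i / \<tau>" "\<lambda>i. a' i / \<tau>" "\<lambda>i. b' i / \<tau>"
    by (rule plane_basis_scale[OF plane_basis_axioms \<tau>(1)])
  interpret p: plane_curve "\<lambda>i. \<tau> * v i" "\<lambda>i. \<tau> * a i" "\<lambda>i. \<tau> * b i" "\<lambda>i. v' i / \<tau>" "\<lambda>i. a' i / \<tau>" "\<lambda>i. b' i / \<tau>" F d
    by unfold_locales (use hF irr pwF d2 in \<open>simp_all add: \<tau>(2)\<close>)
  define L2' where "L2' = lin (\<lambda>i. b' i / \<tau>)"
  have L2': "L2' = Const (1 / \<tau>) * L2"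
    by (simp add: L2'_def lin_scale)
  have "Const (\<kappa> * \<tau>) * L2' = (Const (\<kappa> * \<tau>) * Const (1 / \<tau>)) * L2"
    by (simp add: L2' mult.assoc)
  also have "Const (\<kappa> * \<tau>) * Const (1 / \<tau>) = (Const \<kappa> :: form)"
    using \<tau>(1) by (simp flip: hom_mult[OF is_hom_Const])
  finally have l': "l = Const (\<kappa> * \<tau>) * L2'"
    by (simp add: \<kappa>(2))
  have loc: "local_in p.S"
    using uni p.unibranch_iff_local by (simp add: \<tau>(2))
  have "curve_points (proj_point (Poly_Mapping.lookup L2)) \<subseteq> {x. \<forall>w\<in>x. peval w L2' = 0}"
  proof
    fix y assume "y \<in> curve_points (proj_point (Poly_Mapping.lookup L2))"
    moreover have "L2 \<in> equations (proj_point (Poly_Mapping.lookup L2))"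
      unfolding equations_def by (simp add: proj_point_self)
    ultimately have "\<forall>w\<in>y. peval w L2 = 0"
      unfolding curve_points_def proj_zeros_def by blast
    then show "y \<in> {x. \<forall>w\<in>x. peval w L2' = 0}"
      by (simp add: L2' hom_mult[OF is_hom_peval])
  qed
  then have tc': "tangent_cone F (\<lambda>i. \<tau> * v i) \<subseteq> {x. \<forall>w\<in>x. peval w (lin (\<lambda>i. b' i / \<tau>)) = 0}"
    using tc by (simp add: \<tau>(2) L2'_def)
  note col = s.multiplicity_column[OF hF mult[unfolded \<tau>(2)] tc']
  \<comment> \<open>Otherwise the line would be a component of an irreducible curve of degree at
    least 2.\<close>
  have "\<exists>i. s.cf F i 0 \<noteq> 0"
  proof (rule ccontr)
    assume "\<not> ?thesis"
    then have "p.restr F = 0"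
      by (intro poly_eqI) (simp add: p.coeff_restr)
    then have "L2' dvd F"
      unfolding L2'_def by (rule p.L2_dvd[OF hF])
    then obtain G where G: "F = L2' * G"
      by (elim dvdE)
    have nd: "\<not> F dvd L2'"
      unfolding L2'_def by (rule p.not_dvd_L(3))
    have "L2' dvd 1 \<or> G dvd 1"
      using irr G by (simp add: Factorial_Ring.irreducible_def)
    then show False
    proof
      assume "L2' dvd 1"
      then obtain H where H: "1 = L2' * H"
        by (elim dvdE)
      have "peval (\<lambda>i. \<tau> * v i) (L2' * H) = 0"
        using p.peval_L(3) by (simp add: L2'_def hom_mult[OF is_hom_peval])
      then show False
        unfolding H[symmetric] by simp
    next
      assume "G dvd 1"
      then obtain H where "1 = G * H"
        by (elim dvdE)
      then have "L2' = F * H"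
        by (simp add: G mult.assoc)
      then show False
        using nd by simp
    qed
  qed
  define n0 where "n0 = (LEAST i. s.cf F i 0 \<noteq> 0)"
  have n0: "s.cf F n0 0 \<noteq> 0"
    unfolding n0_def by (rule LeastI_ex) fact
  have row: "s.cf F i 0 = 0" if "i < n0" for i
    using not_less_Least[of i "\<lambda>i. s.cf F i 0 \<noteq> 0"] that by (simp add: n0_def)
  have "s.cf F 0 0 = 0"
    using s.peval_v[OF hF] pwF by (simp add: \<tau>(2))
  then have "n0 > 0"
    using n0 by (intro Nat.gr0I) auto
  moreover have "\<kappa> * \<tau> \<noteq> 0"
    using \<kappa>(1) \<tau>(1) by simp
  \<comment> \<open>The first nonzero entry of the row is the intersection number, which is
    \<open>n\<close> by assumption.\<close>
  ultimately have "n = n0"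
    using p.intersection_number_iff[OF row n0, of "\<kappa> * \<tau>" n] int by (simp add: l' L2'_def \<tau>(2))
  note row = row[folded \<open>n = n0\<close>] n0[folded \<open>n = n0\<close>]
  define g where "g i j = s.cf F i j" for i j
  define g0 where "g0 = g 0 m"
  have g0: "g0 \<noteq> 0"
    using col(2) by (simp add: g0_def g_def)
  \<comment> \<open>Makes the coefficient of \<open>y ^ m\<close> equal to 1; the power of \<tau>
    converts coefficients back to the original basis.\<close>
  define e where "e = \<tau> ^ d / g0"
  define G where "G = Const e * F"
  have "n > 0"
    using par(5,6) by simp
  have cfG: "cf G i j = g i j / g0" for i j
    using cf_scale[OF \<tau>(1) hF, of i j] by (simp add: G_def cf_Const_mult e_def g_def)
  have hG: "homogeneous d G"
    unfolding G_def by (rule homogeneous_Const_mult[OF hF])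
  have low: "g i j = 0" if "(i, j) \<in> Bl" for i j
    using p.newton_lower[OF loc par(5) \<open>n > 0\<close> row col, of i j] that by (auto simp: g_def Bl_def)
  have edge: "g (n1 * k) (m1 * (c - k)) * g0 ^ (k - 1) = kap k * g n1 (m1 * (c - 1)) ^ k" if "0 < k" "k \<le> c" for k
    using p.newton_edge[OF loc par(1-5) \<open>n > 0\<close> row col that] by (simp add: g_def g0_def kap_def)
  define u where "u p = cf G (fst p) (snd p)" for p
  have "phi Bl c u p = u p" for p
  proof -
    consider "p = (0, m)" | "p \<noteq> (0, m)" "p \<in> Bl" | "p \<noteq> (0, m)" "p \<notin> Bl" "\<not> bent c p"
      | "p \<noteq> (0, m)" "p \<notin> Bl" "bent c p"
      by blast
    then show ?thesis
    proof cases
      case 1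
      then show ?thesis
        using g0 by (simp add: phi_def u_def cfG g0_def)
    next
      case 2
      then show ?thesis
        using low[of "fst p" "snd p"] by (simp add: phi_def u_def cfG)
    next
      case 3
      then show ?thesis
        by (simp add: phi_def)
    next
      case 4
      define k where "k = fst p div n1"
      have k: "p = edge k" "2 \<le> k" "k \<le> c"
        using 4(3) by (simp_all add: bent_def k_def)
      have "kap k * (g n1 (m1 * (c - 1)) / g0) ^ k = g (n1 * k) (m1 * (c - k)) * g0 ^ (k - 1) / g0 ^ k"
        using edge[of k] k by (simp add: power_divide)
      also have "g0 ^ k = g0 ^ (k - 1) * g0"
        using k(2) by (simp flip: power_Suc2)
      also have "g (n1 * k) (m1 * (c - k)) * g0 ^ (k - 1) / (g0 ^ (k - 1) * g0) = g (n1 * k) (m1 * (c - k)) / g0"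
        using g0 by simp
      finally have "kap k * u (edge 1) ^ k = u (edge k)"
        by (simp add: u_def cfG edge_def)
      then show ?thesis
        using 4 by (simp add: phi_def k(1) edge_div)
    qed
  qed
  then have "phi Bl c u = u"
    by (rule ext)
  moreover have "frm u = G"
    unfolding frm_def u_def fst_conv snd_conv by (rule of_cf_cf[OF hG])
  ultimately have "vec (phi Bl c u) = Poly_Mapping.lookup G"
    by (simp add: vec_def)
  then have "Poly_Mapping.lookup G \<in> VV Bl c"
    unfolding VV_def by (metis rangeI)
  moreover have "Poly_Mapping.lookup G \<in> proj_point (Poly_Mapping.lookup F)"
  proof -
    have "Poly_Mapping.lookup G = (\<lambda>i. e * Poly_Mapping.lookup F i)" "e \<noteq> 0"
      using g0 \<tau>(1) by (auto simp: G_def lookup_Const_mult e_def)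
    then show ?thesis
      unfolding proj_point_def by blast
  qed
  then have "C = proj_point (Poly_Mapping.lookup G)"
    unfolding CF by (rule proj_point_eq[symmetric])
  ultimately show "C \<in> proj_point ` VV Bl c"
    by blast
qed

text \<open>For \<open>c = 1\<close> the Newton conditions make \<open>S\<close> local, and they
  also determine multiplicity, tangent and intersection number.\<close>

lemma locus_mem:
  assumes c1: "c = 1" and hF: "homogeneous d F" and irr: "irreducible F"
    and W: "\<And>i j. cf F i j \<noteq> 0 \<Longrightarrow> m * n \<le> m * i + n * j" and n0: "cf F n 0 \<noteq> 0" and m0: "cf F 0 m \<noteq> 0"
  shows "proj_point (Poly_Mapping.lookup F) \<in> unibranch_locus d m n (proj_point (Poly_Mapping.lookup L2)) (proj_point v)"
proof -
  have npos: "n > 0"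
    using par(5,6) by simp
  have cop: "coprime m n"
    using par(2-4) c1 by simp
  have "cf F 0 0 = 0"
    using W[of 0 0] par(5) npos by (cases "cf F 0 0 = 0") auto
  then have Fv: "peval v F = 0"
    by (simp add: peval_v[OF hF])
  interpret p: plane_curve v a b v' a' b' F d
    by unfold_locales (use hF irr Fv d2 in simp_all)
  have "local_in p.S"
    by (rule p.local_in_S[OF par(5) npos cop W n0 m0])
  then have uni: "unibranch F v"
    by (simp add: p.unibranch_iff_local)
  have nm1: "multiplicity_at F v = m"
    by (rule newton_multiplicity(1)[OF hF par(5,6) m_le_d W m0])
  have nm2: "peval w (hom_part m (translate v F)) = cf F 0 m * pairing b' w ^ m" for w
    by (rule newton_multiplicity(2)[OF hF par(5,6) m_le_d W m0])
  have tc: "tangent_cone F v = curve_points (proj_point (Poly_Mapping.lookup L2))"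
  proof -
    have hom: "\<forall>p\<in>{hom_part m (translate v F)}. \<exists>k. homogeneous k p"
      using homogeneous_hom_part by blast
    have iff: "proj_point w \<in> tangent_cone F v \<longleftrightarrow> proj_point w \<in> curve_points (proj_point (Poly_Mapping.lookup L2))"
      if "w \<in> coord_vectors UNIV" for w
      unfolding tangent_cone_def nm1 curve_points_L2[OF that] proj_zeros_iff[OF that hom]
      using m0 par(5) by (simp add: nm2)
    have "tangent_cone F v \<subseteq> proj_space UNIV" "curve_points (proj_point (Poly_Mapping.lookup L2)) \<subseteq> proj_space UNIV"
      by (auto simp: tangent_cone_def curve_points_def proj_zeros_def)
    then show ?thesis
      unfolding proj_space_eq using iff by blast
  qed
  have row: "cf F i 0 = 0" if "i < n" for i
    using W[of i 0] that par(5) by (cases "cf F i 0 = 0") auto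
  have "has_intersection_number F (Const 1 * L2) v n"
    by (rule iffD2[OF p.intersection_number_iff[OF row n0 _ npos]]) simp_all
  then have int: "has_intersection_number F L2 v n"
    by (simp add: hom_1[OF is_hom_Const])
  have "F \<noteq> 0"
    using irr by (simp add: Factorial_Ring.irreducible_def)
  then have "proj_point (Poly_Mapping.lookup F) \<in> plane_curves d"
    unfolding plane_curves_def proj_space_eq by (intro imageI lookup_coord hF)
  moreover have "F \<in> equations (proj_point (Poly_Mapping.lookup F))"
      "L2 \<in> equations (proj_point (Poly_Mapping.lookup L2))"
    by (simp_all add: equations_def proj_point_self)
  moreover have "proj_point v \<in> curve_points (proj_point (Poly_Mapping.lookup F))"
  proof -
    have hom: "\<forall>p\<in>{Const c * F | c. c \<noteq> 0}. \<exists>k. homogeneous k p"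
      using homogeneous_Const_mult[OF hF] by blast
    show ?thesis
      unfolding curve_points_def equations_proj_point proj_zeros_iff[OF v_coord hom]
      by (auto simp: hom_mult[OF is_hom_peval] Fv)
  qed
  ultimately show ?thesis
    unfolding unibranch_locus_def mem_Collect_eq
    by (intro conjI bexI[of _ F] bexI[of _ L2] bexI[of _ v] irr uni nm1 tc int proj_point_self)
qed

text \<open>A member of the family may be reducible. But infinitely many members of the pencil
  joining it to \<open>flex d n\<close> are in the locus, and a form vanishing at all of these
  vanishes on the whole pencil, in particular at parameter 0.\<close>

lemma VV_subset_closure:
  assumes c1: "c = 1"
  shows "proj_point ` VV Bl 1 \<subseteq> zariski (monomials d) closure_of
    unibranch_locus d m n (proj_point (Poly_Mapping.lookup L2)) (proj_point v)"
proof
  let ?U = "unibranch_locus d m n (proj_point (Poly_Mapping.lookup L2)) (proj_point v)"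
  let ?T = "zariski (monomials d)"
  fix y assume "y \<in> proj_point ` VV Bl 1"
  then obtain u0 where y: "y = proj_point (vec (phi Bl 1 u0))"
    unfolding VV_def by blast
  define G where "G = frm (phi Bl 1 u0)"
  define Q where "Q = flex d n"
  define K where "K = {k :: nat. irreducible (G + Const (of_nat k) * Q)}"
  \<comment> \<open>Leaves out a parameter for which the coefficient of \<open>x ^ n\<close>
    cancels.\<close>
  define K' where "K' = {k \<in> K. cf G n 0 + of_nat k \<noteq> 0}"
  have npos: "n > 0"
    using par(5,6) by simp
  have hG: "homogeneous d G" and hQ: "homogeneous d Q"
    unfolding G_def Q_def by (rule homogeneous_frm homogeneous_flex)+
  have "infinite K"
    unfolding K_def Q_def by (rule infinite_irreducible[OF hG d2 npos par(7)])
  moreover have "finite {k :: nat. cf G n 0 + of_nat k = 0}"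
  proof -
    have "inj_on (of_nat :: nat \<Rightarrow> complex) A" for A
      by (simp add: inj_on_def)
    then have "finite ((of_nat :: nat \<Rightarrow> complex) -` {- cf G n 0})"
      by (intro finite_vimageI) simp_all
    moreover have "{k :: nat. cf G n 0 + of_nat k = 0} \<subseteq> (of_nat :: nat \<Rightarrow> complex) -` {- cf G n 0}"
      by (auto simp: eq_neg_iff_add_eq_0 add.commute)
    ultimately show ?thesis
      by (rule rev_finite_subset)
  qed
  moreover have "K \<subseteq> K' \<union> {k :: nat. cf G n 0 + of_nat k = 0}"
    by (auto simp: K'_def)
  ultimately have "infinite K'"
    by (meson finite_Un finite_subset)
  have cfH: "cf (G + Const t * Q) i j = cf G i j + t * cf Q i j" for t i j
    by (simp add: cf_add cf_Const_mult)
  note cfQ = cf_flex[OF par(7) d2, folded Q_def]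
  have mem: "proj_point (Poly_Mapping.lookup (G + Const (of_nat k) * Q)) \<in> ?U" if k: "k \<in> K'" for k
  proof (rule locus_mem[OF c1])
    show "homogeneous d (G + Const (of_nat k) * Q)"
      by (intro homogeneous_add homogeneous_Const_mult hG hQ)
    show "irreducible (G + Const (of_nat k) * Q)"
      using k by (simp add: K'_def K_def)
    show "m * n \<le> m * i + n * j" if nz: "cf (G + Const (of_nat k) * Q) i j \<noteq> 0" for i j
    proof (cases "cf Q i j = 0")
      case True
      then have "cf G i j \<noteq> 0"
        using nz by (simp add: cfH)
      then have "phi Bl 1 u0 (i, j) \<noteq> 0"
        by (auto simp: G_def cf_frm split: if_splits)
      moreover have "phi Bl 1 u0 (i, j) = 0" if "(i, j) \<in> Bl"
      proof -
        have "(i, j) \<noteq> (0, m)"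
          using that Bl_triangle by blast
        then show ?thesis
          using that by (simp only: phi_def if_True if_False)
      qed
      ultimately have "(i, j) \<notin> Bl"
        by blast
      then show ?thesis
        by (simp add: Bl_def)
    next
      case False
      \<comment> \<open>The monomials of \<open>Q\<close> are pure powers at or beyond the end
        points of the edge.\<close>
      then have "(i \<ge> n \<or> j \<ge> m)"
        using par(6,7) unfolding cfQ by (auto split: if_splits)
      then show ?thesis
      proof
        assume "n \<le> i"
        then show ?thesis
          by (simp add: trans_le_add1)
      next
        assume "m \<le> j"
        then have "n * m \<le> n * j"
          by simp
        then show ?thesis
          by (simp add: mult.commute[of n m] trans_le_add2)
      qed
    qed
    have "cf Q n 0 = 1"
      using par(6,7) npos unfolding cfQ by auto
    then show "cf (G + Const (of_nat k) * Q) n 0 \<noteq> 0"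
      using k by (simp add: cfH K'_def)
    have "cf G 0 m = 1"
      using m_le_d by (simp add: G_def cf_frm phi_0m)
    \<comment> \<open>The value 1 occurs exactly for \<open>m = d - 1\<close>; the coefficient of
      the pencil member is then \<open>1 + k\<close>, which is nonzero.\<close>
    moreover have "cf Q 0 m = 0 \<or> cf Q 0 m = 1"
      using par(5) npos unfolding cfQ by auto
    moreover have "(of_nat (Suc k) :: complex) \<noteq> 0"
      by (rule of_nat_neq_0)
    then have "(1 :: complex) + of_nat k \<noteq> 0"
      by simp
    ultimately show "cf (G + Const (of_nat k) * Q) 0 m \<noteq> 0"
      by (auto simp: cfH)
  qed
  have "\<exists>Ps. (\<forall>p\<in>Ps. \<exists>k. homogeneous k p) \<and> ?T closure_of ?U = proj_zeros (monomials d) Ps"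
    using closedin_closure_of[of ?T ?U] by (simp only: closedin_zariski)
  then obtain Ps where Ps: "\<forall>p\<in>Ps. \<exists>k. homogeneous k p" "?T closure_of ?U = proj_zeros (monomials d) Ps"
    by (elim exE conjE)
  have "?U \<subseteq> topspace ?T"
    unfolding topspace_zariski unibranch_locus_def plane_curves_def by (rule Collect_restrict)
  then have UU: "?U \<subseteq> ?T closure_of ?U"
    by (rule closure_of_subset)
  have U0: "peval (Poly_Mapping.lookup (G + Const (of_nat k) * Q)) P = 0" if P: "P \<in> Ps" and k: "k \<in> K'" for P k
  proof -
    have "proj_point (Poly_Mapping.lookup (G + Const (of_nat k) * Q)) \<in> proj_zeros (monomials d) Ps"
      using subsetD[OF UU mem[OF k]] by (simp only: Ps(2))
    then have "\<forall>w\<in>proj_point (Poly_Mapping.lookup (G + Const (of_nat k) * Q)). peval w P = 0"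
      using P by (simp add: proj_zeros_def)
    then show ?thesis
      using proj_point_self by (rule bspec)
  qed
  have "peval (vec (phi Bl 1 u0)) P = 0" if P: "P \<in> Ps" for P
  proof -
    obtain r where r: "\<And>t. poly r t = peval (\<lambda>i. poly [:Poly_Mapping.lookup G i, Poly_Mapping.lookup Q i:] t) P"
      using peval_curve[of "\<lambda>i. [:Poly_Mapping.lookup G i, Poly_Mapping.lookup Q i:]" P] by (elim exE) blast
    have vec_t: "(\<lambda>i. poly [:Poly_Mapping.lookup G i, Poly_Mapping.lookup Q i:] t) = Poly_Mapping.lookup (G + Const t * Q)" for t
      by (intro ext) (simp add: lookup_add lookup_Const_mult)
    have root: "poly r (of_nat k) = 0" if "k \<in> K'" for k
      using U0[OF P that] by (simp only: r vec_t)
    have sub: "of_nat ` K' \<subseteq> {t. poly r t = 0}"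
      using root by blast
    have inf: "infinite ((of_nat :: nat \<Rightarrow> complex) ` K')"
      using \<open>infinite K'\<close> by (simp add: finite_image_iff inj_on_def)
    have "r = 0"
    proof (rule ccontr)
      assume "r \<noteq> 0"
      then have "finite {t. poly r t = 0}"
        by (rule poly_roots_finite)
      then show False
        using inf finite_subset[OF sub] by simp
    qed
    then have "poly r 0 = 0"
      by simp
    then have "peval (Poly_Mapping.lookup (G + Const 0 * Q)) P = 0"
      by (simp only: r vec_t)
    then show ?thesis
      by (simp add: hom_0[OF is_hom_Const] vec_def G_def)
  qed
  moreover have "vec (phi Bl 1 u0) \<in> coord_vectors (monomials d)"
    by (rule vec_coord) (simp add: phi_0m)
  ultimately have "proj_point (vec (phi Bl 1 u0)) \<in> proj_zeros (monomials d) Ps"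
    by (intro iffD2[OF proj_zeros_iff[OF _ Ps(1)]] ballI)
  then show "y \<in> ?T closure_of ?U"
    by (simp only: Ps(2) y)
qed

end

text \<open>Monomials of degree 1 are single variables, so a coordinate vector of a line is the
  coefficient vector of a linear form.\<close>

lemma linear_form_ex:
  assumes x: "x \<in> coord_vectors (monomials 1)"
  shows "\<exists>l. l \<noteq> (\<lambda>_. 0) \<and> x = Poly_Mapping.lookup (lin l)"
proof -
  define l where "l i = x (Poly_Mapping.single i 1)" for i :: 3
  have single_inj: "Poly_Mapping.single i (1 :: nat) = Poly_Mapping.single j 1 \<longleftrightarrow> i = j" for i j :: 3
    by (metis lookup_single_eq lookup_single_not_eq zero_neq_one)
  have lk: "Poly_Mapping.lookup (lin l) e = (\<Sum>i\<in>UNIV. if Poly_Mapping.single i 1 = e then l i else 0)" for e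
    unfolding lin_def lookup_sum lookup_Const_mult Var_def
    by (intro sum.cong) (auto simp: lookup_single when_def)
  have eq: "x e = Poly_Mapping.lookup (lin l) e" for e
  proof (cases "\<exists>i. e = Poly_Mapping.single i 1")
    case True
    then obtain i where i: "e = Poly_Mapping.single i 1"
      by blast
    show ?thesis
      unfolding lk i single_inj by (simp add: l_def)
  next
    case False
    have "mdeg e \<noteq> 1"
    proof
      assume 1: "mdeg e = 1"
      then have "Poly_Mapping.keys e \<noteq> {}"
        by (auto simp: mdeg_def)
      then obtain i where i: "Poly_Mapping.lookup e i > 0"
        by (metis all_not_in_conv gr0I in_keys_iff)
      have "Poly_Mapping.lookup e i + (\<Sum>j\<in>UNIV - {i}. Poly_Mapping.lookup e j) = 1"
        using 1 mdeg_superset[of UNIV e] by (simp add: sum.remove[of UNIV i])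
      then have "Poly_Mapping.lookup e i = 1" "(\<Sum>j\<in>UNIV - {i}. Poly_Mapping.lookup e j) = 0"
        using i by linarith+
      then have "Poly_Mapping.lookup e j = Poly_Mapping.lookup (Poly_Mapping.single i 1) j" for j
        by (cases "j = i") (auto simp: lookup_single when_def)
      then have "e = Poly_Mapping.single i 1"
        by (rule poly_mapping_eqI)
      then show False
        using False by blast
    qed
    then have "x e = 0"
      using x by (auto simp: coord_vectors_def)
    moreover have "Poly_Mapping.lookup (lin l) e = 0"
      unfolding lk using False by (intro sum.neutral) auto
    ultimately show ?thesis
      by simp
  qed
  have "l \<noteq> (\<lambda>_. 0)"
  proof
    assume "l = (\<lambda>_. 0)"
    then have l0: "l i = 0" for i
      by (rule fun_cong)
    have "x e = 0" for e
      unfolding eq lk by (intro sum.neutral) (simp add: l0)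
    then show False
      using x by (auto simp: coord_vectors_def)
  qed
  then show ?thesis
    using eq by (intro exI[of _ l]) auto
qed

theorem proposition5p2p1:
  fixes d n m c :: nat and L :: curve and q :: point
  assumes "d \<ge> n" "n > m" "m > 0"
    and "c = gcd n m"
    and "L \<in> plane_curves 1" "q \<in> plane" "q \<in> curve_points L"
  shows "ereal_of_enat (codim (zariski (monomials d))
        (zariski (monomials d) closure_of unibranch_locus d m n L q)) \<ge>
      ereal ((real n * real m + real m + real n + real c - 2) / 2) \<and>
    (c = 1 \<longrightarrow> ereal_of_enat (codim (zariski (monomials d))
        (zariski (monomials d) closure_of unibranch_locus d m n L q)) =
      ereal ((real n * real m + real m + real n + real c - 2) / 2))"
proof -
  obtain x where x: "x \<in> coord_vectors (monomials 1)" "L = proj_point x"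
    using assms(5) unfolding plane_curves_def proj_space_eq by blast
  obtain l where l: "l \<noteq> (\<lambda>_. 0)" "x = Poly_Mapping.lookup (lin l)"
    using linear_form_ex[OF x(1)] by blast
  obtain v where v: "v \<in> coord_vectors UNIV" "q = proj_point v"
    using assms(6) unfolding proj_space_eq by blast
  have v0: "v \<noteq> (\<lambda>_. 0)"
    using v(1) by (auto simp: coord_vectors_def)
  have "lin l \<in> equations L"
    by (simp add: equations_def x(2) l(2) proj_point_self)
  then have "peval v (lin l) = 0"
    using assms(7) proj_point_self[of v] v(2) unfolding curve_points_def proj_zeros_def by blast
  then have "pairing l v = 0"
    by (simp add: peval_lin)
  from plane_basis_ex[OF v0 l(1) this] obtain a b v' a' where basis: "plane_basis v a b v' a' l"
    by (elim exE)
  define m1 where "m1 = m div c"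
  define n1 where "n1 = n div c"
  have "newton_setup_axioms d m n c m1 n1"
  proof
    show "c > 0"
      using assms by simp
    show "m = m1 * c" "n = n1 * c"
      by (simp_all add: m1_def n1_def assms(4))
    show "coprime m1 n1"
      unfolding m1_def n1_def assms(4) using assms(3) div_gcd_coprime[of m n] by (simp add: gcd.commute)
  qed (use assms in simp_all)
  then interpret newton_setup v a b v' a' l d m n c m1 n1
    by (intro newton_setup.intro basis)
  let ?K = "c - 1 + card Bl"
  let ?cd = "codim (zariski (monomials d)) (zariski (monomials d) closure_of unibranch_locus d m n L q)"
  have Lq: "L = proj_point (Poly_Mapping.lookup (lin l))" "q = proj_point v"
    by (simp_all add: x(2) l(2) v(2))
  have "real (2 * card Bl + c + 1) = real ((n + 1) * (m + 1))"
    by (simp only: card_Bl)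
  \<comment> \<open>\<open>card_Bl\<close> is solved for the number of points below the edge, and
    the \<open>c - 1\<close> edge equations are added.\<close>
  then have K: "real ?K = (real n * real m + real m + real n + real c - 2) / 2"
    using par(1) by (simp add: of_nat_diff algebra_simps)
  have "enat ?K \<le> ?cd"
    unfolding Lq by (rule codim_ge[OF locus_subset])
  then have "ereal_of_enat (enat ?K) \<le> ereal_of_enat ?cd"
    by (simp only: ereal_of_enat_le_iff)
  then have lower: "ereal (real ?K) \<le> ereal_of_enat ?cd"
    by simp
  \<comment> \<open>For \<open>c = 1\<close> there are no edge equations, so the upper bound
    \<open>card Bl\<close> is the same number.\<close>
  have "ereal_of_enat ?cd = ereal (real ?K)" if "c = 1"
  proof (rule antisym)
    have "?cd \<le> enat (card Bl)"
      unfolding Lq by (rule codim_le[OF VV_subset_closure[OF that]])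
    then have "ereal_of_enat ?cd \<le> ereal_of_enat (enat (card Bl))"
      by (simp only: ereal_of_enat_le_iff)
    then show "ereal_of_enat ?cd \<le> ereal (real ?K)"
      using that by simp
  qed (rule lower)
  then show ?thesis
    using lower unfolding K by blast
qed

end
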